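(* Let $4\le p<\infty$ and $\nu>\frac nr-1$, and define $\gamma=\frac1p\left(\nu+\frac nr\right)-\frac n{2r}$. Then for any integer $m\ge1$ the following assertions hold. (a) If $\gamma>0$, then $\mathcal M\left(H^{2m}(T_\Omega),A^{mp}_\nu(T_\Omega)\right)=H^\infty_{\gamma/m}(T_\Omega)$. (b) If $\gamma=0$, then $\mathcal M\left(H^{2m}(T_\Omega),A^{mp}_\nu(T_\Omega)\right)=H^\infty(T_\Omega)$. (c) If $\gamma<0$, then $\mathcal M\left(H^{2m}(T_\Omega),A^{mp}_\nu(T_\Omega)\right)=\{0\}$.
   Context: $\Omega$ is an irreducible symmetric cone of rank $r$ in $V=\mathbb R^n$, equipped with the associated Euclidean Jordan algebra structure; $\Delta$ is the determinant function of this Jordan algebra, positive on $\Omega$. $T_\Omega=\mathbb R^n+i\Omega\subset\mathbb C^n$. For $0<p<\infty$, $H^p(T_\Omega)$ is the space of holomorphic $f$ on $T_\Omega$ with $\|f\|_{H^p}=\left(\sup_{t\in\Omega}\int_{\mathbb R^n}|f(x+it)|^pdx\right)^{1/p}<\infty$. For $0<p<\infty$ and $\nu\in\mathbb R$, $A^p_\nu(T_\Omega)$ is the space of holomorphic $f$ on $T_\Omega$ with $\|f\|_{p,\nu}=\left(\int_{T_\Omega}|f(x+iy)|^p\Delta^{\nu-\frac nr}(y)\,dx\,dy\right)^{1/p}<\infty$. For $\alpha\in\mathbb R$, $H^\infty_\alpha(T_\Omega)$ is the space of holomorphic $F$ on $T_\Omega$ with $\|F\|_{\alpha,\infty}=\sup_{z\in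 T_\Omega}\Delta(\operatorname{Im}z)^\alpha|F(z)|<\infty$; $H^\infty(T_\Omega)=H^\infty_0(T_\Omega)$ is the space of bounded holomorphic functions on $T_\Omega$. For Banach spaces $X,Y$ of analytic functions on $T_\Omega$, $\mathcal M(X,Y)$ is the set of multipliers from $X$ to $Y$: analytic functions $G$ on $T_\Omega$ for which there is $C>0$ with $\|FG\|_Y\le C\|F\|_X$ for all $F\in X$. *)

theory Defs
  imports "HOL-Analysis.Analysis" "HOL-Computational_Algebra.Polynomial"
begin

text \<open>
  Symmetric cones, following Faraut and Koranyi. A cone is considered relative to a subspace
  \<open>W\<close> of the ambient space, since irreducibility refers to symmetric cones in proper subspaces.
  The Euclidean structure of \<open>W\<close> is any inner product, not necessarily the coordinate one:
  the cone of positive definite matrices, say, need not be self-dual for the standard inner product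
  of an arbitrary coordinate system.
\<close>

definition inner_product :: "('v::euclidean_space \<Rightarrow> 'v \<Rightarrow> real) \<Rightarrow> bool" where
  "inner_product B \<longleftrightarrow>
     bilinear B \<and> (\<forall>x y. B x y = B y x) \<and> (\<forall>x. x \<noteq> 0 \<longrightarrow> B x x > 0)"

definition self_dual_in :: "'v::euclidean_space set \<Rightarrow> ('v \<Rightarrow> 'v \<Rightarrow> real) \<Rightarrow> 'v set \<Rightarrow> bool" where
  "self_dual_in W B \<Omega> \<longleftrightarrow> \<Omega> = {y \<in> W. \<forall>x \<in> closure \<Omega> - {0}. B x y > 0}"

definition homogeneous_in :: "'v::euclidean_space set \<Rightarrow> 'v set \<Rightarrow> bool" where
  "homogeneous_in W \<Omega> \<longleftrightarrow>
     (\<forall>x\<in>\<Omega>. \<forall>y\<in>\<Omega>. \<exists>g. linear g \<and> bij_betw g W W \<and> g ` \<Omega> = \<Omega> \<and> g x = y)"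

definition symmetric_cone_in :: "'v::euclidean_space set \<Rightarrow> 'v set \<Rightarrow> bool" where
  "symmetric_cone_in W \<Omega> \<longleftrightarrow>
     subspace W \<and> \<Omega> \<noteq> {} \<and> openin (top_of_set W) \<Omega> \<and> convex \<Omega> \<and>
     (\<forall>x\<in>\<Omega>. \<forall>c>0. c *\<^sub>R x \<in> \<Omega>) \<and>
     (\<exists>B. inner_product B \<and> self_dual_in W B \<Omega>) \<and>
     homogeneous_in W \<Omega>"

definition irreducible_symmetric_cone :: "'v::euclidean_space set \<Rightarrow> bool" where
  "irreducible_symmetric_cone \<Omega> \<longleftrightarrow>
     symmetric_cone_in UNIV \<Omega> \<and>
     \<not> (\<exists>V\<^sub>1 V\<^sub>2 \<Omega>\<^sub>1 \<Omega>\<^sub>2. V\<^sub>1 \<noteq> {0} \<and> V\<^sub>2 \<noteq> {0} \<and>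
          V\<^sub>1 \<inter> V\<^sub>2 = {0} \<and> {x + y |x y. x \<in> V\<^sub>1 \<and> y \<in> V\<^sub>2} = UNIV \<and>
          symmetric_cone_in V\<^sub>1 \<Omega>\<^sub>1 \<and> symmetric_cone_in V\<^sub>2 \<Omega>\<^sub>2 \<and>
          \<Omega> = {x + y |x y. x \<in> \<Omega>\<^sub>1 \<and> y \<in> \<Omega>\<^sub>2})"

definition euclidean_jordan_algebra ::
    "('v::euclidean_space \<Rightarrow> 'v \<Rightarrow> 'v) \<Rightarrow> 'v \<Rightarrow> bool" where
  "euclidean_jordan_algebra mul e \<longleftrightarrow>
     bilinear mul \<and> (\<forall>x y. mul x y = mul y x) \<and>
     (\<forall>x y. mul x (mul (mul x x) y) = mul (mul x x) (mul x y)) \<and>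
     (\<forall>x. mul e x = x) \<and>
     (\<exists>B. inner_product B \<and> (\<forall>x u v. B (mul x u) v = B u (mul x v)))"

definition associated_jordan_algebra ::
    "'v::euclidean_space set \<Rightarrow> ('v \<Rightarrow> 'v \<Rightarrow> 'v) \<Rightarrow> 'v \<Rightarrow> bool" where
  "associated_jordan_algebra \<Omega> mul e \<longleftrightarrow>
     euclidean_jordan_algebra mul e \<and> \<Omega> = interior (range (\<lambda>x. mul x x))"

definition jordan_power :: "('v \<Rightarrow> 'v \<Rightarrow> 'v) \<Rightarrow> 'v \<Rightarrow> 'v \<Rightarrow> nat \<Rightarrow> 'v" where
  "jordan_power mul e x k = (mul x ^^ k) e"

definition jordan_poly ::
    "('v::euclidean_space \<Rightarrow> 'v \<Rightarrow> 'v) \<Rightarrow> 'v \<Rightarrow> real poly \<Rightarrow> 'v \<Rightarrow> 'v" where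
  "jordan_poly mul e q x = (\<Sum>k\<le>degree q. coeff q k *\<^sub>R jordan_power mul e x k)"

definition minimal_poly ::
    "('v::euclidean_space \<Rightarrow> 'v \<Rightarrow> 'v) \<Rightarrow> 'v \<Rightarrow> 'v \<Rightarrow> real poly" where
  "minimal_poly mul e x =
     (THE f. lead_coeff f = 1 \<and> (\<forall>q. jordan_poly mul e q x = 0 \<longleftrightarrow> f dvd q))"

definition jordan_rank :: "('v::euclidean_space \<Rightarrow> 'v \<Rightarrow> 'v) \<Rightarrow> 'v \<Rightarrow> nat" where
  "jordan_rank mul e = Max (range (\<lambda>x. degree (minimal_poly mul e x)))"

text \<open>
  The determinant is the polynomial function whose value at every regular element \<open>x\<close>
  (one whose minimal polynomial has degree \<open>r\<close>, the rank) is \<open>a\<^sub>r(x)\<close>, where the minimal polynomial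
  is written \<open>\<lambda>\<^sup>r - a\<^sub>1(x) \<lambda>\<^sup>r\<^sup>-\<^sup>1 + \<dots> + (-1)\<^sup>r a\<^sub>r(x)\<close>. It is unique because the regular elements are dense.
\<close>

definition jordan_det :: "('v::euclidean_space \<Rightarrow> 'v \<Rightarrow> 'v) \<Rightarrow> 'v \<Rightarrow> 'v \<Rightarrow> real" where
  "jordan_det mul e =
     (THE D. real_polynomial_function D \<and>
        (\<forall>x. degree (minimal_poly mul e x) = jordan_rank mul e \<longrightarrow>
             D x = (-1) ^ jordan_rank mul e * coeff (minimal_poly mul e x) 0))"

definition complex_vec :: "real^'n \<Rightarrow> real^'n \<Rightarrow> complex^'n" where
  "complex_vec x y = (\<chi> i. Complex (x $ i) (y $ i))"

definition Im_vec :: "complex^'n \<Rightarrow> real^'n" where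
  "Im_vec z = (\<chi> i. Im (z $ i))"

definition tube :: "(real^'n) set \<Rightarrow> (complex^'n) set" where
  "tube \<Omega> = {z. Im_vec z \<in> \<Omega>}"

text \<open>
  Holomorphy in several variables is complex Frechet differentiability. To identify a holomorphic
  function on \<open>D\<close> with a single HOL function, it is extended by \<open>0\<close> outside \<open>D\<close>; equality of sets of
  such functions is then equality of sets of functions on \<open>D\<close>.
\<close>

definition holomorphic_functions :: "(complex^'n) set \<Rightarrow> (complex^'n \<Rightarrow> complex) set" where
  "holomorphic_functions D =
     {f. (\<forall>z\<in>D. \<exists>f'. (f has_derivative f') (at z) \<and> (\<forall>c v. f' (c *s v) = c * f' v)) \<and>
         (\<forall>z. z \<notin> D \<longrightarrow> f z = 0)}"

text \<open>
  The integrals and suprema are taken in \<open>[0,\<infinity>]\<close>; the real-valued norms are meaningful only on the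
  corresponding spaces, where these quantities are finite.
\<close>

definition hardy_sup :: "(real^'n) set \<Rightarrow> real \<Rightarrow> (complex^'n \<Rightarrow> complex) \<Rightarrow> ennreal" where
  "hardy_sup \<Omega> p f =
     (SUP t\<in>\<Omega>. \<integral>\<^sup>+x. ennreal (norm (f (complex_vec x t)) powr p) \<partial>lborel)"

definition hardy_norm :: "(real^'n) set \<Rightarrow> real \<Rightarrow> (complex^'n \<Rightarrow> complex) \<Rightarrow> real" where
  "hardy_norm \<Omega> p f = enn2real (hardy_sup \<Omega> p f) powr (1 / p)"

definition hardy_space :: "(real^'n) set \<Rightarrow> real \<Rightarrow> (complex^'n \<Rightarrow> complex) set" where
  "hardy_space \<Omega> p = {f \<in> holomorphic_functions (tube \<Omega>). hardy_sup \<Omega> p f < \<infinity>}"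

text \<open>
  Below, \<open>\<Delta>\<close> is the determinant function and \<open>s\<close> stands for \<open>n / r\<close>.
\<close>

definition bergman_integral ::
    "(real^'n) set \<Rightarrow> (real^'n \<Rightarrow> real) \<Rightarrow> real \<Rightarrow> real \<Rightarrow> real
       \<Rightarrow> (complex^'n \<Rightarrow> complex) \<Rightarrow> ennreal" where
  "bergman_integral \<Omega> \<Delta> s p \<nu> f =
     (\<integral>\<^sup>+(x, y). ennreal (norm (f (complex_vec x y)) powr p * \<Delta> y powr (\<nu> - s))
         * indicator \<Omega> y \<partial>(lborel \<Otimes>\<^sub>M lborel))"

definition bergman_norm ::
    "(real^'n) set \<Rightarrow> (real^'n \<Rightarrow> real) \<Rightarrow> real \<Rightarrow> real \<Rightarrow> real
       \<Rightarrow> (complex^'n \<Rightarrow> complex) \<Rightarrow> real" where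
  "bergman_norm \<Omega> \<Delta> s p \<nu> f = enn2real (bergman_integral \<Omega> \<Delta> s p \<nu> f) powr (1 / p)"

definition bergman_space ::
    "(real^'n) set \<Rightarrow> (real^'n \<Rightarrow> real) \<Rightarrow> real \<Rightarrow> real \<Rightarrow> real
       \<Rightarrow> (complex^'n \<Rightarrow> complex) set" where
  "bergman_space \<Omega> \<Delta> s p \<nu> =
     {f \<in> holomorphic_functions (tube \<Omega>). bergman_integral \<Omega> \<Delta> s p \<nu> f < \<infinity>}"

definition weighted_Hinf ::
    "(real^'n) set \<Rightarrow> (real^'n \<Rightarrow> real) \<Rightarrow> real \<Rightarrow> (complex^'n \<Rightarrow> complex) set" where
  "weighted_Hinf \<Omega> \<Delta> \<alpha> =
     {F \<in> holomorphic_functions (tube \<Omega>).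
        bdd_above ((\<lambda>z. \<Delta> (Im_vec z) powr \<alpha> * norm (F z)) ` tube \<Omega>)}"

definition bounded_Hinf :: "(real^'n) set \<Rightarrow> (complex^'n \<Rightarrow> complex) set" where
  "bounded_Hinf \<Omega> = {F \<in> holomorphic_functions (tube \<Omega>). bounded (F ` tube \<Omega>)}"

definition multipliers ::
    "(complex^'n) set \<Rightarrow> (complex^'n \<Rightarrow> complex) set \<Rightarrow> ((complex^'n \<Rightarrow> complex) \<Rightarrow> real)
       \<Rightarrow> (complex^'n \<Rightarrow> complex) set \<Rightarrow> ((complex^'n \<Rightarrow> complex) \<Rightarrow> real)
       \<Rightarrow> (complex^'n \<Rightarrow> complex) set" where
  "multipliers D X normX Y normY =
     {G \<in> holomorphic_functions D.
        \<exists>C>0. \<forall>F\<in>X. (\<lambda>z. F z * G z) \<in> Y \<and> normY (\<lambda>z. F z * G z) \<le> C * normX F}"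

definition hardy_bergman_multipliers ::
    "(real^'n) set \<Rightarrow> (real^'n \<Rightarrow> real) \<Rightarrow> real \<Rightarrow> real \<Rightarrow> real \<Rightarrow> real
       \<Rightarrow> (complex^'n \<Rightarrow> complex) set" where
  "hardy_bergman_multipliers \<Omega> \<Delta> s q p \<nu> =
     multipliers (tube \<Omega>) (hardy_space \<Omega> q) (hardy_norm \<Omega> q)
       (bergman_space \<Omega> \<Delta> s p \<nu>) (bergman_norm \<Omega> \<Delta> s p \<nu>)"

end

theory Submission
  imports Defs "HOL-Complex_Analysis.Complex_Analysis" "HOL-Probability.Probability"
    "HOL-Computational_Algebra.Fundamental_Theorem_Algebra"
begin

text \<open>
  For every \<open>y\<close> in the cone, a product of Peirce operators along a spectral decomposition of \<open>y\<close> is a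
  self-adjoint linear automorphism of the cone that maps the unit \<open>e\<close> to \<open>y\<close>; by irreducibility its
  determinant is \<open>\<Delta>(y)\<close> to the power \<open>n/r\<close>. Combined with the sub-mean value property these
  automorphisms yield the pointwise growth of Hardy and Bergman functions, and, applied to one fixed
  test function, the growth bound on a multiplier. For \<open>\<gamma> < 0\<close> a multiplier therefore vanishes at the
  boundary, so by the reflection principle on complex lines it is zero.

  Conversely, passing from \<open>F\<close> to its \<open>m\<close>-th power and using the pointwise bound for \<open>H\<^sup>2\<close>, it suffices
  to bound the integral of \<open>\<bar>F\<bar>\<^sup>4\<close> over the tube for \<open>F\<close> in \<open>H\<^sup>2\<close>. The Fourier transform \<open>f\<close> of the
  boundary values of \<open>F\<close> lives on the closed cone. Plancherel's theorem for \<open>F\<^sup>2\<close> and the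
  Cauchy-Schwarz inequality bound that integral by the integral of \<open>L(\<xi>) v(\<xi>) (\<bar>f\<bar>\<^sup>2 * \<bar>f\<bar>\<^sup>2)(\<xi>)\<close>, where
  \<open>L\<close> is the Laplace transform of the cone at \<open>2\<xi>\<close> and \<open>v(\<xi>)\<close> is the volume of the intersection of
  the cone with \<open>\<xi>\<close> minus the cone. The automorphisms show that \<open>L v\<close> is constant.
\<close>

section \<open>Spectral theorem\<close>

text \<open>The critical case is p = 4, where the weight at \<gamma> = 0 is Lebesgue measure. For p
  = 4 + 2 a the extra factor |F|^(2 a) is traded by the pointwise bound for the weight \<Delta>^(s
  a), s = n / r; \<gamma> measures how far the given weight is from that one: \<nu> - s = p \<gamma>
  + s (p / 2 - 2). Slices of a function in the Hardy space of exponent 2 need not be integrable, so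
  their Fourier integrals need not converge. They are multiplied by a rational function
  \<open>damp\<close> of modulus at most 1 that decays in the real directions. All estimates kept to
  the end are free of its parameter, and Fatou's lemma removes it. The inner product B of the
  self-dual cone need not be the coordinate one, so the Fourier transform is taken with respect to
  B, with an inversion constant that is never evaluated. Irreducibility enters through one fact:
  multiplication by a primitive idempotent always has the same trace, equal to n / r. It gives the
  equal size of all frames and, by way of volumes of order intervals, the multiplicativity of
  \<Delta> under the automorphisms.\<close>

locale euclidean_jordan =
  fixes mul :: "'v::euclidean_space \<Rightarrow> 'v \<Rightarrow> 'v" (infixl \<open>\<odot>\<close> 72)
    and e :: 'v and B :: "'v \<Rightarrow> 'v \<Rightarrow> real"
  assumes bilin: "bilinear mul" and comm: "x \<odot> y = y \<odot> x"
    and jordan: "x \<odot> ((x \<odot> x) \<odot> y) = (x \<odot> x) \<odot> (x \<odot> y)"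
    and unit [simp]: "e \<odot> x = x"
    and inner: "inner_product B"
    and assoc: "B (x \<odot> u) v = B u (x \<odot> v)"
begin

lemma bilinB: "bilinear B" and symB: "B x y = B y x" and posB: "x \<noteq> 0 \<Longrightarrow> B x x > 0"
  using inner unfolding inner_product_def by auto

lemmas mul_simps [simp] = bilinear_lzero[OF bilin] bilinear_rzero[OF bilin]
  bilinear_lneg[OF bilin] bilinear_rneg[OF bilin]
lemmas mul_add = bilinear_ladd[OF bilin] bilinear_radd[OF bilin]
lemmas mul_diff = bilinear_lsub[OF bilin] bilinear_rsub[OF bilin]
lemmas mul_scale = bilinear_lmul[OF bilin] bilinear_rmul[OF bilin]
lemmas mul_lin = mul_add mul_diff mul_scale
lemmas B_simps [simp] = bilinear_lzero[OF bilinB] bilinear_rzero[OF bilinB]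
  bilinear_lneg[OF bilinB] bilinear_rneg[OF bilinB]
lemmas B_add = bilinear_ladd[OF bilinB] bilinear_radd[OF bilinB]
lemmas B_diff = bilinear_lsub[OF bilinB] bilinear_rsub[OF bilinB]
lemmas B_scale = bilinear_lmul[OF bilinB] bilinear_rmul[OF bilinB]
lemmas B_lin = B_add B_diff B_scale

lemma unit_right [simp]: "x \<odot> e = x"
  by (subst comm) simp

lemma linear_mul: "linear (mul x)" and linear_B: "linear (B x)" and linear_B': "linear (\<lambda>y. B y x)"
  and linear_mul': "linear (\<lambda>y. mul y x)"
  using bilin bilinB unfolding bilinear_def by auto

lemma mul_sum_left: "(\<Sum>i\<in>I. f i) \<odot> x = (\<Sum>i\<in>I. f i \<odot> x)"
  by (rule linear_sum[OF linear_mul'])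
lemma mul_sum_right: "x \<odot> (\<Sum>i\<in>I. f i) = (\<Sum>i\<in>I. x \<odot> f i)"
  by (rule linear_sum[OF linear_mul])
lemma B_sum_left: "B (\<Sum>i\<in>I. f i) x = (\<Sum>i\<in>I. B (f i) x)"
  by (rule linear_sum[OF linear_B'])
lemma B_eq_0_iff: "B x x = 0 \<longleftrightarrow> x = 0"
  using posB[of x] by force

lemma B_nonneg: "B x x \<ge> 0"
  using posB[of x] by (cases "x = 0") auto

lemma B_mul_e: "B (x \<odot> y) e = B x y" "B e (x \<odot> y) = B x y"
  by (metis assoc comm unit_right symB)+

text \<open>Polarisation: the difference of the Jordan identity at \<open>x + z\<close> and at
  \<open>x - z\<close> consists of the terms of odd degree in \<open>z\<close>, and the cubic ones
  cancel by the identity at \<open>z\<close> itself.\<close>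

lemma jordan_linear1:
  "z \<odot> ((x \<odot> x) \<odot> y) + 2 *\<^sub>R (x \<odot> ((x \<odot> z) \<odot> y))
     = 2 *\<^sub>R ((x \<odot> z) \<odot> (x \<odot> y)) + (x \<odot> x) \<odot> (z \<odot> y)"
proof -
  let ?a = "z \<odot> ((x \<odot> x) \<odot> y) + 2 *\<^sub>R (x \<odot> ((x \<odot> z) \<odot> y))"
  let ?b = "2 *\<^sub>R ((x \<odot> z) \<odot> (x \<odot> y)) + (x \<odot> x) \<odot> (z \<odot> y)"
  have zx: "z \<odot> x = x \<odot> z" by (rule comm)
  have "2 *\<^sub>R ?a = ((x+z) \<odot> (((x+z) \<odot> (x+z)) \<odot> y) - (x-z) \<odot> (((x-z) \<odot> (x-z)) \<odot> y))
           - 2 *\<^sub>R (z \<odot> ((z \<odot> z) \<odot> y))"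
    unfolding mul_lin zx by (simp add: algebra_simps scaleR_2)
  also have "\<dots> = (((x+z) \<odot> (x+z)) \<odot> ((x+z) \<odot> y) - ((x-z) \<odot> (x-z)) \<odot> ((x-z) \<odot> y))
           - 2 *\<^sub>R ((z \<odot> z) \<odot> (z \<odot> y))"
    unfolding jordan ..
  also have "\<dots> = 2 *\<^sub>R ?b"
    unfolding mul_lin zx by (simp add: algebra_simps scaleR_2)
  finally show ?thesis by simp
qed

text \<open>Second polarisation, in the variable that is still quadratic: \<open>x + w\<close> is
  put for \<open>x\<close> and the two pure terms are subtracted.\<close>

lemma jordan_linear:
  "z \<odot> ((x \<odot> w) \<odot> y) + x \<odot> ((w \<odot> z) \<odot> y) + w \<odot> ((x \<odot> z) \<odot> y)
     = (x \<odot> z) \<odot> (w \<odot> y) + (w \<odot> z) \<odot> (x \<odot> y) + (x \<odot> w) \<odot> (z \<odot> y)"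
proof -
  have c: "w \<odot> x = x \<odot> w" by (rule comm)
  have "2 *\<^sub>R (z \<odot> ((x \<odot> w) \<odot> y) + x \<odot> ((w \<odot> z) \<odot> y) + w \<odot> ((x \<odot> z) \<odot> y))
     = (z \<odot> (((x+w) \<odot> (x+w)) \<odot> y) + 2 *\<^sub>R ((x+w) \<odot> (((x+w) \<odot> z) \<odot> y)))
       - (z \<odot> ((x \<odot> x) \<odot> y) + 2 *\<^sub>R (x \<odot> ((x \<odot> z) \<odot> y)))
       - (z \<odot> ((w \<odot> w) \<odot> y) + 2 *\<^sub>R (w \<odot> ((w \<odot> z) \<odot> y)))"
    unfolding mul_lin c by (simp add: algebra_simps scaleR_2)
  also have "\<dots> = 2 *\<^sub>R ((x \<odot> z) \<odot> (w \<odot> y) + (w \<odot> z) \<odot> (x \<odot> y) + (x \<odot> w) \<odot> (z \<odot> y))"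
    unfolding jordan_linear1 unfolding mul_lin c by (simp add: algebra_simps scaleR_2)
  finally show ?thesis by simp
qed

text \<open>To be read as an identity between operators applied to \<open>z\<close>.\<close>

lemma mul_triple:
  "((x \<odot> w) \<odot> y) \<odot> z = (w \<odot> y) \<odot> (x \<odot> z) + (x \<odot> y) \<odot> (w \<odot> z) + (x \<odot> w) \<odot> (y \<odot> z)
     - x \<odot> (y \<odot> (w \<odot> z)) - w \<odot> (y \<odot> (x \<odot> z))"
  using jordan_linear[of z x w y]
  by (simp add: algebra_simps comm[of z] comm[of "w \<odot> z" y] comm[of "x \<odot> z" y] comm[of "x \<odot> z" "w \<odot> y"]
      comm[of "w \<odot> z" "x \<odot> y"])

abbreviation pow :: "'v \<Rightarrow> nat \<Rightarrow> 'v" where "pow x k \<equiv> jordan_power mul e x k"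
abbreviation ev :: "real poly \<Rightarrow> 'v \<Rightarrow> 'v" where "ev q x \<equiv> jordan_poly mul e q x"

lemma pow_0 [simp]: "pow x 0 = e" and pow_Suc: "pow x (Suc k) = x \<odot> pow x k"
  by (simp_all add: jordan_power_def)

lemma pow_Suc_Suc: "pow x (Suc (Suc n)) = (x \<odot> x) \<odot> pow x n"
proof (induction n)
  case (Suc n)
  have "pow x (Suc (Suc (Suc n))) = x \<odot> ((x \<odot> x) \<odot> pow x n)" by (subst pow_Suc) (simp add: Suc)
  then show ?case by (simp add: jordan pow_Suc)
qed (simp add: pow_Suc)

text \<open>For \<open>n\<close> at least 2, \<open>mul_triple\<close> expresses multiplication by
  \<open>pow x n\<close> through multiplications by \<open>x\<close>, \<open>x \<odot> x\<close> and
  the two preceding powers. All of these commute with multiplication by \<open>x\<close>, by the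
  Jordan identity and by induction on two predecessors.\<close>

lemma pow_commute: "x \<odot> (pow x n \<odot> z) = pow x n \<odot> (x \<odot> z)"
proof (induction n arbitrary: z rule: less_induct)
  case (less n)
  consider "n = 0" | "n = 1" | k where "n = Suc (Suc k)"
    by (metis One_nat_def not0_implies_Suc)
  then show ?case
  proof cases
    case 3
    have A: "pow x n \<odot> z = 2 *\<^sub>R (pow x (Suc k) \<odot> (x \<odot> z)) + (x \<odot> x) \<odot> (pow x k \<odot> z)
               - 2 *\<^sub>R (x \<odot> (pow x k \<odot> (x \<odot> z)))" for z
      using mul_triple[of x x "pow x k" z]
      by (simp add: 3 pow_Suc_Suc) (simp add: pow_Suc scaleR_2 algebra_simps)
    have I1: "x \<odot> (pow x (Suc k) \<odot> w) = pow x (Suc k) \<odot> (x \<odot> w)"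
      and I2: "x \<odot> (pow x k \<odot> w) = pow x k \<odot> (x \<odot> w)" for w
      using less[of "Suc k"] less[of k] 3 by auto
    have J: "x \<odot> ((x \<odot> x) \<odot> w) = (x \<odot> x) \<odot> (x \<odot> w)" for w by (rule jordan)
    show ?thesis unfolding A by (simp add: mul_lin I1 I2 J)
  qed (simp_all add: pow_Suc)
qed

lemma ev_sum: assumes "degree q \<le> N" shows "ev q x = (\<Sum>k\<le>N. coeff q k *\<^sub>R pow x k)"
  unfolding jordan_poly_def
  by (rule sum.mono_neutral_left) (use assms in \<open>auto simp: coeff_eq_0\<close>)

lemma ev_0 [simp]: "ev 0 x = 0" by (simp add: jordan_poly_def)

lemma ev_add: "ev (p + q) x = ev p x + ev q x"
proof -
  let ?N = "max (degree p) (degree q)"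
  have "degree (p + q) \<le> ?N" by (rule degree_add_le_max)
  then show ?thesis
    using ev_sum[of p ?N] ev_sum[of q ?N] ev_sum[of "p+q" ?N]
    by (simp add: scaleR_add_left sum.distrib)
qed

lemma ev_smult: "ev (smult a p) x = a *\<^sub>R ev p x"
  using ev_sum[of p "degree p"] ev_sum[of "smult a p" "degree p"]
  by (simp add: scaleR_sum_right)

lemma ev_diff: "ev (p - q) x = ev p x - ev q x"
  using ev_add[of p "smult (-1) q" x] by (simp only: ev_smult) simp

lemma ev_pCons: "ev (pCons a q) x = a *\<^sub>R e + x \<odot> ev q x"
proof -
  have "ev (pCons a q) x = (\<Sum>k\<le>Suc (degree q). coeff (pCons a q) k *\<^sub>R pow x k)"
    by (rule ev_sum) (rule degree_pCons_le)
  also have "\<dots> = a *\<^sub>R e + x \<odot> (\<Sum>k\<le>degree q. coeff q k *\<^sub>R pow x k)"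
    by (subst sum.atMost_Suc_shift) (simp add: mul_sum_right mul_scale pow_Suc)
  finally show ?thesis by (simp add: jordan_poly_def)
qed

lemma ev_1 [simp]: "ev 1 x = e" by (simp add: one_pCons ev_pCons)

lemma ev_commute: "x \<odot> (ev q x \<odot> z) = ev q x \<odot> (x \<odot> z)"
  by (simp add: jordan_poly_def mul_sum_left mul_sum_right mul_scale pow_commute)

text \<open>Power associativity: products of powers can be rebracketed since multiplication by
  \<open>x\<close> commutes with multiplication by any polynomial in \<open>x\<close>.\<close>

lemma ev_mult: "ev (p * q) x = ev p x \<odot> ev q x"
proof (induction p)
  case (pCons a p)
  have "(x \<odot> ev p x) \<odot> ev q x = ev q x \<odot> (x \<odot> ev p x)" by (rule comm)
  also have "\<dots> = x \<odot> (ev p x \<odot> ev q x)"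
    by (metis ev_commute comm)
  finally show ?case using pCons
    by (simp add: ev_add ev_smult ev_pCons mul_lin)
qed simp

lemma ev_sum_poly: "ev (\<Sum>i\<in>I. f i) x = (\<Sum>i\<in>I. ev (f i) x)"
  by (induction I rule: infinite_finite_induct) (auto simp: ev_add)

lemma ex_annihilator: "\<exists>q. q \<noteq> 0 \<and> ev q x = 0"
proof (cases "inj_on (pow x) {..DIM('v)}")
  case True
  have "card (pow x ` {..DIM('v)}) > DIM('v)" using True by (simp add: card_image)
  then have "dependent (pow x ` {..DIM('v)})" by (intro dependent_biggerset) auto
  then obtain u v where u: "v \<in> pow x ` {..DIM('v)}" "u v \<noteq> 0"
     "(\<Sum>v\<in>pow x ` {..DIM('v)}. u v *\<^sub>R v) = 0"
    by (subst (asm) dependent_finite) auto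
  define q where "q = (\<Sum>k\<le>DIM('v). monom (u (pow x k)) k)"
  have cq: "coeff q k = (if k \<le> DIM('v) then u (pow x k) else 0)" for k
    by (simp add: q_def coeff_sum sum.delta)
  have dq: "degree q \<le> DIM('v)" by (rule degree_le) (simp add: cq)
  have "ev q x = (\<Sum>k\<le>DIM('v). u (pow x k) *\<^sub>R pow x k)"
    unfolding ev_sum[OF dq] by (simp add: cq)
  also have "\<dots> = 0" using u(3) True by (simp add: sum.reindex)
  finally have "ev q x = 0" .
  moreover have "q \<noteq> 0"
  proof
    assume "q = 0"
    then have "u (pow x k) = 0" if "k \<le> DIM('v)" for k using cq[of k] that by simp
    then show False using u(1,2) by auto
  qed
  ultimately show ?thesis by blast
next
  case False
  \<comment> \<open>Linear dependence concerns sets, so coinciding powers escape the dimension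
    count; two equal powers annihilate \<open>x\<close> through a difference of monomials.\<close>
  then obtain i j where ij: "i \<noteq> j" "pow x i = pow x j" by (auto simp: inj_on_def)
  define q where "q = monom (1::real) i - monom 1 j"
  have em: "ev (monom 1 k) x = pow x k" for k
    using ev_sum[of "monom 1 k" k x] by (simp add: degree_monom_le if_distrib[of "\<lambda>a. a *\<^sub>R _"] cong: if_cong)
  have "coeff q i = 1" using ij by (simp add: q_def)
  then have "q \<noteq> 0" by force
  moreover have "ev q x = 0" using ij by (simp add: q_def ev_diff em)
  ultimately show ?thesis by blast
qed

end

text \<open>The remainder of \<open>f\<close> modulo the real quadratic has degree below 2 and
  vanishes at a non-real number, so both its real coefficients vanish.\<close>

lemma quadratic_dvd_of_complex_root:
  fixes f :: "real poly"
  assumes "poly (map_poly complex_of_real f) (Complex a b) = 0" "b \<noteq> 0"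
  shows "[:a\<^sup>2 + b\<^sup>2, - 2 * a, 1:] dvd f"
proof -
  define g where "g = [:a\<^sup>2 + b\<^sup>2, - 2 * a, 1:]"
  have g0: "g \<noteq> 0" "degree g = 2" by (auto simp: g_def)
  have mh: "map_poly complex_of_real (p + q) = map_poly complex_of_real p + map_poly complex_of_real q"
    and mm: "map_poly complex_of_real (p * q) = map_poly complex_of_real p * map_poly complex_of_real q" for p q
    by (auto intro!: poly_eqI simp: coeff_map_poly coeff_mult)
  define h where "h = f mod g"
  have "degree h < 2" using degree_mod_less[of g f] g0 unfolding h_def by auto
  then obtain u v where h: "h = [:u, v:]"
    by (metis One_nat_def Suc_1 degree_eq_zeroE degree_pCons_eq_if less_Suc_eq less_one nat.inject pCons_cases
        pCons_0_0)
  have "poly (map_poly complex_of_real g) (Complex a b) = 0"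
    by (simp add: g_def map_poly_pCons complex_eq_iff power2_eq_square)
  moreover have "f = f div g * g + h" by (simp add: h_def)
  ultimately have "poly (map_poly complex_of_real h) (Complex a b) = 0"
    using assms(1) by (metis add_0 mh mm mult_zero_right poly_add poly_mult)
  then have "u = 0 \<and> v = 0" using assms(2) by (auto simp: h map_poly_pCons complex_eq_iff)
  then have "h = 0" by (simp add: h)
  then show ?thesis by (simp add: g_def h_def mod_eq_0_iff_dvd)
qed

text \<open>One hypothesis excludes two things: with \<open>b\<close> nonzero a non-real root, with
  \<open>b = 0\<close> a double real root.\<close>

lemma split_into_distinct_linear_factors:
  fixes f :: "real poly"
  assumes "f \<noteq> 0" "\<And>a b. \<not> [:a\<^sup>2 + b\<^sup>2, - 2 * a, 1:] dvd f"
  shows "\<exists>S c. finite S \<and> c \<noteq> 0 \<and> f = smult c (\<Prod>a\<in>S. [:-a, 1:])"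
  using assms
proof (induction "degree f" arbitrary: f)
  case 0
  then obtain c where "f = [:c:]" by (metis degree_eq_zeroE)
  with 0 show ?case by (intro exI[of _ "{}"] exI[of _ c]) auto
next
  case (Suc n)
  have "degree (map_poly complex_of_real f) = Suc n"
    using Suc by (simp add: degree_map_poly)
  then obtain z where z: "poly (map_poly complex_of_real f) z = 0"
    using alg_closed_imp_poly_has_root[of "map_poly complex_of_real f"] by auto
  obtain a b where ab: "z = Complex a b" by (cases z)
  have b: "b = 0" using quadratic_dvd_of_complex_root[of f a b] Suc z ab by auto
  have "z = of_real a" using ab b by (simp add: complex_eq_iff)
  moreover have "poly (map_poly complex_of_real q) (of_real a) = of_real (poly q a)" for q
    by (induction q) (auto simp: map_poly_pCons)
  ultimately have "complex_of_real (poly f a) = 0" using z by simp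
  then have "poly f a = 0" by simp
  then obtain g where g: "f = [:-a, 1:] * g" by (auto simp: poly_eq_0_iff_dvd)
  have g0: "g \<noteq> 0" using g Suc by auto
  have "degree f = 1 + degree g" unfolding g using g0 by (subst degree_mult_eq) auto
  then have "degree g = n" using Suc by simp
  moreover have "\<not> [:a\<^sup>2 + b\<^sup>2, - 2 * a, 1:] dvd g" for a b
    using Suc(4)[of a b] unfolding g by (meson dvd_mult)
  ultimately obtain S c where S: "finite S" "c \<noteq> 0" "g = smult c (\<Prod>a\<in>S. [:-a, 1:])"
    using Suc(1)[of g] g0 by auto
  have "a \<notin> S"
  proof
    assume "a \<in> S"
    then have "[:-a, 1:] dvd g" using S by (auto intro!: dvd_smult dvd_prod_eqI)
    then have "[:-a, 1:] * [:-a, 1:] dvd f" unfolding g by (intro mult_dvd_mono) auto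
    moreover have "[:-a, 1:] * [:-a, 1:] = [:a\<^sup>2 + 0\<^sup>2, - 2 * a, 1:]" by (simp add: power2_eq_square)
    ultimately show False using Suc(4)[of a 0] by simp
  qed
  then have "f = smult c (\<Prod>a\<in>insert a S. [:-a, 1:])" using S g by simp
  then show ?case using S by blast
qed

lemma prod_linear_dvd:
  fixes q :: "'a::idom poly"
  assumes "finite S" "\<And>a. a \<in> S \<Longrightarrow> poly q a = 0"
  shows "(\<Prod>a\<in>S. [:-a, 1:]) dvd q"
  using assms
proof (induction S arbitrary: q rule: finite_induct)
  case (insert a S)
  have "poly q a = 0" using insert by simp
  then obtain g where g: "q = [:-a, 1:] * g" using poly_eq_0_iff_dvd by (metis dvd_def)
  have "poly g b = 0" if "b \<in> S" for b
    using insert.prems[of b] insert.hyps that by (auto simp: g)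
  then have "(\<Prod>a\<in>S. [:-a, 1:]) dvd g" using insert by blast
  then have "[:-a, 1:] * (\<Prod>a\<in>S. [:-a, 1:]) dvd [:-a, 1:] * g" by (rule mult_dvd_mono[OF dvd_refl])
  then show ?case unfolding g prod.insert[OF insert.hyps] .
qed simp

context euclidean_jordan begin

text \<open>Formal reality. The quadratic is (t - a)^2 + b^2, so multiplying the hypothesis by
  \<open>h\<close> and pairing with \<open>e\<close> gives B(u, u) + b^2 B(w, w) = 0 for the values
  u of \<open>[:-a, 1:] * h\<close> and w of \<open>h\<close>; both terms are nonnegative.\<close>

lemma ev_quadratic_zero:
  assumes "ev ([:a\<^sup>2 + b\<^sup>2, - 2 * a, 1:] * h) x = 0" shows "ev ([:-a, 1:] * h) x = 0"
proof -
  have "[:a\<^sup>2 + b\<^sup>2, - 2 * a, 1:] = [:-a, 1:] * [:-a, 1:] + [:b\<^sup>2:]"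
    by (simp add: power2_eq_square)
  moreover have sC: "smult (b\<^sup>2) q = [:b\<^sup>2:] * q" for q by simp
  ultimately have eq: "h * ([:a\<^sup>2 + b\<^sup>2, - 2 * a, 1:] * h) = ([:-a, 1:] * h) * ([:-a, 1:] * h) + smult (b\<^sup>2) (h * h)"
    by (simp only: algebra_simps sC)
  have "ev (h * ([:a\<^sup>2 + b\<^sup>2, - 2 * a, 1:] * h)) x = 0" using assms by (simp only: ev_mult[of h]) simp
  then have "B (ev (([:-a, 1:] * h) * ([:-a, 1:] * h)) x + ev (smult (b\<^sup>2) (h * h)) x) e = 0"
    unfolding eq by (simp only: ev_add) simp
  then have "B (ev ([:-a, 1:] * h) x) (ev ([:-a, 1:] * h) x) + b\<^sup>2 * B (ev h x) (ev h x) = 0"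
    by (simp only: ev_mult[of _ "[:-a,1:] * h"] ev_smult ev_mult[of h h] B_lin B_mul_e real_scaleR_def) 
  moreover have "b\<^sup>2 * B (ev h x) (ev h x) \<ge> 0" by (simp add: B_nonneg)
  ultimately have "B (ev ([:-a, 1:] * h) x) (ev ([:-a, 1:] * h) x) = 0"
    using B_nonneg[of "ev ([:-a, 1:] * h) x"] by linarith
  then show ?thesis by (simp add: B_eq_0_iff)
qed

text \<open>\<open>S\<close> is the root set of a nonzero annihilating polynomial of least degree: a
  divisor (t - a)^2 + b^2 could be replaced by t - a, which lowers the degree, so only distinct real
  linear factors remain.\<close>

lemma spectral_poly:
  "\<exists>S. finite S \<and> (\<forall>q. ev q x = 0 \<longleftrightarrow> (\<forall>a\<in>S. poly q a = 0))"
proof -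
  obtain f where f: "f \<noteq> 0" "ev f x = 0" and min: "\<And>q. q \<noteq> 0 \<Longrightarrow> ev q x = 0 \<Longrightarrow> degree f \<le> degree q"
    using ex_has_least_nat[of "\<lambda>q. q \<noteq> 0 \<and> ev q x = 0" _ degree] ex_annihilator[of x] by blast
  have "\<not> [:a\<^sup>2 + b\<^sup>2, - 2 * a, 1:] dvd f" for a b
  proof
    assume "[:a\<^sup>2 + b\<^sup>2, - 2 * a, 1:] dvd f"
    then obtain h where h: "f = [:a\<^sup>2 + b\<^sup>2, - 2 * a, 1:] * h" by (auto simp: dvd_def)
    have h0: "h \<noteq> 0" using h f by auto
    have "ev ([:-a, 1:] * h) x = 0" using ev_quadratic_zero f(2) h by metis
    moreover have "[:-a, 1:] * h \<noteq> 0" using h0 by (metis mult_eq_0_iff pCons_eq_0_iff zero_neq_one)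
    ultimately have "degree f \<le> degree ([:-a, 1:] * h)" by (intro min)
    also have "\<dots> = 1 + degree h" using h0 by (subst degree_mult_eq) auto
    finally have "degree f \<le> 1 + degree h" .
    moreover have "degree f = 2 + degree h" unfolding h using h0 by (subst degree_mult_eq) auto
    ultimately show False by simp
  qed
  then obtain S c where S: "finite S" "c \<noteq> 0" "f = smult c (\<Prod>a\<in>S. [:-a, 1:])"
    using split_into_distinct_linear_factors f(1) by blast
  have "ev q x = 0 \<longleftrightarrow> (\<forall>a\<in>S. poly q a = 0)" for q
  proof
    assume z: "\<forall>a\<in>S. poly q a = 0"
    then have "(\<Prod>a\<in>S. [:-a, 1:]) dvd q" by (intro prod_linear_dvd S) auto
    then have "f dvd q" using S by (simp add: smult_dvd_iff)
    then show "ev q x = 0" using f(2) by (auto simp: dvd_def ev_mult)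
  next
    assume z: "ev q x = 0"
    have "q mod f = q - (q div f) * f" by (simp add: minus_div_mult_eq_mod)
    then have "ev (q mod f) x = 0" using z f(2) by (simp add: ev_diff ev_mult)
    then have "q mod f = 0" using degree_mod_less[of f q] f(1) min[of "q mod f"] by force
    then have "f dvd q" by (simp add: mod_eq_0_iff_dvd)
    then have "(\<Prod>a\<in>S. [:-a, 1:]) dvd q" using S(3,2) by (simp add: smult_dvd_iff)
    then show "\<forall>a\<in>S. poly q a = 0" using S(1)
      using dvd_prodI[OF S(1), of _ "\<lambda>a. [:-a, 1:]"] dvd_trans poly_eq_0_iff_dvd by blast
  qed
  then show ?thesis using S(1) by blast
qed

definition idem :: "'v \<Rightarrow> bool" where "idem c \<longleftrightarrow> c \<odot> c = c"

text \<open>The idempotents are the values at \<open>x\<close> of the Lagrange polynomials of the roots of the minimal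
  polynomial.\<close>

lemma spectral_idempotents:
  "\<exists>S c. finite S \<and> (\<forall>a\<in>S. idem (c a) \<and> c a \<noteq> 0 \<and> x \<odot> c a = a *\<^sub>R c a \<and> (\<exists>q. c a = ev q x))
     \<and> (\<forall>a\<in>S. \<forall>b\<in>S. a \<noteq> b \<longrightarrow> c a \<odot> c b = 0) \<and> (\<Sum>a\<in>S. c a) = e \<and> x = (\<Sum>a\<in>S. a *\<^sub>R c a)"
proof -
  obtain S where S: "finite S" "\<And>q. ev q x = 0 \<longleftrightarrow> (\<forall>a\<in>S. poly q a = 0)"
    using spectral_poly by blast
  define l where "l a = (\<Prod>b\<in>S - {a}. smult (1 / (a - b)) [:-b, 1:])" for a
  have l: "poly (l a) b = (if a = b then 1 else 0)" if "a \<in> S" "b \<in> S" for a b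
  proof (cases "a = b")
    case True
    have "poly (smult (1 / (b - x)) [:-x, 1:]) b = 1" if "x \<in> S - {b}" for x
      using that by (simp add: diff_divide_distrib[symmetric])
    then show ?thesis using True by (simp only: l_def poly_prod) simp
  next
    case False
    then show ?thesis using that S(1) by (auto simp: l_def poly_prod prod_zero_iff)
  qed
  define c where "c a = ev (l a) x" for a
  have ev_eqI: "ev p x = ev q x" if "\<And>b. b \<in> S \<Longrightarrow> poly p b = poly q b" for p q
    using S(2)[of "p - q"] that by (simp add: ev_diff)
  have "idem (c a)" if "a \<in> S" for a
    unfolding idem_def c_def ev_mult[symmetric] by (rule ev_eqI) (use l that in auto)
  moreover have "c a \<noteq> 0" if "a \<in> S" for a
    unfolding c_def S(2) using l that by force
  moreover have "x \<odot> c a = a *\<^sub>R c a" if "a \<in> S" for a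
  proof -
    have "x \<odot> c a = ev ([:0,1:] * l a) x" by (simp add: c_def ev_mult ev_pCons)
    also have "\<dots> = ev (smult a (l a)) x" by (rule ev_eqI) (use l that in auto)
    finally show ?thesis by (simp add: ev_smult c_def)
  qed
  moreover have "c a \<odot> c b = 0" if "a \<in> S" "b \<in> S" "a \<noteq> b" for a b
    unfolding c_def ev_mult[symmetric] S(2) using l that by auto
  moreover have "(\<Sum>a\<in>S. c a) = ev 1 x"
    unfolding c_def ev_sum_poly[symmetric] 
    by (rule ev_eqI) (use S(1) in \<open>simp add: poly_sum l sum.delta\<close>)
  moreover have "ev [:0,1:] x = ev (\<Sum>a\<in>S. smult a (l a)) x"
    by (rule ev_eqI) (use S(1) in \<open>simp add: poly_sum l if_distrib cong: if_cong\<close>)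
  then have "x = (\<Sum>a\<in>S. a *\<^sub>R c a)"
    by (simp add: ev_sum_poly ev_smult c_def ev_pCons)
  ultimately show ?thesis using S(1) unfolding c_def by (intro exI[of _ S] exI[of _ "\<lambda>a. ev (l a) x"]) auto
qed

end

section \<open>Peirce decomposition\<close>

definition trace_op :: "('v::euclidean_space \<Rightarrow> 'v) \<Rightarrow> real" where
  "trace_op T = (\<Sum>b\<in>Basis. T b \<bullet> b)"

lemma trace_op_comp_commute:
  fixes S T :: "'v::euclidean_space \<Rightarrow> 'v"
  assumes "linear S" "linear T"
  shows "trace_op (\<lambda>x. S (T x)) = trace_op (\<lambda>x. T (S x))"
proof -
  have A: "trace_op (\<lambda>x. S (T x)) = (\<Sum>b\<in>Basis. \<Sum>c\<in>Basis. (T b \<bullet> c) * (S c \<bullet> b))"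
    if "linear S" "linear T" for S T :: "'v \<Rightarrow> 'v"
  proof -
    have "S (T b) \<bullet> b = (\<Sum>c\<in>Basis. (T b \<bullet> c) * (S c \<bullet> b))" for b
    proof -
      have "S (T b) = S (\<Sum>c\<in>Basis. (T b \<bullet> c) *\<^sub>R c)" by (simp add: euclidean_representation)
      also have "\<dots> = (\<Sum>c\<in>Basis. (T b \<bullet> c) *\<^sub>R S c)"
        by (simp add: linear_sum[OF that(1)] linear_cmul[OF that(1)])
      finally show ?thesis by (simp add: inner_sum_left)
    qed
    then show ?thesis by (simp add: trace_op_def)
  qed
  show ?thesis unfolding A[OF assms] A[OF assms(2,1)]
    by (subst sum.swap) (simp add: mult.commute)
qed

lemma scaleR_3: "3 *\<^sub>R (v::'a::real_vector) = v + v + v"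
  using scaleR_left_distrib[of 2 1 v] by (simp add: scaleR_2)

context euclidean_jordan begin

lemma idem_scale_e: "idem c \<Longrightarrow> idem (e - c)"
  unfolding idem_def by (simp add: mul_lin)

lemma commute_of_orth: assumes "idem c" "c \<odot> d = 0" shows "c \<odot> (d \<odot> x) = d \<odot> (c \<odot> x)"
  using jordan_linear1[of d c x] assms by (simp add: idem_def)

lemma commute_of_unit: assumes "idem c" "c \<odot> x = x" shows "c \<odot> (x \<odot> y) = x \<odot> (c \<odot> y)"
  using jordan_linear1[of x c y] assms by (simp add: idem_def scaleR_2)

text \<open>The Peirce spaces for the eigenvalues 1 and 0 annihilate each other:
  \<open>c \<odot> (d \<odot> x)\<close> is \<open>d \<odot> x\<close> when \<open>c\<close> is
  moved past \<open>d\<close>, and 0 when it is moved past \<open>x\<close>.\<close>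

lemma peirce_orth: assumes "idem c" "c \<odot> x = x" "c \<odot> d = 0" shows "d \<odot> x = 0"
proof -
  have "c \<odot> (d \<odot> x) = d \<odot> x" using commute_of_orth[OF assms(1,3)] assms(2) by simp
  moreover have "c \<odot> (x \<odot> d) = 0" using commute_of_unit[OF assms(1,2)] assms(3) by simp
  ultimately show ?thesis by (simp add: comm)
qed

text \<open>\<open>mul_triple\<close> with all entries \<open>c\<close>. Multiplication by
  \<open>c\<close> is a root of t (t - 1) (2 t - 1), so its eigenvalues are among 0, 1/2 and
  1.\<close>

lemma peirce_cubic: assumes "idem c" shows "2 *\<^sub>R (c \<odot> (c \<odot> (c \<odot> x))) = 3 *\<^sub>R (c \<odot> (c \<odot> x)) - c \<odot> x"
proof -
  have "c \<odot> x = 3 *\<^sub>R (c \<odot> (c \<odot> x)) - 2 *\<^sub>R (c \<odot> (c \<odot> (c \<odot> x)))"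
    using mul_triple[of c c c x] assms unfolding idem_def by (simp add: scaleR_2 scaleR_3 diff_diff_eq)
  then show ?thesis by (simp add: algebra_simps)
qed

text \<open>The Lagrange polynomials t (2 t - 1) and 4 t (1 - t) in the multiplication by
  \<open>c\<close>: for idempotent \<open>c\<close>, the projections onto its eigenspaces for 1 and
  1/2.\<close>

definition peirce1 :: "'v \<Rightarrow> 'v \<Rightarrow> 'v" where "peirce1 c x = 2 *\<^sub>R (c \<odot> (c \<odot> x)) - c \<odot> x"
definition peirceh :: "'v \<Rightarrow> 'v \<Rightarrow> 'v" where "peirceh c x = 4 *\<^sub>R (c \<odot> x - c \<odot> (c \<odot> x))"

lemma mul_peirce1: "idem c \<Longrightarrow> c \<odot> peirce1 c x = peirce1 c x"
  using peirce_cubic[of c x] by (simp add: peirce1_def mul_lin algebra_simps scaleR_2 scaleR_left_distrib[of 2 1, simplified])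

lemma mul_peirceh: "idem c \<Longrightarrow> c \<odot> peirceh c x = (1/2) *\<^sub>R peirceh c x"
proof -
  assume "idem c"
  have "2 *\<^sub>R (c \<odot> peirceh c x) = 8 *\<^sub>R (c \<odot> (c \<odot> x)) - 4 *\<^sub>R (2 *\<^sub>R (c \<odot> (c \<odot> (c \<odot> x))))"
    by (simp add: peirceh_def mul_lin scaleR_diff_right)
  also have "\<dots> = (8 *\<^sub>R (c \<odot> (c \<odot> x)) - 12 *\<^sub>R (c \<odot> (c \<odot> x))) + 4 *\<^sub>R (c \<odot> x)"
    unfolding peirce_cubic[OF \<open>idem c\<close>] by (simp add: scaleR_diff_right)
  also have "\<dots> = peirceh c x"
    unfolding scaleR_left_diff_distrib[symmetric] peirceh_def by (simp add: scaleR_diff_right)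
  finally have "(1/2) *\<^sub>R (2 *\<^sub>R (c \<odot> peirceh c x)) = (1/2) *\<^sub>R peirceh c x" by simp
  then show ?thesis by simp
qed

lemma mul_eq_peirce: "c \<odot> x = peirce1 c x + (1/2) *\<^sub>R peirceh c x"
  by (simp add: peirce1_def peirceh_def algebra_simps scaleR_2)

text \<open>Multiplication by \<open>c\<close> is the projection \<open>peirce1 c\<close> plus half
  the projection \<open>peirceh c\<close>, both self-adjoint for \<open>B\<close>. This gives
  positivity and determines the kernel.\<close>

lemma B_peirce: assumes "idem c"
  shows "B (c \<odot> x) x = B (peirce1 c x) (peirce1 c x) + (1/2) * B (peirceh c x) (peirceh c x)"
proof -
  have sa1: "B (peirce1 c u) v = B u (peirce1 c v)" for u v by (simp add: peirce1_def B_lin assoc)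
  have sah: "B (peirceh c u) v = B u (peirceh c v)" for u v by (simp add: peirceh_def B_lin assoc)
  have "peirce1 c (peirce1 c x) = peirce1 c x"
    unfolding peirce1_def[of c "peirce1 c x"] mul_peirce1[OF assms] by (simp add: scaleR_2)
  moreover have "peirceh c (peirceh c x) = peirceh c x"
    unfolding peirceh_def[of c "peirceh c x"] mul_peirceh[OF assms] mul_scale
    by (simp add: scaleR_left_diff_distrib[symmetric])
  ultimately show ?thesis unfolding mul_eq_peirce[of c x] B_lin sa1[of "x", symmetric] 
    by (metis sa1 sah symB real_scaleR_def)
qed

lemma idem_psd: assumes "idem c" shows "B (c \<odot> x) x \<ge> 0"
  unfolding B_peirce[OF assms] by (simp add: B_nonneg)

lemma idem_psd_0: assumes "idem c" "B (c \<odot> x) x = 0" shows "c \<odot> x = 0"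
proof -
  have "B (peirce1 c x) (peirce1 c x) = 0 \<and> B (peirceh c x) (peirceh c x) = 0"
    using assms(2) B_nonneg[of "peirce1 c x"] B_nonneg[of "peirceh c x"] unfolding B_peirce[OF assms(1)]
    by linarith
  then show ?thesis by (subst mul_eq_peirce) (simp add: B_eq_0_iff)
qed

text \<open>B(c d, d) = B(c, d) for an idempotent d, and a positive semidefinite operator
  annihilates every vector on which its quadratic form vanishes.\<close>

lemma orth_iff: assumes "idem c" "idem d" shows "c \<odot> d = 0 \<longleftrightarrow> B c d = 0"
proof -
  have "B (c \<odot> d) d = B c d" using assms(2) unfolding idem_def by (metis assoc comm)
  then show ?thesis using idem_psd_0[OF assms(1), of d] by auto
qed

definition primitive :: "'v \<Rightarrow> bool" where
  "primitive c \<longleftrightarrow> idem c \<and> c \<noteq> 0 \<and> (\<forall>d. idem d \<longrightarrow> c \<odot> d = d \<longrightarrow> d = 0 \<or> d = c)"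

definition orth_system :: "'v set \<Rightarrow> bool" where
  "orth_system C \<longleftrightarrow> finite C \<and> (\<forall>c\<in>C. primitive c) \<and> (\<forall>c\<in>C. \<forall>d\<in>C. c \<noteq> d \<longrightarrow> c \<odot> d = 0)"

definition frame :: "'v set \<Rightarrow> bool" where "frame C \<longleftrightarrow> orth_system C \<and> \<Sum>C = e"

lemma primitive_idem: "primitive c \<Longrightarrow> idem c" and primitive_nz: "primitive c \<Longrightarrow> c \<noteq> 0"
  by (auto simp: primitive_def)

text \<open>\<open>c - d\<close> is orthogonal to \<open>d\<close>, hence annihilates everything
  that \<open>d\<close> fixes.\<close>

lemma unit_trans: assumes "idem c" "idem d" "c \<odot> d = d" "d \<odot> x = x" shows "c \<odot> x = x"
proof -
  have "d \<odot> (c - d) = 0" using assms by (simp add: mul_lin idem_def comm)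
  then have "(c - d) \<odot> x = 0" using peirce_orth[OF assms(2,4)] by simp
  then show ?thesis using assms(4) by (simp add: mul_lin)
qed

text \<open>A proper subidempotent \<open>d\<close> splits \<open>c\<close> into \<open>d\<close>
  and \<open>c - d\<close>, whose Peirce spaces for 1 are both strictly smaller; the induction runs
  on their dimension.\<close>

lemma idem_decomposition:
  "idem c \<Longrightarrow> \<exists>C. orth_system C \<and> \<Sum>C = c \<and> (\<forall>d\<in>C. c \<odot> d = d)"
proof (induction "dim {x. c \<odot> x = x}" arbitrary: c rule: less_induct)
  case less
  note c = \<open>idem c\<close>
  consider "c = 0" | "primitive c" | d where "idem d" "c \<odot> d = d" "d \<noteq> 0" "d \<noteq> c"
    using c by (auto simp: primitive_def)
  then show ?case
  proof cases
    case 1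
    then show ?thesis by (intro exI[of _ "{}"]) (auto simp: orth_system_def)
  next
    case 2
    then show ?thesis by (intro exI[of _ "{c}"]) (auto simp: orth_system_def c[unfolded idem_def])
  next
    case 3
    define d' where "d' = c - d"
    have d': "idem d'" "c \<odot> d' = d'" "d' \<noteq> 0" "d' \<noteq> c" "d \<odot> d' = 0"
      using 3 c comm[of c d] unfolding idem_def d'_def by (auto simp: mul_lin)
    have sub: "subspace {x. a \<odot> x = x}" for a
      by (auto simp: subspace_def mul_lin)
    have less': "dim {x. a \<odot> x = x} < dim {x. c \<odot> x = x}" if "idem a" "c \<odot> a = a" "a \<noteq> c" for a
    proof (rule dim_psubset)
      have "{x. a \<odot> x = x} \<subseteq> {x. c \<odot> x = x}" using unit_trans[OF c that(1,2)] by auto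
      moreover have "c \<in> {x. c \<odot> x = x}" "c \<notin> {x. a \<odot> x = x}"
        using c that comm[of a c] by (auto simp: idem_def)
      ultimately show "span {x. a \<odot> x = x} \<subset> span {x. c \<odot> x = x}"
        by (simp only: span_eq_iff[THEN iffD2, OF sub]) blast
    qed
    obtain C where C: "orth_system C" "\<Sum>C = d" "\<And>a. a \<in> C \<Longrightarrow> d \<odot> a = a"
      using less(1)[OF less'[of d] ] 3 by blast
    obtain D where D: "orth_system D" "\<Sum>D = d'" "\<And>a. a \<in> D \<Longrightarrow> d' \<odot> a = a"
      using less(1)[OF less'[of d']] d' by blast
    have CD: "a \<odot> b = 0" if "a \<in> C" "b \<in> D" for a b
    proof -
      have "d' \<odot> a = 0" using peirce_orth[OF 3(1) C(3)[OF that(1)] d'(5)] .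
      then show ?thesis using peirce_orth[OF d'(1) D(3)[OF that(2)]] by simp
    qed
    then have disj: "C \<inter> D = {}"
      using C(1) unfolding orth_system_def primitive_def idem_def by fastforce
    have "orth_system (C \<union> D)"
      unfolding orth_system_def
    proof (intro conjI ballI impI)
      fix u v assume "u \<in> C \<union> D" "v \<in> C \<union> D" "u \<noteq> v"
      then consider "u \<in> C" "v \<in> C" | "u \<in> C" "v \<in> D" | "u \<in> D" "v \<in> C" | "u \<in> D" "v \<in> D" by blast
      then show "u \<odot> v = 0"
        by cases (use C(1) D(1) CD \<open>u \<noteq> v\<close> comm[of u v] in \<open>auto simp: orth_system_def\<close>)
    qed (use C(1) D(1) in \<open>auto simp: orth_system_def\<close>)
    moreover have "\<Sum>(C \<union> D) = c"
      using C(1,2) D(1,2) disj by (simp add: orth_system_def sum.union_disjoint d'_def)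
    moreover have "\<forall>a\<in>C \<union> D. c \<odot> a = a"
      using unit_trans[OF c 3(1,2) C(3)] unit_trans[OF c d'(1,2) D(3)] by blast
    ultimately show ?thesis by blast
  qed
qed

lemma spectral_idempotentsE:
  obtains S c where "finite S" "\<And>a. a \<in> S \<Longrightarrow> idem (c a)" "\<And>a. a \<in> S \<Longrightarrow> c a \<noteq> 0"
    "\<And>a b. a \<in> S \<Longrightarrow> b \<in> S \<Longrightarrow> a \<noteq> b \<Longrightarrow> c a \<odot> c b = 0"
    "(\<Sum>a\<in>S. c a) = e" "x = (\<Sum>a\<in>S. a *\<^sub>R c a)" "\<And>a. a \<in> S \<Longrightarrow> x \<odot> c a = a *\<^sub>R c a"
    "\<And>a. a \<in> S \<Longrightarrow> \<exists>q. c a = ev q x"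
proof -
  obtain S c where H: "finite S \<and> (\<forall>a\<in>S. idem (c a) \<and> c a \<noteq> 0 \<and> x \<odot> c a = a *\<^sub>R c a \<and> (\<exists>q. c a = ev q x))
     \<and> (\<forall>a\<in>S. \<forall>b\<in>S. a \<noteq> b \<longrightarrow> c a \<odot> c b = 0) \<and> (\<Sum>a\<in>S. c a) = e \<and> x = (\<Sum>a\<in>S. a *\<^sub>R c a)"
    using spectral_idempotents[of x] by (elim exE)
  show thesis
    by (rule that[of S c]) (use H in blast)+
qed

text \<open>Each spectral idempotent is refined into primitive ones. Pieces of different idempotents
  stay orthogonal by two applications of \<open>peirce_orth\<close>.\<close>

theorem spectral: "\<exists>C l. frame C \<and> x = (\<Sum>c\<in>C. l c *\<^sub>R c)"
proof -
  obtain S c where S: "finite S" "\<And>a. a \<in> S \<Longrightarrow> idem (c a)" "\<And>a. a \<in> S \<Longrightarrow> c a \<noteq> 0"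
    "\<And>a b. a \<in> S \<Longrightarrow> b \<in> S \<Longrightarrow> a \<noteq> b \<Longrightarrow> c a \<odot> c b = 0"
    "(\<Sum>a\<in>S. c a) = e" "x = (\<Sum>a\<in>S. a *\<^sub>R c a)"
    by (rule spectral_idempotentsE[of x]) (rule that; assumption)
  have "\<forall>a\<in>S. \<exists>C. orth_system C \<and> \<Sum>C = c a \<and> (\<forall>d\<in>C. c a \<odot> d = d)"
    using idem_decomposition S(2) by blast
  then obtain C where C: "\<And>a. a \<in> S \<Longrightarrow> orth_system (C a)" "\<And>a. a \<in> S \<Longrightarrow> \<Sum>(C a) = c a"
    "\<And>a d. a \<in> S \<Longrightarrow> d \<in> C a \<Longrightarrow> c a \<odot> d = d"
    using bchoice[of S "\<lambda>a C. orth_system C \<and> \<Sum>C = c a \<and> (\<forall>d\<in>C. c a \<odot> d = d)"] by blast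
  have orth: "u \<odot> v = 0" if "a \<in> S" "b \<in> S" "a \<noteq> b" "u \<in> C a" "v \<in> C b" for a b u v
  proof -
    have "c b \<odot> u = 0" using peirce_orth[OF S(2) C(3) S(4)] that by blast
    then show ?thesis using peirce_orth[OF S(2) C(3), of b v u] that by simp
  qed
  have nz: "u \<odot> u \<noteq> 0" if "a \<in> S" "u \<in> C a" for a u
    using C(1)[OF that(1)] that(2) by (auto simp: orth_system_def primitive_def idem_def)
  \<comment> \<open>Different eigenvalues have disjoint systems, since a nonzero idempotent is not
    orthogonal to itself; so each \<open>u\<close> in the union determines its eigenvalue.\<close>
  define l where "l u = (THE a. a \<in> S \<and> u \<in> C a)" for u
  have l: "l u = a" if "a \<in> S" "u \<in> C a" for a u
    unfolding l_def using that orth nz by (intro the_equality) blast+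
  have fin: "finite (C a)" if "a \<in> S" for a using C(1)[OF that] by (simp add: orth_system_def)
  have disj: "\<forall>a\<in>S. \<forall>b\<in>S. a \<noteq> b \<longrightarrow> C a \<inter> C b = {}"
    using orth nz by blast
  have U: "(\<Sum>u\<in>(\<Union>a\<in>S. C a). f u) = (\<Sum>a\<in>S. \<Sum>u\<in>C a. f u)" for f :: "'v \<Rightarrow> 'v"
    by (rule sum.UNION_disjoint) (use S(1) fin disj in auto)
  have "frame (\<Union>a\<in>S. C a)"
    unfolding frame_def U[of id, simplified]
  proof
    show "orth_system (\<Union>a\<in>S. C a)"
      unfolding orth_system_def
    proof (intro conjI ballI impI)
      fix u v assume uv: "u \<in> (\<Union>a\<in>S. C a)" "v \<in> (\<Union>a\<in>S. C a)" "u \<noteq> v"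
      then obtain a b where ab: "a \<in> S" "b \<in> S" "u \<in> C a" "v \<in> C b" by blast
      show "u \<odot> v = 0"
      proof (cases "a = b")
        case True
        then show ?thesis using C(1)[OF ab(1)] ab uv(3) unfolding orth_system_def by blast
      next
        case False
        then show ?thesis using orth ab by blast
      qed
    next
      show "finite (\<Union>a\<in>S. C a)" using S(1) fin by blast
    next
      fix u assume "u \<in> (\<Union>a\<in>S. C a)"
      then show "primitive u" using C(1) unfolding orth_system_def by blast
    qed
    show "(\<Sum>a\<in>S. \<Sum>u\<in>C a. u) = e" 
      using sum.cong[OF refl C(2), of S] S(5) by (simp only:)
  qed
  moreover have "(\<Sum>u\<in>(\<Union>a\<in>S. C a). l u *\<^sub>R u) = (\<Sum>a\<in>S. a *\<^sub>R c a)"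
    unfolding U
  proof (rule sum.cong[OF refl])
    fix a assume a: "a \<in> S"
    have "(\<Sum>u\<in>C a. l u *\<^sub>R u) = (\<Sum>u\<in>C a. a *\<^sub>R u)" using l[OF a] by (intro sum.cong) auto
    then show "(\<Sum>u\<in>C a. l u *\<^sub>R u) = a *\<^sub>R c a" by (simp add: scaleR_sum_right[symmetric] C(2)[OF a])
  qed
  then have "x = (\<Sum>u\<in>(\<Union>a\<in>S. C a). l u *\<^sub>R u)" using S(6) by (simp only:)
  ultimately show ?thesis by blast
qed

text \<open>For a nonzero eigenvalue a, the spectral idempotent \<open>d a\<close> is a multiple of
  \<open>x \<odot> d a\<close>; this is \<open>x\<close> times a polynomial in \<open>x\<close>,
  thus fixed by \<open>c\<close>. Primitivity forces \<open>d a = c\<close>.\<close>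

lemma primitive_span:
  assumes "primitive c" "c \<odot> x = x" shows "\<exists>a. x = a *\<^sub>R c"
proof -
  note c = primitive_idem[OF assms(1)]
  obtain S d where S: "finite S" "\<And>a. a \<in> S \<Longrightarrow> idem (d a)" "\<And>a. a \<in> S \<Longrightarrow> d a \<noteq> 0"
    "x = (\<Sum>a\<in>S. a *\<^sub>R d a)" "\<And>a. a \<in> S \<Longrightarrow> x \<odot> d a = a *\<^sub>R d a" "\<And>a. a \<in> S \<Longrightarrow> \<exists>q. d a = ev q x"
    by (rule spectral_idempotentsE[of x]) (rule that; assumption)
  have cx: "c \<odot> (x \<odot> y) = x \<odot> (c \<odot> y)" for y by (rule commute_of_unit[OF c assms(2)])
  have "c \<odot> (x \<odot> pow x k) = x \<odot> pow x k" for k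
    by (induction k) (simp_all add: assms(2) cx pow_Suc)
  then have ev: "c \<odot> (x \<odot> ev q x) = x \<odot> ev q x" for q
    by (simp add: jordan_poly_def mul_sum_right mul_scale)
  have cd: "d a = c" if "a \<in> S" "a \<noteq> 0" for a
  proof -
    have "c \<odot> (a *\<^sub>R d a) = a *\<^sub>R d a" using S(5,6) that ev by metis
    then have "c \<odot> d a = d a" using that by (simp add: mul_scale)
    then show ?thesis using assms(1) S(2,3) that unfolding primitive_def by blast
  qed
  have "x = (\<Sum>a\<in>S. a *\<^sub>R c)" by (subst S(4), rule sum.cong) (use cd in force)+
  also have "\<dots> = (\<Sum>S) *\<^sub>R c" by (simp add: scaleR_sum_left)
  finally show ?thesis by blast
qed

section \<open>Traces of multiplication operators\<close>

definition tau :: "'v \<Rightarrow> real" where "tau x = trace_op (mul x)"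

lemma tau_linear: "linear tau"
  by (auto simp: linear_iff tau_def trace_op_def mul_lin inner_add_left sum.distrib sum_distrib_left)

lemma tau_e: "tau e = DIM('v)"
  by (simp add: tau_def trace_op_def)

text \<open>Traces are taken in \<open>mul_triple\<close>. When \<open>w\<close> and
  \<open>y\<close> are swapped, cyclic invariance makes the two triple terms change places, and the
  other three terms are permuted.\<close>

lemma tau_assoc: "tau ((x \<odot> w) \<odot> y) = tau ((x \<odot> y) \<odot> w)"
proof -
  have tr: "trace_op (\<lambda>z. f z + g z - h z - k z) = trace_op f + trace_op g - trace_op h - trace_op k"
    for f g h k :: "'v \<Rightarrow> 'v"
    by (simp add: trace_op_def inner_diff_left inner_add_left sum_subtractf sum.distrib)
  have L: "linear (\<lambda>z. a \<odot> (b \<odot> z))" for a b by (auto simp: linear_iff mul_lin)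
  have c1: "trace_op (\<lambda>z. a \<odot> (b \<odot> (c \<odot> z))) = trace_op (\<lambda>z. c \<odot> (a \<odot> (b \<odot> z)))" for a b c
    using trace_op_comp_commute[OF L[of a b] linear_mul[of c]] .
  let ?t = "\<lambda>a b. trace_op (\<lambda>z. a \<odot> (b \<odot> z))"
  have E: "tau ((x \<odot> w) \<odot> y) = (?t (w \<odot> y) x + ?t (x \<odot> y) w + ?t (x \<odot> w) y)
     - trace_op (\<lambda>z. x \<odot> (y \<odot> (w \<odot> z))) - trace_op (\<lambda>z. w \<odot> (y \<odot> (x \<odot> z)))" for x w y
  proof -
    \<comment> \<open>The summand 0 only brings the identity into the shape of
      \<open>tr\<close>.\<close>
    have "mul ((x \<odot> w) \<odot> y) = (\<lambda>z. ((w \<odot> y) \<odot> (x \<odot> z) + (x \<odot> y) \<odot> (w \<odot> z) + (x \<odot> w) \<odot> (y \<odot> z)) + 0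
       - x \<odot> (y \<odot> (w \<odot> z)) - w \<odot> (y \<odot> (x \<odot> z)))"
      using mul_triple by fastforce
    moreover have "trace_op (\<lambda>z. f z + g z + h z) = trace_op f + trace_op g + trace_op h" for f g h :: "'v \<Rightarrow> 'v"
      by (simp add: trace_op_def inner_add_left sum.distrib)
    moreover have "trace_op (\<lambda>z. 0::'v) = 0" by (simp add: trace_op_def)
    ultimately show ?thesis unfolding tau_def by (simp only: tr) 
  qed
  show ?thesis unfolding E[of x w y] E[of x y w]
    using c1[of x y w] c1[of y w x] c1[of x w y] c1[of w y x] comm[of w y] by simp
qed

text \<open>Both sides of the hypothesis are symmetric in \<open>c\<close> and \<open>d\<close>: writing
  \<open>P(c) d = a c\<close> and \<open>P(d) c = b d\<close>, the norm of \<open>c \<odot> d\<close> gives \<open>1 + a = 1 + b\<close>.\<close>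

lemma tau_eq_of_not_orth:
  assumes "primitive c" "primitive d" "B c d \<noteq> 0" shows "tau c = tau d"
proof -
  note c = primitive_idem[OF assms(1)] and d = primitive_idem[OF assms(2)]
  have key: "\<exists>a. a * B c e = B c d \<and> a * tau c = tau (c \<odot> d) \<and> 2 * B (c \<odot> d) (c \<odot> d) = (1 + a) * B c d"
    if cd: "primitive c" "idem c" "idem d" for c d
  proof -
    obtain a where a: "peirce1 c d = a *\<^sub>R c" using primitive_span[OF cd(1) mul_peirce1[OF cd(2)]] by blast
    have ccd: "2 *\<^sub>R (c \<odot> (c \<odot> d)) = a *\<^sub>R c + c \<odot> d" using a by (simp add: peirce1_def algebra_simps)
    have "tau (c \<odot> (c \<odot> d)) = tau (c \<odot> d)"
      using tau_assoc[of c c d] cd(2) comm by (simp add: idem_def)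
    then have t: "a * tau c = tau (c \<odot> d)"
      using arg_cong[OF ccd, of tau] by (simp add: linear_add[OF tau_linear] linear_cmul[OF tau_linear])
    have cde: "B (c \<odot> d) e = B c d" by (rule B_mul_e)
    have "B (c \<odot> (c \<odot> d)) e = B c d"
      using cd(2) by (metis B_mul_e(1) assoc idem_def)
    then have b: "a * B c e = B c d"
      using arg_cong[OF ccd, of "\<lambda>x. B x e"] by (simp add: B_lin cde)
    have "B (c \<odot> d) d = B c d" using cd(3) unfolding idem_def by (metis assoc comm)
    moreover have "B (c \<odot> d) (c \<odot> d) = B (c \<odot> (c \<odot> d)) d" by (simp add: assoc)
    ultimately have "2 * B (c \<odot> d) (c \<odot> d) = (1 + a) * B c d"
      using arg_cong[OF ccd, of "\<lambda>x. B x d"] by (simp add: B_lin algebra_simps)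
    with t b show ?thesis by blast
  qed
  obtain a where a: "a * B c e = B c d" "a * tau c = tau (c \<odot> d)" "2 * B (c \<odot> d) (c \<odot> d) = (1 + a) * B c d"
    using key[OF assms(1) c d] by blast
  obtain b where b: "b * B d e = B d c" "b * tau d = tau (d \<odot> c)" "2 * B (d \<odot> c) (d \<odot> c) = (1 + b) * B d c"
    using key[OF assms(2) d c] by blast
  have "(1 + a) * B c d = (1 + b) * B c d" using a(3) b(3) by (simp add: comm[of d c] symB[of d c])
  then have "a = b" using assms(3) by simp
  moreover have "a \<noteq> 0" using a(1) assms(3) by auto
  \<comment> \<open>Both \<open>a * tau c\<close> and \<open>b * tau d\<close> are the trace of
    multiplication by \<open>c \<odot> d\<close>; the nonzero common factor cancels.\<close>
  ultimately show ?thesis using a(2) b(2) comm[of d c] by (metis mult_left_cancel)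
qed

end

section \<open>The cone of squares\<close>

context euclidean_jordan begin

definition squares :: "'v set" where "squares = range (\<lambda>x. x \<odot> x)"

lemma squaresI: "x \<odot> x \<in> squares" by (simp add: squares_def)

lemma idem_squares: "idem c \<Longrightarrow> c \<in> squares" unfolding idem_def by (metis squaresI)

lemma orth_system_mul:
  assumes "orth_system C" "c \<in> C" shows "(\<Sum>d\<in>C. l d *\<^sub>R d) \<odot> c = l c *\<^sub>R c"
proof -
  have "(\<Sum>d\<in>C. l d *\<^sub>R d) \<odot> c = (\<Sum>d\<in>C. if d = c then l c *\<^sub>R c else 0)"
    unfolding mul_sum_left
    by (rule sum.cong) (use assms in \<open>auto simp: orth_system_def primitive_def idem_def mul_scale\<close>)
  then show ?thesis using assms by (simp add: orth_system_def)
qed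

lemma orth_system_mul_sum:
  assumes "orth_system C"
  shows "(\<Sum>c\<in>C. k c *\<^sub>R c) \<odot> (\<Sum>c\<in>C. l c *\<^sub>R c) = (\<Sum>c\<in>C. (k c * l c) *\<^sub>R c)"
  unfolding mul_sum_right mul_scale orth_system_mul[OF assms]
  by (rule sum.cong) (auto simp: mul_scale orth_system_mul[OF assms] mult.commute)

lemma orth_system_B:
  assumes "orth_system C" "c \<in> C" shows "B (\<Sum>d\<in>C. l d *\<^sub>R d) c = l c * B c c"
  using orth_system_mul[OF assms, of l] B_mul_e(1)[of _ c] by (metis B_scale(1) B_mul_e(1) assms 
      real_scaleR_def orth_system_def primitive_idem idem_def)

lemma squares_nonneg_frame:
  assumes "orth_system C" "\<And>c. c \<in> C \<Longrightarrow> l c \<ge> 0" shows "(\<Sum>c\<in>C. l c *\<^sub>R c) \<in> squares"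
proof -
  have "(\<Sum>c\<in>C. l c *\<^sub>R c) = (\<Sum>c\<in>C. (sqrt (l c) * sqrt (l c)) *\<^sub>R c)"
    by (rule sum.cong) (use assms in auto)
  then show ?thesis unfolding orth_system_mul_sum[OF assms(1), symmetric] by (simp add: squaresI)
qed

lemma squares_psd: assumes "x \<in> squares" shows "B (x \<odot> y) y \<ge> 0"
proof -
  obtain u where u: "x = u \<odot> u" using assms by (auto simp: squares_def)
  obtain C l where C: "frame C" "u = (\<Sum>c\<in>C. l c *\<^sub>R c)" using spectral by blast
  then have "x = (\<Sum>c\<in>C. (l c * l c) *\<^sub>R c)"
    using orth_system_mul_sum[of C l l] unfolding u frame_def by (simp only:)
  then have "B (x \<odot> y) y = (\<Sum>c\<in>C. (l c * l c) * B (c \<odot> y) y)"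
    by (simp add: mul_sum_left B_sum_left mul_scale B_scale)
  also have "\<dots> \<ge> 0"
  proof (rule sum_nonneg)
    fix c assume "c \<in> C"
    then have "idem c" using C(1) by (simp add: frame_def orth_system_def primitive_def)
    then show "0 \<le> (l c * l c) * B (c \<odot> y) y" by (simp add: idem_psd)
  qed
  finally show ?thesis .
qed

lemma squares_B_nonneg: assumes "x \<in> squares" "z \<in> squares" shows "B x z \<ge> 0"
proof -
  obtain v where "z = v \<odot> v" using assms(2) by (auto simp: squares_def)
  then show ?thesis using squares_psd[OF assms(1), of v] by (metis assoc comm)
qed

lemma frame_coeff_nonneg:
  assumes "frame C" "c \<in> C" "\<And>z. z \<in> squares \<Longrightarrow> B (\<Sum>c\<in>C. l c *\<^sub>R c) z \<ge> 0" shows "l c \<ge> 0"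
proof -
  have c: "primitive c" "orth_system C" using assms by (auto simp: frame_def orth_system_def)
  have "l c * B c c \<ge> 0"
    using assms(3)[of c] idem_squares primitive_idem[OF c(1)] orth_system_B[OF c(2) assms(2), of l] by simp
  then show ?thesis using posB[OF primitive_nz[OF c(1)]] by (simp add: zero_le_mult_iff)
qed

text \<open>Self-duality. A spectral coefficient of \<open>x\<close> is, up to the positive factor
  B(c, c), the value of B at \<open>x\<close> and its idempotent \<open>c\<close>, and idempotents
  are squares.\<close>

lemma squares_iff_dual: "x \<in> squares \<longleftrightarrow> (\<forall>z\<in>squares. B x z \<ge> 0)"
proof
  assume *: "\<forall>z\<in>squares. B x z \<ge> 0"
  obtain C l where C: "frame C" "x = (\<Sum>c\<in>C. l c *\<^sub>R c)" using spectral by blast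
  show "x \<in> squares" unfolding C(2)
  proof (rule squares_nonneg_frame)
    show "orth_system C" using C(1) by (simp add: frame_def)
    show "l c \<ge> 0" if "c \<in> C" for c
      using frame_coeff_nonneg[OF C(1) that, of l] * unfolding C(2)[symmetric] by blast
  qed
qed (use squares_B_nonneg in blast)

lemma squares_add: "x \<in> squares \<Longrightarrow> y \<in> squares \<Longrightarrow> x + y \<in> squares"
  unfolding squares_iff_dual[of x] squares_iff_dual[of y] squares_iff_dual[of "x+y"] by (simp add: B_lin)

lemma squares_scale: "x \<in> squares \<Longrightarrow> a \<ge> 0 \<Longrightarrow> a *\<^sub>R x \<in> squares"
  unfolding squares_iff_dual[of x] squares_iff_dual[of "a *\<^sub>R x"] by (simp add: B_lin)

lemma continuous_B: "continuous_on UNIV (\<lambda>x. B x z)"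
  using linear_B' by (simp add: linear_continuous_on linear_conv_bounded_linear)

lemma closed_squares: "closed squares"
proof -
  have "squares = (\<Inter>z\<in>squares. {x. 0 \<le> B x z})" using squares_iff_dual by blast
  moreover have "closed {x. 0 \<le> B x z}" for z
    by (intro closed_Collect_le continuous_B continuous_on_const)
  ultimately show ?thesis by (metis (no_types, lifting) closed_INT)
qed

lemma ex_B_lower: "\<exists>k>0. \<forall>x. B x x \<ge> k * (norm x)\<^sup>2"
proof -
  have cont: "continuous_on (sphere 0 1) (\<lambda>x. B x x)"
    using bilinB bilinear_conv_bounded_bilinear
    by (intro bounded_bilinear.continuous_on[of B] continuous_on_id) auto
  have ne: "sphere (0::'v) 1 \<noteq> {}" by auto
  obtain u where u: "u \<in> sphere 0 1" "\<And>x. x \<in> sphere 0 1 \<Longrightarrow> B u u \<le> B x x"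
    using continuous_attains_inf[OF compact_sphere ne cont] by blast
  have "B x x \<ge> B u u * (norm x)\<^sup>2" for x
  proof (cases "x = 0")
    case False
    have "B u u \<le> B ((1 / norm x) *\<^sub>R x) ((1 / norm x) *\<^sub>R x)" using False by (intro u) auto
    also have "\<dots> = B x x / (norm x)\<^sup>2" by (simp add: B_scale power2_eq_square)
    finally show ?thesis using False by (simp add: field_simps)
  qed simp
  moreover have "B u u > 0" using u(1) by (intro posB) auto
  ultimately show ?thesis by blast
qed

text \<open>Multiplication by \<open>e + h\<close> stays positive for small \<open>h\<close>: B(e +
  h, u u) = B(u, u) + B(h u, u). Hence \<open>e + h\<close> is nonnegative against all squares and
  \<open>squares_iff_dual\<close> applies.\<close>

lemma e_plus_squares: "\<exists>\<epsilon>>0. \<forall>h. norm h < \<epsilon> \<longrightarrow> e + h \<in> squares"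
proof -
  obtain k where k: "k > 0" "\<And>x. B x x \<ge> k * (norm x)\<^sup>2" using ex_B_lower by blast
  obtain M where M: "M > 0" "\<And>x y. norm (x \<odot> y) \<le> M * norm x * norm y"
    using bilinear_bounded_pos[OF bilin] by auto
  obtain N where N: "N > 0" "\<And>x y. norm (B x y) \<le> N * norm x * norm y"
    using bilinear_bounded_pos[OF bilinB] by auto
  \<comment> \<open>The radius compares |B(h u, u)| \<le> M N |h| |u|^2 with the lower bound k |u|^2
    for B(u, u).\<close>
  have "e + h \<in> squares" if h: "norm h < k / (M * N)" for h
    unfolding squares_iff_dual
  proof
    fix z assume "z \<in> squares"
    then obtain u where u: "z = u \<odot> u" by (auto simp: squares_def)
    have "\<bar>B (h \<odot> u) u\<bar> \<le> N * (M * norm h * norm u) * norm u"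
      using N(2)[of "h \<odot> u" u] M(2)[of h u] N(1)
      by (smt (verit, best) mult_left_mono mult_right_mono norm_ge_zero real_norm_def)
    also have "\<dots> = (M * N * norm h) * (norm u)\<^sup>2" by (simp add: power2_eq_square)
    also have "\<dots> \<le> k * (norm u)\<^sup>2"
      using h M(1) N(1) by (intro mult_right_mono) (auto simp: field_simps)
    also have "\<dots> \<le> B u u" by (rule k)
    finally have "B u u + B (h \<odot> u) u \<ge> 0" by linarith
    moreover have "B (e + h) z = B u u + B (h \<odot> u) u"
      unfolding u by (simp add: B_lin B_mul_e) (metis assoc comm)
    ultimately show "B (e + h) z \<ge> 0" by simp
  qed
  moreover have "k / (M * N) > 0" using k M N by simp
  ultimately show ?thesis by blast
qed

section \<open>The open cone and its dual description\<close>

definition pos_cone :: "'v set" where "pos_cone = interior squares"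

lemma frame_sum_e: "frame C \<Longrightarrow> e = (\<Sum>c\<in>C. 1 *\<^sub>R c)"
  by (simp add: frame_def)

text \<open>An interior point can be moved by -t z for a small t > 0 without leaving the squares, so
  B(x, z) \<ge> t B(z, z).\<close>

lemma pos_cone_dual: "x \<in> pos_cone \<Longrightarrow> z \<in> squares \<Longrightarrow> z \<noteq> 0 \<Longrightarrow> B x z > 0"
proof -
  assume x: "x \<in> pos_cone" and z: "z \<in> squares" "z \<noteq> 0"
  obtain \<epsilon> where eps: "\<epsilon> > 0" "ball x \<epsilon> \<subseteq> squares"
    using x unfolding pos_cone_def by (meson mem_interior)
  define t where "t = \<epsilon> / (2 * norm z)"
  have t: "t > 0" using eps z by (simp add: t_def)
  have "x - t *\<^sub>R z \<in> ball x \<epsilon>" using eps z by (simp add: t_def dist_norm)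
  then have "B (x - t *\<^sub>R z) z \<ge> 0" using eps z squares_B_nonneg by blast
  moreover have "t * B z z > 0" using t posB z by simp
  ultimately show ?thesis by (simp add: B_lin)
qed

lemma frame_coeff_pos:
  assumes "frame C" "c \<in> C" "\<And>z. z \<in> squares \<Longrightarrow> z \<noteq> 0 \<Longrightarrow> B (\<Sum>c\<in>C. l c *\<^sub>R c) z > 0" shows "l c > 0"
proof -
  have c: "primitive c" "orth_system C" using assms by (auto simp: frame_def orth_system_def)
  have "l c * B c c > 0"
    using assms(3)[of c] idem_squares primitive_idem[OF c(1)] primitive_nz[OF c(1)]
      orth_system_B[OF c(2) assms(2), of l] by simp
  then show ?thesis using posB[OF primitive_nz[OF c(1)]] by (simp add: zero_less_mult_iff)
qed

text \<open>With \<open>d\<close> a positive lower bound of the coefficients, subtracting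
  \<open>d *\<^sub>R e\<close> still leaves a square, and \<open>d\<close> times a small ball around
  \<open>e\<close> consists of squares; together they fill a ball around the given vector.\<close>

lemma pos_frame_pos_cone:
  assumes "frame C" "\<And>c. c \<in> C \<Longrightarrow> l c > 0" shows "(\<Sum>c\<in>C. l c *\<^sub>R c) \<in> pos_cone"
proof -
  have C: "orth_system C" "finite C" using assms by (auto simp: frame_def orth_system_def)
  define d where "d = Min (insert 1 (l ` C))"
  have d: "d > 0" "\<And>c. c \<in> C \<Longrightarrow> l c \<ge> d" using C assms by (auto simp: d_def)
  obtain \<epsilon> where eps: "\<epsilon> > 0" "\<And>h. norm h < \<epsilon> \<Longrightarrow> e + h \<in> squares" using e_plus_squares by blast
  let ?x = "\<Sum>c\<in>C. l c *\<^sub>R c"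
  have "ball ?x (d * \<epsilon>) \<subseteq> squares"
  proof
    fix y assume "y \<in> ball ?x (d * \<epsilon>)"
    then have "norm ((1/d) *\<^sub>R (y - ?x)) < \<epsilon>" 
      using d by (simp only: mem_ball dist_norm norm_scaleR norm_minus_commute[of ?x]) (simp add: field_simps)
    then have "d *\<^sub>R (e + (1/d) *\<^sub>R (y - ?x)) \<in> squares" using eps d by (intro squares_scale) auto
    moreover have "(\<Sum>c\<in>C. (l c - d) *\<^sub>R c) \<in> squares" using d C by (intro squares_nonneg_frame) auto
    moreover have "(\<Sum>c\<in>C. (l c - d) *\<^sub>R c) = ?x - d *\<^sub>R e"
      using assms(1) by (simp add: frame_def scaleR_left_diff_distrib sum_subtractf scaleR_sum_right[symmetric])
    ultimately have "(?x - d *\<^sub>R e) + d *\<^sub>R (e + (1/d) *\<^sub>R (y - ?x)) \<in> squares" using squares_add by metis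
    then show "y \<in> squares" using d by (simp add: algebra_simps)
  qed
  then show ?thesis unfolding pos_cone_def mem_interior using d eps by (intro exI[of _ "d * \<epsilon>"]) auto
qed

lemma pos_cone_iff_dual: "x \<in> pos_cone \<longleftrightarrow> (\<forall>z\<in>squares - {0}. B x z > 0)"
proof
  assume *: "\<forall>z\<in>squares - {0}. B x z > 0"
  obtain C l where C: "frame C" "x = (\<Sum>c\<in>C. l c *\<^sub>R c)" using spectral by blast
  show "x \<in> pos_cone" unfolding C(2)
  proof (rule pos_frame_pos_cone[OF C(1)])
    show "l c > 0" if "c \<in> C" for c
      using frame_coeff_pos[OF C(1) that, of l] * unfolding C(2)[symmetric] by blast
  qed
qed (use pos_cone_dual in blast)

lemma pos_cone_frame:
  assumes "x \<in> pos_cone" obtains C l where "frame C" "x = (\<Sum>c\<in>C. l c *\<^sub>R c)" "\<And>c. c \<in> C \<Longrightarrow> l c > 0"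
proof -
  obtain C l where C: "frame C" "x = (\<Sum>c\<in>C. l c *\<^sub>R c)" using spectral by blast
  moreover have "l c > 0" if "c \<in> C" for c
    using frame_coeff_pos[OF C(1) that, of l] pos_cone_dual[OF assms] unfolding C(2)[symmetric] by blast
  ultimately show ?thesis using that by blast
qed

lemma e_pos_cone: "e \<in> pos_cone"
  using e_plus_squares unfolding pos_cone_def mem_interior subset_iff mem_ball dist_norm
  by (metis add_diff_cancel_left' diff_add_cancel add.commute norm_minus_commute)

lemma open_pos_cone: "open pos_cone" by (simp add: pos_cone_def)

lemma pos_cone_squares: "x \<in> pos_cone \<Longrightarrow> x \<in> squares"
  unfolding pos_cone_def using interior_subset by blast

lemma pos_cone_add: "x \<in> squares \<Longrightarrow> y \<in> pos_cone \<Longrightarrow> x + y \<in> pos_cone"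
  unfolding pos_cone_iff_dual by (auto simp: B_lin intro!: add_nonneg_pos squares_B_nonneg)

lemma pos_cone_scale: "x \<in> pos_cone \<Longrightarrow> a > 0 \<Longrightarrow> a *\<^sub>R x \<in> pos_cone"
  unfolding pos_cone_iff_dual by (simp add: B_lin)

lemma convex_pos_cone: "convex pos_cone"
proof (rule convexI)
  fix x y and u v :: real
  assume h: "x \<in> pos_cone" "y \<in> pos_cone" "u \<ge> 0" "v \<ge> 0" "u + v = 1"
  then consider "u > 0" | "v > 0" by linarith
  then show "u *\<^sub>R x + v *\<^sub>R y \<in> pos_cone"
  proof cases
    case 1
    then show ?thesis using pos_cone_add[of "v *\<^sub>R y" "u *\<^sub>R x"] h
      by (simp add: pos_cone_scale pos_cone_squares squares_scale add.commute)
  next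
    case 2
    then show ?thesis using pos_cone_add[of "u *\<^sub>R x" "v *\<^sub>R y"] h
      by (simp add: pos_cone_scale pos_cone_squares squares_scale)
  qed
qed

lemma closure_pos_cone: "closure pos_cone = squares"
proof
  show "closure pos_cone \<subseteq> squares"
    using closed_squares pos_cone_squares by (intro closure_minimal) auto
  show "squares \<subseteq> closure pos_cone"
  proof
    fix x assume x: "x \<in> squares"
    have "x + inverse (real (Suc n)) *\<^sub>R e \<in> pos_cone" for n
      using x e_pos_cone by (intro pos_cone_add pos_cone_scale) auto
    moreover have "(\<lambda>n. x + inverse (real (Suc n)) *\<^sub>R e) \<longlonglongrightarrow> x + 0 *\<^sub>R e"
      by (intro tendsto_intros LIMSEQ_inverse_real_of_nat)
    ultimately show "x \<in> closure pos_cone" unfolding closure_sequential by force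
  qed
qed

text \<open>The inverse of multiplication by an element of the open cone preserves squares: the
  coefficient of \<open>c\<close> in \<open>y\<close> times B(a, c) > 0 equals B(a y, c) \<ge>
  0.\<close>

lemma squares_of_mul:
  assumes a: "a \<in> pos_cone" and y: "a \<odot> y \<in> squares" shows "y \<in> squares"
proof -
  obtain C l where C: "frame C" "y = (\<Sum>c\<in>C. l c *\<^sub>R c)" using spectral by blast
  have "l c \<ge> 0" if c: "c \<in> C" for c
  proof -
    have p: "primitive c" "orth_system C" using C(1) c by (auto simp: frame_def orth_system_def)
    have "0 \<le> B (a \<odot> y) c" using y squares_B_nonneg idem_squares primitive_idem[OF p(1)] by blast
    also have "\<dots> = B a (y \<odot> c)" by (metis assoc comm)
    also have "\<dots> = l c * B a c" unfolding C(2) orth_system_mul[OF p(2) c] by (simp add: B_lin)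
    finally show ?thesis
      using pos_cone_dual[OF a idem_squares[OF primitive_idem[OF p(1)]] primitive_nz[OF p(1)]]
      by (simp add: zero_le_mult_iff)
  qed
  then show ?thesis unfolding C(2) using C(1) by (intro squares_nonneg_frame) (auto simp: frame_def)
qed

text \<open>For \<open>b = a\<^sup>2\<close> this is the quadratic representation \<open>P(a c + (e - c))\<close>; the two parameters
  are the eigenvalues on the Peirce spaces.\<close>

definition peirce_op :: "'v \<Rightarrow> real \<Rightarrow> real \<Rightarrow> 'v \<Rightarrow> 'v" where
  "peirce_op c a b x = (x - peirce1 c x - peirceh c x) + a *\<^sub>R peirceh c x + b *\<^sub>R peirce1 c x"

lemma peirce_rules:
  assumes "idem c"
  shows "peirce1 c (peirce1 c x) = peirce1 c x" "peirceh c (peirceh c x) = peirceh c x"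
    "peirce1 c (peirceh c x) = 0" "peirceh c (peirce1 c x) = 0"
  using mul_peirce1[OF assms] mul_peirceh[OF assms]
  by (simp_all add: peirce1_def[of c "peirce1 c x"] peirceh_def[of c "peirceh c x"]
      peirce1_def[of c "peirceh c x"] peirceh_def[of c "peirce1 c x"] mul_scale scaleR_2
      scaleR_left_diff_distrib[symmetric] scaleR_left_distrib[symmetric])

lemma linear_peirce: "linear (peirce1 c)" "linear (peirceh c)" "linear (peirce_op c a b)"
  by (auto simp: linear_iff peirce_op_def peirce1_def peirceh_def mul_lin algebra_simps)

lemma peirce_op_comp:
  assumes "idem c" shows "peirce_op c a b (peirce_op c a' b' x) = peirce_op c (a * a') (b * b') x"
  unfolding peirce_op_def[of c _ _ "peirce_op c a' b' x"]
  unfolding peirce_op_def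
  by (simp add: linear_add[OF linear_peirce(1)] linear_add[OF linear_peirce(2)] linear_diff[OF linear_peirce(1)]
     linear_diff[OF linear_peirce(2)] linear_cmul[OF linear_peirce(1)] linear_cmul[OF linear_peirce(2)]
     peirce_rules[OF assms] algebra_simps)

lemma peirce_op_1 [simp]: "peirce_op c 1 1 x = x" by (simp add: peirce_op_def)

lemma peirce_op_self_adjoint: "B (peirce_op c a b x) y = B x (peirce_op c a b y)"
  by (simp add: peirce_op_def peirce1_def peirceh_def B_lin assoc)

lemma peirce_op_e: "idem c \<Longrightarrow> peirce_op c a b e = e + (b - 1) *\<^sub>R c"
  by (simp add: peirce_op_def peirce1_def peirceh_def idem_def scaleR_2 algebra_simps)

lemma peirce_op_orth: "c \<odot> d = 0 \<Longrightarrow> peirce_op c a b d = d"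
  by (simp add: peirce_op_def peirce1_def peirceh_def)

text \<open>The parameters are the inverses of the eigenvalues 1 - t/2 and 1 - t of multiplication
  by \<open>e - t *\<^sub>R c\<close>, so this is an instance of \<open>squares_of_mul\<close>.
  Negative \<open>t\<close> is included, since scalings below 1 need it.\<close>

lemma peirce_op_resolvent:
  assumes "idem c" "t < 1" "y \<in> squares" shows "peirce_op c (1 / (1 - t/2)) (1 / (1 - t)) y \<in> squares"
proof -
  let ?z = "peirce_op c (1 / (1 - t/2)) (1 / (1 - t)) y"
  have "(e - t *\<^sub>R c) \<odot> x = peirce_op c (1 - t/2) (1 - t) x" for x
    using mul_eq_peirce[of c x] by (simp add: mul_lin peirce_op_def algebra_simps)
  then have "(e - t *\<^sub>R c) \<odot> ?z = y" using assms by (simp add: peirce_op_comp)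
  moreover have "e - t *\<^sub>R c \<in> pos_cone"
    unfolding pos_cone_iff_dual
  proof
    fix z assume z: "z \<in> squares - {0}"
    have p: "B c z \<ge> 0" "B (e - c) z \<ge> 0" "B e z > 0"
      using z squares_B_nonneg idem_squares[OF assms(1)] idem_squares[OF idem_scale_e[OF assms(1)]]
        pos_cone_dual[OF e_pos_cone] by auto
    show "B (e - t *\<^sub>R c) z > 0"
    proof (cases "t \<le> 0")
      case True
      then have "t * B c z \<le> 0" using p by (simp add: mult_nonpos_nonneg)
      then show ?thesis using p by (simp add: B_lin)
    next
      case False
      \<comment> \<open>For t between 0 and 1, \<open>e - t *\<^sub>R c\<close> is the combination
        (1 - t) e + t (e - c) of a point of the open cone and an idempotent.\<close>
      have "B e z - t * B c z = (1 - t) * B e z + t * B (e - c) z" by (simp add: B_lin algebra_simps)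
      moreover have "(1 - t) * B e z > 0" "t * B (e - c) z \<ge> 0" using p False assms by auto
      ultimately show ?thesis by (simp add: B_lin)
    qed
  qed
  ultimately show ?thesis using squares_of_mul[of "e - t *\<^sub>R c" ?z] assms by simp
qed

lemma peirce_op_resolvent_pow:
  assumes "idem c" "t < 1" "y \<in> squares"
  shows "peirce_op c ((1 / (1 - t/2)) ^ k) ((1 / (1 - t)) ^ k) y \<in> squares"
proof (induction k)
  case (Suc k)
  then show ?case using peirce_op_resolvent[OF assms(1,2) Suc] by (simp only: peirce_op_comp[OF assms(1)] power_Suc)
qed (use assms in simp)

text \<open>The exponential formula \<open>exp(t L(c)) = lim (1 - (t/n) L(c))\<^sup>-\<^sup>n\<close>.\<close>

lemma peirce_op_squares:
  assumes "idem c" "s > 0" "y \<in> squares" shows "peirce_op c s (s\<^sup>2) y \<in> squares"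
proof -
  \<comment> \<open>With this \<open>t\<close> the limits exp(t/2) and exp(t) of the two parameters
    are s and s^2.\<close>
  define t where "t = 2 * ln s"
  have lim: "(\<lambda>n. (1 / (1 - u / real n)) ^ n) \<longlonglongrightarrow> exp u" for u :: real
  proof -
    have "(\<lambda>n. inverse ((1 + (- u) / real n) ^ n)) \<longlonglongrightarrow> inverse (exp (- u))"
      by (intro tendsto_inverse tendsto_exp_limit_sequentially) auto
    then show ?thesis by (simp add: power_one_over exp_minus divide_inverse power_inverse)
  qed
  have lim2: "(\<lambda>n. (1 / (1 - (t / real n) / 2)) ^ n) \<longlonglongrightarrow> exp (t/2)"
    using lim[of "t/2"] by (simp add: mult.commute)
  have "(\<lambda>n. peirce_op c ((1 / (1 - (t / real n) / 2)) ^ n) ((1 / (1 - t / real n)) ^ n) y)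
      \<longlonglongrightarrow> peirce_op c (exp (t/2)) (exp t) y"
    unfolding peirce_op_def by (intro tendsto_intros lim lim2)
  moreover have "\<forall>\<^sub>F n in sequentially. peirce_op c ((1 / (1 - (t / real n) / 2)) ^ n) ((1 / (1 - t / real n)) ^ n) y \<in> squares"
  proof -
    have "\<forall>\<^sub>F n in sequentially. t / real n < 1"
      by (rule order_tendstoD(2)[OF lim_const_over_n]) simp
    then show ?thesis by eventually_elim (rule peirce_op_resolvent_pow[OF assms(1) _ assms(3)])
  qed
  ultimately have "peirce_op c (exp (t/2)) (exp t) y \<in> squares"
    using closed_squares by (intro Lim_in_closed_set) auto
  moreover have "exp (t/2) = s" "exp t = s\<^sup>2"
    using assms(2) by (simp_all add: t_def exp_double)
  ultimately show ?thesis by simp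
qed

text \<open>Self-adjointness transfers the invariance of the squares to the dual description of
  \<open>pos_cone\<close>, and the inverse operator has the parameters 1/s and (1/s)^2.\<close>

lemma peirce_op_pos_cone:
  assumes "idem c" "s > 0" shows "peirce_op c s (s\<^sup>2) ` pos_cone = pos_cone"
proof -
  have inv: "peirce_op c s (s\<^sup>2) (peirce_op c (1/s) ((1/s)\<^sup>2) x) = x"
    "peirce_op c (1/s) ((1/s)\<^sup>2) (peirce_op c s (s\<^sup>2) x) = x" for x
    using assms by (simp_all add: peirce_op_comp power_divide)
  have sub: "peirce_op c r (r\<^sup>2) x \<in> pos_cone" if r: "r > 0" and x: "x \<in> pos_cone" for r x
    unfolding pos_cone_iff_dual
  proof
    fix z assume z: "z \<in> squares - {0}"
    have "peirce_op c (1/r) ((1/r)\<^sup>2) (peirce_op c r (r\<^sup>2) z) = z"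
      using assms(1) r by (simp add: peirce_op_comp power_divide)
    then have "peirce_op c r (r\<^sup>2) z \<noteq> 0" using z linear_0[OF linear_peirce(3)] by auto
    then show "B (peirce_op c r (r\<^sup>2) x) z > 0"
      unfolding peirce_op_self_adjoint using z x peirce_op_squares[OF assms(1) r] by (intro pos_cone_dual) auto
  qed
  show ?thesis
  proof
    show "pos_cone \<subseteq> peirce_op c s (s\<^sup>2) ` pos_cone"
      using sub[of "1/s"] inv(1) assms(2) by (metis image_eqI subsetI zero_less_divide_1_iff)
  qed (use sub assms in auto)
qed

end

section \<open>Automorphisms of the cone\<close>

text \<open>A permutation other than the identity moves at least two indices, so after one factor of
  its product has been differentiated, a vanishing off-diagonal entry of the unit matrix is
  left.\<close>

lemma has_derivative_det_at_id:
  fixes A :: "real \<Rightarrow> real^'n^'n"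
  assumes A: "\<And>i j. ((\<lambda>s. A s $ i $ j) has_real_derivative A' $ i $ j) (at s0)" and id: "A s0 = mat 1"
  shows "((\<lambda>s. det (A s)) has_real_derivative trace A') (at s0)"
proof -
  let ?d = "\<lambda>p. \<Sum>i\<in>UNIV. A' $ i $ p i * (\<Prod>j\<in>UNIV - {i}. A s0 $ j $ p j)"
  have P: "((\<lambda>s. \<Prod>i\<in>UNIV. A s $ i $ p i) has_real_derivative ?d p) (at s0)" for p :: "'n \<Rightarrow> 'n"
    by (rule has_field_derivative_prod) (rule A)
  have D: "((\<lambda>s. det (A s)) has_real_derivative
      (\<Sum>p\<in>{p. p permutes UNIV}. of_int (sign p) * ?d p)) (at s0)"
    unfolding det_def by (intro DERIV_sum DERIV_cmult P)
  have z: "?d p = 0" if p: "p permutes UNIV" "p \<noteq> id" for p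
  proof (rule sum.neutral, rule ballI)
    fix i :: 'n
    obtain j where j: "j \<noteq> i" "p j \<noteq> j"
    proof (rule ccontr)
      assume "\<not> thesis"
      then have *: "\<And>j. j \<noteq> i \<Longrightarrow> p j = j" using that by blast
      then have "p i = i" using p(1) by (metis permutes_def)
      with * have "p = id" by (metis eq_id_iff)
      then show False using p(2) by simp
    qed
    then have "A s0 $ j $ p j = 0" by (simp add: id mat_def)
    then have "(\<Prod>j\<in>UNIV - {i}. A s0 $ j $ p j) = 0" using j by (intro prod_zero) auto
    then show "A' $ i $ p i * (\<Prod>j\<in>UNIV - {i}. A s0 $ j $ p j) = 0" by simp
  qed
  have "(\<Sum>p\<in>{p. p permutes UNIV}. of_int (sign p) * ?d p)
      = (\<Sum>p\<in>{id}. of_int (sign p) * ?d p)"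
    using z by (intro sum.mono_neutral_right) (auto simp: finite_permutations permutes_id)
  also have "\<dots> = trace A'"
    by (simp add: trace_def id mat_def sign_id)
  finally show ?thesis using D by simp
qed

lemma trace_op_matrix:
  fixes T :: "real^'n \<Rightarrow> real^'n" shows "trace_op T = trace (matrix T)"
proof -
  have "(Basis :: (real^'n) set) = range (\<lambda>i. axis i 1)" by (auto simp: Basis_vec_def)
  moreover have "inj (\<lambda>i. axis i 1 :: real^'n)" by (auto simp: inj_on_def axis_eq_axis)
  ultimately have "trace_op T = (\<Sum>i\<in>UNIV. T (axis i 1) \<bullet> axis i 1)"
    unfolding trace_op_def using sum.reindex[of "\<lambda>i. axis i 1 :: real^'n" UNIV "\<lambda>b. T b \<bullet> b"] by (simp only: o_def)
  then show ?thesis by (simp add: trace_def matrix_def inner_axis)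
qed

text \<open>Only the derivative at 1 is given: f(t) = M(exp t) satisfies f(h) = f(t) f(h - t), which
  carries the derivative from 0 to every t as k f(t).\<close>

lemma multiplicative_eq_powr:
  fixes M :: "real \<Rightarrow> real"
  assumes mult: "\<And>s t. s > 0 \<Longrightarrow> t > 0 \<Longrightarrow> M (s * t) = M s * M t" and one: "M 1 = 1"
    and deriv: "(M has_real_derivative k) (at 1)" and s: "s > 0"
  shows "M s = s powr k"
proof -
  define f where "f t = M (exp t)" for t :: real
  have f0: "(f has_real_derivative k) (at 0)"
    unfolding f_def using DERIV_chain2[of M k exp 0 1 UNIV] deriv DERIV_exp[of 0] by simp
  have ft: "(f has_real_derivative k * f t) (at t)" for t
  proof -
    have "((\<lambda>h. f t * f (h - t)) has_real_derivative f t * (k * 1)) (at t)"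
      by (intro DERIV_cmult DERIV_chain2[where f = f]) (use f0 in \<open>auto intro!: derivative_eq_intros\<close>)
    moreover have "f t * f (h - t) = f h" for h
      using mult[of "exp t" "exp (h - t)"] by (simp add: f_def exp_add[symmetric])
    ultimately show ?thesis by (simp add: mult.commute)
  qed
  have "((\<lambda>t. f t * exp (- k * t)) has_real_derivative 0) (at t)" for t
    by (rule derivative_eq_intros ft refl)+ (simp add: algebra_simps)
  then have "f (ln s) * exp (- k * ln s) = f 0 * exp (- k * 0)"
    using DERIV_isconst_all[of "\<lambda>t. f t * exp (- k * t)"] by blast
  then show ?thesis using s one by (simp add: f_def powr_def exp_minus field_simps)
qed

locale jordan_rn = euclidean_jordan mul e B
  for mul :: "real^'n \<Rightarrow> real^'n \<Rightarrow> real^'n" (infixl \<open>\<odot>\<close> 72) and e B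
begin

text \<open>A one-parameter group in \<open>s\<close> whose derivative at 1 is twice the
  multiplication by \<open>c\<close>; its determinant is therefore a power of \<open>s\<close> with
  exponent twice the trace.\<close>

lemma det_peirce_op:
  assumes "idem c" "s > 0"
  shows "det (matrix (peirce_op c s (s\<^sup>2))) = s powr (2 * tau c)"
proof (rule multiplicative_eq_powr[where M = "\<lambda>s. det (matrix (peirce_op c s (s\<^sup>2)))"])
  show "det (matrix (peirce_op c (s * t) ((s * t)\<^sup>2))) =
      det (matrix (peirce_op c s (s\<^sup>2))) * det (matrix (peirce_op c t (t\<^sup>2)))" for s t
  proof -
    have "peirce_op c (s * t) ((s * t)\<^sup>2) = peirce_op c s (s\<^sup>2) \<circ> peirce_op c t (t\<^sup>2)"
      by (auto simp: peirce_op_comp[OF assms(1)] power_mult_distrib)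
    then show ?thesis by (simp add: matrix_compose linear_peirce det_mul)
  qed
  have 1: "matrix (peirce_op c 1 (1\<^sup>2)) = mat 1"
  proof -
    have "peirce_op c 1 (1\<^sup>2) = id" by (auto simp: peirce_op_def)
    then show ?thesis by (simp add: matrix_id_mat_1)
  qed
  then show "det (matrix (peirce_op c 1 (1\<^sup>2))) = 1" by simp
  have "((\<lambda>s. det (matrix (peirce_op c s (s\<^sup>2)))) has_real_derivative trace (matrix (\<lambda>x. 2 *\<^sub>R (c \<odot> x)))) (at 1)"
  proof (rule has_derivative_det_at_id[where A = "\<lambda>s. matrix (peirce_op c s (s\<^sup>2))"])
    show "matrix (peirce_op c 1 (1\<^sup>2)) = mat 1" by (fact 1)
    fix i j
    let ?b = "axis j 1 :: real^'n"
    have "((\<lambda>s. (?b - peirce1 c ?b - peirceh c ?b) $ i + s * (peirceh c ?b $ i) + s\<^sup>2 * (peirce1 c ?b $ i))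
       has_real_derivative (peirceh c ?b $ i + 2 * peirce1 c ?b $ i)) (at 1)"
      by (auto intro!: derivative_eq_intros)
    moreover have "peirceh c ?b $ i + 2 * peirce1 c ?b $ i = (2 *\<^sub>R (c \<odot> ?b)) $ i"
      unfolding mul_eq_peirce[of c ?b] by simp
    ultimately show "((\<lambda>s. matrix (peirce_op c s (s\<^sup>2)) $ i $ j) has_real_derivative
          matrix (\<lambda>x. 2 *\<^sub>R (c \<odot> x)) $ i $ j) (at 1)"
      by (simp add: matrix_def peirce_op_def)
  qed
  moreover have "trace (matrix (\<lambda>x. 2 *\<^sub>R (c \<odot> x))) = 2 * tau c"
    unfolding trace_op_matrix[symmetric] tau_def by (simp add: trace_op_def sum_distrib_left)
  ultimately show "((\<lambda>s. det (matrix (peirce_op c s (s\<^sup>2)))) has_real_derivative 2 * tau c) (at 1)" by simp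
qed (fact assms(2))

text \<open>Properties of a product of Peirce operators over \<open>F\<close> with eigenvalues
  \<open>l\<close>. The last clause keeps the induction on \<open>F\<close> going; the clauses on
  fixed vectors and on invariant subspaces serve the restriction to an ideal.\<close>

definition group_elt :: "(real^'n) set \<Rightarrow> (real^'n \<Rightarrow> real) \<Rightarrow> (real^'n \<Rightarrow> real^'n) \<Rightarrow> bool" where
  "group_elt F l G \<longleftrightarrow> linear G \<and> (\<forall>x y. B (G x) y = B x (G y)) \<and> G ` pos_cone = pos_cone
     \<and> G e = e + (\<Sum>c\<in>F. (l c - 1) *\<^sub>R c) \<and> det (matrix G) = (\<Prod>c\<in>F. l c powr tau c)
     \<and> (\<forall>x. (\<forall>c\<in>F. c \<odot> x = 0) \<longrightarrow> G x = x)
     \<and> (\<forall>W. subspace W \<longrightarrow> (\<forall>c\<in>F. \<forall>w\<in>W. c \<odot> w \<in> W) \<longrightarrow> G ` W \<subseteq> W)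
     \<and> (\<forall>d. (\<forall>c\<in>F. c \<odot> d = 0) \<longrightarrow> (\<forall>x. G (d \<odot> x) = d \<odot> G x))"

lemma ex_group_elt:
  assumes "orth_system F" "\<And>c. c \<in> F \<Longrightarrow> l c > 0" shows "\<exists>G. group_elt F l G"
proof -
  have "finite F" using assms by (simp add: orth_system_def)
  then show ?thesis using assms
  proof (induction F rule: finite_induct)
    case empty
    have "group_elt {} l id" by (simp add: group_elt_def matrix_id_mat_1 linear_id)
    then show ?case by blast
  next
    case (insert c F)
    have "orth_system F" using insert.prems insert.hyps by (simp add: orth_system_def)
    then obtain G where G: "group_elt F l G" using insert by auto
    have c: "idem c" "l c > 0" using insert by (auto simp: orth_system_def primitive_def)
    have cF: "d \<odot> c = 0" "c \<odot> d = 0" if "d \<in> F" for d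
      using insert.prems insert.hyps that by (auto simp: orth_system_def)
    \<comment> \<open>On the Peirce space for 1 the operator acts by the square of its parameter,
      which has to be \<open>l c\<close>.\<close>
    let ?s = "sqrt (l c)"
    let ?T = "peirce_op c ?s (?s\<^sup>2)"
    have GL: "linear G" using G by (simp add: group_elt_def)
    have Gc: "G (c \<odot> x) = c \<odot> G x" for x using G cF by (simp add: group_elt_def)
    have comT: "G (?T x) = ?T (G x)" for x
      by (simp add: peirce_op_def peirce1_def peirceh_def linear_add[OF GL] linear_diff[OF GL] linear_cmul[OF GL] Gc)
    have comTd: "?T (d \<odot> x) = d \<odot> ?T x" if "c \<odot> d = 0" for d x
      using commute_of_orth[OF c(1) that] by (simp add: peirce_op_def peirce1_def peirceh_def mul_lin)
    have "group_elt (insert c F) l (?T \<circ> G)"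
      unfolding group_elt_def
    proof (intro conjI allI impI)
      show "linear (?T \<circ> G)" by (intro linear_compose GL linear_peirce)
      show "B ((?T \<circ> G) x) y = B x ((?T \<circ> G) y)" for x y
        using G by (simp add: peirce_op_self_adjoint comT[symmetric] group_elt_def)
      have "(?T \<circ> G) ` pos_cone = ?T ` (G ` pos_cone)" by (rule image_comp[symmetric])
      then show "(?T \<circ> G) ` pos_cone = pos_cone"
        using G peirce_op_pos_cone[OF c(1), of ?s] c(2) by (simp add: group_elt_def del: real_sqrt_pow2_iff real_sqrt_pow2)
      have "?T (\<Sum>d\<in>F. (l d - 1) *\<^sub>R d) = (\<Sum>d\<in>F. (l d - 1) *\<^sub>R d)"
        by (simp add: linear_sum[OF linear_peirce(3)] linear_cmul[OF linear_peirce(3)] peirce_op_orth cF)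
      then show "(?T \<circ> G) e = e + (\<Sum>d\<in>insert c F. (l d - 1) *\<^sub>R d)"
        using G insert.hyps c by (simp add: group_elt_def linear_add[OF linear_peirce(3)] peirce_op_e)
      have "?s powr (2 * tau c) = l c powr tau c" using c(2) by (simp add: powr_half_sqrt[symmetric] powr_powr)
      then show "det (matrix (?T \<circ> G)) = (\<Prod>c\<in>insert c F. l c powr tau c)"
        using G insert.hyps det_peirce_op[OF c(1), of ?s] c(2) GL
        by (simp add: matrix_compose linear_peirce det_mul group_elt_def del: real_sqrt_pow2_iff real_sqrt_pow2)
      fix x assume "\<forall>d\<in>insert c F. d \<odot> x = 0"
      then show "(?T \<circ> G) x = x" using G by (simp add: group_elt_def peirce_op_orth)
    next
      fix W assume W: "subspace W" "\<forall>d\<in>insert c F. \<forall>w\<in>W. d \<odot> w \<in> W"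
      have "?T w \<in> W" if "w \<in> W" for w
        using W that unfolding peirce_op_def peirce1_def peirceh_def
        by (intro subspace_add subspace_diff subspace_scale) auto
      moreover have "G ` W \<subseteq> W" using G W unfolding group_elt_def by blast
      ultimately show "(?T \<circ> G) ` W \<subseteq> W" by auto
    next
      fix d x assume d: "\<forall>c\<in>insert c F. c \<odot> d = 0"
      then show "(?T \<circ> G) (d \<odot> x) = d \<odot> (?T \<circ> G) x"
        using G comTd[of d] by (simp add: group_elt_def)
    qed
    then show ?case by blast
  qed
qed

lemma group_elt_inj:
  assumes "group_elt F l G" "orth_system F" "\<And>c. c \<in> F \<Longrightarrow> l c > 0" shows "inj G"
proof -
  have "det (matrix G) \<noteq> 0"
    using assms unfolding group_elt_def orth_system_def by (simp add: prod_zero_iff) fastforce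
  then show ?thesis using assms(1) det_nz_iff_inj[of G] by (simp add: group_elt_def)
qed

end

text \<open>Two mutually annihilating subspaces that span: the ideals of a decomposition. The locale
  is used for both orders of the pair, so that each result on \<open>V\<close> also covers
  \<open>W\<close>.\<close>

locale ideal_pair = jordan_rn mul e B for mul :: "real^'n \<Rightarrow> real^'n \<Rightarrow> real^'n" (infixl \<open>\<odot>\<close> 72) and e B +
  fixes V W :: "(real^'n) set" and u v :: "real^'n"
  assumes sub: "subspace V" "subspace W" and mul0: "x \<in> V \<Longrightarrow> y \<in> W \<Longrightarrow> x \<odot> y = 0"
    and decomp: "\<exists>x\<in>V. \<exists>y\<in>W. z = x + y" and uv: "u \<in> V" "v \<in> W" "e = u + v"
begin

lemma B0: "x \<in> V \<Longrightarrow> y \<in> W \<Longrightarrow> B x y = 0" "x \<in> V \<Longrightarrow> y \<in> W \<Longrightarrow> B y x = 0"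
  using mul0[of x y] B_mul_e(1)[of x y] symB[of y x] by auto

lemma disjoint: "x \<in> V \<Longrightarrow> x \<in> W \<Longrightarrow> x = 0"
  using B0(1)[of x x] B_eq_0_iff by blast

lemma ideal_V: assumes "x \<in> V" shows "x \<odot> z \<in> V"
proof -
  obtain a b where ab: "a \<in> V" "b \<in> W" "x \<odot> z = a + b" using decomp by blast
  have "B b b = B b (x \<odot> z)" using ab B0 by (simp add: B_lin)
  also have "\<dots> = B (b \<odot> x) z" by (metis assoc comm)
  also have "\<dots> = 0" using mul0[OF assms ab(2)] comm by simp
  finally show ?thesis using ab B_eq_0_iff by simp
qed

text \<open>The cross terms of a square w w vanish, so its components are the squares of the
  components of w.\<close>

lemma squares_components: assumes "x \<in> V" "y \<in> W" "x + y \<in> squares" shows "x \<in> squares \<and> y \<in> squares"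
proof -
  obtain w where w: "x + y = w \<odot> w" using assms by (auto simp: squares_def)
  obtain a b where ab: "a \<in> V" "b \<in> W" "w = a + b" using decomp by blast
  have bb: "b \<odot> b \<in> W"
  proof -
    obtain p q where pq: "p \<in> V" "q \<in> W" "b \<odot> b = p + q" using decomp by blast
    have "B p p = B p (b \<odot> b)" using pq B0 by (simp add: B_lin)
    also have "\<dots> = B (p \<odot> b) b" by (metis assoc comm)
    also have "\<dots> = 0" using mul0[OF pq(1) ab(2)] by simp
    finally show ?thesis using pq B_eq_0_iff by simp
  qed
  have "x + y = a \<odot> a + b \<odot> b" unfolding w ab(3) using mul0[OF ab(1,2)] by (simp add: mul_lin comm[of b a])
  then have eq: "x - a \<odot> a = b \<odot> b - y" by (simp add: algebra_simps)
  have "x - a \<odot> a \<in> V" by (intro subspace_diff sub assms ideal_V ab)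
  moreover have "b \<odot> b - y \<in> W" by (intro subspace_diff sub assms bb)
  ultimately have "x = a \<odot> a" "y = b \<odot> b" using eq disjoint[of "x - a \<odot> a"] by auto
  then show ?thesis using squaresI by simp
qed

text \<open>The components of a test square are squares themselves, so positivity is tested
  separately in \<open>V\<close> and in \<open>W\<close>.\<close>

lemma pos_cone_mix:
  assumes "x \<in> V" "y \<in> W" "x + y \<in> pos_cone" "x' \<in> V" "y' \<in> W" "x' + y' \<in> pos_cone"
  shows "x + y' \<in> pos_cone"
  unfolding pos_cone_iff_dual
proof
  fix z assume z: "z \<in> squares - {0}"
  obtain a b where ab: "a \<in> V" "b \<in> W" "z = a + b" using decomp by blast
  have sq: "a \<in> squares" "b \<in> squares" using squares_components ab z by auto
  have e1: "B x a = B (x + y) a" "B y' b = B (x' + y') b" using ab assms B0 by (simp_all add: B_lin)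
  have "B x a \<ge> 0" "B y' b \<ge> 0" unfolding e1 using sq assms pos_cone_squares squares_B_nonneg by blast+
  moreover have "B x a > 0 \<or> B y' b > 0"
    unfolding e1 using z ab pos_cone_dual[OF assms(3) sq(1)] pos_cone_dual[OF assms(6) sq(2)]
    by (cases "b = 0") auto
  moreover have "B (x + y') z = B x a + B y' b" unfolding ab(3) using ab assms B0 by (simp add: B_lin)
  ultimately show "B (x + y') z > 0" by linarith
qed

text \<open>This is the projection of the cone to \<open>V\<close>: by \<open>pos_cone_mix\<close>
  the element \<open>v\<close> can stand for every admissible component in \<open>W\<close>.\<close>

definition cone_V :: "(real^'n) set" where "cone_V = {x \<in> V. x + v \<in> pos_cone}"

lemma cone_VI: "x \<in> V \<Longrightarrow> y \<in> W \<Longrightarrow> x + y \<in> pos_cone \<Longrightarrow> x \<in> cone_V"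
  using pos_cone_mix[of x y u v] uv e_pos_cone by (simp add: cone_V_def)

lemma closure_cone_V: "closure cone_V = squares \<inter> V"
proof
  have "cone_V \<subseteq> squares \<inter> V" using squares_components uv pos_cone_squares by (auto simp: cone_V_def)
  then show "closure cone_V \<subseteq> squares \<inter> V"
    using closed_squares closed_subspace[OF sub(1)] by (intro closure_minimal) auto
  show "squares \<inter> V \<subseteq> closure cone_V"
  proof
    fix x assume x: "x \<in> squares \<inter> V"
    have "x + inverse (real (Suc n)) *\<^sub>R u \<in> cone_V" for n
    proof (rule cone_VI)
      show "x + inverse (real (Suc n)) *\<^sub>R u \<in> V" using x uv sub by (simp add: subspace_add subspace_scale)
      show "inverse (real (Suc n)) *\<^sub>R v \<in> W" using uv sub by (simp add: subspace_scale)
      have "x + inverse (real (Suc n)) *\<^sub>R e \<in> pos_cone"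
        using x e_pos_cone by (intro pos_cone_add pos_cone_scale) auto
      then show "x + inverse (real (Suc n)) *\<^sub>R u + inverse (real (Suc n)) *\<^sub>R v \<in> pos_cone"
        by (simp add: uv(3) scaleR_add_right add.assoc)
    qed
    moreover have "(\<lambda>n. x + inverse (real (Suc n)) *\<^sub>R u) \<longlonglongrightarrow> x + 0 *\<^sub>R u"
      by (intro tendsto_intros LIMSEQ_inverse_real_of_nat)
    ultimately show "x \<in> closure cone_V" unfolding closure_sequential by force
  qed
qed

lemma self_dual_cone_V: "self_dual_in V B cone_V"
  unfolding self_dual_in_def closure_cone_V
proof (intro set_eqI iffI)
  fix y assume y: "y \<in> cone_V"
  have "B x y > 0" if x: "x \<in> squares \<inter> V - {0}" for x
  proof -
    have "B v x = 0" using B0(2) x uv by blast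
    then have "B x y = B (y + v) x" using symB[of x y] by (simp add: B_lin)
    then show ?thesis using pos_cone_dual[of "y + v" x] x y by (simp add: cone_V_def)
  qed
  then show "y \<in> {y \<in> V. \<forall>x\<in>squares \<inter> V - {0}. 0 < B x y}" using y by (simp add: cone_V_def)
next
  fix y assume y: "y \<in> {y \<in> V. \<forall>x\<in>squares \<inter> V - {0}. 0 < B x y}"
  have "y + v \<in> pos_cone"
    unfolding pos_cone_iff_dual
  proof
    fix z assume z: "z \<in> squares - {0}"
    obtain a b where ab: "a \<in> V" "b \<in> W" "z = a + b" using decomp by blast
    have sq: "a \<in> squares" "b \<in> squares" using squares_components ab z by auto
    have e2: "B v b = B e b" unfolding uv(3) using ab uv B0 by (simp add: B_lin)
    have "B e b \<ge> 0" "b \<noteq> 0 \<Longrightarrow> B e b > 0"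
      using sq(2) e_pos_cone pos_cone_squares squares_B_nonneg pos_cone_dual by blast+
    moreover have "a \<noteq> 0 \<Longrightarrow> B y a > 0" using y ab(1) sq(1) symB[of a y] by force
    moreover have "B (y + v) z = B y a + B e b" unfolding ab(3) e2[symmetric] using ab y uv B0 by (simp add: B_lin)
    moreover have "a \<noteq> 0 \<or> b \<noteq> 0" using z ab by auto
    moreover have "a = 0 \<Longrightarrow> B y a = 0" by simp
    ultimately show "B (y + v) z > 0" by (cases "a = 0") auto
  qed
  then show "y \<in> cone_V" using y by (simp add: cone_V_def)
qed

text \<open>Write c = a + b. Then a a - a lies in \<open>V\<close> and equals b - b b; pairing it
  with itself gives 0, so \<open>a\<close> is an idempotent below \<open>c\<close>.\<close>

lemma primitive_in: assumes "primitive c" shows "c \<in> V \<or> c \<in> W"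
proof -
  obtain a b where ab: "a \<in> V" "b \<in> W" "c = a + b" using decomp by blast
  have c: "c \<odot> c = c" using primitive_idem[OF assms] by (simp add: idem_def)
  have ca: "c \<odot> a = a \<odot> a" unfolding ab(3) using mul0[OF ab(1,2)] comm[of b a] by (simp add: mul_lin)
  have "c \<odot> c = a \<odot> a + b \<odot> b" unfolding ab(3) using mul0[OF ab(1,2)] comm[of b a] by (simp add: mul_lin)
  then have eq: "a \<odot> a - a = b - b \<odot> b" using c ab(3) by (simp add: algebra_simps)
  have aaV: "a \<odot> a - a \<in> V" by (intro subspace_diff sub ideal_V ab)
  have "B (a \<odot> a - a) (a \<odot> a - a) = B (a \<odot> a - a) b - B (a \<odot> a - a) (b \<odot> b)"
    by (subst (2) eq) (simp add: B_lin)
  also have "B (a \<odot> a - a) (b \<odot> b) = B ((a \<odot> a - a) \<odot> b) b" by (metis assoc comm)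
  also have "\<dots> = 0" using mul0[OF aaV ab(2)] by simp
  finally have "a \<odot> a - a = 0" using B0(1)[OF aaV ab(2)] B_eq_0_iff by simp
  then have "idem a" by (simp add: idem_def)
  then have "a = 0 \<or> a = c" using assms ca unfolding primitive_def idem_def by force
  then show ?thesis using ab by auto
qed

text \<open>Only the part \<open>F\<close> of a frame of x + v that lies in \<open>V\<close> is
  used: its group element fixes \<open>W\<close> pointwise, leaves \<open>V\<close> invariant and
  sends \<open>u\<close> to the component of x + v in \<open>V\<close>.\<close>

lemma cone_V_transitive:
  assumes "x \<in> cone_V" shows "\<exists>G. linear G \<and> inj G \<and> G ` V = V \<and> G ` cone_V = cone_V \<and> G u = x"
proof -
  have x: "x \<in> V" "x + v \<in> pos_cone" using assms by (auto simp: cone_V_def)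
  obtain C l where C: "frame C" "x + v = (\<Sum>c\<in>C. l c *\<^sub>R c)" "\<And>c. c \<in> C \<Longrightarrow> l c > 0"
    using pos_cone_frame[OF x(2)] by blast
  define F where "F = C \<inter> V"
  have prim: "primitive c" "finite C" "orth_system C" if "c \<in> C" for c using C(1) that by (auto simp: frame_def orth_system_def)
  have finC: "finite C" using C(1) by (simp add: frame_def orth_system_def)
  have F: "orth_system F" using C(1) by (auto simp: frame_def orth_system_def F_def)
  have CW: "c \<in> W" if "c \<in> C - F" for c using primitive_in prim that by (auto simp: F_def)
  \<comment> \<open>Every primitive idempotent lies in \<open>V\<close> or in \<open>W\<close>, so
    the component in \<open>V\<close> of a combination along the frame collects exactly the
    idempotents in \<open>F\<close>.\<close>
  have part: "(\<Sum>c\<in>F. k c *\<^sub>R c) = a" if "a \<in> V" "b \<in> W" "a + b = (\<Sum>c\<in>C. k c *\<^sub>R c)" for a b k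
  proof -
    let ?p = "\<Sum>c\<in>F. k c *\<^sub>R c" and ?q = "\<Sum>c\<in>C - F. k c *\<^sub>R c"
    have "?p + ?q = (\<Sum>c\<in>C. k c *\<^sub>R c)" using finC sum.subset_diff[of F C "\<lambda>c. k c *\<^sub>R c"] by (simp add: F_def add.commute)
    then have eq: "?p - a = b - ?q" using that(3) by (simp add: algebra_simps)
    have "?p - a \<in> V" using that(1) by (intro subspace_diff sub subspace_sum subspace_scale) (auto simp: F_def)
    moreover have "b - ?q \<in> W" using that(2) CW by (intro subspace_diff sub subspace_sum subspace_scale) auto
    ultimately have "?p - a = 0" using eq disjoint by metis
    then show ?thesis by simp
  qed
  obtain G where G: "group_elt F l G" using ex_group_elt[OF F] C(3) by (auto simp: F_def)
  have inj: "inj G" by (rule group_elt_inj[OF G F]) (use C(3) in \<open>auto simp: F_def\<close>)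
  have lin: "linear G" using G by (simp add: group_elt_def)
  have GW: "G y = y" if "y \<in> W" for y
    using G mul0[of _ y] that by (auto simp: group_elt_def F_def)
  have "G ` V \<subseteq> V"
    using G sub(1) ideal_V unfolding group_elt_def F_def by blast
  moreover have "dim (G ` V) = dim V" using dim_image_eq[OF lin, of V] inj by (simp add: inj_on_subset)
  ultimately have GV: "G ` V = V"
    by (metis subspace_dim_equal linear_subspace_image lin sub(1) order_refl)
  have "u + v = (\<Sum>c\<in>C. 1 *\<^sub>R c)" using frame_sum_e[OF C(1)] uv by simp
  then have sF: "(\<Sum>c\<in>F. 1 *\<^sub>R c) = u" by (rule part[OF uv(1,2), of "\<lambda>_. 1"])
  have "G e = e + (\<Sum>c\<in>F. l c *\<^sub>R c) - (\<Sum>c\<in>F. 1 *\<^sub>R c)"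
    using G by (simp add: group_elt_def scaleR_left_diff_distrib sum_subtractf)
  also have "\<dots> = x + v" using part[OF x(1) uv(2) C(2)] sF uv(3) by simp
  finally have "G u = x" using GW[OF uv(2)] unfolding uv(3) by (simp add: linear_add[OF lin])
  moreover have "G ` cone_V = cone_V"
  proof -
    have pc: "G w \<in> pos_cone \<longleftrightarrow> w \<in> pos_cone" for w
      using inj_image_mem_iff[OF inj, of w pos_cone] G by (simp add: group_elt_def)
    have cV: "G w \<in> cone_V \<longleftrightarrow> w \<in> cone_V" if "w \<in> V" for w
      using pc[of "w + v"] GW[OF uv(2)] GV that by (auto simp: cone_V_def linear_add[OF lin])
    show ?thesis
    proof
      show "G ` cone_V \<subseteq> cone_V" using cV by (auto simp: cone_V_def[THEN eqset_imp_iff])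
      show "cone_V \<subseteq> G ` cone_V"
      proof
        fix y assume y: "y \<in> cone_V"
        then obtain w where "w \<in> V" "y = G w" using GV by (auto simp: cone_V_def)
        then show "y \<in> G ` cone_V" using cV y by blast
      qed
    qed
  qed
  ultimately show ?thesis using lin inj GV by blast
qed

lemma symmetric_cone_V: "symmetric_cone_in V cone_V"
  unfolding symmetric_cone_in_def
proof (intro conjI)
  show "subspace V" by (fact sub)
  show "cone_V \<noteq> {}" using uv e_pos_cone by (auto simp: cone_V_def)
  show "openin (top_of_set V) cone_V"
  proof -
    have "cone_V = V \<inter> (\<lambda>x. x + v) -` pos_cone" by (auto simp: cone_V_def)
    moreover have "open ((\<lambda>x. x + v) -` pos_cone)"
      by (intro open_vimage open_pos_cone continuous_intros)
    ultimately show ?thesis by (auto simp: openin_open)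
  qed
  show "convex cone_V"
  proof -
    have "cone_V = V \<inter> (+) (- v) ` pos_cone"
    proof -
      have "x \<in> (+) (- v) ` pos_cone \<longleftrightarrow> x + v \<in> pos_cone" for x
        by (auto simp: image_iff) (metis add.commute add_diff_cancel_right' uminus_add_conv_diff)
      then show ?thesis by (auto simp: cone_V_def)
    qed
    then show ?thesis using convex_pos_cone subspace_imp_convex[OF sub(1)] by (simp add: convex_Int convex_translation)
  qed
  show "\<forall>x\<in>cone_V. \<forall>c>0. c *\<^sub>R x \<in> cone_V"
  proof (intro ballI allI impI)
    fix x and c :: real assume x: "x \<in> cone_V" "c > 0"
    then have "c *\<^sub>R (x + v) \<in> pos_cone" by (intro pos_cone_scale) (auto simp: cone_V_def)
    then show "c *\<^sub>R x \<in> cone_V"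
      using cone_VI[of "c *\<^sub>R x" "c *\<^sub>R v"] x uv sub by (simp add: scaleR_add_right cone_V_def subspace_scale)
  qed
  show "\<exists>B. inner_product B \<and> self_dual_in V B cone_V" using inner self_dual_cone_V by blast
  show "homogeneous_in V cone_V"
    unfolding homogeneous_in_def
  proof (intro ballI)
    fix x y assume "x \<in> cone_V" "y \<in> cone_V"
    then obtain G H where G: "linear G" "inj G" "G ` V = V" "G ` cone_V = cone_V" "G u = x"
      and H: "linear H" "inj H" "H ` V = V" "H ` cone_V = cone_V" "H u = y"
      using cone_V_transitive by meson
    obtain K where K: "linear K" "K \<circ> G = id" using linear_injective_left_inverse[OF G(1,2)] by blast
    have KG: "K (G w) = w" for w using K(2) by (metis comp_apply id_apply)
    have KV: "K ` V = V" and KC: "K ` cone_V = cone_V"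
      using G(3,4) KG by (metis (no_types, lifting) image_cong image_ident image_image)+
    have "inj_on K V" using G(3) KG by (intro inj_onI) (metis imageE)
    then have "bij_betw (H \<circ> K) V V"
      using H(2,3) KV unfolding bij_betw_def image_comp[symmetric]
      by (metis comp_inj_on inj_on_subset subset_UNIV)
    moreover have "linear (H \<circ> K)" using K(1) H(1) by (rule linear_compose)
    moreover have "(H \<circ> K) ` cone_V = cone_V" unfolding image_comp[symmetric] KC H(4) ..
    moreover have "(H \<circ> K) x = y" using KG[of u] G(5) H(5) by simp
    ultimately show "\<exists>g. linear g \<and> bij_betw g V V \<and> g ` cone_V = cone_V \<and> g x = y" by blast
  qed
qed

end

context jordan_rn begin

text \<open>If the traces differed, the primitive idempotents with the trace of \<open>c0\<close>
  would be orthogonal to all others by \<open>tau_eq_of_not_orth\<close>; the two spans would be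
  nonzero ideals that split the cone.\<close>

lemma tau_primitive_const:
  assumes irr: "irreducible_symmetric_cone pos_cone" and c0: "primitive c0" and d0: "primitive d0"
  shows "tau c0 = tau d0"
proof (rule ccontr)
  assume ne: "tau c0 \<noteq> tau d0"
  define P where "P = {c. primitive c \<and> tau c = tau c0}"
  define R where "R = {c. primitive c \<and> tau c \<noteq> tau c0}"
  define V where "V = span P"
  define W where "W = span R"
  have PR: "c \<odot> d = 0" if "c \<in> P" "d \<in> R" for c d
    using tau_eq_of_not_orth[of c d] orth_iff[of c d] that primitive_idem by (auto simp: P_def R_def)
  have VR: "x \<odot> d = 0" if "x \<in> V" "d \<in> R" for x d
    using that(1) unfolding V_def
    by (induction rule: span_induct_alt) (use PR that in \<open>auto simp: mul_lin\<close>)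
  have VW: "x \<odot> y = 0" if "x \<in> V" "y \<in> W" for x y
    using that(2) unfolding W_def
    by (induction rule: span_induct_alt) (use VR that in \<open>auto simp: mul_lin\<close>)
  have dec: "\<exists>x\<in>V. \<exists>y\<in>W. z = x + y" for z
  proof -
    obtain C l where C: "frame C" "z = (\<Sum>c\<in>C. l c *\<^sub>R c)" using spectral by blast
    have fin: "finite C" and prim: "\<And>c. c \<in> C \<Longrightarrow> primitive c" using C(1) by (auto simp: frame_def orth_system_def)
    have "z = (\<Sum>c\<in>C \<inter> P. l c *\<^sub>R c) + (\<Sum>c\<in>C - P. l c *\<^sub>R c)"
      unfolding C(2) by (rule sum.Int_Diff[OF fin])
    moreover have "(\<Sum>c\<in>C \<inter> P. l c *\<^sub>R c) \<in> V"
      unfolding V_def by (intro span_sum span_scale span_base) auto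
    moreover have "(\<Sum>c\<in>C - P. l c *\<^sub>R c) \<in> W"
      unfolding W_def by (intro span_sum span_scale span_base) (use prim in \<open>auto simp: P_def R_def\<close>)
    ultimately show ?thesis by blast
  qed
  obtain u v where uv: "u \<in> V" "v \<in> W" "e = u + v" using dec by blast
  interpret I1: ideal_pair mul e B V W u v
    by unfold_locales (use VW dec uv in \<open>auto simp: V_def W_def\<close>)
  interpret I2: ideal_pair mul e B W V v u
  proof unfold_locales
    show "\<exists>x\<in>W. \<exists>y\<in>V. z = x + y" for z using dec[of z] by (metis add.commute)
    show "e = v + u" using uv by (simp add: add.commute)
    show "x \<odot> y = 0" if "x \<in> W" "y \<in> V" for x y using VW[OF that(2,1)] comm by metis
  qed (use uv in \<open>auto simp: V_def W_def\<close>)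
  have "c0 \<in> V" "d0 \<in> W" unfolding V_def W_def using c0 d0 ne by (auto intro!: span_base simp: P_def R_def)
  then have nz: "V \<noteq> {0}" "W \<noteq> {0}" using primitive_nz c0 d0 by blast+
  have "V \<inter> W = {0}" using I1.disjoint I1.sub by (auto simp: subspace_0)
  moreover have "{x + y |x y. x \<in> V \<and> y \<in> W} = UNIV" using dec by blast
  moreover have "pos_cone = {x + y |x y. x \<in> I1.cone_V \<and> y \<in> I2.cone_V}"
  proof (intro set_eqI iffI)
    fix z assume z: "z \<in> pos_cone"
    obtain x y where xy: "x \<in> V" "y \<in> W" "z = x + y" using dec by blast
    then show "z \<in> {x + y |x y. x \<in> I1.cone_V \<and> y \<in> I2.cone_V}"
      using I1.cone_VI[of x y] I2.cone_VI[of y x] z by (auto simp: add.commute)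
  next
    fix z assume "z \<in> {x + y |x y. x \<in> I1.cone_V \<and> y \<in> I2.cone_V}"
    then obtain x y where "x \<in> I1.cone_V" "y \<in> I2.cone_V" "z = x + y" by blast
    then show "z \<in> pos_cone"
      using I1.pos_cone_mix[of x v u y] uv by (simp add: I1.cone_V_def I2.cone_V_def add.commute)
  qed
  ultimately show False
    using irr nz I1.symmetric_cone_V I2.symmetric_cone_V unfolding irreducible_symmetric_cone_def by blast
qed

end

section \<open>Lebesgue measure under linear maps\<close>

text \<open>Fubini in the coordinate of \<open>a\<close>: the other coordinates fix the value
  \<open>w b\<close>, by which the inner variable is translated.\<close>

lemma nn_integral_lborel_shear:
  fixes h :: "'a::euclidean_space \<Rightarrow> ennreal"
  assumes [measurable]: "h \<in> borel_measurable borel" and ab: "a \<in> Basis" "b \<in> Basis" "a \<noteq> b"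
  shows "(\<integral>\<^sup>+x. h (x + (x \<bullet> b) *\<^sub>R a) \<partial>lborel) = (\<integral>\<^sup>+x. h x \<partial>lborel)"
proof -
  interpret P: product_sigma_finite "\<lambda>_::'a. lborel :: real measure" ..
  let ?I = "Basis - {a}"
  let ?s = "\<lambda>w. \<Sum>c\<in>Basis. w c *\<^sub>R c"
  have ins: "insert a ?I = Basis" using ab by auto
  have E: "(\<integral>\<^sup>+x. k x \<partial>lborel) = (\<integral>\<^sup>+w. (\<integral>\<^sup>+y. k (?s (w(a := y))) \<partial>lborel) \<partial>Pi\<^sub>M ?I (\<lambda>_. lborel))"
    if [measurable]: "k \<in> borel_measurable borel" for k :: "'a \<Rightarrow> ennreal"
  proof -
    have "(\<integral>\<^sup>+x. k x \<partial>lborel) = (\<integral>\<^sup>+w. k (?s w) \<partial>Pi\<^sub>M Basis (\<lambda>_. lborel))"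
      by (subst lborel_eq) (simp add: nn_integral_distr)
    also have "\<dots> = (\<integral>\<^sup>+w. (\<integral>\<^sup>+y. k (?s (w(a := y))) \<partial>lborel) \<partial>Pi\<^sub>M ?I (\<lambda>_. lborel))"
      using P.product_nn_integral_insert[of ?I a "\<lambda>w. k (?s w)"] unfolding ins by simp
    finally show ?thesis .
  qed
  have s: "?s (w(a := y)) = (\<Sum>c\<in>?I. w c *\<^sub>R c) + y *\<^sub>R a" for w y
  proof -
    have "?s (w(a := y)) = (w(a := y)) a *\<^sub>R a + (\<Sum>c\<in>?I. (w(a := y)) c *\<^sub>R c)"
      using ab(1) by (intro sum.remove) auto
    also have "(\<Sum>c\<in>?I. (w(a := y)) c *\<^sub>R c) = (\<Sum>c\<in>?I. w c *\<^sub>R c)" by (rule sum.cong) auto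
    finally show ?thesis by simp
  qed
  have inb: "?s (w(a := y)) \<bullet> b = w b" for w y
    using ab by (simp add: inner_sum_left inner_Basis if_distrib[of "\<lambda>x. _ * x"] cong: if_cong)
  have "(\<integral>\<^sup>+x. h (x + (x \<bullet> b) *\<^sub>R a) \<partial>lborel)
     = (\<integral>\<^sup>+w. (\<integral>\<^sup>+y. h (?s (w(a := y)) + (?s (w(a := y)) \<bullet> b) *\<^sub>R a) \<partial>lborel) \<partial>Pi\<^sub>M ?I (\<lambda>_. lborel))"
    by (rule E) simp
  also have "\<dots> = (\<integral>\<^sup>+w. (\<integral>\<^sup>+y. h (?s (w(a := y))) \<partial>lborel) \<partial>Pi\<^sub>M ?I (\<lambda>_. lborel))"
  proof (rule nn_integral_cong)
    fix w :: "'a \<Rightarrow> real"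
    let ?k = "\<lambda>y. h ((\<Sum>c\<in>?I. w c *\<^sub>R c) + y *\<^sub>R a)"
    have "(\<integral>\<^sup>+y. ?k y \<partial>lborel) = (\<integral>\<^sup>+y. ?k (w b + y) \<partial>lborel)"
      by (subst lborel_distr_plus[symmetric, of "w b"]) (simp add: nn_integral_distr)
    then show "(\<integral>\<^sup>+y. h (?s (w(a := y)) + (?s (w(a := y)) \<bullet> b) *\<^sub>R a) \<partial>lborel) = (\<integral>\<^sup>+y. h (?s (w(a := y))) \<partial>lborel)"
      unfolding inb unfolding s by (simp add: algebra_simps)
  qed
  also have "\<dots> = (\<integral>\<^sup>+x. h x \<partial>lborel)" by (rule E[symmetric]) simp
  finally show ?thesis .
qed

lemma prod_Basis_vec: "(\<Prod>b\<in>Basis. g b) = (\<Prod>i\<in>UNIV. g (axis i 1))" for g :: "real^'n \<Rightarrow> real"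
proof -
  have "(Basis :: (real^'n) set) = range (\<lambda>i. axis i 1)" by (auto simp: Basis_vec_def)
  moreover have "inj (\<lambda>i. axis i 1 :: real^'n)" by (auto simp: inj_on_def axis_eq_axis)
  ultimately show ?thesis
    using prod.reindex[of "\<lambda>i. axis i 1 :: real^'n" UNIV g] by (simp only: o_def)
qed

lemma axis_Basis: "axis i (1::real) \<in> Basis"
  by (auto simp: Basis_vec_def)

lemma borel_measurable_linear: "linear f \<Longrightarrow> f \<in> borel_measurable borel"
  for f :: "'a::euclidean_space \<Rightarrow> 'b::euclidean_space"
  by (intro borel_measurable_continuous_onI linear_continuous_on) (simp add: linear_conv_bounded_linear)

text \<open>Change of variables, reduced to compositions of diagonal maps, transpositions of
  coordinates and shears; the singular generators of the induction are excluded by the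
  determinant.\<close>

proposition nn_integral_lborel_linear:
  fixes f :: "real^'n \<Rightarrow> real^'n" and h :: "real^'n \<Rightarrow> ennreal"
  assumes "linear f" "det (matrix f) \<noteq> 0" "h \<in> borel_measurable borel"
  shows "(\<integral>\<^sup>+x. h x \<partial>lborel) = ennreal \<bar>det (matrix f)\<bar> * (\<integral>\<^sup>+x. h (f x) \<partial>lborel)"
proof -
  let ?P = "\<lambda>f. det (matrix f) \<noteq> 0 \<longrightarrow> (\<forall>h \<in> borel_measurable borel.
     (\<integral>\<^sup>+x. h x \<partial>lborel) = ennreal \<bar>det (matrix f)\<bar> * (\<integral>\<^sup>+x. h (f x) \<partial>lborel))"
  have "?P f"
  proof (rule induct_linear_elementary[OF assms(1)])
    fix f g :: "real^'n \<Rightarrow> real^'n" assume fg: "linear f" "linear g" "?P f" "?P g"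
    have m: "matrix (f \<circ> g) = matrix f ** matrix g" by (rule matrix_compose[OF fg(2,1)])
    show "?P (f \<circ> g)"
    proof (intro impI ballI)
      fix h :: "real^'n \<Rightarrow> ennreal" assume d: "det (matrix (f \<circ> g)) \<noteq> 0" and h: "h \<in> borel_measurable borel"
      have hf: "(\<lambda>x. h (f x)) \<in> borel_measurable borel"
        using measurable_compose[OF borel_measurable_linear[OF fg(1)] h] .
      have "(\<integral>\<^sup>+x. h x \<partial>lborel) = ennreal \<bar>det (matrix f)\<bar> * (ennreal \<bar>det (matrix g)\<bar> * (\<integral>\<^sup>+x. h (f (g x)) \<partial>lborel))"
        using fg(3,4) d h hf by (auto simp: m det_mul)
      then show "(\<integral>\<^sup>+x. h x \<partial>lborel) = ennreal \<bar>det (matrix (f \<circ> g))\<bar> * (\<integral>\<^sup>+x. h ((f \<circ> g) x) \<partial>lborel)"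
        by (simp add: m det_mul abs_mult ennreal_mult mult.assoc)
    qed
  next
    fix f :: "real^'n \<Rightarrow> real^'n" and i assume f: "linear f" "\<And>x. f x $ i = 0"
    have "\<not> surj f"
    proof
      assume "surj f"
      then obtain x where "f x = axis i 1" by (metis surjD)
      then show False using f(2)[of x] by simp
    qed
    then have "\<not> inj f" using linear_injective_imp_surjective[OF f(1)] by blast
    then show "?P f" using det_nz_iff_inj[OF f(1)] by blast
  next
    fix c :: "'n \<Rightarrow> real"
    let ?f = "\<lambda>x. \<chi> i. c i * x $ i"
    have det: "det (matrix ?f) = prod c UNIV"
      by (simp add: axis_def matrix_def det_diagonal)
    show "?P ?f"
    proof (intro impI ballI)
      fix h :: "real^'n \<Rightarrow> ennreal" assume d: "det (matrix ?f) \<noteq> 0" and h[measurable]: "h \<in> borel_measurable borel"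
      define k where "k b = (?f b) \<bullet> b" for b :: "real^'n"
      have k: "k (axis i 1) = c i" for i by (simp add: k_def inner_axis)
      have nz: "k j \<noteq> 0" if "j \<in> Basis" for j
        using that d det k by (auto simp: Basis_vec_def prod_zero_iff)
      have T: "0 + (\<Sum>j\<in>Basis. (k j * (x \<bullet> j)) *\<^sub>R j) = ?f x" for x
      proof (rule vec_eq_iff[THEN iffD2], rule allI)
        fix i
        have "(0 + (\<Sum>j\<in>Basis. (k j * (x \<bullet> j)) *\<^sub>R j)) \<bullet> axis i 1 = k (axis i 1) * (x \<bullet> axis i 1)"
          by (simp add: inner_sum_left_Basis axis_Basis)
        then show "(0 + (\<Sum>j\<in>Basis. (k j * (x \<bullet> j)) *\<^sub>R j)) $ i = ?f x $ i"
          by (simp add: inner_axis k)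
      qed
      have meas[measurable]: "?f \<in> borel_measurable borel"
        by (intro borel_measurable_linear linearI) (auto simp: vec_eq_iff algebra_simps)
      have "lborel = density (distr lborel borel ?f) (\<lambda>_. (\<Prod>j\<in>Basis. \<bar>k j\<bar>))"
        using lborel_affine_euclidean[of k 0, OF nz] unfolding T .
      then have "(\<integral>\<^sup>+x. h x \<partial>lborel) = (\<integral>\<^sup>+x. h x \<partial>density (distr lborel borel ?f) (\<lambda>_. ennreal (\<Prod>j\<in>Basis. \<bar>k j\<bar>)))"
        by (simp only: )
      also have "\<dots> = ennreal (\<Prod>j\<in>Basis. \<bar>k j\<bar>) * (\<integral>\<^sup>+x. h (?f x) \<partial>lborel)"
        by (simp add: nn_integral_density nn_integral_distr nn_integral_cmult)
      also have "(\<Prod>j\<in>Basis. \<bar>k j\<bar>) = \<bar>det (matrix ?f)\<bar>"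
        unfolding prod_Basis_vec det k abs_prod ..
      finally show "(\<integral>\<^sup>+x. h x \<partial>lborel) = ennreal \<bar>det (matrix ?f)\<bar> * (\<integral>\<^sup>+x. h (?f x) \<partial>lborel)" .
    qed
  next
    fix m n :: 'n assume "m \<noteq> n"
    let ?t = "Transposition.transpose m n"
    let ?f = "\<lambda>x. (\<chi> i. x $ ?t i) :: real^'n"
    have lin: "linear ?f" by (rule linearI) (simp_all add: vec_eq_iff)
    have inv: "?f (?f x) = x" for x by (simp add: vec_eq_iff)
    have "matrix ?f = (\<chi> i. (mat 1 :: real^'n^'n) $ ?t i)"
      by (auto simp: matrix_def vec_eq_iff axis_def mat_def)
    then have det: "\<bar>det (matrix ?f)\<bar> = 1"
      by (simp add: det_permute_rows permutes_swap_id sign_swap_id abs_mult)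
    have [measurable]: "?f \<in> borel_measurable borel" by (rule borel_measurable_linear[OF lin])
    have distr: "lborel = distr lborel borel ?f"
    proof (rule lborel_eqI)
      fix l u :: "real^'n" assume le: "\<And>b. b \<in> Basis \<Longrightarrow> l \<bullet> b \<le> u \<bullet> b"
      then have le': "l $ i \<le> u $ i" for i using le[OF axis_Basis[of i]] by (simp add: inner_axis)
      have "?f -` box l u = box (?f l) (?f u)"
        by (auto simp: mem_box_cart) (metis transpose_involutory)+
      then have "emeasure (distr lborel borel ?f) (box l u) = ennreal (\<Prod>b\<in>Basis. (?f u - ?f l) \<bullet> b)"
        using le by (auto simp: emeasure_distr emeasure_lborel_box_eq Basis_vec_def inner_axis le')
      also have "(\<Prod>b\<in>Basis. (?f u - ?f l) \<bullet> b) = (\<Prod>i\<in>UNIV. (u - l) $ ?t i)"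
        unfolding prod_Basis_vec by (simp add: inner_axis)
      also have "\<dots> = (\<Prod>i\<in>UNIV. (u - l) $ i)"
        using prod.permute[OF permutes_swap_id, where S=UNIV and g="\<lambda>i. (u - l)$i"] by (simp add: o_def)
      also have "\<dots> = (\<Prod>b\<in>Basis. (u - l) \<bullet> b)"
        unfolding prod_Basis_vec by (simp add: inner_axis)
      finally show "emeasure (distr lborel borel ?f) (box l u) = ennreal (\<Prod>b\<in>Basis. (u - l) \<bullet> b)" .
    qed simp
    show "?P ?f"
    proof (intro impI ballI)
      fix h :: "real^'n \<Rightarrow> ennreal" assume h[measurable]: "h \<in> borel_measurable borel"
      have "(\<integral>\<^sup>+x. h x \<partial>lborel) = (\<integral>\<^sup>+x. h x \<partial>distr lborel borel ?f)" using distr by simp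
      then show "(\<integral>\<^sup>+x. h x \<partial>lborel) = ennreal \<bar>det (matrix ?f)\<bar> * (\<integral>\<^sup>+x. h (?f x) \<partial>lborel)"
        by (simp add: nn_integral_distr det)
    qed
  next
    fix m n :: 'n assume mn: "m \<noteq> n"
    let ?f = "\<lambda>x. (\<chi> i. if i = m then x $ m + x $ n else x $ i) :: real^'n"
    have f: "?f x = x + (x \<bullet> axis n 1) *\<^sub>R axis m 1" for x
      unfolding cart_eq_inner_axis[symmetric] by (auto simp: vec_eq_iff axis_def)
    have "matrix ?f = (\<chi> k. if k = m then row m (mat 1) + 1 *s row n (mat 1) else row k (mat 1))"
      by (auto simp: matrix_def vec_eq_iff axis_def mat_def row_def)
    then have det: "det (matrix ?f) = 1"
      by (simp only: det_row_operation[OF mn]) simp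
    show "?P ?f"
    proof (intro impI ballI)
      fix h :: "real^'n \<Rightarrow> ennreal" assume h: "h \<in> borel_measurable borel"
      show "(\<integral>\<^sup>+x. h x \<partial>lborel) = ennreal \<bar>det (matrix ?f)\<bar> * (\<integral>\<^sup>+x. h (?f x) \<partial>lborel)"
        unfolding det unfolding f using nn_integral_lborel_shear[OF h, of "axis m 1" "axis n 1"] mn
        by (simp add: axis_Basis axis_eq_axis)
    qed
  qed
  then show ?thesis using assms by blast
qed

lemma measure_lborel_linear_image:
  fixes f :: "real^'n \<Rightarrow> real^'n"
  assumes f: "linear f" "inj f" and S: "open S"
  shows "measure lborel (f ` S) = \<bar>det (matrix f)\<bar> * measure lborel S"
proof -
  have d: "det (matrix f) \<noteq> 0" using det_nz_iff_inj[OF f(1)] f(2) by simp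
  have "open (f ` S)" using open_surjective_linear_image[OF S f(1)] linear_injective_imp_surjective[OF f] by simp
  then have fS: "f ` S \<in> sets borel" by simp
  have "emeasure lborel (f ` S) = ennreal \<bar>det (matrix f)\<bar> * (\<integral>\<^sup>+x. indicator (f ` S) (f x) \<partial>lborel)"
    using nn_integral_lborel_linear[OF f(1) d, of "indicator (f ` S)"] fS by simp
  also have "(\<lambda>x. indicator (f ` S) (f x)) = (indicator S :: _ \<Rightarrow> ennreal)"
    using inj_image_mem_iff[OF f(2)] by (auto simp: indicator_def)
  finally have "emeasure lborel (f ` S) = ennreal \<bar>det (matrix f)\<bar> * emeasure lborel S"
    using S by simp
  then show ?thesis by (simp add: measure_def enn2real_mult)
qed

section \<open>The determinant\<close>

text \<open>Newton's identities, used as a recursion for the elementary symmetric functions in terms of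
  the power sums.\<close>

fun elementary_of_power_sums :: "(nat \<Rightarrow> real) \<Rightarrow> nat \<Rightarrow> real" where
  "elementary_of_power_sums p 0 = 1"
| "elementary_of_power_sums p (Suc k) =
     (\<Sum>i\<le>k. (-1) ^ i * p (Suc i) * elementary_of_power_sums p (k - i)) / real (Suc k)"

text \<open>The product \<open>E\<close> of all 1 + l X generates the elementary symmetric
  functions. Its logarithmic derivative is the sum of the series l / (1 + l X), whose coefficients
  are the power sums with signs; comparing coefficients in \<open>dE\<close> gives the
  recursion.\<close>

lemma elementary_of_power_sums_top:
  fixes l :: "'a \<Rightarrow> real"
  assumes "finite C"
  shows "elementary_of_power_sums (\<lambda>k. \<Sum>c\<in>C. l c ^ k) (card C) = (\<Prod>c\<in>C. l c)"
proof -
  define E where "E C = (\<Prod>c\<in>C. 1 + fps_const (l c) * fps_X)" for C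
  define G where "G c = Abs_fps (\<lambda>n. l c * (- l c) ^ n)" for c
  have G: "(1 + fps_const (l c) * fps_X) * G c = fps_const (l c)" for c
  proof (rule fps_ext)
    fix n show "fps_nth ((1 + fps_const (l c) * fps_X) * G c) n = fps_nth (fps_const (l c)) n"
      by (cases n) (auto simp: G_def distrib_right mult.assoc)
  qed
  have dE: "fps_deriv (E C) = E C * (\<Sum>c\<in>C. G c)" using assms
  proof (induction C rule: finite_induct)
    case empty
    then show ?case by (simp add: E_def)
  next
    case (insert c C)
    have "fps_deriv (E (insert c C)) = fps_const (l c) * E C + (1 + fps_const (l c) * fps_X) * (E C * (\<Sum>c\<in>C. G c))"
      using insert by (simp add: E_def fps_deriv_mult algebra_simps)
    also have "\<dots> = E (insert c C) * (\<Sum>c\<in>insert c C. G c)"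
      using insert by (subst G[symmetric]) (simp add: E_def algebra_simps)
    finally show ?case .
  qed
  have sumG: "fps_nth (\<Sum>c\<in>C. G c) i = (-1) ^ i * (\<Sum>c\<in>C. l c ^ Suc i)" for i
    by (simp add: fps_sum_nth G_def sum_distrib_left power_minus[of "l _" i] mult_ac)
  have coeff: "elementary_of_power_sums (\<lambda>k. \<Sum>c\<in>C. l c ^ k) k = fps_nth (E C) k" for k
  proof (induction k rule: less_induct)
    case (less k)
    show ?case
    proof (cases k)
      case 0
      have "fps_nth (E C) 0 = 1" unfolding E_def using assms
        by (induction C rule: finite_induct) auto
      then show ?thesis using 0 by simp
    next
      case (Suc j)
      have "real (Suc j) * fps_nth (E C) (Suc j) = fps_nth (E C * (\<Sum>c\<in>C. G c)) j"
        using arg_cong[OF dE, of "\<lambda>f. fps_nth f j"] by (simp del: of_nat_Suc)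
      also have "\<dots> = (\<Sum>i\<le>j. (-1) ^ i * (\<Sum>c\<in>C. l c ^ Suc i) * fps_nth (E C) (j - i))"
        by (simp add: mult.commute[of "E C"] fps_mult_nth sumG atLeast0AtMost)
      also have "\<dots> = (\<Sum>i\<le>j. (-1) ^ i * (\<Sum>c\<in>C. l c ^ Suc i)
          * elementary_of_power_sums (\<lambda>k. \<Sum>c\<in>C. l c ^ k) (j - i))"
        by (rule sum.cong) (use less Suc in auto)
      finally show ?thesis using Suc by (simp add: field_simps del: of_nat_Suc)
    qed
  qed
  have "fps_nth (E C) (card C) = (\<Prod>c\<in>C. l c) \<and> (\<forall>k>card C. fps_nth (E C) k = 0)"
    unfolding E_def using assms
  proof (induction C rule: finite_induct)
    case (insert c C)
    let ?P = "\<Prod>c\<in>C. 1 + fps_const (l c) * fps_X"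
    have "fps_nth ((1 + fps_const (l c) * fps_X) * ?P) (Suc k) = fps_nth ?P (Suc k) + l c * fps_nth ?P k" for k
      by (simp add: distrib_right mult.assoc)
    then show ?case using insert by (auto simp: gr0_conv_Suc elim!: less_natE)
  qed auto
  then show ?thesis using coeff by simp
qed

lemma real_polynomial_function_elementary:
  assumes "\<And>k. real_polynomial_function (\<lambda>x. p x k)"
  shows "real_polynomial_function (\<lambda>x. elementary_of_power_sums (p x) k)"
proof (induction k rule: less_induct)
  case (less k)
  show ?case
  proof (cases k)
    case (Suc j)
    have "real_polynomial_function (\<lambda>x. (\<Sum>i\<le>j. (-1) ^ i * p x (Suc i) * elementary_of_power_sums (p x) (j - i)) * (1 / real (Suc j)))"
      by (intro real_polynomial_function.intros(2-4) real_polynomial_function_sum assms less) (auto simp: Suc)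
    then show ?thesis by (simp add: Suc)
  qed auto
qed

lemma monic_dvd_antisym:
  fixes f g :: "'a::field poly"
  assumes "lead_coeff f = 1" "lead_coeff g = 1" "f dvd g" "g dvd f" shows "f = g"
proof -
  obtain h where h: "g = f * h" using assms(3) by (auto simp: dvd_def)
  have nz: "f \<noteq> 0" "g \<noteq> 0" using assms by auto
  then have "h \<noteq> 0" using h by auto
  moreover have "degree f = degree g" using dvd_imp_degree_le assms nz by (metis order_antisym)
  ultimately have "degree h = 0" using h nz by (simp add: degree_mult_eq)
  then obtain c where "h = [:c:]" by (metis degree_eq_zeroE)
  moreover have "lead_coeff h = 1" using h assms by (simp add: lead_coeff_mult)
  ultimately show ?thesis using h by (simp add: one_pCons[symmetric])
qed

locale simple_jordan = jordan_rn mul e B for mul :: "real^'n \<Rightarrow> real^'n \<Rightarrow> real^'n" (infixl \<open>\<odot>\<close> 72) and e B +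
  assumes irr: "irreducible_symmetric_cone pos_cone"
begin

text \<open>By \<open>tau1_eq\<close> this is n / r, the exponent with which \<Delta> enters the
  determinants of the automorphisms.\<close>

definition tau1 :: real where "tau1 = tau (SOME c. primitive c)"

lemma tau_primitive: "primitive c \<Longrightarrow> tau c = tau1"
  unfolding tau1_def by (rule tau_primitive_const[OF irr]) (auto intro: someI)

definition rk :: nat where "rk = card (SOME C. frame C)"

lemma frame_tau: assumes "frame C" shows "tau1 * card C = CARD('n)"
proof -
  have "tau (\<Sum>C) = (\<Sum>c\<in>C. tau c)" by (rule linear_sum[OF tau_linear])
  also have "\<dots> = (\<Sum>c\<in>C. tau1)" using assms by (intro sum.cong) (auto simp: frame_def orth_system_def tau_primitive)
  finally show ?thesis using assms tau_e by (simp add: frame_def mult.commute)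
qed

text \<open>Counting traces in tau(e) = n replaces the conjugacy of frames.\<close>

lemma card_frame: assumes "frame C" shows "card C = rk"
proof -
  have "frame (SOME C. frame C)" using assms by (rule someI)
  then have "tau1 * card C = tau1 * rk" using frame_tau[OF assms] frame_tau unfolding rk_def by metis
  moreover have "tau1 \<noteq> 0" using frame_tau[OF assms] by force
  ultimately show ?thesis by simp
qed

lemma tau1_rk: "tau1 * rk = CARD('n)" and tau1_pos: "tau1 > 0" and rk_pos: "rk > 0"
proof -
  obtain C where "frame C" using spectral by blast
  then show *: "tau1 * rk = CARD('n)" using frame_tau card_frame by metis
  have "real CARD('n) > 0" by simp
  then show "tau1 > 0" "rk > 0" using * by (metis mult_eq_0_iff of_nat_0_le_iff of_nat_eq_0_iff gr0I not_less zero_less_mult_iff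
        less_irrefl of_nat_0_less_iff)+
qed

lemma tau1_eq: "tau1 = real CARD('n) / real rk"
  using tau1_rk rk_pos by (simp add: field_simps)

lemma ev_frame:
  assumes "frame C" "x = (\<Sum>c\<in>C. l c *\<^sub>R c)" shows "ev q x = (\<Sum>c\<in>C. poly q (l c) *\<^sub>R c)"
proof (induction q)
  case (pCons a q)
  have C: "orth_system C" "e = (\<Sum>c\<in>C. c)" using assms by (auto simp: frame_def)
  have "ev (pCons a q) x = a *\<^sub>R (\<Sum>c\<in>C. c) + (\<Sum>c\<in>C. l c *\<^sub>R c) \<odot> (\<Sum>c\<in>C. poly q (l c) *\<^sub>R c)"
    unfolding ev_pCons pCons.IH C(2)[symmetric] using assms(2) by simp
  then show ?case
    by (simp add: orth_system_mul_sum[OF C(1)] scaleR_sum_right sum.distrib[symmetric] scaleR_left_distrib)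
qed simp

lemma frame_sum_eq_0_iff: assumes "frame C" shows "(\<Sum>c\<in>C. l c *\<^sub>R c) = 0 \<longleftrightarrow> (\<forall>c\<in>C. l c = 0)"
proof
  assume z: "(\<Sum>c\<in>C. l c *\<^sub>R c) = 0"
  show "\<forall>c\<in>C. l c = 0"
  proof
    fix c assume c: "c \<in> C"
    have C: "orth_system C" "c \<noteq> 0" using assms c by (auto simp: frame_def orth_system_def primitive_def)
    have "l c *\<^sub>R c = 0" using orth_system_mul[OF C(1) c, of l] z by simp
    then show "l c = 0" using C by simp
  qed
qed simp

lemma finite_frame: "frame C \<Longrightarrow> finite C" by (simp add: frame_def orth_system_def)

lemma minimal_poly_frame:
  assumes "frame C" "x = (\<Sum>c\<in>C. l c *\<^sub>R c)" shows "minimal_poly mul e x = (\<Prod>a\<in>l ` C. [:-a, 1:])"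
proof -
  let ?f = "\<Prod>a\<in>l ` C. [:-a, 1:]"
  have f: "lead_coeff ?f = 1" by (simp add: lead_coeff_prod)
  have iff: "(ev q x = 0) = (?f dvd q)" for q
    unfolding ev_frame[OF assms] frame_sum_eq_0_iff[OF assms(1)]
  proof
    assume "\<forall>c\<in>C. poly q (l c) = 0"
    then show "?f dvd q" using finite_frame[OF assms(1)] by (intro prod_linear_dvd) auto
  next
    assume d: "?f dvd q"
    show "\<forall>c\<in>C. poly q (l c) = 0"
    proof
      fix c assume "c \<in> C"
      then have "[:- l c, 1:] dvd ?f" using finite_frame[OF assms(1)] by (intro dvd_prodI) auto
      then show "poly q (l c) = 0" using d poly_eq_0_iff_dvd dvd_trans by blast
    qed
  qed
  then show ?thesis
    unfolding minimal_poly_def using f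
  proof (intro the_equality)
    fix g assume g: "lead_coeff g = 1 \<and> (\<forall>q. (ev q x = 0) = (g dvd q))"
    then have "g dvd q \<longleftrightarrow> ?f dvd q" for q using iff[of q] by simp
    then have "g dvd ?f" "?f dvd g" by (metis dvd_refl)+
    then show "g = ?f" using g f by (intro monic_dvd_antisym) auto
  next
    show "lead_coeff ?f = 1 \<and> (\<forall>q. (ev q x = 0) = (?f dvd q))" using f iff by simp
  qed
qed

lemma degree_minimal_poly:
  assumes "frame C" "x = (\<Sum>c\<in>C. l c *\<^sub>R c)" shows "degree (minimal_poly mul e x) = card (l ` C)"
  unfolding minimal_poly_frame[OF assms] by (subst degree_prod_eq_sum_degree) auto

lemma ex_inj_real: "finite C \<Longrightarrow> \<exists>k :: 'a \<Rightarrow> real. inj_on k C"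
  using finite_imp_inj_to_nat_seg[of C] by (metis comp_inj_on inj_of_nat inj_on_subset subset_UNIV)

text \<open>Pairwise distinct coefficients on a frame give a minimal polynomial of the maximal
  degree.\<close>

lemma jordan_rank_eq: "jordan_rank mul e = rk"
  unfolding jordan_rank_def
proof (rule Max_eqI)
  have le: "degree (minimal_poly mul e x) \<le> rk" for x
  proof -
    obtain C l where C: "frame C" "x = (\<Sum>c\<in>C. l c *\<^sub>R c)" using spectral by blast
    show ?thesis unfolding degree_minimal_poly[OF C] card_frame[OF C(1), symmetric]
      by (rule card_image_le) (rule finite_frame[OF C(1)])
  qed
  have "range (\<lambda>x. degree (minimal_poly mul e x)) \<subseteq> {..rk}"
    by (rule image_subsetI) (simp only: atMost_iff le)
  then show "finite (range (\<lambda>x. degree (minimal_poly mul e x)))"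
    by (rule finite_subset) simp
  show "y \<le> rk" if "y \<in> range (\<lambda>x. degree (minimal_poly mul e x))" for y using le that by auto
  obtain C where C: "frame C" using spectral by blast
  obtain k :: "real^'n \<Rightarrow> real" where "inj_on k C" using ex_inj_real finite_frame[OF C] by blast
  then have "degree (minimal_poly mul e (\<Sum>c\<in>C. k c *\<^sub>R c)) = rk"
    unfolding degree_minimal_poly[OF C refl] card_frame[OF C, symmetric] by (rule card_image)
  then show "rk \<in> range (\<lambda>x. degree (minimal_poly mul e x))" by (metis rangeI)
qed

text \<open>Traces of powers are polynomial in \<open>x\<close>, and division by \<open>tau1\<close>
  turns them into the power sums of the eigenvalues; the recursion then yields the product of the
  eigenvalues as a polynomial function.\<close>

definition jdet :: "real^'n \<Rightarrow> real" where
  "jdet x = elementary_of_power_sums (\<lambda>k. tau (pow x k) / tau1) rk"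

lemma pow_frame: assumes "frame C" "x = (\<Sum>c\<in>C. l c *\<^sub>R c)" shows "pow x k = (\<Sum>c\<in>C. (l c ^ k) *\<^sub>R c)"
proof (induction k)
  case 0
  then show ?case using assms by (simp add: frame_def)
next
  case (Suc k)
  have "orth_system C" using assms by (simp add: frame_def)
  then have "pow x (Suc k) = (\<Sum>c\<in>C. (l c * l c ^ k) *\<^sub>R c)"
    unfolding pow_Suc Suc using orth_system_mul_sum[of C l "\<lambda>c. l c ^ k"] assms(2) by simp
  then show ?case by simp
qed

lemma jdet_frame: assumes "frame C" "x = (\<Sum>c\<in>C. l c *\<^sub>R c)" shows "jdet x = (\<Prod>c\<in>C. l c)"
proof -
  have "tau (pow x k) / tau1 = (\<Sum>c\<in>C. l c ^ k)" for k
  proof -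
    have "tau (pow x k) = (\<Sum>c\<in>C. l c ^ k * tau c)"
      unfolding pow_frame[OF assms] by (simp add: linear_sum[OF tau_linear] linear_cmul[OF tau_linear])
    also have "\<dots> = (\<Sum>c\<in>C. l c ^ k * tau1)"
      using assms by (intro sum.cong) (auto simp: frame_def orth_system_def tau_primitive)
    finally show ?thesis using tau1_pos by (simp add: sum_distrib_right[symmetric])
  qed
  then show ?thesis unfolding jdet_def
    using elementary_of_power_sums_top[OF finite_frame[OF assms(1)], of l] by (simp add: card_frame[OF assms(1)])
qed

lemma real_polynomial_function_pow:
  "linear f \<Longrightarrow> real_polynomial_function (\<lambda>x. f (pow x k))" for f :: "real^'n \<Rightarrow> real"
proof (induction k arbitrary: f)
  case (Suc k)
  have lin: "linear (\<lambda>y. f (i \<odot> y))" for i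
    using linear_compose[OF linear_mul Suc.prems] by (simp add: o_def)
  have mul_repr: "f (x \<odot> y) = (\<Sum>i\<in>Basis. (x \<bullet> i) * f (i \<odot> y))" for x y
  proof -
    have "f (x \<odot> y) = f ((\<Sum>i\<in>Basis. (x \<bullet> i) *\<^sub>R i) \<odot> y)" by (simp add: euclidean_representation)
    then show ?thesis by (simp add: mul_sum_left mul_scale linear_sum[OF Suc.prems] linear_cmul[OF Suc.prems])
  qed
  have "real_polynomial_function (\<lambda>x. \<Sum>i\<in>Basis. (x \<bullet> i) * f (i \<odot> pow x k))"
    by (intro real_polynomial_function_sum real_polynomial_function.intros(4) real_polynomial_function.intros(1)
        Suc.IH lin bounded_linear_inner_left) simp
  moreover have "(\<lambda>x. f (x \<odot> pow x k)) = (\<lambda>x. \<Sum>i\<in>Basis. (x \<bullet> i) * f (i \<odot> pow x k))"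
    by (rule ext) (rule mul_repr)
  ultimately show ?case unfolding pow_Suc by (rule ssubst[where P = real_polynomial_function, rotated])
qed (simp add: real_polynomial_function.intros(2))

lemma real_polynomial_function_jdet: "real_polynomial_function jdet"
proof -
  have "linear (\<lambda>x. tau x / tau1)"
    using tau_linear by (simp add: linear_iff add_divide_distrib)
  then show ?thesis unfolding jdet_def[abs_def]
    by (intro real_polynomial_function_elementary real_polynomial_function_pow)
qed

lemma jdet_regular:
  assumes "degree (minimal_poly mul e x) = rk" shows "jdet x = (-1) ^ rk * coeff (minimal_poly mul e x) 0"
proof -
  obtain C l where C: "frame C" "x = (\<Sum>c\<in>C. l c *\<^sub>R c)" using spectral by blast
  have "card (l ` C) = card C" using assms degree_minimal_poly[OF C] card_frame[OF C(1)] by simp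
  then have inj: "inj_on l C" by (rule eq_card_imp_inj_on[OF finite_frame[OF C(1)]])
  have "coeff (minimal_poly mul e x) 0 = (\<Prod>c\<in>C. - l c)"
    unfolding minimal_poly_frame[OF C] by (simp add: poly_0_coeff_0[symmetric] poly_prod prod.reindex[OF inj])
  also have "\<dots> = (-1) ^ rk * (\<Prod>c\<in>C. l c)"
    using prod.distrib[of "\<lambda>_. -1" l C] card_frame[OF C(1)] by simp
  finally show ?thesis unfolding jdet_frame[OF C] by (simp add: power_add[symmetric] mult.assoc[symmetric] power_mult_distrib[symmetric])
qed

lemma jordan_det_eq: "jordan_det mul e = jdet"
  unfolding jordan_det_def jordan_rank_eq
proof (rule the_equality)
  show "real_polynomial_function jdet \<and>
    (\<forall>x. degree (minimal_poly mul e x) = rk \<longrightarrow> jdet x = (- 1) ^ rk * coeff (minimal_poly mul e x) 0)"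
    using real_polynomial_function_jdet jdet_regular by blast
next
  fix D assume D: "real_polynomial_function D \<and>
    (\<forall>x. degree (minimal_poly mul e x) = rk \<longrightarrow> D x = (- 1) ^ rk * coeff (minimal_poly mul e x) 0)"
  show "D = jdet"
  proof
    fix x
    obtain C l where C: "frame C" "x = (\<Sum>c\<in>C. l c *\<^sub>R c)" using spectral by blast
    obtain k :: "real^'n \<Rightarrow> real" where k: "inj_on k C" using ex_inj_real finite_frame[OF C(1)] by blast
    \<comment> \<open>\<open>k\<close> is injective on the frame, so the perturbed coefficients are
      distinct, and \<open>y \<epsilon>\<close> is regular, for all but finitely many
      \<epsilon>.\<close>
    define y where "y \<epsilon> = (\<Sum>c\<in>C. (l c + \<epsilon> * k c) *\<^sub>R c)" for \<epsilon>
    define S where "S = (\<lambda>(c, d). (l d - l c) / (k c - k d)) ` (C \<times> C)"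
    have eq: "D (y \<epsilon>) = jdet (y \<epsilon>)" if "\<epsilon> \<notin> S" for \<epsilon>
    proof -
      have "inj_on (\<lambda>c. l c + \<epsilon> * k c) C"
      proof (rule inj_onI, rule ccontr)
        fix c d assume cd: "c \<in> C" "d \<in> C" "l c + \<epsilon> * k c = l d + \<epsilon> * k d" "c \<noteq> d"
        then have "k c \<noteq> k d" using k by (meson inj_onD)
        then have "\<epsilon> = (l d - l c) / (k c - k d)" using cd(3) by (simp add: field_simps)
        then show False using that cd by (auto simp: S_def)
      qed
      then have "degree (minimal_poly mul e (y \<epsilon>)) = rk"
        using degree_minimal_poly[OF C(1) y_def] card_frame[OF C(1)] by (simp add: card_image)
      then show ?thesis using D jdet_regular by simp
    qed
    have fin: "finite S" using finite_frame[OF C(1)] by (simp add: S_def)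
    \<comment> \<open>Pairs with c = d contribute 0 to \<open>S\<close> through division by zero;
      only \<open>S - {0}\<close> is removed, because the filter \<open>at 0\<close> ignores the
      point 0 itself.\<close>
    have ev: "\<forall>\<^sub>F \<epsilon> in at 0. D (y \<epsilon>) = jdet (y \<epsilon>)"
      unfolding eventually_at_topological using eq fin
      by (intro exI[of _ "- (S - {0})"] conjI open_Compl finite_imp_closed) auto
    have cont: "isCont D z" "isCont jdet z" for z
      using D real_polynomial_function_jdet continuous_real_polymonial_function by blast+
    have ylim: "(y \<longlongrightarrow> y 0) (at 0)" unfolding y_def by (intro tendsto_intros)
    have "((\<lambda>\<epsilon>. D (y \<epsilon>)) \<longlongrightarrow> D (y 0)) (at 0)" "((\<lambda>\<epsilon>. jdet (y \<epsilon>)) \<longlongrightarrow> jdet (y 0)) (at 0)"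
      using isCont_tendsto_compose[OF cont(1) ylim] isCont_tendsto_compose[OF cont(2) ylim] by auto
    then have "D (y 0) = jdet (y 0)"
      using tendsto_unique[OF _ _ Lim_transform_eventually[OF _ ev]] by (metis at_neq_bot)
    then show "D x = jdet x" by (simp add: y_def C(2))
  qed
qed

lemma jdet_pos: assumes "x \<in> pos_cone" shows "jdet x > 0"
proof -
  obtain C l where C: "frame C" "x = (\<Sum>c\<in>C. l c *\<^sub>R c)" "\<And>c. c \<in> C \<Longrightarrow> l c > 0"
    using pos_cone_frame[OF assms] by blast
  show ?thesis unfolding jdet_frame[OF C(1,2)] using C(3) by (rule prod_pos)
qed

lemma jdet_scale: "jdet (a *\<^sub>R x) = a ^ rk * jdet x"
proof -
  obtain C l where C: "frame C" "x = (\<Sum>c\<in>C. l c *\<^sub>R c)" using spectral by blast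
  have "a *\<^sub>R x = (\<Sum>c\<in>C. (a * l c) *\<^sub>R c)" by (simp add: C(2) scaleR_sum_right)
  then show ?thesis using jdet_frame[OF C] jdet_frame[OF C(1), of "a *\<^sub>R x" "\<lambda>c. a * l c"]
    by (simp add: prod.distrib card_frame[OF C(1)])
qed

text \<open>A measuring rod: an automorphism of the cone maps order intervals to order intervals and
  scales their volume by the modulus of its determinant.\<close>

definition order_interval :: "real^'n \<Rightarrow> (real^'n) set" where
  "order_interval x = {y \<in> pos_cone. x - y \<in> pos_cone}"

lemma bounded_order_interval: "bounded (order_interval x)"
proof -
  obtain k where k: "k > 0" "\<And>x. B x x \<ge> k * (norm x)\<^sup>2" using ex_B_lower by blast
  obtain N where N: "N > 0" "\<And>x y. norm (B x y) \<le> N * norm x * norm y"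
    using bilinear_bounded_pos[OF bilinB] by auto
  have "norm y \<le> N * norm x / k" if y: "y \<in> order_interval x" for y
  proof (cases "y = 0")
    case False
    have "0 \<le> B y (x - y)" using y by (auto simp: order_interval_def intro!: squares_B_nonneg pos_cone_squares)
    then have "k * (norm y)\<^sup>2 \<le> B y x" using k(2)[of y] by (simp add: B_lin)
    also have "\<dots> \<le> N * norm y * norm x" using N(2)[of y x] by simp
    finally have "norm y * (k * norm y) \<le> norm y * (N * norm x)" by (simp add: power2_eq_square mult_ac)
    then have "k * norm y \<le> N * norm x" using False by simp
    then show ?thesis using k by (simp add: field_simps)
  qed (use k N in simp)
  then show ?thesis by (meson boundedI)
qed

lemma open_order_interval: "open (order_interval x)"
proof -
  have "order_interval x = pos_cone \<inter> (\<lambda>y. x - y) -` pos_cone" by (auto simp: order_interval_def)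
  then show ?thesis
    by (auto intro!: open_Int open_pos_cone open_vimage continuous_intros)
qed

lemma emeasure_order_interval_finite: "emeasure lborel (order_interval x) < \<infinity>"
  using emeasure_bounded_finite[OF bounded_order_interval] by (simp add: less_top)

lemma order_interval_pos: "measure lborel (order_interval e) > 0"
proof -
  have "(1/2) *\<^sub>R e \<in> order_interval e"
  proof -
    have "(1/2) *\<^sub>R e + (1/2) *\<^sub>R e = e" by (simp add: scaleR_left_distrib[symmetric])
    then have half: "e - (1/2) *\<^sub>R e = (1/2) *\<^sub>R e" by (metis add_diff_cancel)
    show ?thesis unfolding order_interval_def mem_Collect_eq half
      using pos_cone_scale[OF e_pos_cone, of "1/2"] by simp
  qed
  then have "\<not> negligible (order_interval e)" using open_not_negligible[OF open_order_interval] by blast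
  then have "order_interval e \<notin> null_sets lborel" using null_sets_completionI negligible_iff_null_sets by blast
  then have "emeasure lborel (order_interval e) \<noteq> 0" using open_order_interval by (auto simp: null_sets_def)
  then show ?thesis
    using emeasure_order_interval_finite by (simp add: measure_def enn2real_positive_iff zero_less_iff_neq_zero less_top)
qed

lemma measure_order_interval_image:
  assumes "linear G" "inj G" "G ` pos_cone = pos_cone"
  shows "measure lborel (order_interval (G x)) = \<bar>det (matrix G)\<bar> * measure lborel (order_interval x)"
proof -
  have pc: "G y \<in> pos_cone \<longleftrightarrow> y \<in> pos_cone" for y
    using inj_image_mem_iff[OF assms(2), of y pos_cone] assms(3) by simp
  have "order_interval (G x) = G ` order_interval x"
  proof (intro set_eqI iffI)
    fix y assume y: "y \<in> order_interval (G x)"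
    then obtain w where "y = G w" "w \<in> pos_cone" using assms(3) by (auto simp: order_interval_def)
    then show "y \<in> G ` order_interval x"
      using y pc[of "x - w"] by (auto simp: order_interval_def linear_diff[OF assms(1)])
  next
    fix y assume "y \<in> G ` order_interval x"
    then obtain w where w: "y = G w" "w \<in> order_interval x" by blast
    then show "y \<in> order_interval (G x)"
      using pc[of w] pc[of "x - w"] by (simp add: order_interval_def linear_diff[OF assms(1)])
  qed
  then show ?thesis using measure_lborel_linear_image[OF assms(1,2)] open_order_interval by simp
qed

text \<open>All idempotents of the frame have trace \<open>tau1\<close>, so the determinant of the
  group element is the product of the eigenvalues to that power.\<close>

lemma ex_group_elt_to:
  assumes "y \<in> pos_cone"
  shows "\<exists>G. linear G \<and> inj G \<and> (\<forall>x z. B (G x) z = B x (G z)) \<and> G ` pos_cone = pos_cone \<and> G e = y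
     \<and> det (matrix G) = jdet y powr tau1"
proof -
  obtain C l where C: "frame C" "y = (\<Sum>c\<in>C. l c *\<^sub>R c)" "\<And>c. c \<in> C \<Longrightarrow> l c > 0"
    using pos_cone_frame[OF assms] by blast
  have os: "orth_system C" "\<Sum>C = e" using C(1) by (auto simp: frame_def)
  obtain G where G: "group_elt C l G" using ex_group_elt[OF os(1), of l] C(3) by blast
  have "G e = y" using G C(2) os(2)
    by (simp add: group_elt_def scaleR_left_diff_distrib sum_subtractf)
  moreover have "det (matrix G) = jdet y powr tau1"
  proof -
    have "det (matrix G) = (\<Prod>c\<in>C. l c powr tau1)"
      using G os(1) unfolding group_elt_def orth_system_def by (auto simp: tau_primitive intro!: prod.cong)
    also have "\<dots> = jdet y powr tau1"
      unfolding jdet_frame[OF C(1,2)] using finite_frame[OF C(1)] C(3)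
      by (induction C rule: finite_induct) (auto simp: powr_mult prod_nonneg less_imp_le)
    finally show ?thesis .
  qed
  moreover have "inj G" using group_elt_inj[OF G os(1)] C(3) by blast
  moreover have "linear G" "\<forall>x z. B (G x) z = B x (G z)" "G ` pos_cone = pos_cone"
    using G unfolding group_elt_def by simp_all
  ultimately show ?thesis by (intro exI[of _ G]) simp
qed

lemma measure_order_interval:
  assumes "x \<in> pos_cone"
  shows "measure lborel (order_interval x) = jdet x powr tau1 * measure lborel (order_interval e)"
  using ex_group_elt_to[OF assms] measure_order_interval_image by force

text \<open>The volume of \<open>order_interval (G x)\<close> is computed in two ways, as an image
  under \<open>G\<close> and by transitivity; this gives the identity for the powers with exponent
  \<open>tau1\<close>.\<close>

lemma jdet_group:
  assumes G: "linear G" "inj G" "G ` pos_cone = pos_cone" "det (matrix G) = jdet y powr tau1" and y: "y \<in> pos_cone"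
    and x: "x \<in> pos_cone"
  shows "jdet (G x) = jdet y * jdet x"
proof -
  have Gx: "G x \<in> pos_cone" using G x by blast
  have "jdet (G x) powr tau1 * measure lborel (order_interval e)
      = jdet y powr tau1 * (jdet x powr tau1 * measure lborel (order_interval e))"
    using measure_order_interval_image[OF G(1-3), of x] measure_order_interval[OF x] measure_order_interval[OF Gx]
    by (simp add: G(4))
  then have "jdet (G x) powr tau1 = (jdet y * jdet x) powr tau1"
    using order_interval_pos jdet_pos[OF x] jdet_pos[OF y] by (simp add: powr_mult)
  then have "(jdet (G x) powr tau1) powr (1 / tau1) = ((jdet y * jdet x) powr tau1) powr (1 / tau1)" by simp
  then show ?thesis using tau1_pos jdet_pos[OF x] jdet_pos[OF y] jdet_pos[OF Gx] by (simp add: powr_powr)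
qed

end

section \<open>Holomorphic functions on tubes\<close>

definition Re_vec :: "complex^'n \<Rightarrow> real^'n" where "Re_vec z = (\<chi> i. Re (z $ i))"

lemma Im_complex_vec [simp]: "Im_vec (complex_vec x y) = y"
  and Re_complex_vec [simp]: "Re_vec (complex_vec x y) = x"
  and complex_vec_Re_Im [simp]: "complex_vec (Re_vec z) (Im_vec z) = z"
  by (simp_all add: Im_vec_def Re_vec_def complex_vec_def vec_eq_iff)

lemma complex_vec_tube [simp]: "complex_vec x y \<in> tube \<Omega> \<longleftrightarrow> y \<in> \<Omega>"
  by (simp add: tube_def)

lemma complex_vec_add: "complex_vec x y + complex_vec x' y' = complex_vec (x + x') (y + y')"
  by (simp add: complex_vec_def vec_eq_iff complex_eq_iff)

lemma complex_vec_smult: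
  "c *s complex_vec a b = complex_vec (Re c *\<^sub>R a - Im c *\<^sub>R b) (Im c *\<^sub>R a + Re c *\<^sub>R b)"
  by (simp add: complex_vec_def vec_eq_iff complex_eq_iff)

lemma Re_vec_smult: "Re_vec (c *s z) = Re c *\<^sub>R Re_vec z - Im c *\<^sub>R Im_vec z"
  and Im_vec_smult: "Im_vec (c *s z) = Im c *\<^sub>R Re_vec z + Re c *\<^sub>R Im_vec z"
  by (simp_all add: Re_vec_def Im_vec_def vec_eq_iff)

lemma linear_Re_vec: "linear Re_vec" and linear_Im_vec: "linear Im_vec"
  by (auto simp: linear_iff Re_vec_def Im_vec_def vec_eq_iff)

lemma linear_complex_vec: "linear (\<lambda>(x, y). complex_vec x y)"
  by (auto simp: linear_iff complex_vec_def vec_eq_iff complex_eq_iff)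

lemma continuous_on_complex_vec: "continuous_on S (\<lambda>(x, y). complex_vec x y)"
  by (rule linear_continuous_on) (use linear_complex_vec in \<open>simp add: linear_conv_bounded_linear\<close>)

lemma continuous_Im_vec: "continuous_on S Im_vec"
  by (rule linear_continuous_on) (use linear_Im_vec in \<open>simp add: linear_conv_bounded_linear\<close>)

lemma open_tube: "open \<Omega> \<Longrightarrow> open (tube \<Omega>)"
  unfolding tube_def using open_vimage[OF _ continuous_Im_vec, of \<Omega>] by (simp add: vimage_def)

lemma holomorphicD:
  assumes "F \<in> holomorphic_functions D" "z \<in> D"
  shows "\<exists>f'. (F has_derivative f') (at z) \<and> (\<forall>c v. f' (c *s v) = c * f' v)"
  using assms by (simp add: holomorphic_functions_def)

lemma holomorphic_zero: "F \<in> holomorphic_functions D \<Longrightarrow> z \<notin> D \<Longrightarrow> F z = 0"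
  by (simp add: holomorphic_functions_def)

lemma holomorphic_continuous: "F \<in> holomorphic_functions D \<Longrightarrow> continuous_on D F"
  by (meson continuous_at_imp_continuous_on has_derivative_continuous holomorphicD)

lemma holomorphic_mult:
  assumes F: "F \<in> holomorphic_functions D" and G: "G \<in> holomorphic_functions D"
  shows "(\<lambda>z. F z * G z) \<in> holomorphic_functions D"
  unfolding holomorphic_functions_def
proof (intro CollectI conjI ballI allI impI)
  fix z assume z: "z \<in> D"
  obtain f' where f': "(F has_derivative f') (at z)" "\<And>c v. f' (c *s v) = c * f' v"
    using holomorphicD[OF F z] by blast
  obtain g' where g': "(G has_derivative g') (at z)" "\<And>c v. g' (c *s v) = c * g' v"
    using holomorphicD[OF G z] by blast
  show "\<exists>h. ((\<lambda>z. F z * G z) has_derivative h) (at z) \<and> (\<forall>c v. h (c *s v) = c * h v)"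
    using has_derivative_mult[OF f'(1) g'(1)]
    by (intro exI[of _ "\<lambda>h. F z * g' h + f' h * G z"]) (auto simp: f'(2) g'(2) algebra_simps)
qed (use holomorphic_zero[OF F] in auto)

lemma holomorphic_power:
  assumes "F \<in> holomorphic_functions D" "m \<ge> 1" shows "(\<lambda>z. F z ^ m) \<in> holomorphic_functions D"
  using assms(2)
proof (induction m rule: dec_induct)
  case (step m)
  then show ?case using holomorphic_mult[OF assms(1) step(3)] by simp
qed (use assms in simp)

lemma holomorphic_line:
  fixes F :: "complex^'n \<Rightarrow> complex"
  assumes F: "F \<in> holomorphic_functions D"
  shows "(\<lambda>\<zeta>. F (w + \<zeta> *s v)) holomorphic_on {\<zeta>. w + \<zeta> *s v \<in> D}"
  unfolding holomorphic_on_def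
proof
  fix \<zeta> assume "\<zeta> \<in> {\<zeta>. w + \<zeta> *s v \<in> D}"
  then obtain f' where f': "(F has_derivative f') (at (w + \<zeta> *s v))" "\<And>c v. f' (c *s v) = c * f' v"
    using holomorphicD[OF F] by blast
  have "((\<lambda>\<zeta>. w + \<zeta> *s v) has_derivative (\<lambda>h. h *s v)) (at \<zeta>)"
  proof -
    have "linear (\<lambda>h. h *s v)" by (auto simp: linear_iff vec_eq_iff algebra_simps)
    then have "((\<lambda>h. h *s v) has_derivative (\<lambda>h. h *s v)) (at \<zeta>)"
      by (intro bounded_linear_imp_has_derivative) (simp add: linear_conv_bounded_linear)
    from has_derivative_add[OF has_derivative_const[of w] this] show ?thesis by simp
  qed
  from has_derivative_compose[OF this f'(1)]
  have "((\<lambda>\<zeta>. F (w + \<zeta> *s v)) has_derivative (\<lambda>h. h * f' v)) (at \<zeta>)" by (simp add: f'(2))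
  then have "((\<lambda>\<zeta>. F (w + \<zeta> *s v)) has_field_derivative f' v) (at \<zeta>)"
    by (simp add: has_field_derivative_def mult_commute_abs)
  then show "(\<lambda>\<zeta>. F (w + \<zeta> *s v)) field_differentiable at \<zeta> within {\<zeta>. w + \<zeta> *s v \<in> D}"
    using field_differentiable_def field_differentiable_at_within by blast
qed

definition tube_map :: "real^'n \<Rightarrow> (real^'n \<Rightarrow> real^'n) \<Rightarrow> complex^'n \<Rightarrow> complex^'n" where
  "tube_map a g z = complex_vec (a + g (Re_vec z)) (g (Im_vec z))"

lemma holomorphic_tube_map:
  assumes F: "F \<in> holomorphic_functions (tube \<Omega>)" and g: "linear g" "inj g" "g ` \<Omega> = \<Omega>"
  shows "(\<lambda>z. F (tube_map a g z)) \<in> holomorphic_functions (tube \<Omega>)"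
proof -
  have tube: "tube_map a g z \<in> tube \<Omega> \<longleftrightarrow> z \<in> tube \<Omega>" for z
    using inj_image_mem_iff[OF g(2), of "Im_vec z" \<Omega>] g(3) by (simp add: tube_map_def tube_def)
  let ?L = "\<lambda>z. complex_vec (g (Re_vec z)) (g (Im_vec z))"
  have lin: "linear ?L"
  proof -
    have "linear (\<lambda>z. (g (Re_vec z), g (Im_vec z)))"
      using linear_compose[OF linear_Re_vec g(1)] linear_compose[OF linear_Im_vec g(1)]
      by (auto simp: linear_iff o_def)
    from linear_compose[OF this linear_complex_vec] show ?thesis by (simp add: o_def)
  qed
  have cl: "?L (c *s v) = c *s ?L v" for c v
    by (simp add: complex_vec_smult Re_vec_smult Im_vec_smult linear_diff[OF g(1)] linear_add[OF g(1)]
        linear_cmul[OF g(1)])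
  have eq: "tube_map a g z = complex_vec a 0 + ?L z" for z
    by (simp add: tube_map_def complex_vec_add)
  have dL: "(tube_map a g has_derivative ?L) (at z)" for z
  proof -
    have "(?L has_derivative ?L) (at z)"
      using lin by (intro bounded_linear_imp_has_derivative) (simp add: linear_conv_bounded_linear)
    from has_derivative_add[OF has_derivative_const[of "complex_vec a 0"] this] show ?thesis
      unfolding eq[abs_def] by simp
  qed
  show ?thesis unfolding holomorphic_functions_def
  proof (intro CollectI conjI ballI allI impI)
    fix z assume "z \<in> tube \<Omega>"
    then obtain f' where f': "(F has_derivative f') (at (tube_map a g z))" "\<And>c v. f' (c *s v) = c * f' v"
      using holomorphicD[OF F] tube by blast
    from has_derivative_compose[OF dL f'(1)]
    show "\<exists>h. ((\<lambda>z. F (tube_map a g z)) has_derivative h) (at z) \<and> (\<forall>c v. h (c *s v) = c * h v)"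
      by (intro exI[of _ "\<lambda>h. f' (?L h)"]) (auto simp: cl f'(2))
  next
    fix z assume "z \<notin> tube \<Omega>"
    then show "F (tube_map a g z) = 0" using tube holomorphic_zero[OF F] by blast
  qed
qed

text \<open>Continuity is available on the tube only; the value 0 outside gives measurability on the
  whole space.\<close>

lemma holomorphic_measurable:
  fixes \<Omega> :: "(real^'n) set"
  assumes F: "F \<in> holomorphic_functions (tube \<Omega>)" and O: "open \<Omega>"
  shows "(\<lambda>(x, y). F (complex_vec x y)) \<in> borel_measurable (borel \<Otimes>\<^sub>M borel)"
proof -
  let ?S = "{p :: (real^'n) \<times> (real^'n). snd p \<in> \<Omega>}"
  have S: "open ?S"
    using open_vimage[OF O, of snd] by (simp add: vimage_def continuous_on_snd)
  have "continuous_on ?S (\<lambda>(x, y). F (complex_vec x y))"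
    using continuous_on_compose[of ?S "\<lambda>(x, y). complex_vec x y" F] continuous_on_complex_vec
      continuous_on_subset[OF holomorphic_continuous[OF F]]
    by (auto simp: o_def case_prod_unfold image_subset_iff)
  then have "(\<lambda>p. indicator ?S p *\<^sub>R (case p of (x, y) \<Rightarrow> F (complex_vec x y))) \<in> borel_measurable borel"
    using S by (intro borel_measurable_continuous_on_indicator) auto
  moreover have "(\<lambda>p. indicator ?S p *\<^sub>R (case p of (x, y) \<Rightarrow> F (complex_vec x y)))
      = (\<lambda>(x, y). F (complex_vec x y))"
    using holomorphic_zero[OF F] by (auto simp: indicator_def fun_eq_iff)
  ultimately show ?thesis by (simp add: borel_prod)
qed

section \<open>Rotation invariance and the sub-mean value property\<close>

lemma nn_integral_lborel_translate:
  fixes c :: "'a::euclidean_space" and h :: "'a \<Rightarrow> ennreal"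
  assumes [measurable]: "h \<in> borel_measurable borel"
  shows "(\<integral>\<^sup>+x. h (c + x) \<partial>lborel) = (\<integral>\<^sup>+x. h x \<partial>lborel)"
  by (subst (2) lborel_distr_plus[symmetric, of c]) (simp add: nn_integral_distr)

lemma nn_integral_lborel_pair_shear:
  fixes h :: "'a::euclidean_space \<times> 'a \<Rightarrow> ennreal"
  assumes [measurable]: "h \<in> borel_measurable (borel \<Otimes>\<^sub>M borel)"
  shows "(\<integral>\<^sup>+p. h (fst p + t *\<^sub>R snd p, snd p) \<partial>(lborel \<Otimes>\<^sub>M lborel)) = (\<integral>\<^sup>+p. h p \<partial>(lborel \<Otimes>\<^sub>M lborel))"
    and "(\<integral>\<^sup>+p. h (fst p, snd p + t *\<^sub>R fst p) \<partial>(lborel \<Otimes>\<^sub>M lborel)) = (\<integral>\<^sup>+p. h p \<partial>(lborel \<Otimes>\<^sub>M lborel))"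
proof -
  have "(\<integral>\<^sup>+p. h (fst p + t *\<^sub>R snd p, snd p) \<partial>(lborel \<Otimes>\<^sub>M lborel))
      = (\<integral>\<^sup>+y. \<integral>\<^sup>+x. h (t *\<^sub>R y + x, y) \<partial>lborel \<partial>lborel)"
    by (subst lborel_pair.nn_integral_snd[symmetric]) (auto simp: add.commute)
  also have "\<dots> = (\<integral>\<^sup>+y. \<integral>\<^sup>+x. h (x, y) \<partial>lborel \<partial>lborel)"
    by (intro nn_integral_cong nn_integral_lborel_translate) measurable
  also have "\<dots> = (\<integral>\<^sup>+p. h p \<partial>(lborel \<Otimes>\<^sub>M lborel))"
    by (subst lborel_pair.nn_integral_snd[symmetric]) auto
  finally show "(\<integral>\<^sup>+p. h (fst p + t *\<^sub>R snd p, snd p) \<partial>(lborel \<Otimes>\<^sub>M lborel)) = (\<integral>\<^sup>+p. h p \<partial>(lborel \<Otimes>\<^sub>M lborel))" .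
  have "(\<integral>\<^sup>+p. h (fst p, snd p + t *\<^sub>R fst p) \<partial>(lborel \<Otimes>\<^sub>M lborel))
      = (\<integral>\<^sup>+x. \<integral>\<^sup>+y. h (x, t *\<^sub>R x + y) \<partial>lborel \<partial>lborel)"
    by (subst lborel.nn_integral_fst[symmetric]) (auto simp: add.commute)
  also have "\<dots> = (\<integral>\<^sup>+x. \<integral>\<^sup>+y. h (x, y) \<partial>lborel \<partial>lborel)"
    by (intro nn_integral_cong nn_integral_lborel_translate) measurable
  also have "\<dots> = (\<integral>\<^sup>+p. h p \<partial>(lborel \<Otimes>\<^sub>M lborel))"
    by (subst lborel.nn_integral_fst[symmetric]) auto
  finally show "(\<integral>\<^sup>+p. h (fst p, snd p + t *\<^sub>R fst p) \<partial>(lborel \<Otimes>\<^sub>M lborel)) = (\<integral>\<^sup>+p. h p \<partial>(lborel \<Otimes>\<^sub>M lborel))" .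
qed

text \<open>Multiplication by \<open>c\<close> when the pair (x, y) is read as x + i y.\<close>

definition rot :: "complex \<Rightarrow> 'a::euclidean_space \<times> 'a \<Rightarrow> 'a \<times> 'a" where
  "rot c p = (Re c *\<^sub>R fst p - Im c *\<^sub>R snd p, Im c *\<^sub>R fst p + Re c *\<^sub>R snd p)"

text \<open>A rotation is a product of three shears.\<close>

lemma nn_integral_rot:
  fixes h :: "'a::euclidean_space \<times> 'a \<Rightarrow> ennreal"
  assumes [measurable]: "h \<in> borel_measurable (borel \<Otimes>\<^sub>M borel)" and c: "norm c = 1" "c \<noteq> - 1"
  shows "(\<integral>\<^sup>+p. h (rot c p) \<partial>(lborel \<Otimes>\<^sub>M lborel)) = (\<integral>\<^sup>+p. h p \<partial>(lborel \<Otimes>\<^sub>M lborel))"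
proof -
  have n: "(Re c)\<^sup>2 + (Im c)\<^sup>2 = 1" using c(1) by (metis cmod_power2 power_one)
  have ne: "1 + Re c \<noteq> 0"
  proof
    assume "1 + Re c = 0"
    then have "Re c = -1" by simp
    moreover have "Im c = 0" using n \<open>Re c = -1\<close> by simp
    ultimately show False using c(2) by (simp add: complex_eq_iff)
  qed
  \<comment> \<open>The tangent of half the angle of rotation; the shears have the parameters -T, Im
    c and -T. The angle pi, where the tangent is undefined, is excluded.\<close>
  define T where "T = Im c / (1 + Re c)"
  have "(1 + Re c) * (T * Im c) = Im c * Im c" using ne by (simp add: T_def)
  also have "\<dots> = (1 + Re c) * (1 - Re c)" using n by (simp add: power2_eq_square algebra_simps)
  finally have "(1 + Re c) * (T * Im c) = (1 + Re c) * (1 - Re c)" .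
  then have T1: "T * Im c = 1 - Re c" using ne by (simp only: mult_cancel_left) simp
  have T2: "T * (1 + Re c) = Im c" using ne by (simp add: T_def)
  define k where "k p = h (fst p + (- T) *\<^sub>R snd p, snd p)" for p
  define l where "l p = k (fst p, snd p + Im c *\<^sub>R fst p)" for p
  have [measurable]: "k \<in> borel_measurable (borel \<Otimes>\<^sub>M borel)" "l \<in> borel_measurable (borel \<Otimes>\<^sub>M borel)"
    unfolding k_def[abs_def] l_def[abs_def] by measurable
  have "rot c p = ((fst p + (- T) *\<^sub>R snd p) + (- T) *\<^sub>R (snd p + Im c *\<^sub>R (fst p + (- T) *\<^sub>R snd p)),
      snd p + Im c *\<^sub>R (fst p + (- T) *\<^sub>R snd p))" for p :: "'a \<times> 'a"
  proof -
    have "(fst p + (- T) *\<^sub>R snd p) + (- T) *\<^sub>R (snd p + Im c *\<^sub>R (fst p + (- T) *\<^sub>R snd p))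
        = (1 - T * Im c) *\<^sub>R fst p + (T * (T * Im c) - (T + T)) *\<^sub>R snd p"
      by (simp only: scaleR_left_distrib scaleR_left_diff_distrib scaleR_right_distrib scaleR_scaleR)
        (simp add: algebra_simps)
    also have "T * (T * Im c) - (T + T) = - Im c" unfolding T1 using T2 by (simp add: algebra_simps)
    finally have 1: "(fst p + (- T) *\<^sub>R snd p) + (- T) *\<^sub>R (snd p + Im c *\<^sub>R (fst p + (- T) *\<^sub>R snd p))
        = Re c *\<^sub>R fst p - Im c *\<^sub>R snd p" unfolding T1 by simp
    have "snd p + Im c *\<^sub>R (fst p + (- T) *\<^sub>R snd p) = Im c *\<^sub>R fst p + (1 - T * Im c) *\<^sub>R snd p"
      by (simp add: algebra_simps)
    then show ?thesis unfolding 1 rot_def T1 by simp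
  qed
  then have "h (rot c p) = l (fst p + (- T) *\<^sub>R snd p, snd p)" for p
    by (simp add: l_def k_def)
  then have "(\<integral>\<^sup>+p. h (rot c p) \<partial>(lborel \<Otimes>\<^sub>M lborel)) = (\<integral>\<^sup>+p. l p \<partial>(lborel \<Otimes>\<^sub>M lborel))"
    using nn_integral_lborel_pair_shear(1)[of l "- T"] \<open>l \<in> _\<close> by (simp only:)
  also have "\<dots> = (\<integral>\<^sup>+p. k p \<partial>(lborel \<Otimes>\<^sub>M lborel))"
    unfolding l_def by (rule nn_integral_lborel_pair_shear(2)) measurable
  also have "\<dots> = (\<integral>\<^sup>+p. h p \<partial>(lborel \<Otimes>\<^sub>M lborel))"
    unfolding k_def by (rule nn_integral_lborel_pair_shear(1)) measurable
  finally show ?thesis .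
qed

lemma norm_rot: assumes "norm c = 1" shows "norm (rot c p) = norm p"
proof -
  have n: "Re c * Re c + Im c * Im c = 1" using assms by (metis cmod_power2 power_one power2_eq_square)
  have "rot c p \<bullet> rot c p = (Re c * Re c + Im c * Im c) * (fst p \<bullet> fst p + snd p \<bullet> snd p)"
    unfolding rot_def inner_Pair inner_add_left inner_diff_left inner_add_right inner_diff_right
      inner_scaleR_left inner_scaleR_right by (simp add: algebra_simps inner_commute)
  then have "rot c p \<bullet> rot c p = p \<bullet> p" unfolding n by (simp add: inner_prod_def)
  then show ?thesis by (simp add: norm_eq_sqrt_inner)
qed

lemma norm_smult_Im_le:
  fixes a b :: "'a::euclidean_space"
  shows "norm (Im c *\<^sub>R a + Re c *\<^sub>R b) \<le> norm c * norm (a, b)"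
proof (cases "c = 0")
  case False
  have "norm (Im c *\<^sub>R a + Re c *\<^sub>R b) \<le> norm (rot c (a, b))" by (simp add: rot_def norm_Pair)
  also have "rot c (a, b) = norm c *\<^sub>R rot (c / norm c) (a, b)"
    using False by (simp add: rot_def algebra_simps)
  also have "norm \<dots> = norm c * norm (a, b)" using False by (simp add: norm_rot norm_divide)
  finally show ?thesis .
qed simp

lemma circle_mean_value:
  assumes h: "h holomorphic_on S" and S: "open S" "cball 0 1 \<subseteq> S"
  shows "ennreal (norm (h 0)) \<le> (\<integral>\<^sup>+t. ennreal (norm (h (cis (2 * pi * t)))) * indicator {0..1} t \<partial>lborel)"
proof -
  have cont: "continuous_on {0..1} (\<lambda>t. h (cis (2 * pi * t)))"
    using S by (intro continuous_on_compose2[OF holomorphic_on_imp_continuous_on[OF h]] continuous_intros) auto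
  have hc: "continuous_on (cball 0 1) h" "h holomorphic_on ball 0 1"
    using S h holomorphic_on_imp_continuous_on holomorphic_on_subset continuous_on_subset
    by (blast, meson ball_subset_cball dual_order.trans holomorphic_on_subset)
  have "((\<lambda>u. h u / (u - 0)) has_contour_integral (2 * of_real pi * \<i> * h 0)) (circlepath 0 1)"
    by (rule Cauchy_integral_circlepath) (use hc in auto)
  then have "((\<lambda>t. h (circlepath 0 1 t) / circlepath 0 1 t *
      vector_derivative (circlepath 0 1) (at t within {0..1})) has_integral (2 * of_real pi * \<i> * h 0)) {0..1}"
    by (simp add: has_contour_integral_def)
  then have "((\<lambda>t. (2 * of_real pi * \<i>) * h (cis (2 * pi * t))) has_integral (2 * of_real pi * \<i> * h 0)) {0..1}"
    by (rule has_integral_eq[rotated])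
      (simp add: vector_derivative_circlepath01, simp add: circlepath cis_conv_exp mult_ac)
  then have I: "((\<lambda>t. h (cis (2 * pi * t))) has_integral h 0) {0..1}"
    by (subst (asm) has_integral_mult_right_iff) auto
  have "norm (h 0) \<le> integral {0..1} (\<lambda>t. norm (h (cis (2 * pi * t))))"
    using I integral_norm_bound_integral[of "\<lambda>t. h (cis (2 * pi * t))" "{0..1}" "\<lambda>t. norm (h (cis (2 * pi * t)))"]
      integrable_continuous_real[OF continuous_on_norm[OF cont]] by (auto simp: integral_unique integrable_on_def)
  also have "ennreal \<dots> = (\<integral>\<^sup>+t. ennreal (norm (h (cis (2 * pi * t))) * indicator {0..1} t) \<partial>lborel)"
  proof (rule nn_integral_has_integral_lborel[symmetric])
    have "(\<lambda>t. indicator {0..1} t *\<^sub>R norm (h (cis (2 * pi * t)))) \<in> borel_measurable borel"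
      by (intro borel_measurable_continuous_on_indicator continuous_on_norm cont) auto
    then show "(\<lambda>t. norm (h (cis (2 * pi * t))) * indicator {0..1} t) \<in> borel_measurable borel"
      by (simp add: mult.commute)
    have "((\<lambda>t. norm (h (cis (2 * pi * t)))) has_integral integral {0..1} (\<lambda>t. norm (h (cis (2 * pi * t))))) {0..1}"
      by (intro integrable_integral integrable_continuous_real continuous_on_norm cont)
    then show "((\<lambda>t. norm (h (cis (2 * pi * t))) * indicator {0..1} t) has_integral
        integral {0..1} (\<lambda>t. norm (h (cis (2 * pi * t))))) UNIV"
    proof -
      have eq: "(\<lambda>t. norm (h (cis (2 * pi * t))) * indicator {0..1} t)
          = (\<lambda>t. if t \<in> {0..1} then norm (h (cis (2 * pi * t))) else 0)" by (auto simp: indicator_def)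
      show "((\<lambda>t. norm (h (cis (2 * pi * t)))) has_integral integral {0..1} (\<lambda>t. norm (h (cis (2 * pi * t))))) {0..1}
        \<Longrightarrow> ?thesis" unfolding eq has_integral_restrict_UNIV .
    qed
  qed auto
  finally show ?thesis by (simp add: ennreal_mult' ennreal_indicator ennreal_leI)
qed

text \<open>The graph of the convex function t^q lies above its tangent at \<open>a\<close>; in
  \<open>submean\<close> this takes the place of Jensen's inequality.\<close>

lemma powr_ge_tangent:
  fixes a t q :: real
  assumes "a > 0" "t \<ge> 0" "q \<ge> 1" shows "q * a powr (q - 1) * t \<le> t powr q + (q - 1) * a powr q"
proof (cases "t = 0 \<or> q = 1")
  case False
  then have t: "t > 0" "q > 1" using assms by auto
  have c: "convex_on {0<..} (\<lambda>x. x powr q)" using assms by (intro powr_convex)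
  have "((\<lambda>x. x powr q) has_real_derivative q * a powr (q - 1)) (at a within {0<..})"
    using has_real_derivative_powr[OF assms(1)] by (rule has_field_derivative_at_within)
  then have "t powr q - a powr q \<ge> q * a powr (q - 1) * (t - a)"
    using assms t by (intro convex_on_imp_above_tangent[OF c]) (auto simp: interior_open)
  moreover have "a * (q * a powr (q - 1)) = q * a powr q" using assms(1) by (simp add: powr_diff)
  ultimately show ?thesis by (simp add: algebra_simps)
qed (use assms in \<open>auto simp: powr_one\<close>)

lemma continuous_on_rot: "continuous_on S (\<lambda>x. rot (f x) (g x))"
  if "continuous_on S f" "continuous_on S g" for f :: "'b::topological_space \<Rightarrow> complex" and g :: "'b \<Rightarrow> 'a::euclidean_space \<times> 'a"
  unfolding rot_def by (intro continuous_intros that)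

context
  fixes \<Omega> :: "(real^'n) set" and F :: "complex^'n \<Rightarrow> complex" and x0 y0 :: "real^'n" and \<rho> :: real
  assumes F: "F \<in> holomorphic_functions (tube \<Omega>)" and O: "open \<Omega>" and ball: "ball y0 \<rho> \<subseteq> \<Omega>"
begin

lemma translated_measurable:
  "(\<lambda>p. F (complex_vec (x0 + fst p) (y0 + snd p))) \<in> borel_measurable borel"
proof -
  have "(\<lambda>p. (x0 + fst p, y0 + snd p)) \<in> borel_measurable (borel :: ((real^'n) \<times> (real^'n)) measure)"
    by (intro borel_measurable_continuous_onI continuous_intros)
  from measurable_compose[OF this holomorphic_measurable[OF F O, unfolded borel_prod]] show ?thesis by simp
qed

text \<open>\<open>F\<close> is restricted to the complex line through the base point in the
  direction \<open>p\<close>. A factor of modulus at most 1 does not push the imaginary part beyond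
  the norm of \<open>p\<close>, so the closed unit disc stays in the tube.\<close>

lemma circle_bound:
  assumes "norm p < \<rho>"
  shows "ennreal (norm (F (complex_vec x0 y0)))
    \<le> (\<integral>\<^sup>+t. ennreal (norm (F (complex_vec (x0 + fst (rot (cis (2 * pi * t)) p)) (y0 + snd (rot (cis (2 * pi * t)) p)))))
         * indicator {0..1} t \<partial>lborel)"
proof -
  let ?w = "complex_vec x0 y0" and ?v = "complex_vec (fst p) (snd p)"
  let ?S = "{\<zeta>. ?w + \<zeta> *s ?v \<in> tube \<Omega>}"
  have pt: "?w + \<zeta> *s ?v = complex_vec (x0 + fst (rot \<zeta> p)) (y0 + snd (rot \<zeta> p))" for \<zeta>
    by (simp add: complex_vec_smult complex_vec_add rot_def)
  have S: "?S = (\<lambda>\<zeta>. y0 + snd (rot \<zeta> p)) -` \<Omega>" by (auto simp: pt)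
  have "open ?S" unfolding S using O by (intro open_vimage continuous_intros continuous_on_rot)
  moreover have "cball 0 1 \<subseteq> ?S"
  proof
    fix \<zeta> :: complex assume z: "\<zeta> \<in> cball 0 1"
    have "norm (snd (rot \<zeta> p)) \<le> norm \<zeta> * norm p"
      using norm_smult_Im_le[of \<zeta> "fst p" "snd p"] by (simp add: rot_def)
    also have "\<dots> \<le> 1 * norm p" using z by (intro mult_right_mono) auto
    finally have "y0 + snd (rot \<zeta> p) \<in> ball y0 \<rho>" using assms by (simp add: dist_norm)
    then show "\<zeta> \<in> ?S" using ball by (auto simp: pt)
  qed
  ultimately have "ennreal (norm (F (?w + 0 *s ?v))) \<le> (\<integral>\<^sup>+t. ennreal (norm (F (?w + cis (2 * pi * t) *s ?v))) * indicator {0..1} t \<partial>lborel)"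
    by (intro circle_mean_value[OF holomorphic_line[OF F]])
  moreover have "rot 0 p = (0, 0)" by (simp add: rot_def)
  ultimately show ?thesis unfolding pt by simp
qed

text \<open>The circle bound is integrated over all \<open>p\<close> in the ball; after the
  integrals are exchanged, each rotation leaves the inner integral unchanged.\<close>

lemma submean_1:
  "ennreal (norm (F (complex_vec x0 y0))) * emeasure lborel {p :: (real^'n) \<times> (real^'n). norm p < \<rho>}
    \<le> (\<integral>\<^sup>+p. ennreal (norm (F (complex_vec (x0 + fst p) (y0 + snd p)))) * indicator {p. norm p < \<rho>} p \<partial>lborel)"
proof -
  define K where "K p = ennreal (norm (F (complex_vec (x0 + fst p) (y0 + snd p)))) * indicator {p. norm p < \<rho>} p" for p
  have R: "{p :: (real^'n) \<times> (real^'n). norm p < \<rho>} \<in> sets borel"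
    by (intro borel_open open_Collect_less continuous_intros)
  have K[measurable]: "K \<in> borel_measurable borel"
    unfolding K_def[abs_def] using translated_measurable R by measurable
  let ?c = "\<lambda>t. cis (2 * pi * t)"
  have Krot: "K (rot (?c t) p) = ennreal (norm (F (complex_vec (x0 + fst (rot (?c t) p)) (y0 + snd (rot (?c t) p))))) * indicator {p. norm p < \<rho>} p" for t p
    by (simp add: K_def norm_rot indicator_def)
  have meas: "(\<lambda>x. K (rot (?c (snd x)) (fst x)) * indicator {0..1} (snd x)) \<in> borel_measurable (lborel \<Otimes>\<^sub>M lborel)"
  proof -
    have "(\<lambda>x. rot (?c (snd x)) (fst x)) \<in> borel_measurable (borel :: (((real^'n) \<times> (real^'n)) \<times> real) measure)"
      by (intro borel_measurable_continuous_onI continuous_on_rot continuous_intros)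
    then have [measurable]: "(\<lambda>x. rot (?c (snd x)) (fst x)) \<in> borel_measurable (lborel \<Otimes>\<^sub>M lborel :: (((real^'n) \<times> (real^'n)) \<times> real) measure)"
      by (simp add: lborel_prod)
    show ?thesis by measurable
  qed
  have "ennreal (norm (F (complex_vec x0 y0))) * emeasure lborel {p :: (real^'n) \<times> (real^'n). norm p < \<rho>}
     = (\<integral>\<^sup>+p. ennreal (norm (F (complex_vec x0 y0))) * indicator {p :: (real^'n) \<times> (real^'n). norm p < \<rho>} p \<partial>lborel)"
    using R by (simp add: nn_integral_cmult_indicator)
  also have "\<dots> \<le> (\<integral>\<^sup>+p. (\<integral>\<^sup>+t. K (rot (?c t) p) * indicator {0..1} t \<partial>lborel) \<partial>lborel)"
  proof (rule nn_integral_mono)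
    fix p :: "(real^'n) \<times> (real^'n)"
    show "ennreal (norm (F (complex_vec x0 y0))) * indicator {p. norm p < \<rho>} p
        \<le> (\<integral>\<^sup>+t. K (rot (?c t) p) * indicator {0..1} t \<partial>lborel)"
      unfolding Krot using circle_bound[of p] by (cases "norm p < \<rho>") auto
  qed
  also have "\<dots> = (\<integral>\<^sup>+t. (\<integral>\<^sup>+p. K (rot (?c t) p) * indicator {0..1} t \<partial>lborel) \<partial>lborel)"
    using lborel_pair.Fubini'[of "\<lambda>p t. K (rot (?c t) p) * indicator {0..1} t"] meas
    by (simp add: case_prod_unfold)
  also have "\<dots> = (\<integral>\<^sup>+t. (\<integral>\<^sup>+p. K p \<partial>lborel) * indicator {0..1::real} t \<partial>lborel)"
  proof (rule nn_integral_cong_AE)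
    \<comment> \<open>\<open>t = 1/2\<close> gives the rotation by -1, which
      \<open>nn_integral_rot\<close> leaves out.\<close>
    have "AE t in lborel. t \<noteq> (1/2 :: real)" by (rule AE_lborel_singleton)
    then show "AE t in lborel. (\<integral>\<^sup>+p. K (rot (?c t) p) * indicator {0..1} t \<partial>lborel) = (\<integral>\<^sup>+p. K p \<partial>lborel) * indicator {0..1::real} t"
    proof eventually_elim
      case (elim t)
      show ?case
      proof (cases "t \<in> {0..1}")
        case True
        have "?c t \<noteq> -1"
        proof
          assume "?c t = -1"
          then have "cos (2 * pi * t) = -1" by (simp add: complex_eq_iff)
          then have "cos (pi - 2 * pi * t) = 1" by (simp add: cos_diff)
          then obtain k :: int where "pi - 2 * pi * t = of_int k * 2 * pi" using cos_one_2pi_int by blast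
          then have "pi * (1 - 2 * t) = pi * (2 * of_int k)" by (simp add: algebra_simps)
          then have "1 - 2 * t = 2 * of_int k" by (simp only: mult_cancel_left) simp
          then have "2 * real_of_int k \<ge> -1" "2 * real_of_int k \<le> 1" using True by auto
          then have "k = 0" by linarith
          then show False using \<open>1 - 2 * t = 2 * of_int k\<close> elim by simp
        qed
        then have "(\<integral>\<^sup>+p. K (rot (?c t) p) \<partial>lborel) = (\<integral>\<^sup>+p. K p \<partial>lborel)"
          using nn_integral_rot[of K "?c t"] K by (simp add: lborel_prod borel_prod)
        then show ?thesis using True by simp
      qed simp
    qed
  qed
  also have "\<dots> = (\<integral>\<^sup>+p. K p \<partial>lborel)" by (simp add: nn_integral_cmult_indicator)
  finally show ?thesis unfolding K_def .
qed

text \<open>The bound for exponent 1 is multiplied by q a^(q-1), where a is the modulus at the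
  centre, and the tangent inequality at a bounds the integrand.\<close>

lemma submean:
  assumes q: "q \<ge> 1"
  shows "ennreal (norm (F (complex_vec x0 y0)) powr q) * emeasure lborel {p :: (real^'n) \<times> (real^'n). norm p < \<rho>}
    \<le> (\<integral>\<^sup>+p. ennreal (norm (F (complex_vec (x0 + fst p) (y0 + snd p))) powr q) * indicator {p. norm p < \<rho>} p \<partial>lborel)"
proof (cases "F (complex_vec x0 y0) = 0")
  case False
  define a where "a = norm (F (complex_vec x0 y0))"
  have a: "a > 0" using False by (simp add: a_def)
  let ?R = "{p :: (real^'n) \<times> (real^'n). norm p < \<rho>}"
  define f where "f p = norm (F (complex_vec (x0 + fst p) (y0 + snd p)))" for p
  have R[measurable]: "?R \<in> sets borel"
    by (intro borel_open open_Collect_less continuous_intros)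
  have f[measurable]: "f \<in> borel_measurable borel" unfolding f_def using translated_measurable by measurable
  have fin: "emeasure lborel ?R < \<infinity>"
  proof -
    have "?R = ball 0 \<rho>" by auto
    then show ?thesis using emeasure_bounded_finite[of ?R] bounded_ball by simp
  qed
  have "ennreal (q * a powr (q - 1)) * (ennreal a * emeasure lborel ?R)
      \<le> ennreal (q * a powr (q - 1)) * (\<integral>\<^sup>+p. ennreal (f p) * indicator ?R p \<partial>lborel)"
    using submean_1 unfolding a_def f_def by (intro mult_left_mono) auto
  also have "\<dots> = (\<integral>\<^sup>+p. ennreal (q * a powr (q - 1)) * (ennreal (f p) * indicator ?R p) \<partial>lborel)"
    by (rule nn_integral_cmult[symmetric]) measurable
  also have "\<dots> \<le> (\<integral>\<^sup>+p. ennreal (f p powr q) * indicator ?R p + ennreal ((q - 1) * a powr q) * indicator ?R p \<partial>lborel)"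
  proof (rule nn_integral_mono)
    fix p
    have "q * a powr (q - 1) * f p \<le> f p powr q + (q - 1) * a powr q"
      by (rule powr_ge_tangent) (use a q in \<open>auto simp: f_def\<close>)
    then have "ennreal (q * a powr (q - 1) * f p) \<le> ennreal (f p powr q + (q - 1) * a powr q)" by (rule ennreal_leI)
    then show "ennreal (q * a powr (q - 1)) * (ennreal (f p) * indicator ?R p)
        \<le> ennreal (f p powr q) * indicator ?R p + ennreal ((q - 1) * a powr q) * indicator ?R p"
      using q a by (auto simp: indicator_def ennreal_mult'[symmetric] ennreal_plus[symmetric] f_def simp del: ennreal_plus)
  qed
  also have "\<dots> = (\<integral>\<^sup>+p. ennreal (f p powr q) * indicator ?R p \<partial>lborel) + ennreal ((q - 1) * a powr q) * emeasure lborel ?R"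
    by (subst nn_integral_add) (auto simp: nn_integral_cmult_indicator)
  also have "ennreal (q * a powr (q - 1)) * (ennreal a * emeasure lborel ?R)
      = ennreal (a powr q) * emeasure lborel ?R + ennreal ((q - 1) * a powr q) * emeasure lborel ?R"
  proof -
    have "q * a powr (q - 1) * a = a powr q + (q - 1) * a powr q" using a by (simp add: powr_diff algebra_simps)
    then have "ennreal (q * a powr (q - 1)) * ennreal a = ennreal (a powr q) + ennreal ((q - 1) * a powr q)"
      using a q by (simp add: ennreal_mult'[symmetric] ennreal_plus[symmetric] del: ennreal_plus)
    then show ?thesis by (simp add: mult.assoc[symmetric] distrib_right)
  qed
  \<comment> \<open>The surplus (q - 1) a^q times the volume of the ball occurs on both sides and is
    finite, so it cancels.\<close>
  finally have "ennreal (a powr q) * emeasure lborel ?R \<le> (\<integral>\<^sup>+p. ennreal (f p powr q) * indicator ?R p \<partial>lborel)"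
    using fin by (subst (asm) (1 2) add.commute, subst (asm) ennreal_add_left_cancel_le)
      (auto simp: ennreal_mult_eq_top_iff less_top)
  then show ?thesis by (simp add: a_def f_def)
qed simp

end

text \<open>What the analysis uses of the Jordan algebra: \<open>s\<close> stands for n / r,
  \<open>r\<close> is the degree of homogeneity of \<Delta>, and the automorphisms are self-adjoint,
  transitive on the cone and of known determinant.\<close>

locale symmetric_cone =
  fixes \<Omega> :: "(real^'n) set" and B :: "real^'n \<Rightarrow> real^'n \<Rightarrow> real" and \<Delta> :: "real^'n \<Rightarrow> real"
    and s :: real and r :: nat and e :: "real^'n"
  assumes inner: "inner_product B" and opn: "open \<Omega>" and cvx: "convex \<Omega>"
    and cone: "x \<in> \<Omega> \<Longrightarrow> c > 0 \<Longrightarrow> c *\<^sub>R x \<in> \<Omega>" and e_in: "e \<in> \<Omega>"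
    and dual: "\<Omega> = {y. \<forall>x \<in> closure \<Omega> - {0}. B x y > 0}"
    and r_pos: "r > 0" and det_pos: "y \<in> \<Omega> \<Longrightarrow> \<Delta> y > 0" and det_e: "\<Delta> e = 1"
    and det_cont: "continuous_on UNIV \<Delta>" and det_scale: "\<Delta> (c *\<^sub>R y) = c ^ r * \<Delta> y"
    and transitive: "y \<in> \<Omega> \<Longrightarrow> \<exists>G. linear G \<and> inj G \<and> (\<forall>x z. B (G x) z = B x (G z)) \<and> G ` \<Omega> = \<Omega> \<and> G e = y
        \<and> det (matrix G) = \<Delta> y powr s \<and> (\<forall>x\<in>\<Omega>. \<Delta> (G x) = \<Delta> y * \<Delta> x)"
begin

definition moves :: "(real^'n \<Rightarrow> real^'n) \<Rightarrow> real^'n \<Rightarrow> bool" where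
  "moves G y \<longleftrightarrow> linear G \<and> inj G \<and> (\<forall>x z. B (G x) z = B x (G z)) \<and> G ` \<Omega> = \<Omega> \<and> G e = y
     \<and> det (matrix G) = \<Delta> y powr s \<and> (\<forall>x\<in>\<Omega>. \<Delta> (G x) = \<Delta> y * \<Delta> x)"

lemma ex_moves: "y \<in> \<Omega> \<Longrightarrow> \<exists>G. moves G y"
  using transitive unfolding moves_def by blast

lemma moves_in: assumes "moves G y" shows "G x \<in> \<Omega> \<longleftrightarrow> x \<in> \<Omega>"
  using assms inj_image_mem_iff[of G x \<Omega>] by (simp add: moves_def)

lemma nn_integral_moves:
  assumes G: "moves G y" "y \<in> \<Omega>" and h: "h \<in> borel_measurable borel"
  shows "(\<integral>\<^sup>+x. h (G x) \<partial>lborel) = ennreal (\<Delta> y powr (- s)) * (\<integral>\<^sup>+x. h x \<partial>lborel)"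
proof -
  have d: "\<Delta> y > 0" using det_pos G by blast
  have "(\<integral>\<^sup>+x. h x \<partial>lborel) = ennreal (\<Delta> y powr s) * (\<integral>\<^sup>+x. h (G x) \<partial>lborel)"
    using nn_integral_lborel_linear[of G h] G h d by (simp add: moves_def)
  moreover have "ennreal (\<Delta> y powr (- s)) * ennreal (\<Delta> y powr s) = 1"
    using d by (simp add: ennreal_mult'[symmetric] powr_add[symmetric])
  ultimately show ?thesis by (simp add: mult.assoc[symmetric])
qed

text \<open>The substitution acts on the real part alone; on the imaginary part the automorphism
  permutes the heights over which the supremum is taken.\<close>

lemma hardy_sup_moves:
  assumes F: "F \<in> holomorphic_functions (tube \<Omega>)" and G: "moves G y" "y \<in> \<Omega>"
  shows "hardy_sup \<Omega> q (\<lambda>z. F (tube_map a G z)) = ennreal (\<Delta> y powr (- s)) * hardy_sup \<Omega> q F"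
proof -
  let ?h = "\<lambda>x t. ennreal (norm (F (complex_vec x t)) powr q)"
  have m: "(\<lambda>x. ?h x t) \<in> borel_measurable borel" for t
  proof -
    have "(\<lambda>x. (x, t)) \<in> borel \<rightarrow>\<^sub>M (borel \<Otimes>\<^sub>M borel)" by measurable
    from measurable_compose[OF this holomorphic_measurable[OF F opn]] show ?thesis by simp
  qed
  have "(\<integral>\<^sup>+x. ennreal (norm (F (tube_map a G (complex_vec x t))) powr q) \<partial>lborel)
      = ennreal (\<Delta> y powr (- s)) * (\<integral>\<^sup>+x. ?h x (G t) \<partial>lborel)" for t
  proof -
    have "(\<integral>\<^sup>+x. ?h (a + G x) (G t) \<partial>lborel) = ennreal (\<Delta> y powr (- s)) * (\<integral>\<^sup>+x. ?h (a + x) (G t) \<partial>lborel)"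
      by (rule nn_integral_moves[OF G]) (use measurable_compose[OF _ m, of "\<lambda>x. a + x" borel] in auto)
    then show ?thesis using nn_integral_lborel_translate[OF m, of a] by (simp add: tube_map_def)
  qed
  then have "hardy_sup \<Omega> q (\<lambda>z. F (tube_map a G z)) = (SUP t\<in>\<Omega>. ennreal (\<Delta> y powr (- s)) * (\<integral>\<^sup>+x. ?h x (G t) \<partial>lborel))"
    by (simp add: hardy_sup_def)
  also have "\<dots> = ennreal (\<Delta> y powr (- s)) * (SUP t\<in>\<Omega>. \<integral>\<^sup>+x. ?h x (G t) \<partial>lborel)"
    by (rule SUP_mult_left_ennreal[symmetric])
  also have "(SUP t\<in>\<Omega>. \<integral>\<^sup>+x. ?h x (G t) \<partial>lborel) = (SUP t\<in>G ` \<Omega>. \<integral>\<^sup>+x. ?h x t \<partial>lborel)"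
    by (simp add: image_image)
  finally show ?thesis using G by (simp add: hardy_sup_def moves_def)
qed

lemma bergman_measurable:
  assumes F: "F \<in> holomorphic_functions (tube \<Omega>)"
  shows "(\<lambda>(x, y). ennreal (norm (F (complex_vec x y)) powr q * \<Delta> y powr k) * indicator \<Omega> y)
    \<in> borel_measurable (borel \<Otimes>\<^sub>M borel)"
proof -
  have [measurable]: "(\<lambda>p. F (complex_vec (fst p) (snd p))) \<in> borel_measurable (borel \<Otimes>\<^sub>M borel)"
    using holomorphic_measurable[OF F opn] by (simp add: case_prod_unfold)
  have [measurable]: "\<Delta> \<in> borel_measurable borel" by (rule borel_measurable_continuous_onI[OF det_cont])
  have [measurable]: "\<Omega> \<in> sets borel" using opn by simp
  show ?thesis unfolding case_prod_unfold by measurable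
qed

text \<open>Exponent count: the substitutions in the real and in the imaginary part contribute -s
  each, the weight contributes -(\<nu> - s).\<close>

lemma bergman_moves:
  assumes F: "F \<in> holomorphic_functions (tube \<Omega>)" and G: "moves G y" "y \<in> \<Omega>"
  shows "bergman_integral \<Omega> \<Delta> s q \<nu> (\<lambda>z. F (tube_map a G z))
     = ennreal (\<Delta> y powr (- (\<nu> + s))) * bergman_integral \<Omega> \<Delta> s q \<nu> F"
proof -
  have d: "\<Delta> y > 0" using det_pos G by blast
  let ?k = "\<lambda>x t. ennreal (norm (F (complex_vec x t)) powr q * \<Delta> t powr (\<nu> - s)) * indicator \<Omega> t"
  note [measurable] = bergman_measurable[OF F, of q "\<nu> - s"]
  have "F' \<in> holomorphic_functions (tube \<Omega>)" if "F' = (\<lambda>z. F (tube_map a G z))" for F'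
    unfolding that by (rule holomorphic_tube_map[OF F]) (use G in \<open>auto simp: moves_def\<close>)
  note [measurable] = bergman_measurable[OF this[OF refl], of q "\<nu> - s"]
  have kx: "(\<lambda>x. ?k x t) \<in> borel_measurable borel" for t
    using measurable_compose[OF _ bergman_measurable[OF F, of q "\<nu> - s"], of "\<lambda>x. (x, t)" borel] by simp
  have kt: "(\<lambda>t. \<integral>\<^sup>+x. ?k x t \<partial>lborel) \<in> borel_measurable borel"
    using lborel.borel_measurable_nn_integral_fst[of "\<lambda>(t, x). ?k x t" borel] measurable_pair_swap[OF bergman_measurable[OF F, of q "\<nu> - s"]]
    by (simp add: case_prod_unfold)
  have "bergman_integral \<Omega> \<Delta> s q \<nu> (\<lambda>z. F (tube_map a G z))
      = (\<integral>\<^sup>+t. (\<integral>\<^sup>+x. ennreal (norm (F (tube_map a G (complex_vec x t))) powr q * \<Delta> t powr (\<nu> - s)) * indicator \<Omega> t \<partial>lborel) \<partial>lborel)"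
    unfolding bergman_integral_def by (subst lborel_pair.nn_integral_snd[symmetric]) (auto simp: case_prod_unfold)
  also have "\<dots> = (\<integral>\<^sup>+t. ennreal (\<Delta> y powr (- s - (\<nu> - s))) * (\<integral>\<^sup>+x. ?k x (G t) \<partial>lborel) \<partial>lborel)"
  proof (rule nn_integral_cong)
    fix t
    have "(\<integral>\<^sup>+x. ennreal (norm (F (tube_map a G (complex_vec x t))) powr q * \<Delta> t powr (\<nu> - s)) * indicator \<Omega> t \<partial>lborel)
        = (\<integral>\<^sup>+x. ennreal (\<Delta> y powr (- (\<nu> - s))) * ?k (a + G x) (G t) \<partial>lborel)"
    proof (rule nn_integral_cong)
      fix x
      have "\<Delta> t powr (\<nu> - s) = \<Delta> y powr (- (\<nu> - s)) * \<Delta> (G t) powr (\<nu> - s)" if "t \<in> \<Omega>"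
      proof -
        have "\<Delta> (G t) = \<Delta> y * \<Delta> t" using G that by (simp add: moves_def)
        moreover have "\<Delta> y powr (- (\<nu> - s)) * \<Delta> y powr (\<nu> - s) = 1"
          using d by (simp only: powr_add[symmetric]) simp
        ultimately show ?thesis using d det_pos[OF that] by (simp add: powr_mult mult.assoc[symmetric])
      qed
      then show "ennreal (norm (F (tube_map a G (complex_vec x t))) powr q * \<Delta> t powr (\<nu> - s)) * indicator \<Omega> t
         = ennreal (\<Delta> y powr (- (\<nu> - s))) * ?k (a + G x) (G t)"
        using moves_in[OF G(1), of t]
        by (auto simp: indicator_def tube_map_def ennreal_mult'[symmetric] mult_ac)
    qed
    also have "\<dots> = ennreal (\<Delta> y powr (- (\<nu> - s))) * (\<integral>\<^sup>+x. ?k (a + G x) (G t) \<partial>lborel)"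
    proof (rule nn_integral_cmult)
      have "G \<in> borel_measurable borel" using G by (simp add: moves_def borel_measurable_linear)
      then have "(\<lambda>x. a + G x) \<in> borel_measurable borel" by measurable
      then show "(\<lambda>x. ?k (a + G x) (G t)) \<in> borel_measurable lborel"
        using measurable_compose[OF _ kx[of "G t"]] by simp
    qed
    also have "(\<integral>\<^sup>+x. ?k (a + G x) (G t) \<partial>lborel) = ennreal (\<Delta> y powr (- s)) * (\<integral>\<^sup>+x. ?k (a + x) (G t) \<partial>lborel)"
      by (rule nn_integral_moves[OF G]) (use measurable_compose[OF _ kx, of "\<lambda>x. a + x" borel] in auto)
    also have "(\<integral>\<^sup>+x. ?k (a + x) (G t) \<partial>lborel) = (\<integral>\<^sup>+x. ?k x (G t) \<partial>lborel)"
      by (rule nn_integral_lborel_translate[OF kx])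
    finally show "(\<integral>\<^sup>+x. ennreal (norm (F (tube_map a G (complex_vec x t))) powr q * \<Delta> t powr (\<nu> - s)) * indicator \<Omega> t \<partial>lborel)
       = ennreal (\<Delta> y powr (- s - (\<nu> - s))) * (\<integral>\<^sup>+x. ?k x (G t) \<partial>lborel)"
      by (simp add: mult.assoc[symmetric] ennreal_mult'[symmetric] powr_add[symmetric])
  qed
  also have "\<dots> = ennreal (\<Delta> y powr (- s - (\<nu> - s))) * (\<integral>\<^sup>+t. (\<integral>\<^sup>+x. ?k x (G t) \<partial>lborel) \<partial>lborel)"
  proof (rule nn_integral_cmult)
    have "G \<in> borel_measurable borel" using G by (simp add: moves_def borel_measurable_linear)
    from measurable_compose[OF this kt]
    show "(\<lambda>t. \<integral>\<^sup>+x. ?k x (G t) \<partial>lborel) \<in> borel_measurable lborel" by simp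
  qed
  also have "(\<integral>\<^sup>+t. (\<integral>\<^sup>+x. ?k x (G t) \<partial>lborel) \<partial>lborel) = ennreal (\<Delta> y powr (- s)) * (\<integral>\<^sup>+t. (\<integral>\<^sup>+x. ?k x t \<partial>lborel) \<partial>lborel)"
    by (rule nn_integral_moves[OF G kt])
  also have "(\<integral>\<^sup>+t. (\<integral>\<^sup>+x. ?k x t \<partial>lborel) \<partial>lborel) = bergman_integral \<Omega> \<Delta> s q \<nu> F"
    unfolding bergman_integral_def by (subst lborel_pair.nn_integral_snd[symmetric]) (auto simp: case_prod_unfold)
  finally show ?thesis by (simp add: mult.assoc[symmetric] ennreal_mult'[symmetric] powr_add[symmetric])
qed

end

section \<open>The Fourier transform\<close>

lemma integral_kernel_swap:
  fixes f g :: "'a::euclidean_space \<Rightarrow> complex" and E :: "'a \<Rightarrow> 'a \<Rightarrow> complex"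
  assumes f: "integrable lborel f" and g: "integrable lborel g"
    and E: "(\<lambda>(x, y). E x y) \<in> borel_measurable (borel \<Otimes>\<^sub>M borel)" "\<And>x y. norm (E x y) \<le> 1"
  shows "(\<integral>x. f x * (\<integral>y. g y * E x y \<partial>lborel) \<partial>lborel) = (\<integral>y. g y * (\<integral>x. f x * E x y \<partial>lborel) \<partial>lborel)"
proof -
  let ?h = "\<lambda>x y. f x * (g y * E x y)"
  have [measurable]: "f \<in> borel_measurable borel" "g \<in> borel_measurable borel"
    using borel_measurable_integrable[OF f] borel_measurable_integrable[OF g] by simp_all
  have Em[measurable]: "(\<lambda>p. E (fst p) (snd p)) \<in> borel_measurable (borel \<Otimes>\<^sub>M borel)"
    using E(1) by (simp add: case_prod_unfold)
  have Ex[measurable]: "(\<lambda>y. E x y) \<in> borel_measurable borel" for x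
    using measurable_compose[OF _ Em, of "\<lambda>y. (x, y)" borel] by simp
  have intE: "integrable lborel (\<lambda>y. g y * E x y)" for x
    by (rule Bochner_Integration.integrable_bound[OF g]) (auto simp: norm_mult intro!: AE_I2 mult_left_le E(2))
  have "integrable (lborel \<Otimes>\<^sub>M lborel) (case_prod ?h)"
  proof (rule lborel_pair.Fubini_integrable)
    show "case_prod ?h \<in> borel_measurable (lborel \<Otimes>\<^sub>M lborel)" unfolding case_prod_unfold by measurable
    have le: "norm (\<integral>y. norm (?h x y) \<partial>lborel) \<le> norm (f x) * (\<integral>y. norm (g y) \<partial>lborel)" for x
    proof -
      have "(\<integral>y. norm (?h x y) \<partial>lborel) = norm (f x) * (\<integral>y. norm (g y * E x y) \<partial>lborel)"
        by (simp add: norm_mult)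
      also have "\<dots> \<le> norm (f x) * (\<integral>y. norm (g y) \<partial>lborel)"
        using E(2) by (intro mult_left_mono integral_mono integrable_norm intE g) (auto simp: norm_mult mult_left_le)
      finally show ?thesis by (simp add: integral_nonneg_AE)
    qed
    have m: "(\<lambda>x. \<integral>y. norm (?h x y) \<partial>lborel) \<in> borel_measurable lborel"
      using lborel.borel_measurable_lebesgue_integral[of "\<lambda>x y. norm (?h x y)" lborel] 
      by (simp add: case_prod_unfold)
    show "integrable lborel (\<lambda>x. \<integral>y. norm (case_prod ?h (x, y)) \<partial>lborel)"
      unfolding prod.case
      by (rule Bochner_Integration.integrable_bound[OF integrable_mult_left[OF integrable_norm[OF f]] m, of "\<integral>y. norm (g y) \<partial>lborel"])
        (use le in \<open>auto intro!: AE_I2 simp: integral_nonneg_AE abs_mult\<close>)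
    show "AE x in lborel. integrable lborel (\<lambda>y. case_prod ?h (x, y))"
      using intE by (auto intro!: AE_I2)
  qed
  from lborel_pair.Fubini_integral[OF this]
  have "(\<integral>y. (\<integral>x. ?h x y \<partial>lborel) \<partial>lborel) = (\<integral>x. (\<integral>y. ?h x y \<partial>lborel) \<partial>lborel)" .
  moreover have "(\<integral>x. ?h x y \<partial>lborel) = g y * (\<integral>x. f x * E x y \<partial>lborel)" for y
    by (subst integral_mult_right_zero[symmetric]) (simp add: mult_ac)
  ultimately show ?thesis by simp
qed

lemma lborel_integral_prod:
  fixes f :: "'a::euclidean_space \<Rightarrow> real \<Rightarrow> complex"
  assumes f: "\<And>b. b \<in> Basis \<Longrightarrow> integrable lborel (f b)"
  shows "integrable lborel (\<lambda>x. \<Prod>b\<in>Basis. f b (x \<bullet> b))"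
    and "(\<integral>x. (\<Prod>b\<in>Basis. f b (x \<bullet> b)) \<partial>lborel) = (\<Prod>b\<in>Basis. \<integral>t. f b t \<partial>lborel)"
proof -
  interpret P: product_sigma_finite "\<lambda>_::'a. lborel :: real measure" ..
  have fm: "f b \<in> borel_measurable borel" if "b \<in> Basis" for b
    using borel_measurable_integrable[OF f[OF that]] by simp
  have m: "(\<lambda>x. \<Prod>b\<in>Basis. f b (x \<bullet> b)) \<in> borel_measurable borel"
  proof (rule borel_measurable_prod)
    fix b :: 'a assume b: "b \<in> Basis"
    show "(\<lambda>x. f b (x \<bullet> b)) \<in> borel_measurable borel"
      by (rule measurable_compose[OF _ fm[OF b]]) simp
  qed
  have T[measurable]: "(\<lambda>w. \<Sum>b\<in>Basis. w b *\<^sub>R b) \<in> Pi\<^sub>M Basis (\<lambda>_. lborel) \<rightarrow>\<^sub>M (borel :: 'a measure)"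
    by measurable
  have w: "(\<Prod>b\<in>Basis. f b ((\<Sum>c\<in>Basis. w c *\<^sub>R c) \<bullet> b)) = (\<Prod>b\<in>Basis. f b (w b))" for w
    by (rule prod.cong) (auto simp: inner_sum_left_Basis)
  have "integrable (Pi\<^sub>M Basis (\<lambda>_. lborel)) (\<lambda>w. \<Prod>b\<in>Basis. f b (w b))"
    using f by (intro P.product_integrable_prod) auto
  then show "integrable lborel (\<lambda>x. \<Prod>b\<in>Basis. f b (x \<bullet> b))"
    by (subst lborel_eq) (simp add: integrable_distr_eq[OF T m] w)
  show "(\<integral>x. (\<Prod>b\<in>Basis. f b (x \<bullet> b)) \<partial>lborel) = (\<Prod>b\<in>Basis. \<integral>t. f b t \<partial>lborel)"
    by (subst lborel_eq) (simp add: integral_distr[OF T m] w P.product_integral_prod f)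
qed

lemma lborel_integral_affine:
  fixes h :: "'a::euclidean_space \<Rightarrow> complex"
  assumes [measurable]: "h \<in> borel_measurable borel" and "c \<noteq> 0"
  shows "(\<integral>x. h x \<partial>lborel) = of_real (\<bar>c\<bar> ^ DIM('a)) * (\<integral>x. h (t + c *\<^sub>R x) \<partial>lborel)"
proof -
  have "(\<integral>x. h x \<partial>lborel) = (\<integral>x. h x \<partial>density (distr lborel borel (\<lambda>x. t + c *\<^sub>R x)) (\<lambda>_. ennreal (\<bar>c\<bar> ^ DIM('a))))"
    using lborel_affine[OF assms(2), of t] by simp
  then show ?thesis by (simp add: integral_density integral_distr scaleR_conv_of_real)
qed

lemma lborel_integrable_affine:
  fixes h :: "'a::euclidean_space \<Rightarrow> complex"
  assumes h: "integrable lborel h" and c: "c \<noteq> 0"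
  shows "integrable lborel (\<lambda>x. h (t + c *\<^sub>R x))"
proof -
  have [measurable]: "h \<in> borel_measurable borel" using borel_measurable_integrable[OF h] by simp
  have "integrable (density (distr lborel borel (\<lambda>x. t + c *\<^sub>R x)) (\<lambda>_. ennreal (\<bar>c\<bar> ^ DIM('a)))) h"
    using h lborel_affine[OF c, of t] by simp
  then have "integrable (distr lborel borel (\<lambda>x. t + c *\<^sub>R x)) (\<lambda>x. (\<bar>c\<bar> ^ DIM('a)) *\<^sub>R h x)"
    by (subst (asm) integrable_density) auto
  then have "integrable lborel (\<lambda>x. (\<bar>c\<bar> ^ DIM('a)) *\<^sub>R h (t + c *\<^sub>R x))"
    by (rule integrable_distr[rotated]) measurable
  then have "integrable lborel (\<lambda>x. (1 / \<bar>c\<bar> ^ DIM('a)) *\<^sub>R ((\<bar>c\<bar> ^ DIM('a)) *\<^sub>R h (t + c *\<^sub>R x)))"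
    by (rule integrable_scaleR_right)
  moreover have "(\<lambda>x. (1 / \<bar>c\<bar> ^ DIM('a)) *\<^sub>R ((\<bar>c\<bar> ^ DIM('a)) *\<^sub>R h (t + c *\<^sub>R x))) = (\<lambda>x. h (t + c *\<^sub>R x))"
    using c by simp
  ultimately show ?thesis by (simp only:)
qed

text \<open>The standard normal density; its value at 0, a power of 2 pi, is carried along without
  being evaluated.\<close>

definition gauss :: "'a::euclidean_space \<Rightarrow> real" where "gauss x = (\<Prod>b\<in>Basis. std_normal_density (x \<bullet> b))"

lemma std_normal_ft:
  "(\<integral>t. complex_of_real (std_normal_density t) * cis (a * t) \<partial>lborel) = of_real (exp (- a\<^sup>2 / 2))"
proof -
  have "char std_normal_distribution a = (\<integral>t. std_normal_density t *\<^sub>R iexp (a * t) \<partial>lborel)"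
    unfolding char_def by (subst integral_density) (auto simp: normal_density_nonneg)
  then show ?thesis by (simp add: char_std_normal_distribution cis_conv_exp scaleR_conv_of_real)
qed

lemma cis_inner: "cis (u \<bullet> x) = (\<Prod>b\<in>Basis. cis ((u \<bullet> b) * (x \<bullet> b)))" for u x :: "'a::euclidean_space"
proof -
  have "cis (\<Sum>b\<in>S. f b) = (\<Prod>b\<in>S. cis (f b))" if "finite S" for S :: "'a set" and f
    using that by induction (auto simp: cis_mult[symmetric])
  then show ?thesis by (subst euclidean_inner) simp
qed

lemma integrable_std_normal_cis: "integrable lborel (\<lambda>t. complex_of_real (std_normal_density t) * cis (a * t))"
proof (rule Bochner_Integration.integrable_bound)
  show "integrable lborel std_normal_density" by (simp add: integrable_normal_density)
  show "(\<lambda>t. complex_of_real (std_normal_density t) * cis (a * t)) \<in> borel_measurable lborel"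
    unfolding cis_conv_exp by measurable
qed (auto simp: norm_mult)

lemma gauss_ft:
  fixes u :: "'a::euclidean_space"
  shows "integrable lborel (\<lambda>x. complex_of_real (gauss x) * cis (u \<bullet> x))"
    and "(\<integral>x. complex_of_real (gauss x) * cis (u \<bullet> x) \<partial>lborel) = of_real (exp (- (u \<bullet> u) / 2))"
proof -
  have eq: "complex_of_real (gauss x) * cis (u \<bullet> x)
      = (\<Prod>b\<in>Basis. complex_of_real (std_normal_density (x \<bullet> b)) * cis ((u \<bullet> b) * (x \<bullet> b)))" for x
    by (simp add: gauss_def cis_inner prod.distrib)
  show "integrable lborel (\<lambda>x. complex_of_real (gauss x) * cis (u \<bullet> x))"
    unfolding eq using lborel_integral_prod(1)[of "\<lambda>b t. complex_of_real (std_normal_density t) * cis ((u \<bullet> b) * t)"]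
      integrable_std_normal_cis by simp
  have "(\<integral>x. complex_of_real (gauss x) * cis (u \<bullet> x) \<partial>lborel) = (\<Prod>b\<in>Basis. of_real (exp (- (u \<bullet> b)\<^sup>2 / 2)))"
    unfolding eq using lborel_integral_prod(2)[of "\<lambda>b t. complex_of_real (std_normal_density t) * cis ((u \<bullet> b) * t)"]
      integrable_std_normal_cis std_normal_ft by simp
  also have "\<dots> = of_real (exp (\<Sum>b\<in>Basis. - (u \<bullet> b)\<^sup>2 / 2))" by (simp add: exp_sum)
  also have "(\<Sum>b\<in>Basis. - (u \<bullet> b)\<^sup>2 / 2) = - (u \<bullet> u) / 2"
    by (subst euclidean_inner) (simp add: sum_negf sum_divide_distrib power2_eq_square)
  finally show "(\<integral>x. complex_of_real (gauss x) * cis (u \<bullet> x) \<partial>lborel) = of_real (exp (- (u \<bullet> u) / 2))" .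
qed

lemma gauss_measurable [measurable]: "(gauss :: 'a::euclidean_space \<Rightarrow> real) \<in> borel_measurable borel"
  unfolding gauss_def[abs_def] by measurable

lemma
  fixes x :: "'a::euclidean_space"
  shows gauss_eq: "gauss x = gauss (0::'a) * exp (- (x \<bullet> x) / 2)" and gauss_pos: "gauss x > 0"
proof -
  have "exp (- (x \<bullet> x) / 2) = (\<Prod>b\<in>Basis. exp (- (x \<bullet> b)\<^sup>2 / 2))"
    by (subst euclidean_inner) (simp add: exp_sum[symmetric] sum_negf sum_divide_distrib power2_eq_square)
  then show "gauss x = gauss (0::'a) * exp (- (x \<bullet> x) / 2)"
    by (simp add: gauss_def std_normal_density_def prod_dividef power_one_over)
  show "gauss x > 0" unfolding gauss_def by (intro prod_pos) (simp add: normal_density_pos)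
qed

lemma integrable_exp_sq: "integrable lborel (\<lambda>x::'a::euclidean_space. exp (- (x \<bullet> x) / 2))"
  and integral_exp_sq: "(\<integral>x. exp (- (x \<bullet> x) / 2) \<partial>(lborel :: 'a measure)) = 1 / gauss (0::'a)"
proof -
  have i: "integrable lborel (\<lambda>x::'a. complex_of_real (gauss x))"
    and s: "(\<integral>x. complex_of_real (gauss x) \<partial>(lborel :: 'a measure)) = 1"
    using gauss_ft[of 0] by simp_all
  have i': "integrable lborel (gauss :: 'a \<Rightarrow> real)" using i by (simp add: complex_of_real_integrable_eq)
  have eq: "exp (- (x \<bullet> x) / 2) = gauss x / gauss (0::'a)" for x :: 'a
    using gauss_eq[of x] gauss_pos[of "0::'a"] by (simp add: field_simps)
  show "integrable lborel (\<lambda>x::'a. exp (- (x \<bullet> x) / 2))" unfolding eq using i' by simp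
  have "complex_of_real (\<integral>x. gauss x \<partial>(lborel :: 'a measure)) = 1" using s by (simp only: integral_complex_of_real)
  then have "(\<integral>x. gauss x \<partial>(lborel :: 'a measure)) = 1" by simp
  then show "(\<integral>x. exp (- (x \<bullet> x) / 2) \<partial>(lborel :: 'a measure)) = 1 / gauss (0::'a)" unfolding eq by simp
qed

definition fourier :: "('a::euclidean_space \<Rightarrow> 'a \<Rightarrow> real) \<Rightarrow> ('a \<Rightarrow> complex) \<Rightarrow> 'a \<Rightarrow> complex" where
  "fourier B f \<xi> = (\<integral>x. f x * cis (- B x \<xi>) \<partial>lborel)"

lemma bilinear_measurable:
  fixes B :: "'a::euclidean_space \<Rightarrow> 'a \<Rightarrow> real"
  assumes "bilinear B" shows "(\<lambda>(x, y). B x y) \<in> borel_measurable (borel \<Otimes>\<^sub>M borel)"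
proof -
  have "continuous_on UNIV (\<lambda>p. B (fst p) (snd p))"
    using assms bilinear_conv_bounded_bilinear by (intro bounded_bilinear.continuous_on[of B] continuous_intros) auto
  then have "(\<lambda>p. B (fst p) (snd p)) \<in> borel_measurable borel" by (rule borel_measurable_continuous_onI)
  then show ?thesis by (simp add: case_prod_unfold borel_prod)
qed

lemma cis_measurable[measurable]: "cis \<in> borel_measurable borel"
  by (intro borel_measurable_continuous_onI continuous_intros)

lemma fourier_bound:
  "norm (fourier B f \<xi>) \<le> (\<integral>x. norm (f x) \<partial>lborel)"
proof -
  have "norm (fourier B f \<xi>) \<le> (\<integral>x. norm (f x * cis (- B x \<xi>)) \<partial>lborel)"
    unfolding fourier_def by (rule integral_norm_bound)
  then show ?thesis by (simp add: norm_mult)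
qed

text \<open>Gaussian summation: the inversion integral is damped by \<open>gauss\<close> at \<xi> /
  (k+1), and Fubini turns it into a Gaussian average of \<open>f\<close> around \<open>x\<close>.
  Dominated convergence on both sides gives gauss(0) times the integral and f(x) / gauss(0).\<close>

lemma fourier_inversion_inner:
  fixes f :: "'a::euclidean_space \<Rightarrow> complex"
  assumes cont: "continuous_on UNIV f" and bdd: "bounded (range f)" and f: "integrable lborel f"
    and ff: "integrable lborel (fourier (\<bullet>) f)"
  shows "(\<integral>\<xi>. fourier (\<bullet>) f \<xi> * cis (x \<bullet> \<xi>) \<partial>lborel) = of_real (1 / (gauss (0::'a))\<^sup>2) * f x"
proof -
  obtain M where M: "\<And>u. norm (f u) \<le> M" using bdd by (auto simp: bounded_iff)
  have [measurable]: "f \<in> borel_measurable borel" by (rule borel_measurable_continuous_onI[OF cont])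
  have [measurable]: "fourier (\<bullet>) f \<in> borel_measurable borel" using borel_measurable_integrable[OF ff] by simp
  let ?c = "\<lambda>k::nat. real (Suc k)"
  define L where "L k = (\<integral>\<xi>. fourier (\<bullet>) f \<xi> * cis (x \<bullet> \<xi>) * of_real (gauss ((1 / ?c k) *\<^sub>R \<xi>)) \<partial>lborel)" for k
  define R where "R k = (\<integral>v. f (x + (- 1 / ?c k) *\<^sub>R v) * of_real (exp (- (v \<bullet> v) / 2)) \<partial>lborel)" for k
  have LR: "L k = R k" for k
  proof -
    let ?k = "?c k"
    define g where "g \<xi> = complex_of_real (gauss ((1 / ?k) *\<^sub>R \<xi>)) * cis (x \<bullet> \<xi>)" for \<xi>
    have scaled: "integrable lborel (\<lambda>\<xi>. complex_of_real (gauss ((1 / ?k) *\<^sub>R \<xi>)) * cis (w \<bullet> \<xi>))" for w :: 'a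
    proof -
      have "(\<lambda>\<xi>. complex_of_real (gauss ((1 / ?k) *\<^sub>R \<xi>)) * cis (w \<bullet> \<xi>))
          = (\<lambda>\<xi>. complex_of_real (gauss (0 + (1 / ?k) *\<^sub>R \<xi>)) * cis ((?k *\<^sub>R w) \<bullet> (0 + (1 / ?k) *\<^sub>R \<xi>)))"
        by (simp del: of_nat_Suc)
      then show ?thesis
        using gauss_ft(1)[of "?k *\<^sub>R w"] lborel_integrable_affine[of "\<lambda>\<xi>. complex_of_real (gauss \<xi>) * cis ((?k *\<^sub>R w) \<bullet> \<xi>)" "1 / ?k" 0]
        by (simp del: of_nat_Suc)
    qed
    have inner: "(\<integral>\<xi>. complex_of_real (gauss ((1 / ?k) *\<^sub>R \<xi>)) * cis (w \<bullet> \<xi>) \<partial>lborel)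
        = of_real (?k ^ DIM('a)) * of_real (exp (- ((?k *\<^sub>R w) \<bullet> (?k *\<^sub>R w)) / 2))" for w :: 'a
    proof -
      have "(\<integral>\<xi>. complex_of_real (gauss ((1 / ?k) *\<^sub>R \<xi>)) * cis (w \<bullet> \<xi>) \<partial>lborel)
         = of_real (\<bar>?k\<bar> ^ DIM('a)) * (\<integral>\<xi>. complex_of_real (gauss ((1 / ?k) *\<^sub>R (0 + ?k *\<^sub>R \<xi>))) * cis (w \<bullet> (0 + ?k *\<^sub>R \<xi>)) \<partial>lborel)"
      proof (rule lborel_integral_affine)
        show "(\<lambda>\<xi>. complex_of_real (gauss ((1 / ?k) *\<^sub>R \<xi>)) * cis (w \<bullet> \<xi>)) \<in> borel_measurable borel"
          by measurable
      qed simp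
      also have "(\<integral>\<xi>. complex_of_real (gauss ((1 / ?k) *\<^sub>R (0 + ?k *\<^sub>R \<xi>))) * cis (w \<bullet> (0 + ?k *\<^sub>R \<xi>)) \<partial>lborel)
         = (\<integral>\<xi>. complex_of_real (gauss \<xi>) * cis ((?k *\<^sub>R w) \<bullet> \<xi>) \<partial>lborel)"
        by (simp del: of_nat_Suc)
      finally show ?thesis unfolding gauss_ft(2) by simp
    qed
    have "L k = (\<integral>\<xi>. g \<xi> * (\<integral>u. f u * cis (- (u \<bullet> \<xi>)) \<partial>lborel) \<partial>lborel)"
      by (simp add: L_def g_def fourier_def mult_ac)
    also have "\<dots> = (\<integral>u. f u * (\<integral>\<xi>. g \<xi> * cis (- (u \<bullet> \<xi>)) \<partial>lborel) \<partial>lborel)"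
    proof (rule integral_kernel_swap[symmetric, OF f])
      show "integrable lborel g" unfolding g_def using scaled .
      have "(\<lambda>p. cis (- (fst p \<bullet> snd p))) \<in> borel_measurable (borel :: ('a \<times> 'a) measure)"
        by (intro borel_measurable_continuous_onI continuous_intros)
      then show "(\<lambda>(u, \<xi>). cis (- (u \<bullet> \<xi>))) \<in> borel_measurable (borel \<Otimes>\<^sub>M borel :: ('a \<times> 'a) measure)"
        by (simp add: borel_prod case_prod_unfold)
    qed simp
    also have "\<dots> = (\<integral>u. f u * (of_real (?k ^ DIM('a)) * of_real (exp (- ((?k *\<^sub>R (x - u)) \<bullet> (?k *\<^sub>R (x - u))) / 2))) \<partial>lborel)"
    proof (rule Bochner_Integration.integral_cong[OF refl])
      fix u
      have "(\<integral>\<xi>. g \<xi> * cis (- (u \<bullet> \<xi>)) \<partial>lborel) = (\<integral>\<xi>. complex_of_real (gauss ((1 / ?k) *\<^sub>R \<xi>)) * cis ((x - u) \<bullet> \<xi>) \<partial>lborel)"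
        by (simp add: g_def cis_mult inner_diff_left mult.assoc)
      then show "f u * (\<integral>\<xi>. g \<xi> * cis (- (u \<bullet> \<xi>)) \<partial>lborel) =
          f u * (of_real (?k ^ DIM('a)) * of_real (exp (- ((?k *\<^sub>R (x - u)) \<bullet> (?k *\<^sub>R (x - u))) / 2)))"
        by (simp only: inner)
    qed
    \<comment> \<open>Substitution u = x - v / (k+1), after which the width of the Gaussian no
      longer depends on k.\<close>
    also have "\<dots> = of_real (\<bar>- 1 / ?k\<bar> ^ DIM('a)) * (\<integral>v. f (x + (- 1 / ?k) *\<^sub>R v) * (of_real (?k ^ DIM('a)) *
        of_real (exp (- ((?k *\<^sub>R (x - (x + (- 1 / ?k) *\<^sub>R v))) \<bullet> (?k *\<^sub>R (x - (x + (- 1 / ?k) *\<^sub>R v)))) / 2))) \<partial>lborel)"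
    proof (rule lborel_integral_affine)
      show "(\<lambda>u. f u * (of_real (?k ^ DIM('a)) * of_real (exp (- ((?k *\<^sub>R (x - u)) \<bullet> (?k *\<^sub>R (x - u))) / 2)))) \<in> borel_measurable borel"
        using cont by (intro borel_measurable_continuous_onI continuous_intros) auto
    qed simp
    also have "\<dots> = of_real (\<bar>- 1 / ?k\<bar> ^ DIM('a)) * (\<integral>v. of_real (?k ^ DIM('a)) * (f (x + (- 1 / ?k) *\<^sub>R v) *
        of_real (exp (- (v \<bullet> v) / 2))) \<partial>lborel)"
      by (simp del: of_nat_Suc add: mult_ac)
    also have "\<dots> = of_real (\<bar>- 1 / ?k\<bar> ^ DIM('a)) * (of_real (?k ^ DIM('a)) * R k)"
      by (simp only: integral_mult_right_zero R_def)
    also have "\<dots> = R k"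
      by (simp add: mult.assoc[symmetric] of_real_mult[symmetric] power_mult_distrib[symmetric] del: of_real_mult of_nat_Suc)
    finally show ?thesis .
  qed
  have kinv: "(\<lambda>k. 1 / ?c k) \<longlonglongrightarrow> 0" using LIMSEQ_inverse_real_of_nat by (simp add: inverse_eq_divide)
  have gc: "continuous_on UNIV (gauss :: 'a \<Rightarrow> real)"
  proof (rule continuous_on_eq)
    show "continuous_on UNIV (\<lambda>x::'a. gauss (0::'a) * exp (- (x \<bullet> x) / 2))" by (intro continuous_intros) auto
  qed (rule gauss_eq[symmetric])
  have g0: "gauss v \<le> gauss (0::'a)" for v :: 'a
  proof -
    have "gauss (0::'a) * exp (- (v \<bullet> v) / 2) \<le> gauss (0::'a) * 1"
      using gauss_pos[of "0::'a"] by (intro mult_left_mono) auto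
    then show ?thesis using gauss_eq[of v] by simp
  qed
  have "L \<longlonglongrightarrow> (\<integral>\<xi>. fourier (\<bullet>) f \<xi> * cis (x \<bullet> \<xi>) * of_real (gauss (0::'a)) \<partial>lborel)"
    unfolding L_def
  proof (rule integral_dominated_convergence[where w = "\<lambda>\<xi>. norm (fourier (\<bullet>) f \<xi>) * gauss (0::'a)"])
    show "integrable lborel (\<lambda>\<xi>. norm (fourier (\<bullet>) f \<xi>) * gauss (0::'a))" using ff by simp
    show "AE \<xi> in lborel. (\<lambda>k. fourier (\<bullet>) f \<xi> * cis (x \<bullet> \<xi>) * of_real (gauss ((1 / ?c k) *\<^sub>R \<xi>)))
        \<longlonglongrightarrow> fourier (\<bullet>) f \<xi> * cis (x \<bullet> \<xi>) * of_real (gauss (0::'a))"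
    proof (intro AE_I2 tendsto_mult tendsto_const tendsto_of_real)
      fix \<xi> :: 'a
      have "(\<lambda>k. (1 / ?c k) *\<^sub>R \<xi>) \<longlonglongrightarrow> 0 *\<^sub>R \<xi>" by (intro tendsto_scaleR kinv tendsto_const)
      from continuous_on_tendsto_compose[OF gc this]
      show "(\<lambda>k. gauss ((1 / ?c k) *\<^sub>R \<xi>)) \<longlonglongrightarrow> gauss (0::'a)" by simp
    qed
    show "AE \<xi> in lborel. norm (fourier (\<bullet>) f \<xi> * cis (x \<bullet> \<xi>) * of_real (gauss ((1 / ?c k) *\<^sub>R \<xi>)))
        \<le> norm (fourier (\<bullet>) f \<xi>) * gauss (0::'a)" for k
    proof (rule AE_I2)
      fix \<xi> :: 'a
      have "\<bar>gauss ((1 / ?c k) *\<^sub>R \<xi>)\<bar> \<le> gauss (0::'a)"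
        using g0[of "(1 / ?c k) *\<^sub>R \<xi>"] gauss_pos[of "(1 / ?c k) *\<^sub>R \<xi>"] by linarith
      then show "norm (fourier (\<bullet>) f \<xi> * cis (x \<bullet> \<xi>) * of_real (gauss ((1 / ?c k) *\<^sub>R \<xi>)))
        \<le> norm (fourier (\<bullet>) f \<xi>) * gauss (0::'a)"
        by (simp only: norm_mult norm_cis norm_of_real mult_1_right mult_left_mono norm_ge_zero)
    qed
  qed measurable
  moreover have "(\<lambda>k. L k) \<longlonglongrightarrow> (\<integral>v. f x * of_real (exp (- (v \<bullet> v) / 2)) \<partial>(lborel :: 'a measure))"
    unfolding LR R_def
  proof (rule integral_dominated_convergence[where w = "\<lambda>v::'a. M * exp (- (v \<bullet> v) / 2)"])
    show "integrable lborel (\<lambda>v::'a. M * exp (- (v \<bullet> v) / 2))" 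
      by (intro integrable_mult_right integrable_exp_sq)
    show "AE v in lborel. (\<lambda>k. f (x + (- 1 / ?c k) *\<^sub>R v) * of_real (exp (- (v \<bullet> v) / 2)))
        \<longlonglongrightarrow> f x * of_real (exp (- (v \<bullet> v) / 2))"
    proof (intro AE_I2 tendsto_mult tendsto_const)
      fix v :: 'a
      have "(\<lambda>k. x + (- (1 / ?c k)) *\<^sub>R v) \<longlonglongrightarrow> x + (- 0) *\<^sub>R v" by (intro tendsto_intros kinv)
      from continuous_on_tendsto_compose[OF cont this]
      show "(\<lambda>k. f (x + (- 1 / ?c k) *\<^sub>R v)) \<longlonglongrightarrow> f x" by simp
    qed
    show "AE v in lborel. norm (f (x + (- 1 / ?c k) *\<^sub>R v) * of_real (exp (- (v \<bullet> v) / 2))) \<le> M * exp (- (v \<bullet> v) / 2)" for k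
      using M by (auto simp: norm_mult intro!: AE_I2 mult_right_mono)
  qed measurable
  ultimately have "(\<integral>\<xi>. fourier (\<bullet>) f \<xi> * cis (x \<bullet> \<xi>) * of_real (gauss (0::'a)) \<partial>lborel)
      = (\<integral>v. f x * of_real (exp (- (v \<bullet> v) / 2)) \<partial>(lborel :: 'a measure))"
    by (rule LIMSEQ_unique)
  then have "(\<integral>\<xi>. fourier (\<bullet>) f \<xi> * cis (x \<bullet> \<xi>) \<partial>lborel) * of_real (gauss (0::'a))
      = f x * of_real (1 / gauss (0::'a))"
    unfolding integral_mult_left_zero integral_mult_right_zero integral_complex_of_real integral_exp_sq .
  then show ?thesis using gauss_pos[of "0::'a"] by (simp add: field_simps power2_eq_square)
qed

lemma lborel_linear_density:
  fixes A :: "real^'n \<Rightarrow> real^'n"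
  assumes "linear A" "det (matrix A) \<noteq> 0"
  shows "lborel = density (distr lborel borel A) (\<lambda>_. ennreal \<bar>det (matrix A)\<bar>)"
proof (rule measure_eqI)
  fix X :: "(real^'n) set" assume X: "X \<in> sets lborel"
  have [measurable]: "A \<in> borel_measurable borel" by (rule borel_measurable_linear[OF assms(1)])
  have [measurable]: "X \<in> sets borel" using X by simp
  have "emeasure lborel X = (\<integral>\<^sup>+x. indicator X x \<partial>lborel)" by simp
  also have "\<dots> = ennreal \<bar>det (matrix A)\<bar> * (\<integral>\<^sup>+x. indicator X (A x) \<partial>lborel)"
    by (rule nn_integral_lborel_linear[OF assms]) measurable
  also have "(\<integral>\<^sup>+x. indicator X (A x) \<partial>lborel) = emeasure (distr lborel borel A) X"
    using nn_integral_distr[of A lborel borel "indicator X"] by simp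
  finally show "emeasure lborel X = emeasure (density (distr lborel borel A) (\<lambda>_. ennreal \<bar>det (matrix A)\<bar>)) X"
    by (simp add: emeasure_density nn_integral_cmult_indicator)
qed simp

lemma
  fixes A :: "real^'n \<Rightarrow> real^'n" and h :: "real^'n \<Rightarrow> complex"
  assumes A: "linear A" "det (matrix A) \<noteq> 0" and [measurable]: "h \<in> borel_measurable borel"
  shows lborel_integral_linear: "(\<integral>x. h x \<partial>lborel) = of_real \<bar>det (matrix A)\<bar> * (\<integral>x. h (A x) \<partial>lborel)"
    and lborel_integrable_linear: "integrable lborel h \<longleftrightarrow> integrable lborel (\<lambda>x. h (A x))"
proof -
  have [measurable]: "A \<in> borel_measurable borel" by (rule borel_measurable_linear[OF A(1)])
  let ?D = "density (distr lborel borel A) (\<lambda>_. ennreal \<bar>det (matrix A)\<bar>)"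
  have "(\<integral>x. h x \<partial>lborel) = (\<integral>x. h x \<partial>?D)" using lborel_linear_density[OF A] by simp
  then show "(\<integral>x. h x \<partial>lborel) = of_real \<bar>det (matrix A)\<bar> * (\<integral>x. h (A x) \<partial>lborel)"
    by (simp add: integral_density integral_distr scaleR_conv_of_real)
  have "integrable lborel h \<longleftrightarrow> integrable ?D h" using lborel_linear_density[OF A] by simp
  also have "\<dots> \<longleftrightarrow> integrable (distr lborel borel A) (\<lambda>x. \<bar>det (matrix A)\<bar> *\<^sub>R h x)"
    by (rule integrable_density) auto
  also have "\<dots> \<longleftrightarrow> integrable (distr lborel borel A) h"
  proof
    assume "integrable (distr lborel borel A) (\<lambda>x. \<bar>det (matrix A)\<bar> *\<^sub>R h x)"
    then have "integrable (distr lborel borel A) (\<lambda>x. (1 / \<bar>det (matrix A)\<bar>) *\<^sub>R (\<bar>det (matrix A)\<bar> *\<^sub>R h x))"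
      by (rule integrable_scaleR_right)
    moreover have "(\<lambda>x. (1 / \<bar>det (matrix A)\<bar>) *\<^sub>R (\<bar>det (matrix A)\<bar> *\<^sub>R h x)) = h" using A(2) by simp
    ultimately show "integrable (distr lborel borel A) h" by (simp only:)
  qed (rule integrable_scaleR_right)
  also have "\<dots> \<longleftrightarrow> integrable lborel (\<lambda>x. h (A x))" by (rule integrable_distr_eq) measurable
  finally show "integrable lborel h \<longleftrightarrow> integrable lborel (\<lambda>x. h (A x))" .
qed

text \<open>The functions for which inversion and Plancherel's theorem hold with absolutely
  convergent integrals; the proof of \<open>L4_fourier\<close> shows that the class is closed under
  squaring.\<close>

definition fourier_nice :: "('a::euclidean_space \<Rightarrow> 'a \<Rightarrow> real) \<Rightarrow> ('a \<Rightarrow> complex) \<Rightarrow> bool" where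
  "fourier_nice B f \<longleftrightarrow> continuous_on UNIV f \<and> bounded (range f) \<and> integrable lborel f \<and> integrable lborel (fourier B f)"

text \<open>The factor depends on the normalisation of \<open>B\<close>; its existence and
  positivity are enough.\<close>

definition inversion_constant :: "('a::euclidean_space \<Rightarrow> 'a \<Rightarrow> real) \<Rightarrow> real \<Rightarrow> bool" where
  "inversion_constant B k \<longleftrightarrow> k > 0 \<and>
     (\<forall>f. fourier_nice B f \<longrightarrow> (\<forall>x. f x = of_real k * (\<integral>\<xi>. fourier B f \<xi> * cis (B x \<xi>) \<partial>lborel)))"

text \<open>B(x, \<xi>) is the coordinate inner product of x with A \<xi> for an invertible A, and
  the substitution A gives the constant |det A| gauss(0)^2.\<close>

lemma ex_inversion_constant:
  fixes B :: "real^'n \<Rightarrow> real^'n \<Rightarrow> real"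
  assumes "inner_product B" shows "\<exists>k. inversion_constant B k"
proof -
  have bil: "bilinear B" and pos: "\<And>x. x \<noteq> 0 \<Longrightarrow> B x x > 0" using assms by (auto simp: inner_product_def)
  have lin: "linear (\<lambda>x. B x y)" "linear (B x)" for x y using bil by (auto simp: bilinear_def)
  define A where "A \<xi> = (\<Sum>b\<in>Basis. B b \<xi> *\<^sub>R b)" for \<xi>
  have A: "x \<bullet> A \<xi> = B x \<xi>" for x \<xi>
  proof -
    have "B x \<xi> = B (\<Sum>b\<in>Basis. (x \<bullet> b) *\<^sub>R b) \<xi>" by (simp add: euclidean_representation)
    also have "\<dots> = (\<Sum>b\<in>Basis. (x \<bullet> b) * B b \<xi>)" by (simp add: linear_sum[OF lin(1)] linear_cmul[OF lin(1)])
    finally show ?thesis by (simp add: A_def inner_sum_right mult.commute)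
  qed
  have linA: "linear A"
    by (auto simp: linear_iff A_def linear_add[OF lin(2)] linear_cmul[OF lin(2)] algebra_simps sum.distrib scaleR_sum_right)
  have "inj A"
  proof (subst linear_injective_0[OF linA], intro allI impI)
    fix x assume "A x = 0"
    then have "B x x = 0" using A[of x x] by simp
    then show "x = 0" using pos[of x] by force
  qed
  then have det: "det (matrix A) \<noteq> 0" using det_nz_iff_inj[OF linA] by simp
  have Am[measurable]: "A \<in> borel_measurable borel" by (rule borel_measurable_linear[OF linA])
  have fB: "fourier B f = (\<lambda>\<xi>. fourier (\<bullet>) f (A \<xi>))" for f by (simp add: fourier_def A fun_eq_iff)
  let ?g = "1 / (gauss (0::real^'n))\<^sup>2" and ?d = "\<bar>det (matrix A)\<bar>"
  have pos: "?g > 0" using gauss_pos[of "0::real^'n"] by simp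
  have "inversion_constant B (?d / ?g)"
    unfolding inversion_constant_def
  proof (intro conjI allI impI)
    show "?d / ?g > 0" using det pos by simp
    fix f x assume f: "fourier_nice B f"
    have fm: "f \<in> borel_measurable borel" using f by (simp add: fourier_nice_def borel_measurable_continuous_onI)
    have inm: "(\<lambda>p. fst p \<bullet> snd p) \<in> borel_measurable (borel \<Otimes>\<^sub>M borel :: ((real^'n) \<times> (real^'n)) measure)"
      unfolding borel_prod by (intro borel_measurable_continuous_onI continuous_intros)
    have Fm[measurable]: "fourier (\<bullet>) f \<in> borel_measurable borel"
    proof -
      have "(\<lambda>p. f (snd p) * cis (- (snd p \<bullet> fst p))) \<in> borel_measurable (borel \<Otimes>\<^sub>M borel)"
        using fm inm by (simp add: inner_commute) measurable
      then show ?thesis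
        using lborel.borel_measurable_lebesgue_integral[of "\<lambda>\<xi> x. f x * cis (- (x \<bullet> \<xi>))" borel]
        by (simp add: fourier_def[abs_def] case_prod_unfold)
    qed
    have "integrable lborel (fourier (\<bullet>) f)"
      using f lborel_integrable_linear[OF linA det Fm] by (simp add: fourier_nice_def fB)
    then have inv: "(\<integral>\<xi>. fourier (\<bullet>) f \<xi> * cis (x \<bullet> \<xi>) \<partial>lborel) = of_real ?g * f x"
      using f by (intro fourier_inversion_inner) (auto simp: fourier_nice_def)
    have xm[measurable]: "(\<lambda>\<xi>. x \<bullet> \<xi>) \<in> borel_measurable borel"
      by (intro borel_measurable_continuous_onI continuous_intros)
    have "(\<integral>\<xi>. fourier (\<bullet>) f \<xi> * cis (x \<bullet> \<xi>) \<partial>lborel) = of_real ?d * (\<integral>\<xi>. fourier (\<bullet>) f (A \<xi>) * cis (x \<bullet> A \<xi>) \<partial>lborel)"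
      by (rule lborel_integral_linear[OF linA det]) measurable
    then have "of_real ?g * f x = of_real ?d * (\<integral>\<xi>. fourier B f \<xi> * cis (B x \<xi>) \<partial>lborel)"
      unfolding inv by (simp add: fB A)
    then show "f x = of_real (?d / ?g) * (\<integral>\<xi>. fourier B f \<xi> * cis (B x \<xi>) \<partial>lborel)"
      using pos by (simp add: field_simps)
  qed
  then show ?thesis by blast
qed

lemma cnj_measurable [measurable]: "cnj \<in> borel_measurable borel"
  by (intro borel_measurable_continuous_onI continuous_intros)

lemma fourier_measurable:
  fixes B :: "'a::euclidean_space \<Rightarrow> 'a \<Rightarrow> real"
  assumes "bilinear B" and f[measurable]: "f \<in> borel_measurable borel"
  shows "fourier B f \<in> borel_measurable borel"
proof -
  have [measurable]: "(\<lambda>p. B (snd p) (fst p)) \<in> borel_measurable (borel \<Otimes>\<^sub>M borel)"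
    using measurable_pair_swap[OF bilinear_measurable[OF assms(1)]] by (simp add: case_prod_unfold)
  have "(\<lambda>p. f (snd p) * cis (- B (snd p) (fst p))) \<in> borel_measurable (borel \<Otimes>\<^sub>M borel)"
    by measurable
  then show ?thesis
    using lborel.borel_measurable_lebesgue_integral[of "\<lambda>\<xi> x. f x * cis (- B x \<xi>)" borel]
    by (simp add: fourier_def[abs_def] case_prod_unfold)
qed

locale fourier_pair =
  fixes B :: "real^'n \<Rightarrow> real^'n \<Rightarrow> real" and k :: real
  assumes inner: "inner_product B" and inv_const: "inversion_constant B k"
begin

lemma bil: "bilinear B" using inner by (simp add: inner_product_def)

lemma k_pos: "k > 0" using inv_const by (simp add: inversion_constant_def)

lemma B_measurable [measurable]: "(\<lambda>p. B (fst p) (snd p)) \<in> borel_measurable (borel \<Otimes>\<^sub>M borel)"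
  "B x \<in> borel_measurable borel" "(\<lambda>y. B y x) \<in> borel_measurable borel"
  using bilinear_measurable[OF bil] bil
  by (auto simp: case_prod_unfold bilinear_def intro!: borel_measurable_linear)

lemma inversion:
  "fourier_nice B f \<Longrightarrow> f x = of_real k * (\<integral>\<xi>. fourier B f \<xi> * cis (B x \<xi>) \<partial>lborel)"
  using inv_const by (auto simp: inversion_constant_def)

lemma nice_measurable: "fourier_nice B f \<Longrightarrow> f \<in> borel_measurable borel"
  by (simp add: fourier_nice_def borel_measurable_continuous_onI)

lemma integrable_bounded_mult:
  fixes f g :: "real^'n \<Rightarrow> complex"
  assumes "integrable lborel f" "g \<in> borel_measurable borel" "bounded (range g)"
  shows "integrable lborel (\<lambda>x. f x * g x)"
proof -
  obtain M where M: "\<And>x. norm (g x) \<le> M" using assms(3) by (auto simp: bounded_iff)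
  show ?thesis
  proof (rule Bochner_Integration.integrable_bound)
    show "integrable lborel (\<lambda>x. M * norm (f x))" using assms(1) by simp
    show "(\<lambda>x. f x * g x) \<in> borel_measurable lborel" using assms(1,2) by measurable
    show "AE x in lborel. norm (f x * g x) \<le> norm (M * norm (f x))"
    proof (rule AE_I2)
      fix x
      have "norm (f x * g x) \<le> norm (f x) * M" unfolding norm_mult using M by (intro mult_left_mono) auto
      also have "\<dots> \<le> norm (M * norm (f x))"
        using abs_ge_self[of "M * norm (f x)"] by (simp add: mult.commute)
      finally show "norm (f x * g x) \<le> norm (M * norm (f x))" .
    qed
  qed
qed

lemma bounded_fourier: "bounded (range (fourier B f))"
  using fourier_bound[of B f] by (auto simp: bounded_iff)

text \<open>Inversion is inserted for the conjugate factor; after Fubini the inner integral is the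
  transform of \<open>f\<close>.\<close>

lemma plancherel:
  assumes f: "fourier_nice B f"
  shows "(\<integral>\<^sup>+x. ennreal ((norm (f x))\<^sup>2) \<partial>lborel) = ennreal k * (\<integral>\<^sup>+\<xi>. ennreal ((norm (fourier B f \<xi>))\<^sup>2) \<partial>lborel)"
proof -
  have fm[measurable]: "f \<in> borel_measurable borel" by (rule nice_measurable[OF f])
  have Fm[measurable]: "fourier B f \<in> borel_measurable borel" by (rule fourier_measurable[OF bil fm])
  have fi: "integrable lborel f" and Fi: "integrable lborel (fourier B f)" and bd: "bounded (range f)"
    using f by (auto simp: fourier_nice_def)
  have cb: "bounded (range (\<lambda>x. cnj (g x)))" if "bounded (range g)" for g :: "real^'n \<Rightarrow> complex"
    using that by (auto simp: bounded_iff)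
  have ii: "integrable lborel (\<lambda>x. f x * cnj (f x))"
    by (intro integrable_bounded_mult fi cb bd) measurable
  have II: "integrable lborel (\<lambda>x. fourier B f x * cnj (fourier B f x))"
    by (intro integrable_bounded_mult Fi cb bounded_fourier) measurable
  have cnjF: "cnj (f x) = of_real k * (\<integral>\<xi>. cnj (fourier B f \<xi>) * cis (- B x \<xi>) \<partial>lborel)" for x
  proof -
    have "cnj (f x) = of_real k * cnj (\<integral>\<xi>. fourier B f \<xi> * cis (B x \<xi>) \<partial>lborel)"
      by (subst inversion[OF f]) simp
    also have "cnj (\<integral>\<xi>. fourier B f \<xi> * cis (B x \<xi>) \<partial>lborel) = (\<integral>\<xi>. cnj (fourier B f \<xi> * cis (B x \<xi>)) \<partial>lborel)"
      by (rule Bochner_Integration.integral_cnj[symmetric])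
    also have "\<dots> = (\<integral>\<xi>. cnj (fourier B f \<xi>) * cis (- B x \<xi>) \<partial>lborel)"
      by (simp only: complex_cnj_mult cis_cnj)
    finally show ?thesis .
  qed
  have "(\<integral>x. f x * cnj (f x) \<partial>lborel) = of_real k * (\<integral>x. f x * (\<integral>\<xi>. cnj (fourier B f \<xi>) * cis (- B x \<xi>) \<partial>lborel) \<partial>lborel)"
    unfolding cnjF by (simp add: mult.left_commute)
  also have "(\<integral>x. f x * (\<integral>\<xi>. cnj (fourier B f \<xi>) * cis (- B x \<xi>) \<partial>lborel) \<partial>lborel)
     = (\<integral>\<xi>. cnj (fourier B f \<xi>) * (\<integral>x. f x * cis (- B x \<xi>) \<partial>lborel) \<partial>lborel)"
  proof (rule integral_kernel_swap[OF fi])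
    show "integrable lborel (\<lambda>\<xi>. cnj (fourier B f \<xi>))" using Fi by simp
    show "(\<lambda>(x, \<xi>). cis (- B x \<xi>)) \<in> borel_measurable (borel \<Otimes>\<^sub>M borel)"
      unfolding case_prod_unfold by measurable
  qed simp
  also have "\<dots> = (\<integral>\<xi>. fourier B f \<xi> * cnj (fourier B f \<xi>) \<partial>lborel)"
    by (simp add: fourier_def[symmetric] mult.commute)
  finally have eq: "(\<integral>x. f x * cnj (f x) \<partial>lborel) = of_real k * (\<integral>\<xi>. fourier B f \<xi> * cnj (fourier B f \<xi>) \<partial>lborel)" .
  have conv: "(\<integral>\<^sup>+x. ennreal ((norm (g x))\<^sup>2) \<partial>lborel) = ennreal (Re (\<integral>x. g x * cnj (g x) \<partial>lborel))"
    if "integrable lborel (\<lambda>x. g x * cnj (g x))" for g :: "real^'n \<Rightarrow> complex"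
  proof -
    have e: "g x * cnj (g x) = of_real ((norm (g x))\<^sup>2)" for x by (simp add: complex_norm_square[symmetric])
    have "integrable lborel (\<lambda>x. (norm (g x))\<^sup>2)"
      using that unfolding e by (simp only: complex_of_real_integrable_eq)
    then have "(\<integral>\<^sup>+x. ennreal ((norm (g x))\<^sup>2) \<partial>lborel) = ennreal (\<integral>x. (norm (g x))\<^sup>2 \<partial>lborel)"
      by (rule nn_integral_eq_integral) auto
    then show ?thesis unfolding e integral_complex_of_real by simp
  qed
  show ?thesis unfolding conv[OF ii] conv[OF II] eq using k_pos by (simp add: ennreal_mult')
qed

text \<open>Inversion for one factor and Fubini turn the transform of the square into
  \<open>k\<close> times a convolution.\<close>

lemma fourier_square:
  assumes f: "fourier_nice B f"
  shows "fourier B (\<lambda>x. f x * f x) \<xi> = of_real k * (\<integral>\<eta>. fourier B f \<eta> * fourier B f (\<xi> - \<eta>) \<partial>lborel)"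
proof -
  have fm[measurable]: "f \<in> borel_measurable borel" by (rule nice_measurable[OF f])
  have fi: "integrable lborel f" and Fi: "integrable lborel (fourier B f)" using f by (auto simp: fourier_nice_def)
  have "fourier B (\<lambda>x. f x * f x) \<xi> = (\<integral>x. f x * (of_real k * (\<integral>\<eta>. fourier B f \<eta> * (cis (B x \<eta>) * cis (- B x \<xi>)) \<partial>lborel)) \<partial>lborel)"
    unfolding fourier_def[of B "\<lambda>x. f x * f x"]
  proof (rule Bochner_Integration.integral_cong[OF refl])
    fix x
    have "f x * cis (- B x \<xi>) = of_real k * ((\<integral>\<eta>. fourier B f \<eta> * cis (B x \<eta>) \<partial>lborel) * cis (- B x \<xi>))"
      by (subst inversion[OF f]) simp
    also have "(\<integral>\<eta>. fourier B f \<eta> * cis (B x \<eta>) \<partial>lborel) * cis (- B x \<xi>) = (\<integral>\<eta>. fourier B f \<eta> * (cis (B x \<eta>) * cis (- B x \<xi>)) \<partial>lborel)"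
      by (subst integral_mult_left_zero[symmetric]) (simp add: mult.assoc)
    finally show "f x * f x * cis (- B x \<xi>) = f x * (of_real k * (\<integral>\<eta>. fourier B f \<eta> * (cis (B x \<eta>) * cis (- B x \<xi>)) \<partial>lborel))"
      by (simp add: mult.assoc)
  qed
  also have "\<dots> = of_real k * (\<integral>x. f x * (\<integral>\<eta>. fourier B f \<eta> * (cis (B x \<eta>) * cis (- B x \<xi>)) \<partial>lborel) \<partial>lborel)"
    by (simp add: mult.left_commute)
  also have "(\<integral>x. f x * (\<integral>\<eta>. fourier B f \<eta> * (cis (B x \<eta>) * cis (- B x \<xi>)) \<partial>lborel) \<partial>lborel)
     = (\<integral>\<eta>. fourier B f \<eta> * (\<integral>x. f x * (cis (B x \<eta>) * cis (- B x \<xi>)) \<partial>lborel) \<partial>lborel)"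
  proof (rule integral_kernel_swap[OF fi Fi])
    have [measurable]: "(\<lambda>p. B (fst p) \<xi>) \<in> borel_measurable (borel \<Otimes>\<^sub>M borel)"
      using measurable_compose[OF measurable_fst B_measurable(3)] by simp
    show "(\<lambda>(x, \<eta>). cis (B x \<eta>) * cis (- B x \<xi>)) \<in> borel_measurable (borel \<Otimes>\<^sub>M borel)"
      unfolding case_prod_unfold by measurable
  qed (simp add: norm_mult)
  finally show ?thesis by (simp add: fourier_def[of B f "\<xi> - _"] cis_mult bilinear_rsub[OF bil])
qed

lemma nn_integral_lborel_reflect:
  fixes h :: "real^'n \<Rightarrow> ennreal"
  assumes [measurable]: "h \<in> borel_measurable borel"
  shows "(\<integral>\<^sup>+\<xi>. h (\<xi> - \<eta>) \<partial>lborel) = (\<integral>\<^sup>+\<xi>. h \<xi> \<partial>lborel)"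
  using nn_integral_lborel_translate[of h "- \<eta>"] by simp

lemma nn_integral_convolution:
  fixes g :: "real^'n \<Rightarrow> ennreal"
  assumes [measurable]: "g \<in> borel_measurable borel"
  shows "(\<integral>\<^sup>+\<xi>. (\<integral>\<^sup>+\<eta>. g \<eta> * g (\<xi> - \<eta>) \<partial>lborel) \<partial>lborel) = (\<integral>\<^sup>+\<xi>. g \<xi> \<partial>lborel)\<^sup>2"
proof -
  have "(\<integral>\<^sup>+\<xi>. (\<integral>\<^sup>+\<eta>. g \<eta> * g (\<xi> - \<eta>) \<partial>lborel) \<partial>lborel) = (\<integral>\<^sup>+\<eta>. (\<integral>\<^sup>+\<xi>. g \<eta> * g (\<xi> - \<eta>) \<partial>lborel) \<partial>lborel)"
    by (rule lborel_pair.Fubini') (unfold case_prod_unfold, measurable)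
  also have "\<dots> = (\<integral>\<^sup>+\<eta>. g \<eta> * (\<integral>\<^sup>+\<xi>. g \<xi> \<partial>lborel) \<partial>lborel)"
    by (simp add: nn_integral_cmult nn_integral_lborel_reflect)
  also have "\<dots> = (\<integral>\<^sup>+\<xi>. g \<xi> \<partial>lborel)\<^sup>2" by (simp add: nn_integral_multc power2_eq_square)
  finally show ?thesis .
qed

lemma fourier_square_bound:
  assumes f: "fourier_nice B f"
  shows "ennreal (norm (fourier B (\<lambda>x. f x * f x) \<xi>))
    \<le> ennreal k * (\<integral>\<^sup>+\<eta>. ennreal (norm (fourier B f \<eta>)) * ennreal (norm (fourier B f (\<xi> - \<eta>))) \<partial>lborel)"
proof -
  have [measurable]: "fourier B f \<in> borel_measurable borel"
    by (rule fourier_measurable[OF bil nice_measurable[OF f]])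
  have "ennreal (norm (\<integral>\<eta>. fourier B f \<eta> * fourier B f (\<xi> - \<eta>) \<partial>lborel))
      \<le> (\<integral>\<^sup>+\<eta>. ennreal (norm (fourier B f \<eta> * fourier B f (\<xi> - \<eta>))) \<partial>lborel)"
    by (rule integral_norm_bound_ennreal)
     (intro integrable_bounded_mult, use f in \<open>auto simp: fourier_nice_def intro: bounded_subset[OF bounded_fourier[of f]]\<close>)
  then show ?thesis unfolding fourier_square[OF f] using k_pos
    by (simp add: norm_mult ennreal_mult' mult_left_mono)
qed

text \<open>|f|^4 is |f^2|^2. Plancherel for f^2 contributes one factor \<open>k\<close>; the
  transform of f^2, being bounded by \<open>k\<close> times a convolution, contributes the other
  two.\<close>

lemma L4_fourier:
  assumes f: "fourier_nice B f"
  shows "(\<integral>\<^sup>+x. ennreal (norm (f x) ^ 4) \<partial>lborel)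
    \<le> ennreal (k ^ 3) * (\<integral>\<^sup>+\<xi>. (\<integral>\<^sup>+\<eta>. ennreal (norm (fourier B f \<eta>)) * ennreal (norm (fourier B f (\<xi> - \<eta>))) \<partial>lborel)\<^sup>2 \<partial>lborel)"
proof -
  have fm[measurable]: "f \<in> borel_measurable borel" by (rule nice_measurable[OF f])
  have Fm[measurable]: "fourier B f \<in> borel_measurable borel" by (rule fourier_measurable[OF bil fm])
  let ?H = "\<lambda>\<xi>. \<integral>\<^sup>+\<eta>. ennreal (norm (fourier B f \<eta>)) * ennreal (norm (fourier B f (\<xi> - \<eta>))) \<partial>lborel"
  have Hm[measurable]: "?H \<in> borel_measurable borel"
    by (rule lborel.borel_measurable_nn_integral[of "\<lambda>\<xi> \<eta>. ennreal (norm (fourier B f \<eta>)) * ennreal (norm (fourier B f (\<xi> - \<eta>)))", simplified])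
      (unfold case_prod_unfold, measurable)
  have "fourier_nice B (\<lambda>x. f x * f x)"
    unfolding fourier_nice_def
  proof (intro conjI)
    show "continuous_on UNIV (\<lambda>x. f x * f x)" using f by (auto simp: fourier_nice_def intro!: continuous_intros)
    obtain M where M: "\<And>x. norm (f x) \<le> M" using f by (auto simp: fourier_nice_def bounded_iff)
    have "norm (f x * f x) \<le> M * M" for x
      unfolding norm_mult using M[of x] order_trans[OF norm_ge_zero M[of x]] by (intro mult_mono) auto
    then show "bounded (range (\<lambda>x. f x * f x))" by (auto simp: bounded_iff)
    show "integrable lborel (\<lambda>x. f x * f x)"
      using f by (intro integrable_bounded_mult) (auto simp: fourier_nice_def)
    have "(\<integral>\<^sup>+\<xi>. ennreal (norm (fourier B (\<lambda>x. f x * f x) \<xi>)) \<partial>lborel) \<le> (\<integral>\<^sup>+\<xi>. ennreal k * ?H \<xi> \<partial>lborel)"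
      by (intro nn_integral_mono fourier_square_bound f)
    also have "\<dots> = ennreal k * (\<integral>\<^sup>+\<xi>. ennreal (norm (fourier B f \<xi>)) \<partial>lborel)\<^sup>2"
      by (simp add: nn_integral_cmult nn_integral_convolution[of "\<lambda>\<xi>. ennreal (norm (fourier B f \<xi>))"])
    also have "\<dots> < \<infinity>"
      using f by (auto simp: fourier_nice_def integrable_iff_bounded ennreal_mult_less_top power2_eq_square)
    finally show "integrable lborel (fourier B (\<lambda>x. f x * f x))"
      by (intro integrableI_bounded) (auto intro!: fourier_measurable[OF bil])
  qed
  note pl = plancherel[OF this]
  have "(\<integral>\<^sup>+x. ennreal (norm (f x) ^ 4) \<partial>lborel) = (\<integral>\<^sup>+x. ennreal ((norm (f x * f x))\<^sup>2) \<partial>lborel)"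
    by (simp add: norm_mult power2_eq_square power4_eq_xxxx mult.assoc)
  also have "\<dots> = ennreal k * (\<integral>\<^sup>+\<xi>. ennreal ((norm (fourier B (\<lambda>x. f x * f x) \<xi>))\<^sup>2) \<partial>lborel)" by (rule pl)
  also have "\<dots> \<le> ennreal k * (\<integral>\<^sup>+\<xi>. ennreal (k\<^sup>2) * (?H \<xi>)\<^sup>2 \<partial>lborel)"
  proof (intro mult_left_mono nn_integral_mono)
    fix \<xi>
    have "ennreal ((norm (fourier B (\<lambda>x. f x * f x) \<xi>))\<^sup>2) = (ennreal (norm (fourier B (\<lambda>x. f x * f x) \<xi>)))\<^sup>2"
      by (simp add: ennreal_power)
    also have "\<dots> \<le> (ennreal k * ?H \<xi>)\<^sup>2" by (intro power_mono fourier_square_bound f) simp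
    also have "\<dots> = ennreal (k\<^sup>2) * (?H \<xi>)\<^sup>2" using k_pos by (simp add: power_mult_distrib ennreal_power)
    finally show "ennreal ((norm (fourier B (\<lambda>x. f x * f x) \<xi>))\<^sup>2) \<le> ennreal (k\<^sup>2) * (?H \<xi>)\<^sup>2" .
  qed simp
  also have "\<dots> = ennreal k * (ennreal (k\<^sup>2) * (\<integral>\<^sup>+\<xi>. (?H \<xi>)\<^sup>2 \<partial>lborel))"
    by (simp add: nn_integral_cmult)
  also have "\<dots> = ennreal (k ^ 3) * (\<integral>\<^sup>+\<xi>. (?H \<xi>)\<^sup>2 \<partial>lborel)"
    using k_pos by (simp add: mult.assoc[symmetric] ennreal_mult'[symmetric] power3_eq_cube power2_eq_square)
  finally show ?thesis .
qed

end

section \<open>Estimates in the tube over a symmetric cone\<close>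

lemma nn_integral_inverse_1_plus_square: "(\<integral>\<^sup>+t. ennreal (1 / (1 + t\<^sup>2)) \<partial>(lborel :: real measure)) < \<infinity>"
proof -
  have "integrable lborel (\<lambda>t::real. inverse (1 + t\<^sup>2))"
    using integrable_inverse_1_plus_square by (simp add: set_integrable_def einterval_def)
  then show ?thesis by (simp add: integrable_iff_bounded inverse_eq_divide)
qed

lemma nn_integral_inverse_1_plus_square_scaled:
  assumes "a > 0" shows "(\<integral>\<^sup>+t. ennreal (1 / (1 + a * t\<^sup>2)) \<partial>(lborel :: real measure)) < \<infinity>"
proof -
  define c where "c = max 1 (1 / a)"
  have le: "1 / (1 + a * t\<^sup>2) \<le> c * (1 / (1 + t\<^sup>2))" for t :: real
  proof -
    have "1 \<le> c" "1 \<le> c * a" using assms by (auto simp: c_def max_def field_simps)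
    then have "1 * 1 + 1 * t\<^sup>2 \<le> c * 1 + (c * a) * t\<^sup>2" by (intro add_mono mult_right_mono) auto
    then have "1 + t\<^sup>2 \<le> c * (1 + a * t\<^sup>2)" by (simp add: algebra_simps)
    moreover have "1 + t\<^sup>2 > 0" "1 + a * t\<^sup>2 > 0" using assms by (auto intro!: add_pos_nonneg)
    ultimately show ?thesis by (simp add: field_simps)
  qed
  have "(\<integral>\<^sup>+t. ennreal (1 / (1 + a * t\<^sup>2)) \<partial>(lborel :: real measure)) \<le> (\<integral>\<^sup>+t. ennreal c * ennreal (1 / (1 + t\<^sup>2)) \<partial>lborel)"
    using le by (intro nn_integral_mono) (simp add: ennreal_mult'[symmetric] c_def ennreal_leI)
  also have "\<dots> = ennreal c * (\<integral>\<^sup>+t. ennreal (1 / (1 + t\<^sup>2)) \<partial>lborel)" by (rule nn_integral_cmult) measurable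
  also have "\<dots> < \<infinity>" using nn_integral_inverse_1_plus_square by (simp add: ennreal_mult_less_top)
  finally show ?thesis .
qed

lemma nn_integral_prod_inverse_square:
  assumes "a > 0" shows "(\<integral>\<^sup>+x. ennreal (\<Prod>b\<in>Basis. 1 / (1 + a * (x \<bullet> b)\<^sup>2)) \<partial>(lborel :: 'a::euclidean_space measure)) < \<infinity>"
proof -
  have "(\<integral>\<^sup>+x. ennreal (\<Prod>b\<in>Basis. 1 / (1 + a * (x \<bullet> b)\<^sup>2)) \<partial>(lborel :: 'a measure))
     = (\<integral>\<^sup>+x. (\<Prod>b\<in>Basis. ennreal (1 / (1 + a * (x \<bullet> b)\<^sup>2))) \<partial>(lborel :: 'a measure))"
    using assms by (intro nn_integral_cong prod_ennreal[symmetric]) (auto intro!: divide_nonneg_nonneg add_nonneg_nonneg)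
  also have "\<dots> = (\<Prod>b\<in>(Basis::'a set). \<integral>\<^sup>+t. ennreal (1 / (1 + a * t\<^sup>2)) \<partial>lborel)"
    by (rule nn_integral_lborel_prod) auto
  also have "\<dots> < \<infinity>"
    using nn_integral_inverse_1_plus_square_scaled[OF assms] by (simp add: power_less_top_ennreal)
  finally show ?thesis .
qed

text \<open>The majorant is a product over the coordinates: the norm is at least the mean of their
  moduli, and exp(-a t) \<le> 1 / (1 + a^2 t^2 / 2) by the quadratic Taylor bound.\<close>

lemma nn_integral_exp_norm:
  assumes "d > 0" shows "(\<integral>\<^sup>+x. ennreal (exp (- d * norm x)) \<partial>(lborel :: 'a::euclidean_space measure)) < \<infinity>"
proof -
  let ?n = "real DIM('a)"
  define a where "a = d / ?n"
  have a: "a > 0" using assms by (simp add: a_def)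
  define q where "q = a\<^sup>2 / 2"
  have q: "q > 0" using a by (simp add: q_def)
  have e: "exp (- (a * t)) \<le> 1 / (1 + q * t\<^sup>2)" if "t \<ge> 0" for t
  proof -
    have "1 + a * t + (a * t)\<^sup>2 / 2 \<le> exp (a * t)" using a that by (intro exp_lower_Taylor_quadratic) auto
    moreover have "a * t \<ge> 0" using a that by simp
    ultimately have "1 + q * t\<^sup>2 \<le> exp (a * t)" by (simp add: q_def power_mult_distrib)
    moreover have "1 + q * t\<^sup>2 > 0" using q by (intro add_pos_nonneg) auto
    ultimately show ?thesis by (simp add: exp_minus field_simps)
  qed
  have "exp (- d * norm x) \<le> (\<Prod>b\<in>Basis. 1 / (1 + q * (x \<bullet> b)\<^sup>2))" for x :: 'a
  proof -
    have "(\<Sum>b\<in>(Basis::'a set). a * \<bar>x \<bullet> b\<bar>) \<le> (\<Sum>b\<in>(Basis::'a set). a * norm x)"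
      using a by (intro sum_mono mult_left_mono Basis_le_norm) auto
    also have "\<dots> = d * norm x" by (simp add: a_def)
    finally have "exp (- d * norm x) \<le> exp (- (\<Sum>b\<in>(Basis::'a set). a * \<bar>x \<bullet> b\<bar>))" by simp
    also have "\<dots> = (\<Prod>b\<in>(Basis::'a set). exp (- (a * \<bar>x \<bullet> b\<bar>)))" by (simp add: sum_negf[symmetric] exp_sum)
    also have "\<dots> \<le> (\<Prod>b\<in>Basis. 1 / (1 + q * (x \<bullet> b)\<^sup>2))"
      using e[of "\<bar>x \<bullet> _\<bar>"] by (intro prod_mono) auto
    finally show ?thesis .
  qed
  then have "(\<integral>\<^sup>+x. ennreal (exp (- d * norm x)) \<partial>(lborel :: 'a measure))
      \<le> (\<integral>\<^sup>+x. ennreal (\<Prod>b\<in>Basis. 1 / (1 + q * (x \<bullet> b)\<^sup>2)) \<partial>(lborel :: 'a measure))"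
    by (intro nn_integral_mono ennreal_leI)
  then show ?thesis using nn_integral_prod_inverse_square[OF q] by (rule le_less_trans)
qed

lemma holomorphic_functions_cong:
  assumes "open D" "\<And>z. z \<in> D \<Longrightarrow> \<exists>f'. (g has_derivative f') (at z) \<and> (\<forall>c v. f' (c *s v) = c * f' v)"
  shows "(\<lambda>z. if z \<in> D then g z else 0) \<in> holomorphic_functions D"
  unfolding holomorphic_functions_def
proof (intro CollectI conjI ballI allI impI)
  fix z assume z: "z \<in> D"
  obtain f' where f': "(g has_derivative f') (at z)" "\<forall>c v. f' (c *s v) = c * f' v" using assms(2)[OF z] by blast
  have "((\<lambda>z. if z \<in> D then g z else 0) has_derivative f') (at z)"
    by (rule has_derivative_transform_within_open[OF f'(1) assms(1) z]) simp
  then show "\<exists>f'. ((\<lambda>z. if z \<in> D then g z else 0) has_derivative f') (at z) \<and> (\<forall>c v. f' (c *s v) = c * f' v)"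
    using f'(2) by blast
qed simp

text \<open>Cauchy's theorem for the rectangle with vertices \<open>x + i y\<close>, \<open>x + w + i y\<close>, \<open>x + w + i (y + w)\<close>,
  \<open>x + i (y + w)\<close>, integrated over \<open>x\<close>: by translation invariance the two vertical sides cancel.\<close>

lemma contour_shift:
  fixes \<Omega> :: "(real^'n) set"
  assumes P: "P \<in> holomorphic_functions (tube \<Omega>)" and O: "open \<Omega>" "convex \<Omega>"
    and y: "y \<in> \<Omega>" "y + w \<in> \<Omega>" and C: "C < \<infinity>"
    and bound: "\<And>t. t \<in> {0..1} \<Longrightarrow> (\<integral>\<^sup>+x. ennreal (norm (P (complex_vec x (y + t *\<^sub>R w)))) \<partial>lborel) \<le> C"
  shows "(\<integral>x. P (complex_vec x y) \<partial>lborel) = (\<integral>x. P (complex_vec x (y + w)) \<partial>lborel)"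
proof -
  define H where "H x v = P (complex_vec x (y + v *\<^sub>R w))" for x v
  have Hm: "(\<lambda>(x, v). H x v) \<in> borel_measurable (borel \<Otimes>\<^sub>M borel)"
  proof -
    have "(\<lambda>p. (fst p, y + snd p *\<^sub>R w)) \<in> borel \<Otimes>\<^sub>M borel \<rightarrow>\<^sub>M borel \<Otimes>\<^sub>M (borel :: (real^'n) measure)"
      by measurable
    from measurable_compose[OF this holomorphic_measurable[OF P O(1)]] show ?thesis
      by (simp add: H_def case_prod_unfold)
  qed
  note [measurable] = Hm[unfolded case_prod_unfold]
  have Hx[measurable]: "(\<lambda>x. H x v) \<in> borel_measurable borel" for v
    using measurable_compose[OF _ Hm, of "\<lambda>x. (x, v)" borel] by simp
  have seg: "y + v *\<^sub>R w \<in> \<Omega>" if "v \<in> {0..1}" for v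
  proof -
    have "(1 - v) *\<^sub>R y + v *\<^sub>R (y + w) \<in> \<Omega>" using convexD_alt[OF O(2) y] that by auto
    then show ?thesis by (simp add: algebra_simps)
  qed
  define S where "S = {\<zeta>. y + Im \<zeta> *\<^sub>R w \<in> \<Omega>}"
  have S: "open S" "convex S"
  proof -
    have eq: "S = (\<lambda>\<zeta>. y + Im \<zeta> *\<^sub>R w) -` \<Omega>" by (auto simp: S_def)
    show "open S" unfolding eq using O(1) by (intro open_vimage continuous_intros)
    show "convex S"
    proof (rule convexI)
      fix a b :: complex and p q :: real
      assume ab: "a \<in> S" "b \<in> S" "p \<ge> 0" "q \<ge> 0" "p + q = 1"
      then have "p *\<^sub>R (y + Im a *\<^sub>R w) + q *\<^sub>R (y + Im b *\<^sub>R w) \<in> \<Omega>" using O(2) by (auto simp: S_def convex_def)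
      moreover have "p *\<^sub>R (y + Im a *\<^sub>R w) + q *\<^sub>R (y + Im b *\<^sub>R w) = (p + q) *\<^sub>R y + (p * Im a + q * Im b) *\<^sub>R w"
        by (simp add: algebra_simps)
      ultimately show "p *\<^sub>R a + q *\<^sub>R b \<in> S" using ab by (simp add: S_def)
    qed
  qed
  have SI: "Complex a v \<in> S" if "v \<in> {0..1}" for a v using seg[OF that] by (simp add: S_def)
  let ?g = "\<lambda>x \<zeta>. P (complex_vec x y + \<zeta> *s complex_vec w 0)"
  have g: "?g x \<zeta> = H (x + Re \<zeta> *\<^sub>R w) (Im \<zeta>)" for x \<zeta>
    by (simp add: complex_vec_smult complex_vec_add H_def)
  have hol: "?g x holomorphic_on S" for x
    by (rule holomorphic_on_subset[OF holomorphic_line[OF P]])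
      (auto simp: complex_vec_smult complex_vec_add S_def)
  let ?I = "\<lambda>h. \<integral>t. indicator {0..1::real} t *\<^sub>R (h t :: complex) \<partial>lborel"
  have rect: "?I (\<lambda>u. H (x + u *\<^sub>R w) 0) + \<i> * ?I (\<lambda>v. H (x + w) v) = ?I (\<lambda>u. H (x + u *\<^sub>R w) 1) + \<i> * ?I (\<lambda>v. H x v)" for x
  proof -
    \<comment> \<open>A primitive on the convex set \<open>S\<close> evaluates the four sides of the
      unit square by differences at its corners.\<close>
    obtain \<Phi> where \<Phi>: "\<And>\<zeta>. \<zeta> \<in> S \<Longrightarrow> (\<Phi> has_field_derivative ?g x \<zeta>) (at \<zeta> within S)"
      using holomorphic_convex_primitive'[OF S(2,1) hol[of x]] by blast
    have path: "?I (\<lambda>t. c * ?g x (a + of_real t * c)) = \<Phi> (a + c) - \<Phi> a"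
      if sub: "\<And>t. t \<in> {0..1} \<Longrightarrow> a + of_real t * c \<in> S" for a c
    proof -
      have "has_bochner_integral lborel (\<lambda>t. indicator {0..1::real} t *\<^sub>R (c * ?g x (a + of_real t * c)))
          (\<Phi> (a + of_real 1 * c) - \<Phi> (a + of_real 0 * c))"
      proof (rule has_bochner_integral_FTC_Icc)
        fix t :: real assume t: "0 \<le> t" "t \<le> 1"
        then have inS: "a + of_real t * c \<in> S" using sub by simp
        have d: "((\<lambda>t. a + complex_of_real t * c) has_vector_derivative c) (at t within {0..1})"
          by (auto intro!: derivative_eq_intros simp: has_vector_derivative_def scaleR_conv_of_real)
        have "(\<Phi> has_field_derivative ?g x (a + of_real t * c)) (at (a + of_real t * c))"
          using \<Phi>[OF inS] unfolding at_within_open[OF inS S(1)] .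
        from field_vector_diff_chain_within[OF d has_field_derivative_at_within[OF this]]
        show "((\<lambda>t. \<Phi> (a + of_real t * c)) has_vector_derivative (c * ?g x (a + of_real t * c))) (at t within {0..1})"
          by (simp add: o_def)
      next
        show "continuous_on {0..1} (\<lambda>t. c * ?g x (a + of_real t * c))"
          by (intro continuous_intros continuous_on_compose2[OF holomorphic_on_imp_continuous_on[OF hol]])
            (use sub in auto)
      qed simp
      then show ?thesis by (simp add: has_bochner_integral_iff)
    qed
    have pull: "?I (\<lambda>t. c * h t) = c * ?I h" for c h
      by (subst integral_mult_right_zero[symmetric]) (simp add: mult.left_commute scaleR_conv_of_real)
    have inS: "\<zeta> \<in> S" if "Im \<zeta> \<in> {0..1}" for \<zeta> using SI[OF that, of "Re \<zeta>"] by simp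
    have 1: "?I (\<lambda>u. H (x + u *\<^sub>R w) 0) = \<Phi> 1 - \<Phi> 0"
      using path[of 0 1] inS unfolding g by simp
    have 2: "\<i> * ?I (\<lambda>v. H (x + w) v) = \<Phi> (1 + \<i>) - \<Phi> 1"
      using path[of 1 \<i>] inS unfolding g pull by simp
    have 3: "?I (\<lambda>u. H (x + u *\<^sub>R w) 1) = \<Phi> (\<i> + 1) - \<Phi> \<i>"
      using path[of \<i> 1] inS unfolding g by simp
    have 4: "\<i> * ?I (\<lambda>v. H x v) = \<Phi> \<i> - \<Phi> 0"
      using path[of 0 \<i>] inS unfolding g pull by simp
    show ?thesis unfolding 1 2 3 4 by (simp add: add.commute)
  qed
  have trans: "(\<integral>x. h (x + c) \<partial>lborel) = (\<integral>x. h x \<partial>lborel)" "integrable lborel h \<Longrightarrow> integrable lborel (\<lambda>x. h (x + c))"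
    if "h \<in> borel_measurable borel" for h :: "real^'n \<Rightarrow> complex" and c
    using lborel_integral_affine[OF that, of 1 c] lborel_integrable_affine[of h 1 c] by (simp_all add: add.commute)
  have pairI: "integrable (lborel \<Otimes>\<^sub>M lborel) (\<lambda>(x, t). indicator {0..1::real} t *\<^sub>R K x t)"
    if K: "(\<lambda>(x, t). K x t) \<in> borel_measurable (borel \<Otimes>\<^sub>M borel)"
      and b: "\<And>t. t \<in> {0..1} \<Longrightarrow> (\<integral>\<^sup>+x. ennreal (norm (K x t)) \<partial>lborel) \<le> C"
    for K :: "real^'n \<Rightarrow> real \<Rightarrow> complex"
  proof (rule integrableI_bounded)
    note [measurable] = K[unfolded case_prod_unfold]
    show "(\<lambda>(x, t). indicator {0..1::real} t *\<^sub>R K x t) \<in> borel_measurable (lborel \<Otimes>\<^sub>M lborel)"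
      unfolding case_prod_unfold by measurable
    have "(\<integral>\<^sup>+p. ennreal (norm (case p of (x, t) \<Rightarrow> indicator {0..1::real} t *\<^sub>R K x t)) \<partial>(lborel \<Otimes>\<^sub>M lborel))
       = (\<integral>\<^sup>+t. (\<integral>\<^sup>+x. ennreal (norm (indicator {0..1::real} t *\<^sub>R K x t)) \<partial>lborel) \<partial>lborel)"
      by (subst lborel_pair.nn_integral_snd[symmetric]) (auto simp: case_prod_unfold)
    also have "\<dots> \<le> (\<integral>\<^sup>+t. C * indicator {0..1::real} t \<partial>lborel)"
      using b by (intro nn_integral_mono) (auto simp: indicator_def)
    also have "\<dots> = C" by (simp add: nn_integral_cmult_indicator)
    finally show "(\<integral>\<^sup>+p. ennreal (norm (case p of (x, t) \<Rightarrow> indicator {0..1::real} t *\<^sub>R K x t)) \<partial>(lborel \<Otimes>\<^sub>M lborel)) < \<infinity>"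
      using C by (rule le_less_trans)
  qed
  have int_side: "(\<integral>x. ?I (\<lambda>u. H (x + u *\<^sub>R w) v) \<partial>lborel) = (\<integral>x. H x v \<partial>lborel) \<and> integrable lborel (\<lambda>x. ?I (\<lambda>u. H (x + u *\<^sub>R w) v))"
    if v: "v \<in> {0..1}" for v
  proof -
    have i: "integrable (lborel \<Otimes>\<^sub>M lborel) (\<lambda>(x, u). indicator {0..1::real} u *\<^sub>R H (x + u *\<^sub>R w) v)"
    proof (rule pairI)
      show "(\<lambda>(x, u). H (x + u *\<^sub>R w) v) \<in> borel_measurable (borel \<Otimes>\<^sub>M borel)"
        unfolding case_prod_unfold by measurable
      fix u :: real
      have "(\<integral>\<^sup>+x. ennreal (norm (H (x + u *\<^sub>R w) v)) \<partial>lborel) = (\<integral>\<^sup>+x. ennreal (norm (H x v)) \<partial>lborel)"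
        using nn_integral_lborel_translate[of "\<lambda>x. ennreal (norm (H x v))" "u *\<^sub>R w"] by (simp add: add.commute)
      then show "(\<integral>\<^sup>+x. ennreal (norm (H (x + u *\<^sub>R w) v)) \<partial>lborel) \<le> C" using bound[OF v] by (simp add: H_def)
    qed
    have "(\<integral>x. ?I (\<lambda>u. H (x + u *\<^sub>R w) v) \<partial>lborel) = (\<integral>u. (\<integral>x. indicator {0..1::real} u *\<^sub>R H (x + u *\<^sub>R w) v \<partial>lborel) \<partial>lborel)"
      by (rule lborel_pair.Fubini_integral[OF i, symmetric])
    also have "\<dots> = (\<integral>u. indicator {0..1::real} u *\<^sub>R (\<integral>x. H x v \<partial>lborel) \<partial>lborel)"
      using trans(1)[OF Hx[of v]] by simp
    also have "\<dots> = (\<integral>x. H x v \<partial>lborel)" by simp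
    finally show ?thesis using lborel_pair.integrable_fst'[OF i] by simp
  qed
  have i2: "integrable (lborel \<Otimes>\<^sub>M lborel) (\<lambda>(x, v). indicator {0..1::real} v *\<^sub>R H x v)"
    by (rule pairI[OF Hm]) (use bound in \<open>simp add: H_def\<close>)
  then have i3: "integrable lborel (\<lambda>x. ?I (\<lambda>v. H x v))" using lborel_pair.integrable_fst'[OF i2] by simp
  have m3: "(\<lambda>x. ?I (\<lambda>v. H x v)) \<in> borel_measurable borel" using borel_measurable_integrable[OF i3] by simp
  have "(\<integral>x. ?I (\<lambda>u. H (x + u *\<^sub>R w) 0) + \<i> * ?I (\<lambda>v. H (x + w) v) \<partial>lborel)
      = (\<integral>x. ?I (\<lambda>u. H (x + u *\<^sub>R w) 1) + \<i> * ?I (\<lambda>v. H x v) \<partial>lborel)"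
    by (simp only: rect)
  then have "(\<integral>x. H x 0 \<partial>lborel) + \<i> * (\<integral>x. ?I (\<lambda>v. H (x + w) v) \<partial>lborel)
      = (\<integral>x. H x 1 \<partial>lborel) + \<i> * (\<integral>x. ?I (\<lambda>v. H x v) \<partial>lborel)"
    using int_side[of 0] int_side[of 1] i3 trans(2)[OF m3 i3, of w]
    by (subst (asm) (1 2) Bochner_Integration.integral_add) (auto simp: add.commute)
  moreover have "(\<integral>x. ?I (\<lambda>v. H (x + w) v) \<partial>lborel) = (\<integral>x. ?I (\<lambda>v. H x v) \<partial>lborel)"
    by (rule trans(1)[OF m3])
  ultimately show ?thesis by (simp add: H_def)
qed

lemma ennreal_mult_le_imp:
  fixes a x :: ennreal
  assumes "a * v \<le> x" "v \<noteq> 0" "v < \<infinity>" shows "a \<le> inverse v * x"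
proof -
  have "inverse v * (a * v) = a * (v * inverse v)" by (simp only: mult_ac)
  moreover have "v * inverse v = 1" using assms(2,3) by (simp add: divide_ennreal_def[symmetric] ennreal_divide_self less_top)
  ultimately have "a = inverse v * (a * v)" by simp
  also have "\<dots> \<le> inverse v * x" using assms(1) by (rule mult_left_mono) simp
  finally show ?thesis .
qed

section \<open>Geometry of the cone and pointwise bounds\<close>

context symmetric_cone begin

lemma bil: "bilinear B" and symB: "B x y = B y x" and posB: "x \<noteq> 0 \<Longrightarrow> B x x > 0"
  using inner by (auto simp: inner_product_def)

lemma linB: "linear (B x)" "linear (\<lambda>y. B y x)"
  using bil by (auto simp: bilinear_def)

lemmas B_lin = bilinear_ladd[OF bil] bilinear_radd[OF bil] bilinear_lsub[OF bil] bilinear_rsub[OF bil]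
  bilinear_lmul[OF bil] bilinear_rmul[OF bil]

lemma B_zero [simp]: "B 0 x = 0" "B x 0 = 0"
  using linear_0[OF linB(1)] linear_0[OF linB(2)] by auto

lemma contB: "continuous_on S (B x)" "continuous_on S (\<lambda>y. B y x)"
  using linB by (auto intro!: linear_continuous_on simp: linear_conv_bounded_linear)

lemma omega_sets [measurable]: "\<Omega> \<in> sets borel" using opn by simp

lemma closure_sets [measurable]: "closure \<Omega> \<in> sets borel" by simp

lemma B_pos: "x \<in> closure \<Omega> \<Longrightarrow> x \<noteq> 0 \<Longrightarrow> y \<in> \<Omega> \<Longrightarrow> B x y > 0"
  by (subst (asm) (2) dual) auto

lemma B_nonneg: "x \<in> closure \<Omega> \<Longrightarrow> y \<in> \<Omega> \<Longrightarrow> B x y \<ge> 0"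
  using B_pos[of x y] by (cases "x = 0") auto

lemma in_closure: "y \<in> \<Omega> \<Longrightarrow> y \<in> closure \<Omega>" using closure_subset by blast

text \<open>Adding a small multiple of \<open>e\<close> makes the weak inequality strict on the
  closed cone, so the perturbed point lies in the cone by self-duality.\<close>

lemma closure_iff: "x \<in> closure \<Omega> \<longleftrightarrow> (\<forall>y\<in>\<Omega>. B x y \<ge> 0)"
proof
  assume *: "\<forall>y\<in>\<Omega>. B x y \<ge> 0"
  have cl: "B z x \<ge> 0" if "z \<in> closure \<Omega>" for z
  proof -
    have "closed {z. B z x \<ge> 0}" by (intro closed_Collect_le continuous_on_const contB)
    then have "closure \<Omega> \<subseteq> {z. B z x \<ge> 0}" using * symB by (intro closure_minimal) auto
    then show ?thesis using that by auto
  qed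
  have "x + inverse (real (Suc n)) *\<^sub>R e \<in> \<Omega>" for n
  proof -
    have "B z (x + inverse (real (Suc n)) *\<^sub>R e) > 0" if "z \<in> closure \<Omega> - {0}" for z
      using cl[of z] B_pos[of z e] e_in that by (simp add: B_lin add_nonneg_pos)
    then show ?thesis by (subst dual) auto
  qed
  moreover have "(\<lambda>n. x + inverse (real (Suc n)) *\<^sub>R e) \<longlonglongrightarrow> x + 0 *\<^sub>R e"
    by (intro tendsto_intros LIMSEQ_inverse_real_of_nat)
  ultimately show "x \<in> closure \<Omega>" unfolding closure_sequential by force
qed (use B_nonneg in blast)

lemma closure_scale: "x \<in> closure \<Omega> \<Longrightarrow> c \<ge> 0 \<Longrightarrow> c *\<^sub>R x \<in> closure \<Omega>"
  unfolding closure_iff by (simp add: B_lin)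

lemma closure_add: "x \<in> closure \<Omega> \<Longrightarrow> y \<in> closure \<Omega> \<Longrightarrow> x + y \<in> closure \<Omega>"
  unfolding closure_iff by (simp add: B_lin)

lemma closure_moves: assumes "moves G y" shows "G x \<in> closure \<Omega> \<longleftrightarrow> x \<in> closure \<Omega>"
proof -
  have "(\<forall>z\<in>\<Omega>. B (G x) z \<ge> 0) \<longleftrightarrow> (\<forall>z\<in>\<Omega>. B x (G z) \<ge> 0)" using assms by (simp add: moves_def)
  also have "\<dots> \<longleftrightarrow> (\<forall>z\<in>G ` \<Omega>. B x z \<ge> 0)" by blast
  also have "G ` \<Omega> = \<Omega>" using assms by (simp add: moves_def)
  finally show ?thesis unfolding closure_iff .
qed

text \<open>Compactness of the unit vectors in the closed cone. This provides the exponential decay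
  of exp(-B(x, y)) on the cone.\<close>

lemma B_lower: assumes "y \<in> \<Omega>" shows "\<exists>d>0. \<forall>x\<in>closure \<Omega>. B x y \<ge> d * norm x"
proof -
  let ?S = "sphere 0 1 \<inter> closure \<Omega>"
  have S: "compact ?S" by (intro compact_Int_closed) auto
  have "\<exists>d>0. \<forall>x\<in>?S. B x y \<ge> d"
  proof (cases "?S = {}")
    case False
    obtain u where u: "u \<in> ?S" "\<And>x. x \<in> ?S \<Longrightarrow> B u y \<le> B x y"
      using continuous_attains_inf[OF S False contB(2)] by blast
    moreover have "u \<noteq> 0" using u(1) by auto
    ultimately show ?thesis using B_pos[of u y] assms by (intro exI[of _ "B u y"]) auto
  qed (auto intro: exI[of _ 1])
  then obtain d where d: "d > 0" "\<And>x. x \<in> ?S \<Longrightarrow> B x y \<ge> d" by blast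
  have "B x y \<ge> d * norm x" if x: "x \<in> closure \<Omega>" for x
  proof (cases "x = 0")
    case False
    have "(1 / norm x) *\<^sub>R x \<in> ?S" using x False closure_scale by simp
    from d(2)[OF this] show ?thesis using False by (simp add: B_lin field_simps)
  qed simp
  then show ?thesis using d(1) by blast
qed

lemma ex_radius: "\<exists>\<rho>>0. cball e \<rho> \<subseteq> \<Omega>"
  using opn e_in open_contains_cball by blast

lemma emeasure_ball_pair: "emeasure lborel {p :: (real^'n) \<times> (real^'n). norm p < \<rho>} < \<infinity>"
  "\<rho> > 0 \<Longrightarrow> emeasure lborel {p :: (real^'n) \<times> (real^'n). norm p < \<rho>} \<noteq> 0"
proof -
  have eq: "{p :: (real^'n) \<times> (real^'n). norm p < \<rho>} = ball 0 \<rho>" by auto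
  show "emeasure lborel {p :: (real^'n) \<times> (real^'n). norm p < \<rho>} < \<infinity>"
    unfolding eq using emeasure_bounded_finite[OF bounded_ball] by simp
  assume "\<rho> > 0"
  then have "\<not> negligible (ball (0 :: (real^'n) \<times> (real^'n)) \<rho>)" by (intro open_not_negligible) auto
  then have "ball (0 :: (real^'n) \<times> (real^'n)) \<rho> \<notin> null_sets lborel"
    using null_sets_completionI negligible_iff_null_sets by blast
  then show "emeasure lborel {p :: (real^'n) \<times> (real^'n). norm p < \<rho>} \<noteq> 0" unfolding eq by (auto simp: null_sets_def)
qed

text \<open>Composition with the automorphism that carries \<open>e\<close> to \<open>y\<close> and
  translation by \<open>x\<close> moves the point to the base point i e. There the sub-mean value
  property applies on a fixed ball, whose horizontal slices are bounded by the Hardy supremum;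
  undoing the move gives \<Delta>(y)^(-s).\<close>

lemma hardy_pointwise:
  assumes q: "q \<ge> 1"
  shows "\<exists>C<\<infinity>. \<forall>F\<in>holomorphic_functions (tube \<Omega>). \<forall>x. \<forall>y\<in>\<Omega>.
    ennreal (norm (F (complex_vec x y)) powr q) \<le> C * (ennreal (\<Delta> y powr (- s)) * hardy_sup \<Omega> q F)"
proof -
  obtain \<rho> where \<rho>: "\<rho> > 0" "cball e \<rho> \<subseteq> \<Omega>" using ex_radius by blast
  let ?R = "{p :: (real^'n) \<times> (real^'n). norm p < \<rho>}"
  define v where "v = emeasure lborel ?R"
  have v: "v < \<infinity>" "v \<noteq> 0" unfolding v_def using emeasure_ball_pair[of \<rho>] \<rho>(1) by auto
  define w where "w = emeasure lborel (ball (0::real^'n) \<rho>)"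
  have w: "w < \<infinity>" unfolding w_def using emeasure_bounded_finite[OF bounded_ball] by simp
  have "ennreal (norm (F (complex_vec x y)) powr q) \<le> (inverse v * w) * (ennreal (\<Delta> y powr (- s)) * hardy_sup \<Omega> q F)"
    if F: "F \<in> holomorphic_functions (tube \<Omega>)" and y: "y \<in> \<Omega>" for F x y
  proof -
    obtain G where G: "moves G y" using ex_moves[OF y] by blast
    define F' where "F' = (\<lambda>z. F (tube_map x G z))"
    have F': "F' \<in> holomorphic_functions (tube \<Omega>)"
      unfolding F'_def by (rule holomorphic_tube_map[OF F]) (use G in \<open>auto simp: moves_def\<close>)
    have pt: "F' (complex_vec 0 e) = F (complex_vec x y)"
      using G linear_0[of G] by (simp add: F'_def tube_map_def moves_def)
    have F'm: "(\<lambda>p. ennreal (norm (F' (complex_vec (fst p) (e + snd p))) powr q)) \<in> borel_measurable (borel \<Otimes>\<^sub>M borel)"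
    proof -
      have "(\<lambda>p. (fst p, e + snd p)) \<in> borel \<Otimes>\<^sub>M borel \<rightarrow>\<^sub>M borel \<Otimes>\<^sub>M borel" by measurable
      from measurable_compose[OF this holomorphic_measurable[OF F' opn]]
      have [measurable]: "(\<lambda>p. F' (complex_vec (fst p) (e + snd p))) \<in> borel_measurable (borel \<Otimes>\<^sub>M borel)" by simp
      show ?thesis by measurable
    qed
    have "ball e \<rho> \<subseteq> \<Omega>" using \<rho>(2) by auto
    from submean[OF F' opn this q, of 0]
    have "ennreal (norm (F (complex_vec x y)) powr q) * v
        \<le> (\<integral>\<^sup>+p. ennreal (norm (F' (complex_vec (fst p) (e + snd p))) powr q) * indicator ?R p \<partial>lborel)"
      by (simp add: pt v_def)
    also have "\<dots> \<le> (\<integral>\<^sup>+p. ennreal (norm (F' (complex_vec (fst p) (e + snd p))) powr q) * indicator (ball 0 \<rho>) (snd p) \<partial>lborel)"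
    proof (rule nn_integral_mono)
      fix p :: "(real^'n) \<times> (real^'n)"
      have "norm (snd p) \<le> norm p" using norm_snd_le[of "snd p" "fst p"] by simp
      then show "ennreal (norm (F' (complex_vec (fst p) (e + snd p))) powr q) * indicator ?R p
          \<le> ennreal (norm (F' (complex_vec (fst p) (e + snd p))) powr q) * indicator (ball 0 \<rho>) (snd p)"
        by (auto simp: indicator_def)
    qed
    also have "\<dots> = (\<integral>\<^sup>+b. (\<integral>\<^sup>+a. ennreal (norm (F' (complex_vec a (e + b))) powr q) * indicator (ball 0 \<rho>) b \<partial>lborel) \<partial>lborel)"
    proof -
      have "(\<lambda>p :: (real^'n) \<times> (real^'n). indicator (ball 0 \<rho>) (snd p) :: ennreal) \<in> borel_measurable (borel \<Otimes>\<^sub>M borel)"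
        by (rule measurable_compose[OF measurable_snd borel_measurable_indicator]) simp
      from borel_measurable_times_ennreal[OF F'm this]
      have "(\<lambda>p. ennreal (norm (F' (complex_vec (fst p) (e + snd p))) powr q) * indicator (ball 0 \<rho>) (snd p))
          \<in> borel_measurable (borel \<Otimes>\<^sub>M borel)" .
      then have m: "(\<lambda>p. ennreal (norm (F' (complex_vec (fst p) (e + snd p))) powr q) * indicator (ball 0 \<rho>) (snd p))
          \<in> borel_measurable (lborel \<Otimes>\<^sub>M lborel)" by simp
      show ?thesis unfolding lborel_prod[symmetric] using lborel_pair.nn_integral_snd[OF m] by simp
    qed
    also have "\<dots> \<le> (\<integral>\<^sup>+b. hardy_sup \<Omega> q F' * indicator (ball (0::real^'n) \<rho>) b \<partial>lborel)"
    proof (rule nn_integral_mono)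
      fix b :: "real^'n"
      show "(\<integral>\<^sup>+a. ennreal (norm (F' (complex_vec a (e + b))) powr q) * indicator (ball 0 \<rho>) b \<partial>lborel)
          \<le> hardy_sup \<Omega> q F' * indicator (ball 0 \<rho>) b"
      proof (cases "b \<in> ball 0 \<rho>")
        case True
        then have "e + b \<in> \<Omega>" using \<rho>(2) by (auto simp: subset_iff dist_norm)
        then have "(\<integral>\<^sup>+a. ennreal (norm (F' (complex_vec a (e + b))) powr q) \<partial>lborel) \<le> hardy_sup \<Omega> q F'"
          unfolding hardy_sup_def by (rule SUP_upper)
        then show ?thesis using True by simp
      qed simp
    qed
    also have "\<dots> = hardy_sup \<Omega> q F' * w" by (simp add: nn_integral_cmult_indicator w_def)
    also have "hardy_sup \<Omega> q F' = ennreal (\<Delta> y powr (- s)) * hardy_sup \<Omega> q F"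
      unfolding F'_def by (rule hardy_sup_moves[OF F G y])
    finally have "ennreal (norm (F (complex_vec x y)) powr q) \<le> inverse v * ((ennreal (\<Delta> y powr (- s)) * hardy_sup \<Omega> q F) * w)"
      by (rule ennreal_mult_le_imp) (use v in auto)
    then show ?thesis by (simp add: mult_ac)
  qed
  moreover have "inverse v < \<infinity>" using v by (simp add: less_top[symmetric])
  then have "inverse v * w < \<infinity>" using w by (simp add: ennreal_mult_less_top)
  ultimately show ?thesis by blast
qed

text \<open>As for Hardy functions, but the weight enters on the fixed ball, where it has a positive
  minimum \<open>m\<close>; undoing the move gives the exponent -(\<nu> + s).\<close>

lemma bergman_pointwise:
  assumes q: "q \<ge> 1"
  shows "\<exists>C<\<infinity>. \<forall>F\<in>holomorphic_functions (tube \<Omega>). \<forall>x. \<forall>y\<in>\<Omega>.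
    ennreal (norm (F (complex_vec x y)) powr q) \<le> C * (ennreal (\<Delta> y powr (- (\<nu> + s))) * bergman_integral \<Omega> \<Delta> s q \<nu> F)"
proof -
  obtain \<rho> where \<rho>: "\<rho> > 0" "cball e \<rho> \<subseteq> \<Omega>" using ex_radius by blast
  let ?R = "{p :: (real^'n) \<times> (real^'n). norm p < \<rho>}"
  define v where "v = emeasure lborel ?R"
  have v: "v < \<infinity>" "v \<noteq> 0" unfolding v_def using emeasure_ball_pair[of \<rho>] \<rho>(1) by auto
  have cont: "continuous_on (cball e \<rho>) (\<lambda>t. \<Delta> t powr (\<nu> - s))"
    using \<rho>(2) det_pos by (intro continuous_intros continuous_on_subset[OF det_cont]) force+
  obtain u where u: "u \<in> cball e \<rho>" "\<And>t. t \<in> cball e \<rho> \<Longrightarrow> \<Delta> u powr (\<nu> - s) \<le> \<Delta> t powr (\<nu> - s)"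
    using continuous_attains_inf[OF compact_cball _ cont] \<rho>(1) by auto
  define m where "m = \<Delta> u powr (\<nu> - s)"
  have m: "m > 0" using det_pos[of u] u(1) \<rho>(2) by (auto simp: m_def)
  have "ennreal (norm (F (complex_vec x y)) powr q)
      \<le> (inverse v * ennreal (1 / m)) * (ennreal (\<Delta> y powr (- (\<nu> + s))) * bergman_integral \<Omega> \<Delta> s q \<nu> F)"
    if F: "F \<in> holomorphic_functions (tube \<Omega>)" and y: "y \<in> \<Omega>" for F x y
  proof -
    obtain G where G: "moves G y" using ex_moves[OF y] by blast
    define F' where "F' = (\<lambda>z. F (tube_map x G z))"
    have F': "F' \<in> holomorphic_functions (tube \<Omega>)"
      unfolding F'_def by (rule holomorphic_tube_map[OF F]) (use G in \<open>auto simp: moves_def\<close>)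
    have pt: "F' (complex_vec 0 e) = F (complex_vec x y)"
      using G linear_0[of G] by (simp add: F'_def tube_map_def moves_def)
    let ?k = "\<lambda>a t. ennreal (norm (F' (complex_vec a t)) powr q * \<Delta> t powr (\<nu> - s)) * indicator \<Omega> t"
    note km = bergman_measurable[OF F', of q "\<nu> - s"]
    have km': "(\<lambda>p. ?k (fst p) (e + snd p)) \<in> borel_measurable (borel \<Otimes>\<^sub>M borel)"
    proof -
      have "(\<lambda>p. (fst p, e + snd p)) \<in> borel \<Otimes>\<^sub>M borel \<rightarrow>\<^sub>M borel \<Otimes>\<^sub>M borel" by measurable
      from measurable_compose[OF this km] show ?thesis by simp
    qed
    have kt: "(\<lambda>t. \<integral>\<^sup>+a. ?k a t \<partial>lborel) \<in> borel_measurable borel"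
      using lborel.borel_measurable_nn_integral_fst[of "\<lambda>(t, a). ?k a t" borel] measurable_pair_swap[OF km]
      by (simp add: case_prod_unfold)
    have "ball e \<rho> \<subseteq> \<Omega>" using \<rho>(2) by auto
    from submean[OF F' opn this q, of 0]
    have "ennreal (norm (F (complex_vec x y)) powr q) * v
        \<le> (\<integral>\<^sup>+p. ennreal (norm (F' (complex_vec (fst p) (e + snd p))) powr q) * indicator ?R p \<partial>lborel)"
      by (simp add: pt v_def)
    also have "\<dots> \<le> (\<integral>\<^sup>+p. ennreal (1 / m) * ?k (fst p) (e + snd p) \<partial>lborel)"
    proof (rule nn_integral_mono)
      fix p :: "(real^'n) \<times> (real^'n)"
      show "ennreal (norm (F' (complex_vec (fst p) (e + snd p))) powr q) * indicator ?R p
          \<le> ennreal (1 / m) * ?k (fst p) (e + snd p)"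
      proof (cases "norm p < \<rho>")
        case True
        then have "norm (snd p) < \<rho>" using norm_snd_le[of "snd p" "fst p"] by simp
        then have b: "e + snd p \<in> cball e \<rho>" by (simp add: dist_norm)
        let ?n = "norm (F' (complex_vec (fst p) (e + snd p))) powr q"
        have "?n * 1 \<le> ?n * (1 / m * \<Delta> (e + snd p) powr (\<nu> - s))"
          using u(2)[OF b] m by (intro mult_left_mono) (auto simp: m_def[symmetric] field_simps)
        then have "ennreal ?n \<le> ennreal (1 / m * (?n * \<Delta> (e + snd p) powr (\<nu> - s)))"
          by (intro ennreal_leI) (simp add: mult_ac)
        then show ?thesis using True b \<rho>(2) m by (auto simp: ennreal_mult'[symmetric])
      qed simp
    qed
    also have "\<dots> = ennreal (1 / m) * (\<integral>\<^sup>+p. ?k (fst p) (e + snd p) \<partial>lborel)"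
      using km' by (intro nn_integral_cmult) (simp add: borel_prod)
    also have "(\<integral>\<^sup>+p. ?k (fst p) (e + snd p) \<partial>lborel) = (\<integral>\<^sup>+b. (\<integral>\<^sup>+a. ?k a (e + b) \<partial>lborel) \<partial>lborel)"
      unfolding lborel_prod[symmetric]
      by (subst lborel_pair.nn_integral_snd[symmetric]) (use km' in auto)
    also have "\<dots> = (\<integral>\<^sup>+b. (\<integral>\<^sup>+a. ?k a b \<partial>lborel) \<partial>lborel)"
      by (rule nn_integral_lborel_translate[OF kt])
    also have "\<dots> = bergman_integral \<Omega> \<Delta> s q \<nu> F'"
      unfolding bergman_integral_def by (subst lborel_pair.nn_integral_snd[symmetric]) (use km in auto)
    also have "\<dots> = ennreal (\<Delta> y powr (- (\<nu> + s))) * bergman_integral \<Omega> \<Delta> s q \<nu> F"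
      unfolding F'_def by (rule bergman_moves[OF F G y])
    finally have "ennreal (norm (F (complex_vec x y)) powr q)
        \<le> inverse v * (ennreal (1 / m) * (ennreal (\<Delta> y powr (- (\<nu> + s))) * bergman_integral \<Omega> \<Delta> s q \<nu> F))"
      by (rule ennreal_mult_le_imp) (use v in auto)
    then show ?thesis by (simp add: mult_ac)
  qed
  moreover have "inverse v < \<infinity>" using v by (simp add: less_top[symmetric])
  then have "inverse v * ennreal (1 / m) < \<infinity>" by (simp add: ennreal_mult_less_top)
  ultimately show ?thesis by blast
qed

text \<open>The complex-linear extension of B(_, u) to complex vectors.\<close>

definition pairing :: "real^'n \<Rightarrow> complex^'n \<Rightarrow> complex" where
  "pairing u z = Complex (B (Re_vec z) u) (B (Im_vec z) u)"

lemma pairing_complex_vec [simp]: "pairing u (complex_vec x y) = Complex (B x u) (B y u)"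
  by (simp add: pairing_def)

lemma pairing_clinear: "linear (pairing u)" "pairing u (c *s z) = c * pairing u z"
proof -
  have "linear (\<lambda>z. B (Re_vec z) u)" "linear (\<lambda>z. B (Im_vec z) u)"
    using linear_compose[OF linear_Re_vec linB(2)] linear_compose[OF linear_Im_vec linB(2)] by (simp_all add: o_def)
  then show "linear (pairing u)" by (auto simp: linear_iff pairing_def complex_eq_iff)
  show "pairing u (c *s z) = c * pairing u z"
    by (simp add: pairing_def Re_vec_smult Im_vec_smult B_lin complex_eq_iff)
qed

definition hol_at :: "(complex^'n \<Rightarrow> complex) \<Rightarrow> complex^'n \<Rightarrow> bool" where
  "hol_at f z \<longleftrightarrow> (\<exists>f'. (f has_derivative f') (at z) \<and> (\<forall>c v. f' (c *s v) = c * f' v))"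

lemma hol_at_const: "hol_at (\<lambda>z. c) z"
  unfolding hol_at_def by (intro exI[of _ "\<lambda>_. 0"]) auto

lemma hol_at_mult: assumes "hol_at f z" "hol_at g z" shows "hol_at (\<lambda>z. f z * g z) z"
proof -
  obtain f' where f': "(f has_derivative f') (at z)" "\<And>c v. f' (c *s v) = c * f' v" using assms(1) by (auto simp: hol_at_def)
  obtain g' where g': "(g has_derivative g') (at z)" "\<And>c v. g' (c *s v) = c * g' v" using assms(2) by (auto simp: hol_at_def)
  show ?thesis unfolding hol_at_def using has_derivative_mult[OF f'(1) g'(1)]
    by (intro exI[of _ "\<lambda>h. f z * g' h + f' h * g z"]) (auto simp: f'(2) g'(2) algebra_simps)
qed

lemma hol_at_prod: "(\<And>b. b \<in> S \<Longrightarrow> hol_at (f b) z) \<Longrightarrow> hol_at (\<lambda>z. \<Prod>b\<in>S. f b z) z"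
  by (induction S rule: infinite_finite_induct) (auto intro: hol_at_const hol_at_mult)

lemma hol_at_compose:
  assumes g: "(g has_field_derivative g') (at (pairing u z))" shows "hol_at (\<lambda>z. g (pairing u z)) z"
proof -
  have "(pairing u has_derivative pairing u) (at z)"
    using pairing_clinear(1) by (intro bounded_linear_imp_has_derivative) (simp add: linear_conv_bounded_linear)
  from has_derivative_compose[OF this g[unfolded has_field_derivative_def]]
  show ?thesis unfolding hol_at_def by (intro exI[of _ "\<lambda>h. g' * pairing u h"]) (auto simp: pairing_clinear(2))
qed

section \<open>The damping factor\<close>

definition shift :: real where
  "shift = (SOME t. t > 0 \<and> (\<forall>b\<in>Basis. e + t *\<^sub>R b \<in> \<Omega> \<and> e - t *\<^sub>R b \<in> \<Omega>))"

lemma shift: "shift > 0" "b \<in> Basis \<Longrightarrow> e + shift *\<^sub>R b \<in> \<Omega>" "b \<in> Basis \<Longrightarrow> e - shift *\<^sub>R b \<in> \<Omega>"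
proof -
  obtain \<rho> where \<rho>: "\<rho> > 0" "cball e \<rho> \<subseteq> \<Omega>" using ex_radius by blast
  have "\<exists>t. t > 0 \<and> (\<forall>b\<in>Basis. e + t *\<^sub>R b \<in> \<Omega> \<and> e - t *\<^sub>R b \<in> \<Omega>)"
    using \<rho> by (intro exI[of _ \<rho>]) (auto simp: subset_iff dist_norm)
  from someI_ex[OF this]
  show "shift > 0" "b \<in> Basis \<Longrightarrow> e + shift *\<^sub>R b \<in> \<Omega>" "b \<in> Basis \<Longrightarrow> e - shift *\<^sub>R b \<in> \<Omega>"
    unfolding shift_def[symmetric] by auto
qed

text \<open>All factors have modulus at most \<open>1\<close> because the directions \<open>e \<plusminus> shift b\<close> lie in the cone;
  since their differences span the space, the product decays in every direction.\<close>

definition damp :: "real \<Rightarrow> complex^'n \<Rightarrow> complex" where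
  "damp \<epsilon> z = (if z \<in> tube \<Omega> then \<Prod>b\<in>Basis.
     inverse (1 - \<i> * of_real \<epsilon> * pairing (e + shift *\<^sub>R b) z) * inverse (1 - \<i> * of_real \<epsilon> * pairing (e - shift *\<^sub>R b) z) else 0)"

text \<open>The real part of the factor is 1 + \<epsilon> B(y, u) \<ge> 1 by self-duality, and the
  imaginary part is -\<epsilon> B(x, u).\<close>

lemma factor_norm:
  assumes "y \<in> \<Omega>" "u \<in> \<Omega>" "\<epsilon> \<ge> 0"
  shows "(norm (1 - \<i> * of_real \<epsilon> * pairing u (complex_vec x y)))\<^sup>2 \<ge> 1 + (\<epsilon> * B x u)\<^sup>2"
proof -
  have "\<epsilon> * B y u \<ge> 0" using assms B_nonneg in_closure by simp
  then have "(1 + \<epsilon> * B y u)\<^sup>2 \<ge> 1\<^sup>2" by (intro power_mono) auto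
  moreover have "(norm (1 - \<i> * of_real \<epsilon> * pairing u (complex_vec x y)))\<^sup>2 = (1 + \<epsilon> * B y u)\<^sup>2 + (\<epsilon> * B x u)\<^sup>2"
    by (simp add: cmod_power2)
  ultimately show ?thesis by simp
qed

lemma factor_norm_ge_1:
  assumes "y \<in> \<Omega>" "u \<in> \<Omega>" "\<epsilon> \<ge> 0"
  shows "norm (1 - \<i> * of_real \<epsilon> * pairing u (complex_vec x y)) \<ge> 1"
proof -
  have "(norm (1 - \<i> * of_real \<epsilon> * pairing u (complex_vec x y)))\<^sup>2 \<ge> 1\<^sup>2" using factor_norm[OF assms, of x] by (smt (verit) zero_le_power2 one_power2)
  then show ?thesis by (rule power2_le_imp_le) simp
qed

lemma damp_holomorphic: assumes "\<epsilon> \<ge> 0" shows "damp \<epsilon> \<in> holomorphic_functions (tube \<Omega>)"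
  unfolding damp_def[abs_def]
proof (rule holomorphic_functions_cong[OF open_tube[OF opn]])
  fix z assume z: "z \<in> tube \<Omega>"
  have f: "hol_at (\<lambda>z. inverse (1 - \<i> * of_real \<epsilon> * pairing u z)) z" if u: "u \<in> \<Omega>" for u
  proof -
    have "1 - \<i> * of_real \<epsilon> * pairing u z \<noteq> 0"
      using factor_norm_ge_1[of "Im_vec z" u \<epsilon> "Re_vec z"] z u assms by (auto simp: tube_def)
    then have "((\<lambda>t. inverse (1 - \<i> * of_real \<epsilon> * t)) has_field_derivative
        - (inverse (1 - \<i> * of_real \<epsilon> * pairing u z) * (- (\<i> * of_real \<epsilon>)) * inverse (1 - \<i> * of_real \<epsilon> * pairing u z))) (at (pairing u z))"
      by (auto intro!: derivative_eq_intros)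
    then show ?thesis by (rule hol_at_compose)
  qed
  have "hol_at (\<lambda>z. \<Prod>b\<in>Basis. inverse (1 - \<i> * of_real \<epsilon> * pairing (e + shift *\<^sub>R b) z) * inverse (1 - \<i> * of_real \<epsilon> * pairing (e - shift *\<^sub>R b) z)) z"
    by (intro hol_at_prod hol_at_mult f shift)
  then show "\<exists>f'. ((\<lambda>z. \<Prod>b\<in>Basis. inverse (1 - \<i> * of_real \<epsilon> * pairing (e + shift *\<^sub>R b) z) * inverse (1 - \<i> * of_real \<epsilon> * pairing (e - shift *\<^sub>R b) z))
      has_derivative f') (at z) \<and> (\<forall>c v. f' (c *s v) = c * f' v)"
    by (simp add: hol_at_def)
qed

lemma damp_le_1: assumes "y \<in> \<Omega>" "\<epsilon> \<ge> 0" shows "norm (damp \<epsilon> (complex_vec x y)) \<le> 1"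
proof -
  have "norm (inverse (1 - \<i> * of_real \<epsilon> * pairing u (complex_vec x y))) \<le> 1" if "u \<in> \<Omega>" for u
    using factor_norm_ge_1[OF assms(1) that assms(2), of x] by (simp add: norm_inverse inverse_le_1_iff)
  then show ?thesis using assms(1) shift
    by (simp add: damp_def prod_norm[symmetric] norm_mult mult_le_one prod_le_1)
qed

lemma damp_nz: assumes "y \<in> \<Omega>" "\<epsilon> \<ge> 0" shows "damp \<epsilon> (complex_vec x y) \<noteq> 0"
proof -
  have "1 - \<i> * of_real \<epsilon> * pairing u (complex_vec x y) \<noteq> 0" if "u \<in> \<Omega>" for u
    using factor_norm_ge_1[OF assms(1) that assms(2), of x] by auto
  then show ?thesis using assms(1) shift by (simp add: damp_def)
qed

text \<open>The bound does not depend on the height \<open>y\<close>. For a basis vector b the two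
  directions give p = \<epsilon> B(x, e + t b) and q = \<epsilon> B(x, e - t b) with t the shift,
  and p^2 + q^2 \<ge> (p - q)^2 / 2 isolates B(x, b).\<close>

lemma damp_sq:
  assumes "y \<in> \<Omega>" "\<epsilon> \<ge> 0"
  shows "(norm (damp \<epsilon> (complex_vec x y)))\<^sup>2 \<le> (\<Prod>b\<in>Basis. 1 / (1 + 2 * (\<epsilon> * shift)\<^sup>2 * (B x b)\<^sup>2))"
proof -
  have f: "(norm (inverse (1 - \<i> * of_real \<epsilon> * pairing (e + shift *\<^sub>R b) (complex_vec x y)) * inverse (1 - \<i> * of_real \<epsilon> * pairing (e - shift *\<^sub>R b) (complex_vec x y))))\<^sup>2
      \<le> 1 / (1 + 2 * (\<epsilon> * shift)\<^sup>2 * (B x b)\<^sup>2)" if b: "b \<in> Basis" for b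
  proof -
    let ?p = "\<epsilon> * B x (e + shift *\<^sub>R b)" and ?q = "\<epsilon> * B x (e - shift *\<^sub>R b)"
    have "?p - ?q = 2 * (\<epsilon> * shift * B x b)" by (simp add: B_lin algebra_simps)
    then have "(?p - ?q)\<^sup>2 = 4 * ((\<epsilon> * shift)\<^sup>2 * (B x b)\<^sup>2)" by (simp add: power_mult_distrib)
    moreover have "(?p - ?q)\<^sup>2 + (?p + ?q)\<^sup>2 = 2 * (?p\<^sup>2 + ?q\<^sup>2)" by (simp add: power2_eq_square algebra_simps)
    ultimately have "4 * ((\<epsilon> * shift)\<^sup>2 * (B x b)\<^sup>2) \<le> 2 * (?p\<^sup>2 + ?q\<^sup>2)" by (smt (verit) zero_le_power2)
    moreover have "1 + 2 * X \<le> (1 + P) * (1 + Q)" if "4 * X \<le> 2 * (P + Q)" "0 \<le> P" "0 \<le> Q" for X P Q :: real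
    proof -
      have "2 * X \<le> P + Q" using that(1) by simp
      then have "1 + 2 * X \<le> 1 + (P + Q) + P * Q" using mult_nonneg_nonneg[OF that(2,3)] by linarith
      then show ?thesis by (simp add: algebra_simps)
    qed
    ultimately have 1: "1 + 2 * (\<epsilon> * shift)\<^sup>2 * (B x b)\<^sup>2 \<le> (1 + ?p\<^sup>2) * (1 + ?q\<^sup>2)"
      by (simp only: mult.assoc zero_le_power2)
    also have "\<dots> \<le> (norm (1 - \<i> * of_real \<epsilon> * pairing (e + shift *\<^sub>R b) (complex_vec x y)))\<^sup>2 * (norm (1 - \<i> * of_real \<epsilon> * pairing (e - shift *\<^sub>R b) (complex_vec x y)))\<^sup>2"
      using factor_norm[OF assms(1) shift(2)[OF b] assms(2), of x] factor_norm[OF assms(1) shift(3)[OF b] assms(2), of x]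
      by (intro mult_mono) auto
    finally have 2: "1 + 2 * (\<epsilon> * shift)\<^sup>2 * (B x b)\<^sup>2 \<le> \<dots>" .
    have "1 + 2 * (\<epsilon> * shift)\<^sup>2 * (B x b)\<^sup>2 > 0" by (intro add_pos_nonneg) auto
    from le_imp_inverse_le[OF 2 this]
    have "inverse ((norm (1 - \<i> * of_real \<epsilon> * pairing (e + shift *\<^sub>R b) (complex_vec x y)))\<^sup>2 * (norm (1 - \<i> * of_real \<epsilon> * pairing (e - shift *\<^sub>R b) (complex_vec x y)))\<^sup>2)
        \<le> 1 / (1 + 2 * (\<epsilon> * shift)\<^sup>2 * (B x b)\<^sup>2)" by (simp only: inverse_eq_divide)
    moreover have "(norm (inverse u * inverse w))\<^sup>2 = inverse ((norm u)\<^sup>2 * (norm w)\<^sup>2)" for u w :: complex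
      by (simp add: norm_mult norm_inverse power_mult_distrib power_inverse)
    ultimately show ?thesis by (simp only:)
  qed
  have "(norm (damp \<epsilon> (complex_vec x y)))\<^sup>2 = (\<Prod>b\<in>Basis. (norm (inverse (1 - \<i> * of_real \<epsilon> * pairing (e + shift *\<^sub>R b) (complex_vec x y)) * inverse (1 - \<i> * of_real \<epsilon> * pairing (e - shift *\<^sub>R b) (complex_vec x y))))\<^sup>2)"
    using assms(1) by (simp add: damp_def prod_norm[symmetric] prod_power_distrib)
  also have "\<dots> \<le> (\<Prod>b\<in>Basis. 1 / (1 + 2 * (\<epsilon> * shift)\<^sup>2 * (B x b)\<^sup>2))"
    by (rule prod_mono) (use f in auto)
  finally show ?thesis .
qed

lemma damp_tendsto: assumes "y \<in> \<Omega>" shows "(\<lambda>k. damp (1 / real (Suc k)) (complex_vec x y)) \<longlonglongrightarrow> 1"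
proof -
  have "(\<lambda>k. 1 / real (Suc k)) \<longlonglongrightarrow> 0" using LIMSEQ_inverse_real_of_nat by (simp add: inverse_eq_divide)
  then have k: "(\<lambda>k. complex_of_real (1 / real (Suc k))) \<longlonglongrightarrow> of_real 0" by (rule tendsto_of_real)
  have "(\<lambda>k. inverse (1 - \<i> * complex_of_real (1 / real (Suc k)) * w)) \<longlonglongrightarrow> inverse (1 - \<i> * of_real 0 * w)" for w
    by (intro tendsto_intros k) auto
  then have "(\<lambda>k. \<Prod>b\<in>Basis. inverse (1 - \<i> * complex_of_real (1 / real (Suc k)) * pairing (e + shift *\<^sub>R b) (complex_vec x y))
      * inverse (1 - \<i> * complex_of_real (1 / real (Suc k)) * pairing (e - shift *\<^sub>R b) (complex_vec x y)))
    \<longlonglongrightarrow> (\<Prod>b\<in>(Basis::(real^'n) set). inverse (1 - \<i> * of_real 0 * pairing (e + shift *\<^sub>R b) (complex_vec x y))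
      * inverse (1 - \<i> * of_real 0 * pairing (e - shift *\<^sub>R b) (complex_vec x y)))"
    by (intro tendsto_prod tendsto_mult)
  then show ?thesis using assms by (simp add: damp_def)
qed

definition damp_mass :: "real \<Rightarrow> ennreal" where
  "damp_mass \<epsilon> = (\<integral>\<^sup>+x. ennreal (\<Prod>b\<in>Basis. 1 / (1 + 2 * (\<epsilon> * shift)\<^sup>2 * (B x b)\<^sup>2)) \<partial>lborel)"

lemma damp_mass_finite: assumes "\<epsilon> > 0" shows "damp_mass \<epsilon> < \<infinity>"
proof -
  \<comment> \<open>Passage to the coordinates B(x, b), an invertible linear substitution since
    \<open>B\<close> is definite.\<close>
  define A where "A x = (\<Sum>b\<in>Basis. B x b *\<^sub>R b)" for x
  have A: "A x \<bullet> b = B x b" if "b \<in> Basis" for x b using that by (simp add: A_def inner_sum_left_Basis)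
  have linA: "linear A"
    by (auto simp: linear_iff A_def B_lin algebra_simps sum.distrib scaleR_sum_right)
  have "inj A"
  proof (subst linear_injective_0[OF linA], intro allI impI)
    fix x assume "A x = 0"
    then have "B x b = 0" if "b \<in> Basis" for b using A[OF that, of x] by simp
    then have "B x (\<Sum>b\<in>Basis. (x \<bullet> b) *\<^sub>R b) = 0"
      by (simp add: linear_sum[OF linB(1)] B_lin)
    then have "B x x = 0" by (simp add: euclidean_representation)
    then show "x = 0" using posB[of x] by force
  qed
  then have det: "det (matrix A) \<noteq> 0" using det_nz_iff_inj[OF linA] by simp
  let ?h = "\<lambda>x::real^'n. ennreal (\<Prod>b\<in>Basis. 1 / (1 + 2 * (\<epsilon> * shift)\<^sup>2 * (x \<bullet> b)\<^sup>2))"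
  have pos: "2 * (\<epsilon> * shift)\<^sup>2 > 0" using assms shift by simp
  have "(\<integral>\<^sup>+x. ?h x \<partial>lborel) = ennreal \<bar>det (matrix A)\<bar> * (\<integral>\<^sup>+x. ?h (A x) \<partial>lborel)"
    by (rule nn_integral_lborel_linear[OF linA det, of ?h]) measurable
  also have "(\<integral>\<^sup>+x. ?h (A x) \<partial>lborel) = damp_mass \<epsilon>"
    unfolding damp_mass_def by (simp add: A)
  finally have "ennreal \<bar>det (matrix A)\<bar> * damp_mass \<epsilon> < \<infinity>"
    using nn_integral_prod_inverse_square[OF pos, where 'a = "real^'n"] by simp
  then show ?thesis using det by (auto simp: ennreal_mult_less_top)
qed

lemma damp_L2: assumes "y \<in> \<Omega>" "\<epsilon> \<ge> 0"
  shows "(\<integral>\<^sup>+x. ennreal ((norm (damp \<epsilon> (complex_vec x y)))\<^sup>2) \<partial>lborel) \<le> damp_mass \<epsilon>"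
  unfolding damp_mass_def by (intro nn_integral_mono ennreal_leI damp_sq assms)

end

section \<open>The Hardy space and fourth powers\<close>

context symmetric_cone begin

definition laplace :: "real^'n \<Rightarrow> ennreal" where
  "laplace \<xi> = (\<integral>\<^sup>+y. ennreal (exp (- 2 * B y \<xi>)) * indicator \<Omega> y \<partial>lborel)"

definition slice_volume :: "real^'n \<Rightarrow> ennreal" where
  "slice_volume \<xi> = (\<integral>\<^sup>+\<eta>. indicator (closure \<Omega>) \<eta> * indicator (closure \<Omega>) (\<xi> - \<eta>) \<partial>lborel)"

lemma B_measurable [measurable]: "(\<lambda>y. B y x) \<in> borel_measurable borel" "B x \<in> borel_measurable borel"
  using contB by (auto intro!: borel_measurable_continuous_onI)

lemma laplace_e_finite: "laplace e < \<infinity>"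
proof -
  obtain d where d: "d > 0" "\<And>x. x \<in> closure \<Omega> \<Longrightarrow> B x e \<ge> d * norm x" using B_lower[OF e_in] by blast
  have "laplace e \<le> (\<integral>\<^sup>+x. ennreal (exp (- (2 * d) * norm x)) \<partial>(lborel :: (real^'n) measure))"
    unfolding laplace_def by (rule nn_integral_mono) (use d(2) in_closure in \<open>auto simp: indicator_def intro!: ennreal_leI\<close>)
  also have "\<dots> < \<infinity>" by (rule nn_integral_exp_norm) (use d in simp)
  finally show ?thesis .
qed

lemma slice_volume_e_finite: "slice_volume e < \<infinity>"
proof -
  obtain d where d: "d > 0" "\<And>x. x \<in> closure \<Omega> \<Longrightarrow> B x e \<ge> d * norm x" using B_lower[OF e_in] by blast
  have "norm \<eta> \<le> B e e / d" if "\<eta> \<in> closure \<Omega>" "e - \<eta> \<in> closure \<Omega>" for \<eta>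
  proof -
    have "d * norm \<eta> \<le> B \<eta> e" "B (e - \<eta>) e \<ge> 0" using that d(2) B_nonneg e_in by blast+
    then have "d * norm \<eta> \<le> B e e" by (simp add: B_lin)
    then show ?thesis using d(1) by (simp add: field_simps)
  qed
  then have "slice_volume e \<le> (\<integral>\<^sup>+\<eta>. indicator (cball (0::real^'n) (B e e / d)) \<eta> \<partial>lborel)"
    unfolding slice_volume_def by (intro nn_integral_mono) (auto simp: indicator_def)
  also have "\<dots> < \<infinity>" using emeasure_bounded_finite[OF bounded_cball] by simp
  finally show ?thesis .
qed

text \<open>Both functions are homogeneous under the maps \<open>G\<close>, of opposite degrees.\<close>

lemma laplace_slice_volume:
  assumes y: "y \<in> \<Omega>" shows "laplace y * slice_volume y = laplace e * slice_volume e"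
proof -
  obtain G where G: "moves G y" using ex_moves[OF y] by blast
  have lin: "linear G" and self: "B (G x) z = B x (G z)" and Ge: "G e = y" for x z
    using G by (auto simp: moves_def)
  \<comment> \<open>Self-adjointness turns B(t, G e) into B(G t, e), so that \<open>G\<close>
    becomes a substitution.\<close>
  have "laplace y = (\<integral>\<^sup>+t. ennreal (exp (- 2 * B (G t) e)) * indicator \<Omega> (G t) \<partial>lborel)"
    unfolding laplace_def by (intro nn_integral_cong) (simp add: self Ge indicator_def moves_in[OF G])
  also have "\<dots> = ennreal (\<Delta> y powr - s) * laplace e"
    unfolding laplace_def by (rule nn_integral_moves[OF G y]) measurable
  finally have 1: "laplace y = ennreal (\<Delta> y powr - s) * laplace e" .
  have "slice_volume e = (\<integral>\<^sup>+\<eta>. indicator (closure \<Omega>) (G \<eta>) * indicator (closure \<Omega>) (y - G \<eta>) \<partial>lborel)"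
    unfolding slice_volume_def
    by (intro nn_integral_cong) (simp add: indicator_def closure_moves[OF G] linear_diff[OF lin, symmetric] Ge[symmetric])
  also have "\<dots> = ennreal (\<Delta> y powr - s) * slice_volume y"
    unfolding slice_volume_def by (rule nn_integral_moves[OF G y]) measurable
  finally show ?thesis by (simp add: 1 mult_ac)
qed

text \<open>The frontier of a convex set is a null set. This lets
  \<open>laplace_slice_volume\<close>, which holds on the open cone, be used in integrals over the
  closed one.\<close>

lemma AE_closure_imp_in: "AE \<xi> in lborel. \<xi> \<in> closure \<Omega> \<longrightarrow> \<xi> \<in> \<Omega>"
proof -
  have "negligible (frontier \<Omega>)" by (rule negligible_convex_frontier[OF cvx])
  then have "AE \<xi> in lebesgue. \<xi> \<notin> frontier \<Omega>"
    by (intro AE_not_in) (simp add: negligible_iff_null_sets)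
  then have "AE \<xi> in lborel. \<xi> \<notin> frontier \<Omega>" by (simp add: AE_completion_iff)
  then show ?thesis by eventually_elim (use opn in \<open>auto simp: frontier_def interior_open\<close>)
qed

lemma slice_measurable:
  assumes F: "F \<in> holomorphic_functions (tube \<Omega>)"
  shows "(\<lambda>x. F (complex_vec x y)) \<in> borel_measurable borel"
proof -
  have "(\<lambda>x. (x, y)) \<in> borel \<rightarrow>\<^sub>M (borel \<Otimes>\<^sub>M borel)" by measurable
  from measurable_compose[OF this holomorphic_measurable[OF F opn]] show ?thesis by simp
qed

lemma slice_continuous:
  assumes F: "F \<in> holomorphic_functions (tube \<Omega>)" and y: "y \<in> \<Omega>"
  shows "continuous_on UNIV (\<lambda>x. F (complex_vec x y))"
proof -
  have "continuous_on UNIV (\<lambda>x. case (x, y) of (x, y) \<Rightarrow> complex_vec x y)"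
    by (rule continuous_on_compose2[OF continuous_on_complex_vec]) (auto intro: continuous_intros)
  then show ?thesis
    by (intro continuous_on_compose2[OF holomorphic_continuous[OF F]]) (use y in auto)
qed

end

locale symmetric_cone_fourier = symmetric_cone \<Omega> B \<Delta> s r e + fp: fourier_pair B k
  for \<Omega> :: "(real^'n) set" and B \<Delta> s r e k

context symmetric_cone_fourier begin

section \<open>Boundary transform of a damped function\<close>

context
  fixes F :: "complex^'n \<Rightarrow> complex" and \<epsilon> :: real
  assumes F: "F \<in> holomorphic_functions (tube \<Omega>)" and hs: "hardy_sup \<Omega> 2 F < \<infinity>" and \<epsilon>: "\<epsilon> > 0"
begin

definition "F\<^sub>\<epsilon> z = F z * damp \<epsilon> z"

lemma F\<^sub>\<epsilon>_holomorphic: "F\<^sub>\<epsilon> \<in> holomorphic_functions (tube \<Omega>)"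
  unfolding F\<^sub>\<epsilon>_def[abs_def] using \<epsilon> by (intro holomorphic_mult F damp_holomorphic) simp

definition "damped_slice y x = F\<^sub>\<epsilon> (complex_vec x y)"

lemma damped_slice_measurable [measurable]: "damped_slice y \<in> borel_measurable borel"
  unfolding damped_slice_def[abs_def] by (rule slice_measurable[OF F\<^sub>\<epsilon>_holomorphic])

lemma damped_slice_continuous: "y \<in> \<Omega> \<Longrightarrow> continuous_on UNIV (damped_slice y)"
  unfolding damped_slice_def[abs_def] by (rule slice_continuous[OF F\<^sub>\<epsilon>_holomorphic])

lemma norm_damped_slice: "y \<in> \<Omega> \<Longrightarrow> norm (damped_slice y x) \<le> norm (F (complex_vec x y))"
  using mult_left_mono[OF damp_le_1[of y \<epsilon> x], of "norm (F (complex_vec x y))"] \<epsilon> by (simp add: damped_slice_def F\<^sub>\<epsilon>_def norm_mult)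

lemma damped_slice_bounded: assumes y: "y \<in> \<Omega>" shows "bounded (range (damped_slice y))"
proof -
  obtain C where C: "C < \<infinity>" and b: "\<And>x. ennreal (norm (F (complex_vec x y)) powr 2) \<le> C * (ennreal (\<Delta> y powr (- s)) * hardy_sup \<Omega> 2 F)"
    using hardy_pointwise[of 2] F y by auto
  let ?D = "C * (ennreal (\<Delta> y powr (- s)) * hardy_sup \<Omega> 2 F)"
  have D: "?D < \<infinity>" using C hs by (simp add: ennreal_mult_less_top)
  have "norm (damped_slice y x) \<le> sqrt (enn2real ?D)" for x
  proof -
    have "norm (F (complex_vec x y)) powr 2 \<le> enn2real ?D"
      using enn2real_mono[OF b[of x]] D by simp
    then have "(norm (F (complex_vec x y)))\<^sup>2 \<le> enn2real ?D" by simp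
    then show ?thesis using norm_damped_slice[OF y, of x] real_le_rsqrt by (meson order_trans)
  qed
  then show ?thesis by (auto simp: bounded_iff)
qed

lemma damped_slice_L2: assumes y: "y \<in> \<Omega>" shows "(\<integral>\<^sup>+x. ennreal ((norm (damped_slice y x))\<^sup>2) \<partial>lborel) \<le> hardy_sup \<Omega> 2 F"
proof -
  have "(\<integral>\<^sup>+x. ennreal ((norm (damped_slice y x))\<^sup>2) \<partial>lborel) \<le> (\<integral>\<^sup>+x. ennreal (norm (F (complex_vec x y)) powr 2) \<partial>lborel)"
    by (intro nn_integral_mono ennreal_leI) (simp add: power_mono norm_damped_slice[OF y])
  also have "\<dots> \<le> hardy_sup \<Omega> 2 F" unfolding hardy_sup_def by (rule SUP_upper[OF y])
  finally show ?thesis .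
qed

text \<open>Bounds the integrals of the moduli of all damped slices at once, by a b \<le> a^2 + b^2.
  It may grow as \<epsilon> tends to 0 and must not occur in the final estimate.\<close>

definition "slice_mass = enn2real (hardy_sup \<Omega> 2 F + damp_mass \<epsilon>)"

lemma ennreal_slice_mass: "ennreal slice_mass = hardy_sup \<Omega> 2 F + damp_mass \<epsilon>"
  unfolding slice_mass_def using hs damp_mass_finite[OF \<epsilon>] by (simp add: less_top)

lemma slice_mass_nonneg: "slice_mass \<ge> 0" by (simp add: slice_mass_def)

lemma damped_slice_L1: assumes y: "y \<in> \<Omega>" shows "(\<integral>\<^sup>+x. ennreal (norm (damped_slice y x)) \<partial>lborel) \<le> ennreal slice_mass"
proof -
  note [measurable] = slice_measurable[OF F] slice_measurable[OF damp_holomorphic]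
  have "(\<integral>\<^sup>+x. ennreal (norm (damped_slice y x)) \<partial>lborel)
      \<le> (\<integral>\<^sup>+x. ennreal (norm (F (complex_vec x y)) powr 2) + ennreal ((norm (damp \<epsilon> (complex_vec x y)))\<^sup>2) \<partial>lborel)"
  proof (rule nn_integral_mono)
    fix x
    have "a * b \<le> a\<^sup>2 + b\<^sup>2" for a b :: real
    proof -
      have "2 * (a * b) \<le> a\<^sup>2 + b\<^sup>2" using sum_squares_bound[of a b] by (simp add: mult.assoc)
      then show ?thesis using zero_le_power2[of a] zero_le_power2[of b] by linarith
    qed
    then show "ennreal (norm (damped_slice y x)) \<le> ennreal (norm (F (complex_vec x y)) powr 2) + ennreal ((norm (damp \<epsilon> (complex_vec x y)))\<^sup>2)"
      by (simp add: damped_slice_def F\<^sub>\<epsilon>_def norm_mult ennreal_plus[symmetric] ennreal_leI del: ennreal_plus)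
  qed
  also have "\<dots> = (\<integral>\<^sup>+x. ennreal (norm (F (complex_vec x y)) powr 2) \<partial>lborel) + (\<integral>\<^sup>+x. ennreal ((norm (damp \<epsilon> (complex_vec x y)))\<^sup>2) \<partial>lborel)"
    using \<epsilon> by (intro nn_integral_add) (auto intro!: measurable)
  also have "\<dots> \<le> hardy_sup \<Omega> 2 F + damp_mass \<epsilon>"
    unfolding hardy_sup_def using \<epsilon> by (intro add_mono SUP_upper damp_L2 y) simp
  finally show ?thesis by (simp add: ennreal_slice_mass)
qed

lemma damped_slice_integrable: "y \<in> \<Omega> \<Longrightarrow> integrable lborel (damped_slice y)"
  using damped_slice_L1[of y] by (intro integrableI_bounded) (auto simp: le_less_trans)

lemma fourier_damped_slice_bound: assumes "y \<in> \<Omega>" shows "norm (fourier B (damped_slice y) \<xi>) \<le> slice_mass"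
proof -
  have "ennreal (\<integral>x. norm (damped_slice y x) \<partial>lborel) \<le> ennreal slice_mass"
    using damped_slice_L1[OF assms] damped_slice_integrable[OF assms] by (subst nn_integral_eq_integral[symmetric]) auto
  then have "(\<integral>x. norm (damped_slice y x) \<partial>lborel) \<le> slice_mass" using slice_mass_nonneg by (simp add: ennreal_le_iff)
  then show ?thesis using fourier_bound[of B "damped_slice y" \<xi>] by simp
qed

text \<open>Either side is the integral over the real part of \<open>F\<^sub>\<epsilon>\<close>
  times the exponential of -i times the pairing of z with \<xi>, at one of the two heights. This
  product is holomorphic in z, so \<open>contour_shift\<close> applies.\<close>

lemma fourier_damped_slice_shift:
  assumes y: "y \<in> \<Omega>" "y' \<in> \<Omega>"
  shows "of_real (exp (B y \<xi>)) * fourier B (damped_slice y) \<xi> = of_real (exp (B y' \<xi>)) * fourier B (damped_slice y') \<xi>"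
proof -
  define E where "E z = (if z \<in> tube \<Omega> then exp (- \<i> * pairing \<xi> z) else 0)" for z
  have E: "E \<in> holomorphic_functions (tube \<Omega>)" unfolding E_def[abs_def]
  proof (rule holomorphic_functions_cong[OF open_tube[OF opn]])
    fix z
    have "((\<lambda>t. exp (- \<i> * t)) has_field_derivative (- \<i>) * exp (- \<i> * pairing \<xi> z)) (at (pairing \<xi> z))"
      by (auto intro!: derivative_eq_intros)
    from hol_at_compose[OF this]
    show "\<exists>f'. ((\<lambda>z. exp (- \<i> * pairing \<xi> z)) has_derivative f') (at z) \<and> (\<forall>c v. f' (c *s v) = c * f' v)"
      unfolding hol_at_def .
  qed
  define P where "P z = F\<^sub>\<epsilon> z * E z" for z
  have P: "P \<in> holomorphic_functions (tube \<Omega>)" unfolding P_def[abs_def] by (rule holomorphic_mult[OF F\<^sub>\<epsilon>_holomorphic E])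
  have Pv: "P (complex_vec x t) = of_real (exp (B t \<xi>)) * (damped_slice t x * cis (- B x \<xi>))" if "t \<in> \<Omega>" for x t
    using that by (simp add: P_def E_def damped_slice_def exp_eq_polar)
  let ?w = "y' - y"
  let ?C = "exp (\<bar>B y \<xi>\<bar> + \<bar>B ?w \<xi>\<bar>)"
  have int: "(\<integral>x. P (complex_vec x t) \<partial>lborel) = of_real (exp (B t \<xi>)) * fourier B (damped_slice t) \<xi>" if "t \<in> \<Omega>" for t
    unfolding fourier_def Pv[OF that] by (rule integral_mult_right_zero)
  have "(\<integral>x. P (complex_vec x y) \<partial>lborel) = (\<integral>x. P (complex_vec x (y + ?w)) \<partial>lborel)"
  proof (rule contour_shift[OF P opn cvx y(1), of ?w "ennreal (?C * slice_mass)"])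
    fix t :: real assume t: "t \<in> {0..1}"
    have "(1 - t) *\<^sub>R y + t *\<^sub>R y' \<in> \<Omega>" using cvx y t by (intro convexD) auto
    then have in\<Omega>: "y + t *\<^sub>R ?w \<in> \<Omega>" by (simp add: algebra_simps)
    have "\<bar>t * B ?w \<xi>\<bar> \<le> 1 * \<bar>B ?w \<xi>\<bar>" using t unfolding abs_mult by (intro mult_right_mono) auto
    then have tw: "\<bar>t * B ?w \<xi>\<bar> \<le> \<bar>B ?w \<xi>\<bar>" by simp
    have e: "exp (B (y + t *\<^sub>R ?w) \<xi>) \<le> ?C"
    proof -
      have "B y \<xi> + t * B ?w \<xi> \<le> \<bar>B y \<xi>\<bar> + \<bar>B ?w \<xi>\<bar>"
        using abs_ge_self[of "t * B ?w \<xi>"] abs_ge_self[of "B y \<xi>"] tw by linarith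
      then show ?thesis by (simp only: B_lin(1,5) real_scaleR_def exp_le_cancel_iff)
    qed
    have "(\<integral>\<^sup>+x. ennreal (norm (P (complex_vec x (y + t *\<^sub>R ?w)))) \<partial>lborel)
        \<le> (\<integral>\<^sup>+x. ennreal ?C * ennreal (norm (damped_slice (y + t *\<^sub>R ?w) x)) \<partial>lborel)"
      unfolding Pv[OF in\<Omega>] using e
      by (intro nn_integral_mono) (simp add: norm_mult ennreal_mult'[symmetric] ennreal_leI mult_right_mono)
    also have "\<dots> = ennreal ?C * (\<integral>\<^sup>+x. ennreal (norm (damped_slice (y + t *\<^sub>R ?w) x)) \<partial>lborel)"
      by (rule nn_integral_cmult) simp
    also have "\<dots> \<le> ennreal ?C * ennreal slice_mass" by (intro mult_left_mono damped_slice_L1 in\<Omega>) simp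
    finally show "(\<integral>\<^sup>+x. ennreal (norm (P (complex_vec x (y + t *\<^sub>R ?w)))) \<partial>lborel) \<le> ennreal (?C * slice_mass)"
      by (simp add: ennreal_mult')
  qed (use y in auto)
  then show ?thesis using int[OF y(1)] int[OF y(2)] by simp
qed

text \<open>The Fourier transform of the boundary values, up to the factor \<open>exp\<close> that shifts the height.\<close>

definition "boundary_transform \<xi> = of_real (exp (B e \<xi>)) * fourier B (damped_slice e) \<xi>"

lemma fourier_damped_slice: assumes y: "y \<in> \<Omega>" shows "fourier B (damped_slice y) \<xi> = of_real (exp (- B y \<xi>)) * boundary_transform \<xi>"
proof -
  have "boundary_transform \<xi> = of_real (exp (B y \<xi>)) * fourier B (damped_slice y) \<xi>" unfolding boundary_transform_def by (rule fourier_damped_slice_shift[OF e_in y])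
  moreover have "complex_of_real (exp (- B y \<xi>)) * of_real (exp (B y \<xi>)) = 1"
    by (simp flip: of_real_mult exp_add)
  ultimately show ?thesis by (simp add: mult.assoc[symmetric])
qed

lemma boundary_transform_measurable [measurable]: "boundary_transform \<in> borel_measurable borel"
proof -
  have [measurable]: "fourier B (damped_slice e) \<in> borel_measurable borel" by (rule fourier_measurable[OF bil]) simp
  show ?thesis unfolding boundary_transform_def[abs_def] by measurable
qed

lemma boundary_transform_bound: assumes y: "y \<in> \<Omega>" shows "norm (boundary_transform \<xi>) \<le> exp (B y \<xi>) * slice_mass"
proof -
  have "norm (boundary_transform \<xi>) = exp (B y \<xi>) * norm (fourier B (damped_slice y) \<xi>)"
    unfolding boundary_transform_def fourier_damped_slice_shift[OF e_in y] by (simp add: norm_mult)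
  then show ?thesis using fourier_damped_slice_bound[OF y] by (simp add: mult_left_mono)
qed

text \<open>Outside the closed cone some y in the cone has B(y, \<xi>) < 0, and the bound at the
  heights (n+1) y tends to 0.\<close>

lemma boundary_transform_support: assumes "\<xi> \<notin> closure \<Omega>" shows "boundary_transform \<xi> = 0"
proof -
  obtain y where y: "y \<in> \<Omega>" "B y \<xi> < 0" using assms unfolding closure_iff by (auto simp: symB not_le)
  have "norm (boundary_transform \<xi>) \<le> exp (B y \<xi>) ^ Suc n * slice_mass" for n
    using boundary_transform_bound[OF cone[OF y(1)], of "real (Suc n)" \<xi>] by (simp add: B_lin exp_of_nat_mult[symmetric] del: power_Suc of_nat_Suc)
  moreover have "(\<lambda>n. exp (B y \<xi>) ^ n) \<longlonglongrightarrow> 0" by (rule LIMSEQ_power_zero) (use y(2) in simp)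
  then have "(\<lambda>n. exp (B y \<xi>) ^ Suc n * slice_mass) \<longlonglongrightarrow> 0 * slice_mass" by (rule tendsto_mult_right[OF LIMSEQ_Suc])
  ultimately have "norm (boundary_transform \<xi>) \<le> 0 * slice_mass" by (intro LIMSEQ_le_const) auto
  then show ?thesis by simp
qed

text \<open>The bound at height y/2 leaves a factor exp(-B(y, \<xi>) / 2), which decays
  exponentially on the closed cone.\<close>

lemma fourier_damped_slice_integrable: assumes y: "y \<in> \<Omega>" shows "integrable lborel (fourier B (damped_slice y))"
proof (rule integrableI_bounded)
  show "fourier B (damped_slice y) \<in> borel_measurable lborel" using fourier_measurable[OF bil damped_slice_measurable] by simp
  have h: "(1 / 2) *\<^sub>R y \<in> \<Omega>" using cone y by simp
  obtain d where d: "d > 0" "\<And>x. x \<in> closure \<Omega> \<Longrightarrow> B x ((1 / 2) *\<^sub>R y) \<ge> d * norm x" using B_lower[OF h] by blast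
  have "norm (fourier B (damped_slice y) \<xi>) \<le> exp (- d * norm \<xi>) * slice_mass" for \<xi>
  proof (cases "\<xi> \<in> closure \<Omega>")
    case True
    have "norm (fourier B (damped_slice y) \<xi>) = exp (- B y \<xi>) * norm (boundary_transform \<xi>)" by (simp add: fourier_damped_slice[OF y] norm_mult)
    also have "\<dots> \<le> exp (- B y \<xi>) * (exp (B ((1 / 2) *\<^sub>R y) \<xi>) * slice_mass)" by (intro mult_left_mono boundary_transform_bound h) simp
    also have "\<dots> = exp (- B \<xi> ((1 / 2) *\<^sub>R y)) * slice_mass"
      by (simp add: B_lin symB[of \<xi> y] mult.assoc[symmetric] exp_add[symmetric])
    also have "\<dots> \<le> exp (- d * norm \<xi>) * slice_mass" using d(2)[OF True] slice_mass_nonneg by (intro mult_right_mono) auto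
    finally show ?thesis .
  qed (simp add: fourier_damped_slice[OF y] boundary_transform_support slice_mass_nonneg)
  then have "(\<integral>\<^sup>+\<xi>. ennreal (norm (fourier B (damped_slice y) \<xi>)) \<partial>lborel) \<le> (\<integral>\<^sup>+\<xi>. ennreal (exp (- d * norm \<xi>)) * ennreal slice_mass \<partial>(lborel::(real^'n) measure))"
    by (intro nn_integral_mono) (simp add: ennreal_mult'[symmetric] ennreal_leI slice_mass_nonneg)
  also have "\<dots> = (\<integral>\<^sup>+\<xi>. ennreal (exp (- d * norm \<xi>)) \<partial>(lborel::(real^'n) measure)) * ennreal slice_mass"
    by (rule nn_integral_multc) simp
  also have "\<dots> < \<infinity>" using nn_integral_exp_norm[OF d(1), where 'a = "real^'n"] by (simp add: ennreal_mult_less_top)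
  finally show "(\<integral>\<^sup>+\<xi>. ennreal (norm (fourier B (damped_slice y) \<xi>)) \<partial>lborel) < \<infinity>" .
qed

lemma damped_slice_nice: "y \<in> \<Omega> \<Longrightarrow> fourier_nice B (damped_slice y)"
  by (simp add: fourier_nice_def damped_slice_continuous damped_slice_bounded damped_slice_integrable fourier_damped_slice_integrable)

text \<open>Plancherel at the heights e / (j+1), where the damped slices are dominated by those of
  \<open>F\<close>, and Fatou's lemma. Unlike \<open>slice_mass\<close>, the bound does not depend
  on \<epsilon>.\<close>

lemma boundary_transform_L2: "ennreal k * (\<integral>\<^sup>+\<xi>. ennreal ((norm (boundary_transform \<xi>))\<^sup>2) \<partial>lborel) \<le> hardy_sup \<Omega> 2 F"
proof -
  let ?y = "\<lambda>j. inverse (real (Suc j)) *\<^sub>R e"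
  let ?u = "\<lambda>j \<xi>. ennreal ((norm (fourier B (damped_slice (?y j)) \<xi>))\<^sup>2)"
  have y: "?y j \<in> \<Omega>" for j using cone e_in by simp
  have um: "?u j \<in> borel_measurable lborel" for j
    using fourier_measurable[OF bil damped_slice_measurable, of "?y j"] by measurable
  have lim: "(\<lambda>j. ?u j \<xi>) \<longlonglongrightarrow> ennreal ((norm (boundary_transform \<xi>))\<^sup>2)" for \<xi>
  proof -
    have "(\<lambda>j. (exp (- (inverse (real (Suc j)) * B e \<xi>)) * norm (boundary_transform \<xi>))\<^sup>2) \<longlonglongrightarrow> (exp (- (0 * B e \<xi>)) * norm (boundary_transform \<xi>))\<^sup>2"
      by (intro tendsto_intros LIMSEQ_inverse_real_of_nat)
    from tendsto_ennrealI[OF this]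
    have "(\<lambda>j. ennreal ((exp (- (inverse (real (Suc j)) * B e \<xi>)) * norm (boundary_transform \<xi>))\<^sup>2)) \<longlonglongrightarrow> ennreal ((norm (boundary_transform \<xi>))\<^sup>2)" by simp
    moreover have "norm (fourier B (damped_slice (?y j)) \<xi>) = exp (- (inverse (real (Suc j)) * B e \<xi>)) * norm (boundary_transform \<xi>)" for j
      unfolding fourier_damped_slice[OF y] norm_mult B_lin(5) by simp
    ultimately show ?thesis by (simp only:)
  qed
  have "ennreal k * (\<integral>\<^sup>+\<xi>. ennreal ((norm (boundary_transform \<xi>))\<^sup>2) \<partial>lborel) = ennreal k * (\<integral>\<^sup>+\<xi>. liminf (\<lambda>j. ?u j \<xi>) \<partial>lborel)"
    using lim_imp_Liminf[OF _ lim] by simp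
  also have "\<dots> = (\<integral>\<^sup>+\<xi>. liminf (\<lambda>j. ennreal k * ?u j \<xi>) \<partial>lborel)"
  proof -
    have "liminf (\<lambda>j. ennreal k * ?u j \<xi>) = ennreal k * liminf (\<lambda>j. ?u j \<xi>)" for \<xi>
      using lim_imp_Liminf[OF _ ennreal_tendsto_cmult[OF _ lim]] lim_imp_Liminf[OF _ lim] by simp
    then show ?thesis by (simp only:) (rule nn_integral_cmult[symmetric], rule borel_measurable_liminf, rule um)
  qed
  also have "\<dots> \<le> liminf (\<lambda>j. \<integral>\<^sup>+\<xi>. ennreal k * ?u j \<xi> \<partial>lborel)" using um by (intro nn_integral_liminf) auto
  also have "\<dots> \<le> hardy_sup \<Omega> 2 F"
  proof -
    have "(\<integral>\<^sup>+\<xi>. ennreal k * ?u j \<xi> \<partial>lborel) \<le> hardy_sup \<Omega> 2 F" for j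
      using fp.plancherel[OF damped_slice_nice[OF y[of j]]] damped_slice_L2[OF y[of j]] um[of j] by (simp add: nn_integral_cmult)
    then show ?thesis by (intro Liminf_le) auto
  qed
  finally show ?thesis .
qed


definition "abs_convolution \<xi> = (\<integral>\<^sup>+\<eta>. ennreal (norm (boundary_transform \<eta>)) * ennreal (norm (boundary_transform (\<xi> - \<eta>))) \<partial>lborel)"

definition "square_convolution \<xi> = (\<integral>\<^sup>+\<eta>. ennreal ((norm (boundary_transform \<eta>))\<^sup>2) * ennreal ((norm (boundary_transform (\<xi> - \<eta>)))\<^sup>2) \<partial>lborel)"

lemma convolutions_measurable [measurable]: "abs_convolution \<in> borel_measurable borel" "square_convolution \<in> borel_measurable borel"
  unfolding abs_convolution_def[abs_def] square_convolution_def[abs_def]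
  using lborel.borel_measurable_nn_integral[of "\<lambda>\<xi> \<eta>. ennreal (norm (boundary_transform \<eta>)) * ennreal (norm (boundary_transform (\<xi> - \<eta>)))" borel]
    lborel.borel_measurable_nn_integral[of "\<lambda>\<xi> \<eta>. ennreal ((norm (boundary_transform \<eta>))\<^sup>2) * ennreal ((norm (boundary_transform (\<xi> - \<eta>)))\<^sup>2)" borel]
  by (simp_all add: case_prod_unfold)

lemma abs_convolution_support: assumes "\<xi> \<notin> closure \<Omega>" shows "abs_convolution \<xi> = 0"
proof -
  have "boundary_transform \<eta> = 0 \<or> boundary_transform (\<xi> - \<eta>) = 0" for \<eta>
    using closure_add[of \<eta> "\<xi> - \<eta>"] assms boundary_transform_support by fastforce
  then have "(\<lambda>\<eta>. ennreal (norm (boundary_transform \<eta>)) * ennreal (norm (boundary_transform (\<xi> - \<eta>)))) = (\<lambda>\<eta>. 0)" by fastforce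
  then show ?thesis by (simp add: abs_convolution_def)
qed

text \<open>Cauchy-Schwarz against the indicator of the set where both arguments lie in the closed
  cone, which contains the support.\<close>

lemma abs_convolution_sq: "(abs_convolution \<xi>)\<^sup>2 \<le> slice_volume \<xi> * square_convolution \<xi>"
proof -
  let ?f = "\<lambda>\<eta>. indicator (closure \<Omega>) \<eta> * indicator (closure \<Omega>) (\<xi> - \<eta>) :: ennreal"
  let ?g = "\<lambda>\<eta>. ennreal (norm (boundary_transform \<eta>)) * ennreal (norm (boundary_transform (\<xi> - \<eta>)))"
  have "abs_convolution \<xi> = (\<integral>\<^sup>+\<eta>. ?f \<eta> * ?g \<eta> \<partial>lborel)"
    unfolding abs_convolution_def by (intro nn_integral_cong) (auto simp: indicator_def boundary_transform_support)
  then have "(abs_convolution \<xi>)\<^sup>2 \<le> (\<integral>\<^sup>+\<eta>. (?f \<eta>)\<^sup>2 \<partial>lborel) * (\<integral>\<^sup>+\<eta>. (?g \<eta>)\<^sup>2 \<partial>lborel)"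
    by (simp only:) (rule Cauchy_Schwarz_nn_integral; measurable)
  moreover have "(?f \<eta>)\<^sup>2 = ?f \<eta>" "(?g \<eta>)\<^sup>2 = ennreal ((norm (boundary_transform \<eta>))\<^sup>2) * ennreal ((norm (boundary_transform (\<xi> - \<eta>)))\<^sup>2)" for \<eta>
    by (auto simp: indicator_def power_mult_distrib ennreal_power)
  ultimately show ?thesis by (simp only: slice_volume_def square_convolution_def)
qed

text \<open>The height contributes exp(-B(y, \<eta>)) exp(-B(y, \<xi> - \<eta>)) = exp(-B(y,
  \<xi>)), which leaves the convolution and is squared.\<close>

lemma damped_slice_L4: assumes y: "y \<in> \<Omega>"
  shows "(\<integral>\<^sup>+x. ennreal (norm (damped_slice y x) ^ 4) \<partial>lborel)
    \<le> ennreal (k ^ 3) * (\<integral>\<^sup>+\<xi>. ennreal (exp (- 2 * B y \<xi>)) * (abs_convolution \<xi>)\<^sup>2 \<partial>lborel)"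
proof -
  have "(\<integral>\<^sup>+\<eta>. ennreal (norm (fourier B (damped_slice y) \<eta>)) * ennreal (norm (fourier B (damped_slice y) (\<xi> - \<eta>))) \<partial>lborel)
      = ennreal (exp (- B y \<xi>)) * abs_convolution \<xi>" for \<xi>
  proof -
    have "norm (fourier B (damped_slice y) \<eta>) * norm (fourier B (damped_slice y) (\<xi> - \<eta>)) = exp (- B y \<xi>) * (norm (boundary_transform \<eta>) * norm (boundary_transform (\<xi> - \<eta>)))" for \<eta>
    proof -
      have "exp (- B y \<xi>) = exp (- B y \<eta>) * exp (- B y (\<xi> - \<eta>))" by (simp add: B_lin exp_add[symmetric])
      then show ?thesis by (simp add: fourier_damped_slice[OF y] norm_mult)
    qed
    then show ?thesis unfolding abs_convolution_def
      by (subst nn_integral_cmult[symmetric]) (auto simp: ennreal_mult'[symmetric])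
  qed
  moreover have "(ennreal (exp (- B y \<xi>)))\<^sup>2 = ennreal (exp (- 2 * B y \<xi>))" for \<xi>
    by (simp add: ennreal_power exp_double[symmetric])
  ultimately show ?thesis using fp.L4_fourier[OF damped_slice_nice[OF y]] by (simp add: power_mult_distrib)
qed

lemma damped_L4:
  "(\<integral>\<^sup>+y. (\<integral>\<^sup>+x. ennreal (norm (damped_slice y x) ^ 4) \<partial>lborel) * indicator \<Omega> y \<partial>lborel)
    \<le> ennreal k * (laplace e * slice_volume e) * (hardy_sup \<Omega> 2 F)\<^sup>2"
proof -
  let ?K = "laplace e * slice_volume e"
  let ?I = "\<integral>\<^sup>+\<xi>. ennreal ((norm (boundary_transform \<xi>))\<^sup>2) \<partial>lborel"
  have "(\<integral>\<^sup>+y. (\<integral>\<^sup>+x. ennreal (norm (damped_slice y x) ^ 4) \<partial>lborel) * indicator \<Omega> y \<partial>lborel)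
      \<le> (\<integral>\<^sup>+y. ennreal (k ^ 3) * (\<integral>\<^sup>+\<xi>. ennreal (exp (- 2 * B y \<xi>)) * indicator \<Omega> y * (abs_convolution \<xi>)\<^sup>2 \<partial>lborel) \<partial>lborel)"
    using damped_slice_L4 by (intro nn_integral_mono) (auto simp: indicator_def)
  also have "\<dots> = ennreal (k ^ 3) * (\<integral>\<^sup>+y. (\<integral>\<^sup>+\<xi>. ennreal (exp (- 2 * B y \<xi>)) * indicator \<Omega> y * (abs_convolution \<xi>)\<^sup>2 \<partial>lborel) \<partial>lborel)"
    using lborel.borel_measurable_nn_integral[of "\<lambda>y \<xi>. ennreal (exp (- 2 * B y \<xi>)) * indicator \<Omega> y * (abs_convolution \<xi>)\<^sup>2" borel]
    by (intro nn_integral_cmult) (simp add: case_prod_unfold)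
  also have "(\<integral>\<^sup>+y. (\<integral>\<^sup>+\<xi>. ennreal (exp (- 2 * B y \<xi>)) * indicator \<Omega> y * (abs_convolution \<xi>)\<^sup>2 \<partial>lborel) \<partial>lborel)
      = (\<integral>\<^sup>+\<xi>. (\<integral>\<^sup>+y. ennreal (exp (- 2 * B y \<xi>)) * indicator \<Omega> y * (abs_convolution \<xi>)\<^sup>2 \<partial>lborel) \<partial>lborel)"
    by (rule lborel_pair.Fubini'[symmetric]) (simp add: case_prod_unfold)
  \<comment> \<open>After Fubini only the exponential depends on the height.\<close>
  also have "\<dots> = (\<integral>\<^sup>+\<xi>. laplace \<xi> * (abs_convolution \<xi>)\<^sup>2 \<partial>lborel)"
    unfolding laplace_def by (intro nn_integral_cong nn_integral_multc) simp
  also have "\<dots> \<le> (\<integral>\<^sup>+\<xi>. ?K * square_convolution \<xi> \<partial>lborel)"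
  proof (rule nn_integral_mono_AE)
    show "AE \<xi> in lborel. laplace \<xi> * (abs_convolution \<xi>)\<^sup>2 \<le> ?K * square_convolution \<xi>"
      using AE_closure_imp_in
    proof eventually_elim
      case (elim \<xi>)
      show ?case
      proof (cases "\<xi> \<in> closure \<Omega>")
        case True
        have "laplace \<xi> * (abs_convolution \<xi>)\<^sup>2 \<le> laplace \<xi> * (slice_volume \<xi> * square_convolution \<xi>)" by (intro mult_left_mono abs_convolution_sq) simp
        also have "\<dots> = ?K * square_convolution \<xi>" using elim True by (simp add: mult.assoc[symmetric] laplace_slice_volume)
        finally show ?thesis .
      qed (simp add: abs_convolution_support)
    qed
  qed
  also have "\<dots> = ?K * ?I\<^sup>2"
    using fp.nn_integral_convolution[of "\<lambda>\<xi>. ennreal ((norm (boundary_transform \<xi>))\<^sup>2)"] by (simp add: nn_integral_cmult) (simp add: square_convolution_def)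
  finally have "(\<integral>\<^sup>+y. (\<integral>\<^sup>+x. ennreal (norm (damped_slice y x) ^ 4) \<partial>lborel) * indicator \<Omega> y \<partial>lborel) \<le> ennreal (k ^ 3) * (?K * ?I\<^sup>2)"
    by (simp add: mult_left_mono)
  \<comment> \<open>Two of the three factors \<open>k\<close> join the squared integral of the
    transform, in the form that \<open>boundary_transform_L2\<close> bounds.\<close>
  also have "\<dots> = ennreal k * ?K * (ennreal k * ?I)\<^sup>2"
  proof -
    have "ennreal (k ^ 3) = ennreal k * (ennreal k)\<^sup>2"
      using fp.k_pos by (simp add: ennreal_mult' power3_eq_cube power2_eq_square mult.assoc)
    then show ?thesis by (simp only: power_mult_distrib mult_ac)
  qed
  also have "\<dots> \<le> ennreal k * ?K * (hardy_sup \<Omega> 2 F)\<^sup>2" by (intro mult_left_mono power_mono boundary_transform_L2) auto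
  finally show ?thesis .
qed

end

text \<open>The bound for the damped function is free of \<epsilon>, so Fatou's lemma removes the
  damping along \<epsilon> = 1 / (j+1).\<close>

lemma L4_embedding:
  assumes F: "F \<in> holomorphic_functions (tube \<Omega>)" and hs: "hardy_sup \<Omega> 2 F < \<infinity>"
  shows "(\<integral>\<^sup>+y. (\<integral>\<^sup>+x. ennreal (norm (F (complex_vec x y)) ^ 4) \<partial>lborel) * indicator \<Omega> y \<partial>lborel)
    \<le> ennreal k * (laplace e * slice_volume e) * (hardy_sup \<Omega> 2 F)\<^sup>2"
proof -
  define u where "u j p = ennreal (norm (damped_slice F (1 / real (Suc j)) (snd p) (fst p)) ^ 4) * indicator \<Omega> (snd p)" for j and p :: "(real^'n) \<times> (real^'n)"
  note damped_slice = damped_slice_def[OF F hs]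
  have Fe: "F\<^sub>\<epsilon> F (1 / real (Suc j)) \<in> holomorphic_functions (tube \<Omega>)" for j
    by (rule F\<^sub>\<epsilon>_holomorphic[OF F hs]) simp
  have ind: "(\<lambda>p :: (real^'n) \<times> (real^'n). indicator \<Omega> (snd p) :: ennreal) \<in> borel_measurable (borel \<Otimes>\<^sub>M borel)"
    by (rule measurable_compose[OF measurable_snd borel_measurable_indicator]) (use opn in simp)
  have um: "u j \<in> borel_measurable (borel \<Otimes>\<^sub>M borel)" for j
  proof -
    have [measurable]: "(\<lambda>p. damped_slice F (1 / real (Suc j)) (snd p) (fst p)) \<in> borel_measurable (borel \<Otimes>\<^sub>M borel)"
      using holomorphic_measurable[OF Fe opn, of j] by (simp add: damped_slice case_prod_unfold)
    note [measurable] = ind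
    show ?thesis unfolding u_def[abs_def] by measurable
  qed
  let ?U = "\<lambda>p. ennreal (norm (F (complex_vec (fst p) (snd p))) ^ 4) * indicator \<Omega> (snd p)"
  have Um: "?U \<in> borel_measurable (borel \<Otimes>\<^sub>M borel)"
  proof -
    note [measurable] = ind holomorphic_measurable[OF F opn, unfolded case_prod_unfold]
    show ?thesis by measurable
  qed
  have lim: "(\<lambda>j. u j p) \<longlonglongrightarrow> ?U p" for p
  proof (cases "snd p \<in> \<Omega>")
    case True
    have "(\<lambda>j. norm (F (complex_vec (fst p) (snd p)) * damp (1 / real (Suc j)) (complex_vec (fst p) (snd p))) ^ 4)
      \<longlonglongrightarrow> norm (F (complex_vec (fst p) (snd p)) * 1) ^ 4" by (intro tendsto_intros damp_tendsto True)
    from tendsto_ennrealI[OF this] show ?thesis using True by (simp add: u_def damped_slice F\<^sub>\<epsilon>_def[OF F hs])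
  qed (simp add: u_def)
  have iter: "(\<integral>\<^sup>+y. (\<integral>\<^sup>+x. h x y \<partial>lborel) * indicator \<Omega> y \<partial>lborel) = (\<integral>\<^sup>+p. h (fst p) (snd p) * indicator \<Omega> (snd p) \<partial>(lborel \<Otimes>\<^sub>M lborel))"
    if m: "(\<lambda>p. h (fst p) (snd p) * indicator \<Omega> (snd p)) \<in> borel_measurable (borel \<Otimes>\<^sub>M borel)" for h :: "real^'n \<Rightarrow> real^'n \<Rightarrow> ennreal"
  proof -
    have "(\<integral>\<^sup>+x. h x y \<partial>lborel) * indicator \<Omega> y = (\<integral>\<^sup>+x. h x y * indicator \<Omega> y \<partial>lborel)" for y
      by (cases "y \<in> \<Omega>") auto
    then show ?thesis using lborel_pair.nn_integral_snd[of "\<lambda>p. h (fst p) (snd p) * indicator \<Omega> (snd p)"] m by simp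
  qed
  have "(\<integral>\<^sup>+y. (\<integral>\<^sup>+x. ennreal (norm (F (complex_vec x y)) ^ 4) \<partial>lborel) * indicator \<Omega> y \<partial>lborel) = (\<integral>\<^sup>+p. ?U p \<partial>(lborel \<Otimes>\<^sub>M lborel))"
    by (rule iter[OF Um])
  also have "\<dots> = (\<integral>\<^sup>+p. liminf (\<lambda>j. u j p) \<partial>(lborel \<Otimes>\<^sub>M lborel))"
    using lim_imp_Liminf[OF _ lim] by simp
  also have "\<dots> \<le> liminf (\<lambda>j. \<integral>\<^sup>+p. u j p \<partial>(lborel \<Otimes>\<^sub>M lborel))" using um by (intro nn_integral_liminf) auto
  also have "\<dots> \<le> ennreal k * (laplace e * slice_volume e) * (hardy_sup \<Omega> 2 F)\<^sup>2"
  proof -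
    have "(\<integral>\<^sup>+p. u j p \<partial>(lborel \<Otimes>\<^sub>M lborel)) \<le> ennreal k * (laplace e * slice_volume e) * (hardy_sup \<Omega> 2 F)\<^sup>2" for j
      using damped_L4[OF F hs, of "1 / real (Suc j)"] iter[OF um[of j, unfolded u_def[abs_def]]] by (simp add: u_def del: of_nat_Suc)
    then show ?thesis by (intro Liminf_le) auto
  qed
  finally show ?thesis .
qed

end

section \<open>Multipliers\<close>

context symmetric_cone_fourier begin

text \<open>Write p = 4 + 2 a and h for the Hardy supremum. The bound |F|^2 \<le> c \<Delta>^(-s) h,
  raised to the power a, cancels the weight \<Delta>^(s a) and leaves the fourth power. The exponent
  s a equals \<nu> - s in the case \<gamma> = 0.\<close>

lemma bergman_embedding:
  assumes p: "p \<ge> 4"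
  shows "\<exists>C\<ge>0. \<forall>F\<in>holomorphic_functions (tube \<Omega>). hardy_sup \<Omega> 2 F < \<infinity> \<longrightarrow>
    (\<integral>\<^sup>+(x, y). ennreal (norm (F (complex_vec x y)) powr p * \<Delta> y powr (s * (p / 2 - 2))) * indicator \<Omega> y \<partial>(lborel \<Otimes>\<^sub>M lborel))
      \<le> ennreal (C * enn2real (hardy_sup \<Omega> 2 F) powr (p / 2))"
proof -
  define a where "a = p / 2 - 2"
  have a: "a \<ge> 0" "p = 4 + 2 * a" using p by (auto simp: a_def)
  obtain C0 where C0: "C0 < \<infinity>" and pt: "\<And>F x y. F \<in> holomorphic_functions (tube \<Omega>) \<Longrightarrow> y \<in> \<Omega> \<Longrightarrow>
      ennreal (norm (F (complex_vec x y)) powr 2) \<le> C0 * (ennreal (\<Delta> y powr (- s)) * hardy_sup \<Omega> 2 F)"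
    using hardy_pointwise[of 2] by auto
  define c where "c = enn2real C0"
  have c: "C0 = ennreal c" "c \<ge> 0" using C0 by (simp_all add: c_def less_top)
  define K where "K = enn2real (laplace e * slice_volume e)"
  have K: "laplace e * slice_volume e = ennreal K" "K \<ge> 0"
  proof -
    have "laplace e * slice_volume e < \<infinity>" using laplace_e_finite slice_volume_e_finite by (simp add: ennreal_mult_less_top)
    then show "laplace e * slice_volume e = ennreal K" "K \<ge> 0" by (simp_all add: K_def less_top)
  qed
  have k: "k \<ge> 0" using fp.k_pos by simp
  have "(\<integral>\<^sup>+(x, y). ennreal (norm (F (complex_vec x y)) powr p * \<Delta> y powr (s * a)) * indicator \<Omega> y \<partial>(lborel \<Otimes>\<^sub>M lborel))
      \<le> ennreal (c powr a * (k * K) * enn2real (hardy_sup \<Omega> 2 F) powr (p / 2))"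
    if F: "F \<in> holomorphic_functions (tube \<Omega>)" and fin: "hardy_sup \<Omega> 2 F < \<infinity>" for F
  proof -
    define h where "h = enn2real (hardy_sup \<Omega> 2 F)"
    have h: "hardy_sup \<Omega> 2 F = ennreal h" "h \<ge> 0" using fin by (simp_all add: h_def less_top)
    have le: "norm (F (complex_vec x y)) powr p * \<Delta> y powr (s * a) \<le> (c * h) powr a * norm (F (complex_vec x y)) ^ 4"
      if y: "y \<in> \<Omega>" for x y
    proof (cases "F (complex_vec x y) = 0")
      case False
      define t where "t = norm (F (complex_vec x y))"
      have t: "t > 0" using False by (simp add: t_def)
      have d: "\<Delta> y > 0" using det_pos y by simp
      have "ennreal (t powr 2) \<le> ennreal (c * (\<Delta> y powr (- s) * h))"
        using pt[OF F y, of x] h c by (simp add: t_def ennreal_mult)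
      then have "t powr 2 \<le> c * (\<Delta> y powr (- s) * h)" using h c by (simp add: ennreal_le_iff)
      then have "(t powr 2) powr a \<le> (c * (\<Delta> y powr (- s) * h)) powr a" by (intro powr_mono2 a) auto
      also have "\<dots> = (c * h) powr a * \<Delta> y powr (- (s * a))"
        using c h by (simp add: powr_mult powr_powr)
      finally have 1: "t powr (2 * a) \<le> (c * h) powr a * \<Delta> y powr (- (s * a))" by (simp only: powr_powr)
      have 2: "t powr p = t ^ 4 * t powr (2 * a)" unfolding a(2) powr_add using t by simp
      have "t powr p * \<Delta> y powr (s * a) \<le> (t ^ 4 * ((c * h) powr a * \<Delta> y powr (- (s * a)))) * \<Delta> y powr (s * a)"
        unfolding 2 using 1 t by (intro mult_right_mono mult_left_mono) auto
      also have "\<dots> = (c * h) powr a * t ^ 4" using d by (simp add: powr_minus field_simps)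
      finally show ?thesis by (simp add: t_def)
    qed simp
    let ?U = "\<lambda>p. ennreal (norm (F (complex_vec (fst p) (snd p))) ^ 4) * indicator \<Omega> (snd p)"
    have Um: "?U \<in> borel_measurable (borel \<Otimes>\<^sub>M borel)"
    proof -
      have [measurable]: "(\<lambda>p :: (real^'n) \<times> (real^'n). indicator \<Omega> (snd p) :: ennreal) \<in> borel_measurable (borel \<Otimes>\<^sub>M borel)"
        by (rule measurable_compose[OF measurable_snd borel_measurable_indicator]) (use opn in simp)
      note [measurable] = holomorphic_measurable[OF F opn, unfolded case_prod_unfold]
      show ?thesis by measurable
    qed
    have "(\<integral>\<^sup>+(x, y). ennreal (norm (F (complex_vec x y)) powr p * \<Delta> y powr (s * a)) * indicator \<Omega> y \<partial>(lborel \<Otimes>\<^sub>M lborel))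
        \<le> (\<integral>\<^sup>+p. ennreal ((c * h) powr a) * ?U p \<partial>(lborel \<Otimes>\<^sub>M lborel))"
      using le by (intro nn_integral_mono) (auto simp: indicator_def ennreal_mult'[symmetric] intro!: ennreal_leI)
    also have "\<dots> = ennreal ((c * h) powr a) * (\<integral>\<^sup>+p. ?U p \<partial>(lborel \<Otimes>\<^sub>M lborel))"
      using Um by (intro nn_integral_cmult) simp
    also have "(\<integral>\<^sup>+p. ?U p \<partial>(lborel \<Otimes>\<^sub>M lborel)) = (\<integral>\<^sup>+y. (\<integral>\<^sup>+x. ennreal (norm (F (complex_vec x y)) ^ 4) \<partial>lborel) * indicator \<Omega> y \<partial>lborel)"
    proof -
      have "(\<integral>\<^sup>+x. ennreal (norm (F (complex_vec x y)) ^ 4) \<partial>lborel) * indicator \<Omega> y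
          = (\<integral>\<^sup>+x. ennreal (norm (F (complex_vec x y)) ^ 4) * indicator \<Omega> y \<partial>lborel)" for y
        by (cases "y \<in> \<Omega>") auto
      then show ?thesis using lborel_pair.nn_integral_snd[of ?U] Um by simp
    qed
    also have "ennreal ((c * h) powr a) * \<dots> \<le> ennreal ((c * h) powr a) * (ennreal k * (laplace e * slice_volume e) * (hardy_sup \<Omega> 2 F)\<^sup>2)"
      by (intro mult_left_mono L4_embedding F fin) simp
    also have "\<dots> = ennreal ((c * h) powr a * (k * K * h\<^sup>2))"
      using h(2) K(2) k by (simp add: h(1) K(1) ennreal_mult ennreal_power)
    also have "(c * h) powr a * (k * K * h\<^sup>2) = c powr a * (k * K) * h powr (p / 2)"
    proof -
      have p2: "p / 2 = a + 2" by (simp add: a(2))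
      have "h powr (p / 2) = h powr a * h\<^sup>2"
        unfolding p2 using h(2) powr_add[of h a 2] by simp
      then show ?thesis using c h by (simp add: powr_mult)
    qed
    finally show ?thesis by (simp add: h_def)
  qed
  then show ?thesis using K(2) k unfolding a_def by (intro exI[of _ "c powr a * (k * K)"]) (auto simp: a_def)
qed

context
  fixes p \<nu> \<gamma> :: real and m :: nat
  assumes p: "p \<ge> 4" and m: "m \<ge> 1" and \<gamma>: "\<gamma> = (\<nu> + s) / p - s / 2"
begin

lemma mp: "real m * p \<ge> 1" "real m * p > 0"
proof -
  have "1 * 4 \<le> real m * p" using p m by (intro mult_mono) auto
  then show "real m * p \<ge> 1" "real m * p > 0" by auto
qed

text \<open>The exponent of \<Delta> left over when the scaling of the Bergman integral is compared
  with that of the Hardy integral to the power p / 2.\<close>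

lemma \<gamma>_times_p: "p * \<gamma> = \<nu> + s - s * p / 2"
  using p by (simp add: \<gamma> field_simps)

lemma zero_multiplier: "(\<lambda>z. 0) \<in> hardy_bergman_multipliers \<Omega> \<Delta> s (2 * real m) (real m * p) \<nu>"
proof -
  have "(\<lambda>z. 0) \<in> holomorphic_functions (tube \<Omega>)"
    unfolding holomorphic_functions_def by (auto intro!: exI[of _ "\<lambda>_. 0"])
  moreover have "bergman_integral \<Omega> \<Delta> s (real m * p) \<nu> (\<lambda>z. 0) = 0"
    using mp by (simp add: bergman_integral_def case_prod_unfold)
  ultimately show ?thesis
    by (auto simp: hardy_bergman_multipliers_def multipliers_def bergman_space_def bergman_norm_def hardy_norm_def intro!: exI[of _ 1])
qed

text \<open>F^m lies in the Hardy space of exponent 2 with the same integrals, and the weight splits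
  as \<Delta>^(p \<gamma>) \<Delta>^(s (p/2 - 2)): the first factor is absorbed by |G|^(m p), the
  second is the one of \<open>bergman_embedding\<close>.\<close>

lemma weighted_bound_imp_multiplier:
  assumes G: "G \<in> holomorphic_functions (tube \<Omega>)"
    and M: "\<And>x y. y \<in> \<Omega> \<Longrightarrow> \<Delta> y powr (\<gamma> / real m) * norm (G (complex_vec x y)) \<le> M"
  shows "G \<in> hardy_bergman_multipliers \<Omega> \<Delta> s (2 * real m) (real m * p) \<nu>"
proof -
  let ?q = "real m * p"
  obtain C where C: "C \<ge> 0" and emb: "\<And>F. F \<in> holomorphic_functions (tube \<Omega>) \<Longrightarrow> hardy_sup \<Omega> 2 F < \<infinity> \<Longrightarrow>
    (\<integral>\<^sup>+(x, y). ennreal (norm (F (complex_vec x y)) powr p * \<Delta> y powr (s * (p / 2 - 2))) * indicator \<Omega> y \<partial>(lborel \<Otimes>\<^sub>M lborel))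
      \<le> ennreal (C * enn2real (hardy_sup \<Omega> 2 F) powr (p / 2))"
    using bergman_embedding[OF p] by blast
  have main: "bergman_integral \<Omega> \<Delta> s ?q \<nu> (\<lambda>z. F z * G z) \<le> ennreal (M powr ?q * C * enn2real (hardy_sup \<Omega> (2 * real m) F) powr (p / 2))"
    if F: "F \<in> holomorphic_functions (tube \<Omega>)" and fin: "hardy_sup \<Omega> (2 * real m) F < \<infinity>" for F
  proof -
    define Fm where "Fm z = F z ^ m" for z
    have Fm: "Fm \<in> holomorphic_functions (tube \<Omega>)" unfolding Fm_def[abs_def] by (rule holomorphic_power[OF F m])
    have pw: "norm (Fm z) powr t = norm (F z) powr (real m * t)" for z t
      by (cases "F z = 0") (use m in \<open>auto simp: Fm_def norm_power powr_realpow[symmetric] powr_powr\<close>)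
    have hs: "hardy_sup \<Omega> 2 Fm = hardy_sup \<Omega> (2 * real m) F" unfolding hardy_sup_def pw by (simp only: mult.commute)
    have le: "norm (F (complex_vec x y) * G (complex_vec x y)) powr ?q * \<Delta> y powr (\<nu> - s)
        \<le> M powr ?q * (norm (Fm (complex_vec x y)) powr p * \<Delta> y powr (s * (p / 2 - 2)))" if y: "y \<in> \<Omega>" for x y
    proof -
      have d: "\<Delta> y > 0" using det_pos y by simp
      have "(\<Delta> y powr (\<gamma> / real m) * norm (G (complex_vec x y))) powr ?q \<le> M powr ?q"
        by (rule powr_mono2) (use M[OF y] mp in auto)
      then have 1: "\<Delta> y powr (p * \<gamma>) * norm (G (complex_vec x y)) powr ?q \<le> M powr ?q"
        using m d by (simp add: powr_mult powr_powr mult.commute)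
      have "\<Delta> y powr (\<nu> - s) = \<Delta> y powr (p * \<gamma>) * \<Delta> y powr (s * (p / 2 - 2))"
        unfolding powr_add[symmetric] \<gamma>_times_p by (simp add: algebra_simps)
      then have "norm (F (complex_vec x y) * G (complex_vec x y)) powr ?q * \<Delta> y powr (\<nu> - s)
          = (\<Delta> y powr (p * \<gamma>) * norm (G (complex_vec x y)) powr ?q) * (norm (Fm (complex_vec x y)) powr p * \<Delta> y powr (s * (p / 2 - 2)))"
        by (simp add: norm_mult powr_mult pw mult_ac)
      also have "\<dots> \<le> M powr ?q * (norm (Fm (complex_vec x y)) powr p * \<Delta> y powr (s * (p / 2 - 2)))"
        by (intro mult_right_mono 1) auto
      finally show ?thesis .
    qed
    have "bergman_integral \<Omega> \<Delta> s ?q \<nu> (\<lambda>z. F z * G z)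
      \<le> (\<integral>\<^sup>+p'. ennreal (M powr ?q) * (case p' of (x, y) \<Rightarrow> ennreal (norm (Fm (complex_vec x y)) powr p * \<Delta> y powr (s * (p / 2 - 2))) * indicator \<Omega> y) \<partial>(lborel \<Otimes>\<^sub>M lborel))"
      unfolding bergman_integral_def using le
      by (intro nn_integral_mono) (auto simp: indicator_def ennreal_mult'[symmetric] intro!: ennreal_leI)
    also have "\<dots> = ennreal (M powr ?q) * (\<integral>\<^sup>+(x, y). ennreal (norm (Fm (complex_vec x y)) powr p * \<Delta> y powr (s * (p / 2 - 2))) * indicator \<Omega> y \<partial>(lborel \<Otimes>\<^sub>M lborel))"
      using bergman_measurable[OF Fm, of p "s * (p / 2 - 2)"] by (intro nn_integral_cmult) simp
    also have "\<dots> \<le> ennreal (M powr ?q) * ennreal (C * enn2real (hardy_sup \<Omega> 2 Fm) powr (p / 2))"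
      by (intro mult_left_mono emb Fm) (use fin hs in auto)
    also have "\<dots> = ennreal (M powr ?q * C * enn2real (hardy_sup \<Omega> (2 * real m) F) powr (p / 2))"
      using C by (simp add: ennreal_mult[symmetric] hs mult.assoc)
    finally show ?thesis .
  qed
  define D where "D = (M powr ?q * C) powr (1 / ?q)"
  have D: "D \<ge> 0" by (simp add: D_def)
  \<comment> \<open>A multiplier constant must be positive, whereas \<open>D\<close> may vanish;
    hence \<open>D + 1\<close>.\<close>
  have "(\<lambda>z. F z * G z) \<in> bergman_space \<Omega> \<Delta> s ?q \<nu> \<and> bergman_norm \<Omega> \<Delta> s ?q \<nu> (\<lambda>z. F z * G z) \<le> (D + 1) * hardy_norm \<Omega> (2 * real m) F"
    if "F \<in> hardy_space \<Omega> (2 * real m)" for F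
  proof
    have F: "F \<in> holomorphic_functions (tube \<Omega>)" and fin: "hardy_sup \<Omega> (2 * real m) F < \<infinity>" using that by (auto simp: hardy_space_def)
    define h where "h = enn2real (hardy_sup \<Omega> (2 * real m) F)"
    have b: "bergman_integral \<Omega> \<Delta> s ?q \<nu> (\<lambda>z. F z * G z) \<le> ennreal (M powr ?q * C * h powr (p / 2))"
      using main[OF F fin] by (simp add: h_def)
    then show "(\<lambda>z. F z * G z) \<in> bergman_space \<Omega> \<Delta> s ?q \<nu>"
      unfolding bergman_space_def using holomorphic_mult[OF F G] by (auto intro: le_less_trans)
    have "enn2real (bergman_integral \<Omega> \<Delta> s ?q \<nu> (\<lambda>z. F z * G z)) \<le> M powr ?q * C * h powr (p / 2)"
      using enn2real_mono[OF b] C by simp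
    then have "bergman_norm \<Omega> \<Delta> s ?q \<nu> (\<lambda>z. F z * G z) \<le> (M powr ?q * C * h powr (p / 2)) powr (1 / ?q)"
      unfolding bergman_norm_def using mp by (intro powr_mono2) auto
    also have "\<dots> = D * h powr (1 / (2 * real m))"
      using C p by (simp add: D_def powr_mult powr_powr)
    also have "\<dots> \<le> (D + 1) * h powr (1 / (2 * real m))" by (intro mult_right_mono) auto
    finally show "bergman_norm \<Omega> \<Delta> s ?q \<nu> (\<lambda>z. F z * G z) \<le> (D + 1) * hardy_norm \<Omega> (2 * real m) F"
      by (simp add: hardy_norm_def h_def)
  qed
  then show ?thesis unfolding hardy_bergman_multipliers_def multipliers_def using G D by (auto intro!: exI[of _ "D + 1"])
qed

text \<open>Test on the translates and dilates of one fixed function of the Hardy space, moved by the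
  affine automorphisms of the tube.\<close>

lemma multiplier_imp_weighted_bound:
  assumes "G \<in> hardy_bergman_multipliers \<Omega> \<Delta> s (2 * real m) (real m * p) \<nu>"
  shows "\<exists>M. \<forall>x. \<forall>y\<in>\<Omega>. \<Delta> y powr (\<gamma> / real m) * norm (G (complex_vec x y)) \<le> M"
proof -
  let ?q = "real m * p"
  have G: "G \<in> holomorphic_functions (tube \<Omega>)" using assms by (simp add: hardy_bergman_multipliers_def multipliers_def)
  obtain C where C: "C > 0" and mult: "\<And>F. F \<in> hardy_space \<Omega> (2 * real m) \<Longrightarrow> (\<lambda>z. F z * G z) \<in> bergman_space \<Omega> \<Delta> s ?q \<nu> \<and>
      bergman_norm \<Omega> \<Delta> s ?q \<nu> (\<lambda>z. F z * G z) \<le> C * hardy_norm \<Omega> (2 * real m) F"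
    using assms by (auto simp: hardy_bergman_multipliers_def multipliers_def)
  obtain C1 where C1: "C1 < \<infinity>" and pt: "\<And>F x y. F \<in> holomorphic_functions (tube \<Omega>) \<Longrightarrow> y \<in> \<Omega> \<Longrightarrow>
      ennreal (norm (F (complex_vec x y)) powr ?q) \<le> C1 * (ennreal (\<Delta> y powr (- (\<nu> + s))) * bergman_integral \<Omega> \<Delta> s ?q \<nu> F)"
    using bergman_pointwise[OF mp(1), of \<nu>] by auto
  define c1 where "c1 = enn2real C1"
  have c1: "C1 = ennreal c1" "c1 \<ge> 0" using C1 by (simp_all add: c1_def less_top)
  \<comment> \<open>Zero-free in the tube, with square integrals bounded over all heights; having
    modulus at most 1, it satisfies the same bound for the exponent 2m.\<close>
  define F0 where "F0 = damp 1"
  have F0: "F0 \<in> holomorphic_functions (tube \<Omega>)" unfolding F0_def by (rule damp_holomorphic) simp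
  have "hardy_sup \<Omega> (2 * real m) F0 \<le> damp_mass 1" unfolding hardy_sup_def
  proof (rule SUP_least)
    fix t assume t: "t \<in> \<Omega>"
    have "norm (F0 (complex_vec x t)) powr (2 * real m) \<le> (norm (damp 1 (complex_vec x t)))\<^sup>2" for x
    proof -
      have "norm (damp 1 (complex_vec x t)) \<le> 1" by (rule damp_le_1[OF t]) simp
      then have "norm (damp 1 (complex_vec x t)) powr (2 * real m) \<le> norm (damp 1 (complex_vec x t)) powr 2"
        using m by (intro powr_mono') auto
      then show ?thesis by (simp add: F0_def)
    qed
    then have "(\<integral>\<^sup>+x. ennreal (norm (F0 (complex_vec x t)) powr (2 * real m)) \<partial>lborel) \<le> (\<integral>\<^sup>+x. ennreal ((norm (damp 1 (complex_vec x t)))\<^sup>2) \<partial>lborel)"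
      by (intro nn_integral_mono ennreal_leI)
    also have "\<dots> \<le> damp_mass 1" by (rule damp_L2[OF t]) simp
    finally show "(\<integral>\<^sup>+x. ennreal (norm (F0 (complex_vec x t)) powr (2 * real m)) \<partial>lborel) \<le> damp_mass 1" .
  qed
  also have "\<dots> < \<infinity>" by (rule damp_mass_finite) simp
  finally have h0fin: "hardy_sup \<Omega> (2 * real m) F0 < \<infinity>" .
  define h0 where "h0 = enn2real (hardy_sup \<Omega> (2 * real m) F0)"
  have h0: "hardy_sup \<Omega> (2 * real m) F0 = ennreal h0" "h0 \<ge> 0" using h0fin by (simp_all add: h0_def less_top)
  define n0 where "n0 = norm (F0 (complex_vec 0 e))"
  have n0: "n0 > 0" using damp_nz[OF e_in, of 1 0] by (simp add: n0_def F0_def)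
  \<comment> \<open>\<open>c1\<close> stems from the pointwise bound of the Bergman space,
    \<open>C\<close> from the multiplier, \<open>h0\<close> from the Hardy supremum of
    \<open>F0\<close> and \<open>n0\<close> from its modulus at i e.\<close>
  define D where "D = c1 * (C powr ?q * h0 powr (p / 2)) / n0 powr ?q"
  have "\<Delta> y powr (\<gamma> / real m) * norm (G (complex_vec a y)) \<le> D powr (1 / ?q)" if y: "y \<in> \<Omega>" for a y
  proof -
    have d: "\<Delta> y > 0" using det_pos y by simp
    obtain g where g: "moves g y" using ex_moves[OF y] by blast
    have lin: "linear g" and inj: "inj g" and img: "g ` \<Omega> = \<Omega>" and ge: "g e = y" using g by (auto simp: moves_def)
    have surj: "surj g" using linear_injective_imp_surjective[OF lin inj] by simp
    have inv1: "inv g (g x) = x" "g (inv g x) = x" for x using inj surj by (simp_all add: surj_f_inv_f)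
    have lini: "linear (inv g)" using inj_linear_imp_inv_linear[OF lin inj] .
    have imgi: "inv g ` \<Omega> = \<Omega>" using img inv1(1) by (metis image_inv_f_f inj)
    \<comment> \<open>The test function is moved so that its value at a + i y is that of
      \<open>F0\<close> at i e, while its Hardy supremum gains the factor \<Delta>(y)^s.\<close>
    define F where "F z = F0 (tube_map (- inv g a) (inv g) z)" for z
    have F: "F \<in> holomorphic_functions (tube \<Omega>)" unfolding F_def[abs_def]
      by (rule holomorphic_tube_map[OF F0 lini _ imgi]) (simp add: surj_imp_inj_inv surj)
    have "F (tube_map a g z) = F0 z" for z
      by (simp add: F_def tube_map_def linear_add[OF lini] inv1)
    then have "ennreal h0 = ennreal (\<Delta> y powr (- s)) * hardy_sup \<Omega> (2 * real m) F"
      using hardy_sup_moves[OF F g y, of "2 * real m" a] by (simp add: h0)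
    then have "ennreal (\<Delta> y powr s) * ennreal h0 = (ennreal (\<Delta> y powr s) * ennreal (\<Delta> y powr (- s))) * hardy_sup \<Omega> (2 * real m) F"
      by (simp only: mult.assoc)
    also have "ennreal (\<Delta> y powr s) * ennreal (\<Delta> y powr (- s)) = 1"
      using d by (simp add: ennreal_mult'[symmetric] powr_add[symmetric])
    finally have hF: "hardy_sup \<Omega> (2 * real m) F = ennreal (\<Delta> y powr s * h0)" using h0 by (simp add: ennreal_mult)
    then have FH: "F \<in> hardy_space \<Omega> (2 * real m)" using F by (simp add: hardy_space_def)
    define J where "J = enn2real (bergman_integral \<Omega> \<Delta> s ?q \<nu> (\<lambda>z. F z * G z))"
    have J: "bergman_integral \<Omega> \<Delta> s ?q \<nu> (\<lambda>z. F z * G z) = ennreal J" "J \<ge> 0"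
      using mult[OF FH] by (simp_all add: J_def bergman_space_def less_top)
    have "J powr (1 / ?q) \<le> C * (\<Delta> y powr s * h0) powr (1 / (2 * real m))"
      using mult[OF FH] h0(2) by (simp add: bergman_norm_def J_def[symmetric] hardy_norm_def hF)
    then have "(J powr (1 / ?q)) powr ?q \<le> (C * (\<Delta> y powr s * h0) powr (1 / (2 * real m))) powr ?q"
      using mp by (intro powr_mono2) auto
    then have JC: "J \<le> C powr ?q * h0 powr (p / 2) * \<Delta> y powr (s * p / 2)"
      using J(2) m p C h0(2) by (simp add: powr_powr powr_mult mult_ac)
    have "F (complex_vec a y) = F0 (complex_vec 0 e)"
      by (simp add: F_def tube_map_def linear_add[OF lini, symmetric]) (simp add: ge[symmetric] inv1)
    then have "ennreal ((n0 * norm (G (complex_vec a y))) powr ?q) \<le> ennreal (c1 * (\<Delta> y powr (- (\<nu> + s)) * J))"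
      using pt[OF holomorphic_mult[OF F G] y, of a] J(2) c1(2) by (simp add: J(1) c1(1) n0_def norm_mult ennreal_mult)
    then have "(n0 * norm (G (complex_vec a y))) powr ?q \<le> c1 * (\<Delta> y powr (- (\<nu> + s)) * J)"
      using J(2) c1(2) by (simp add: ennreal_le_iff)
    also have "\<dots> \<le> c1 * (\<Delta> y powr (- (\<nu> + s)) * (C powr ?q * h0 powr (p / 2) * \<Delta> y powr (s * p / 2)))"
      using JC c1(2) by (intro mult_left_mono) auto
    also have "\<dots> = c1 * (C powr ?q * h0 powr (p / 2)) * \<Delta> y powr (- (p * \<gamma>))"
    proof -
      have "\<Delta> y powr (- (\<nu> + s)) * \<Delta> y powr (s * p / 2) = \<Delta> y powr (- (p * \<gamma>))"
        unfolding powr_add[symmetric] \<gamma>_times_p by (intro arg_cong[where f = "\<lambda>t. \<Delta> y powr t"]) simp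
      then show ?thesis by (simp add: mult_ac)
    qed
    finally have "n0 powr ?q * norm (G (complex_vec a y)) powr ?q \<le> c1 * (C powr ?q * h0 powr (p / 2)) * \<Delta> y powr (- (p * \<gamma>))"
      using n0 by (simp add: powr_mult)
    then have "norm (G (complex_vec a y)) powr ?q \<le> D * \<Delta> y powr (- (p * \<gamma>))"
      using n0 by (simp add: D_def field_simps)
    then have "\<Delta> y powr (p * \<gamma>) * norm (G (complex_vec a y)) powr ?q \<le> \<Delta> y powr (p * \<gamma>) * (D * \<Delta> y powr (- (p * \<gamma>)))"
      by (intro mult_left_mono) auto
    also have "\<dots> = D" using d by (simp add: powr_minus)
    finally have "(\<Delta> y powr (\<gamma> / real m) * norm (G (complex_vec a y))) powr ?q \<le> D"
      using m by (simp add: powr_mult powr_powr mult.commute)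
    then have "((\<Delta> y powr (\<gamma> / real m) * norm (G (complex_vec a y))) powr ?q) powr (1 / ?q) \<le> D powr (1 / ?q)"
      using mp by (intro powr_mono2) auto
    then show ?thesis using mp m p by (simp add: powr_powr)
  qed
  then show ?thesis by blast
qed

end

end

context symmetric_cone begin

text \<open>On a complex line in a cone direction the function extends by \<open>0\<close> to the real axis; the
  reflection principle makes it entire, vanishing on the axis.\<close>

lemma holomorphic_vanishing_at_boundary:
  assumes G: "G \<in> holomorphic_functions (tube \<Omega>)" and \<alpha>: "\<alpha> > 0"
    and M: "\<And>x y. y \<in> \<Omega> \<Longrightarrow> norm (G (complex_vec x y)) \<le> M * \<Delta> y powr \<alpha>"
  shows "G = (\<lambda>z. 0)"
proof
  fix z0
  show "G z0 = 0"
  proof (cases "z0 \<in> tube \<Omega>")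
    case True
    define x y where "x = Re_vec z0" and "y = Im_vec z0"
    have y: "y \<in> \<Omega>" using True by (simp add: y_def tube_def)
    have d: "\<Delta> y > 0" using det_pos y by simp
    have pt: "complex_vec x 0 + \<zeta> *s complex_vec y 0 = complex_vec (x + Re \<zeta> *\<^sub>R y) (Im \<zeta> *\<^sub>R y)" for \<zeta>
      by (simp add: complex_vec_smult complex_vec_add)
    define g where "g \<zeta> = G (complex_vec x 0 + \<zeta> *s complex_vec y 0)" for \<zeta>
    have holg: "g holomorphic_on {\<zeta>. 0 < Im \<zeta>}" unfolding g_def
      by (rule holomorphic_on_subset[OF holomorphic_line[OF G]]) (use cone[OF y] in \<open>auto simp: pt\<close>)
    define N where "N = \<bar>M\<bar> * \<Delta> y powr \<alpha>"
    \<comment> \<open>The homogeneity of \<Delta> turns the hypothesis into a bound by a positive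
      power of Im \<zeta>, so the boundary values on the real axis are 0.\<close>
    have bound: "norm (g \<zeta>) \<le> N * Im \<zeta> powr (r * \<alpha>)" if "Im \<zeta> > 0" for \<zeta>
    proof -
      have "norm (g \<zeta>) \<le> M * \<Delta> (Im \<zeta> *\<^sub>R y) powr \<alpha>" unfolding g_def pt by (rule M) (use cone[OF y] that in simp)
      also have "\<dots> \<le> \<bar>M\<bar> * \<Delta> (Im \<zeta> *\<^sub>R y) powr \<alpha>" by (intro mult_right_mono) auto
      also have "\<Delta> (Im \<zeta> *\<^sub>R y) powr \<alpha> = \<Delta> y powr \<alpha> * Im \<zeta> powr (r * \<alpha>)"
        using that d by (simp add: det_scale powr_mult powr_realpow[symmetric] powr_powr)
      finally show ?thesis by (simp add: N_def mult.assoc)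
    qed
    define f where "f \<zeta> = (if Im \<zeta> > 0 then g \<zeta> else 0)" for \<zeta>
    have fb: "norm (f \<zeta>) \<le> N * \<bar>Im \<zeta>\<bar> powr (r * \<alpha>)" for \<zeta>
      using bound[of \<zeta>] by (auto simp: f_def N_def)
    have holf: "f holomorphic_on {\<zeta>. 0 < Im \<zeta>}" using holg by (rule holomorphic_transform) (simp add: f_def)
    have contf: "continuous_on {\<zeta>. 0 \<le> Im \<zeta>} f"
      unfolding continuous_on_eq_continuous_within
    proof
      fix \<zeta> assume "\<zeta> \<in> {\<zeta>. 0 \<le> Im \<zeta>}"
      then consider "Im \<zeta> > 0" | "Im \<zeta> = 0" by force
      then show "continuous (at \<zeta> within {\<zeta>. 0 \<le> Im \<zeta>}) f"
      proof cases
        case 1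
        have "open {\<zeta>. 0 < Im \<zeta>}" by (rule open_halfspace_Im_gt)
        then have "isCont f \<zeta>" using holomorphic_on_imp_continuous_on[OF holf] 1 by (simp add: continuous_on_eq_continuous_at)
        then show ?thesis by (rule continuous_at_imp_continuous_at_within)
      next
        case 2
        have "((\<lambda>\<zeta>. N * \<bar>Im \<zeta>\<bar> powr (r * \<alpha>)) \<longlongrightarrow> N * \<bar>Im \<zeta>\<bar> powr (r * \<alpha>)) (at \<zeta> within {\<zeta>. 0 \<le> Im \<zeta>})"
          using \<alpha> r_pos by (intro tendsto_intros tendsto_powr2) auto
        then have "((\<lambda>\<zeta>. N * \<bar>Im \<zeta>\<bar> powr (r * \<alpha>)) \<longlongrightarrow> 0) (at \<zeta> within {\<zeta>. 0 \<le> Im \<zeta>})" using 2 by simp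
        then have "(f \<longlongrightarrow> 0) (at \<zeta> within {\<zeta>. 0 \<le> Im \<zeta>})"
          by (rule Lim_null_comparison[rotated]) (simp add: fb)
        then show ?thesis using 2 by (simp add: continuous_within f_def)
      qed
    qed
    let ?E = "\<lambda>\<zeta>. if 0 \<le> Im \<zeta> then f \<zeta> else cnj (f (cnj \<zeta>))"
    have E: "?E holomorphic_on UNIV"
      by (rule Schwarz_reflection) (auto simp: holf contf, simp add: f_def complex_is_Real_iff)
    \<comment> \<open>The entire extension vanishes on the real axis, which accumulates at 0; the
      parameter i corresponds to \<open>z0\<close>.\<close>
    have "?E \<i> = 0"
    proof (rule analytic_continuation[OF E, of \<real> 0])
      show "(0::complex) islimpt \<real>"
      proof (rule islimptI)
        fix T :: "complex set" assume "0 \<in> T" "open T"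
        then obtain \<epsilon> where \<epsilon>: "\<epsilon> > 0" "ball 0 \<epsilon> \<subseteq> T" using open_contains_ball by blast
        then have "complex_of_real (\<epsilon> / 2) \<in> ball 0 \<epsilon>" by (simp add: norm_divide)
        then show "\<exists>y\<in>\<real>. y \<in> T \<and> y \<noteq> 0" using \<epsilon> by (intro bexI[of _ "complex_of_real (\<epsilon> / 2)"]) auto
      qed
    qed (auto simp: f_def complex_is_Real_iff)
    then have "g \<i> = 0" by (simp add: f_def)
    moreover have "complex_vec x y = z0" by (simp add: x_def y_def)
    ultimately show ?thesis by (simp add: g_def pt)
  qed (rule holomorphic_zero[OF G])
qed

end

theorem theorem1p7:
  fixes \<Omega> :: "(real^'n) set" and mul :: "real^'n \<Rightarrow> real^'n \<Rightarrow> real^'n" and e :: "real^'n"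
    and \<Delta> :: "real^'n \<Rightarrow> real" and n r m :: nat and p \<nu> \<gamma> :: real
  assumes "irreducible_symmetric_cone \<Omega>"
    and "associated_jordan_algebra \<Omega> mul e"
    and "n = CARD('n)"
    and "r = jordan_rank mul e"
    and "\<Delta> = jordan_det mul e"
    and "4 \<le> p"
    and "\<nu> > real n / real r - 1"
    and "\<gamma> = 1 / p * (\<nu> + real n / real r) - real n / (2 * real r)"
    and "m \<ge> 1"
  shows
    "(\<gamma> > 0 \<longrightarrow>
        hardy_bergman_multipliers \<Omega> \<Delta> (real n / real r) (2 * real m) (real m * p) \<nu>
          = weighted_Hinf \<Omega> \<Delta> (\<gamma> / real m)) \<and>
     (\<gamma> = 0 \<longrightarrow>
        hardy_bergman_multipliers \<Omega> \<Delta> (real n / real r) (2 * real m) (real m * p) \<nu>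
          = bounded_Hinf \<Omega>) \<and>
     (\<gamma> < 0 \<longrightarrow>
        hardy_bergman_multipliers \<Omega> \<Delta> (real n / real r) (2 * real m) (real m * p) \<nu>
          = {\<lambda>z. 0})"
proof -
  obtain B where B: "inner_product B" "\<And>x u v. B (mul x u) v = B u (mul x v)"
    using assms(2) by (auto simp: associated_jordan_algebra_def euclidean_jordan_algebra_def)
  have ej: "euclidean_jordan mul e B"
    using assms(2) B by unfold_locales (auto simp: associated_jordan_algebra_def euclidean_jordan_algebra_def)
  have \<Omega>: "\<Omega> = euclidean_jordan.pos_cone mul"
    using assms(2) by (simp add: associated_jordan_algebra_def euclidean_jordan.pos_cone_def[OF ej] euclidean_jordan.squares_def[OF ej])
  interpret J: simple_jordan mul e B
    by (intro simple_jordan.intro simple_jordan_axioms.intro jordan_rn.intro ej) (use assms(1) \<Omega> in simp)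
  have r: "r = J.rk" and \<Delta>: "\<Delta> = J.jdet" and s: "real n / real r = J.tau1"
    using assms J.jordan_rank_eq J.jordan_det_eq J.tau1_eq by simp_all
  obtain k where k: "inversion_constant B k" using ex_inversion_constant[OF B(1)] by blast
  interpret S: symmetric_cone_fourier \<Omega> B \<Delta> "real n / real r" r e k
  proof unfold_locales
    show "\<Omega> = {y. \<forall>x \<in> closure \<Omega> - {0}. B x y > 0}"
      unfolding \<Omega> J.closure_pos_cone using J.pos_cone_iff_dual J.symB by (simp add: set_eq_iff)
    show "\<Delta> e = 1"
    proof -
      obtain C where "J.frame C" using J.spectral by blast
      from J.jdet_frame[OF this J.frame_sum_e[OF this]] show ?thesis by (simp add: \<Delta>)
    qed
    show "continuous_on UNIV \<Delta>" unfolding \<Delta>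
      using J.real_polynomial_function_jdet
      by (simp add: continuous_on_polymonial_function real_polynomial_function_eq)
    show "\<exists>G. linear G \<and> inj G \<and> (\<forall>x z. B (G x) z = B x (G z)) \<and> G ` \<Omega> = \<Omega> \<and> G e = y
        \<and> det (matrix G) = \<Delta> y powr (real n / real r) \<and> (\<forall>x\<in>\<Omega>. \<Delta> (G x) = \<Delta> y * \<Delta> x)"
      if "y \<in> \<Omega>" for y
      using J.ex_group_elt_to[of y] J.jdet_group[of _ y] that unfolding \<Omega> \<Delta> s by metis
  qed (use B k J.tau1_pos J.rk_pos J.jdet_pos J.jdet_scale J.open_pos_cone J.convex_pos_cone J.pos_cone_scale J.e_pos_cone
      in \<open>auto simp: \<Omega> \<Delta> s r\<close>)
  have \<gamma>: "\<gamma> = (\<nu> + real n / real r) / p - real n / real r / 2" using assms(8) by simp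
  let ?M = "hardy_bergman_multipliers \<Omega> \<Delta> (real n / real r) (2 * real m) (real m * p) \<nu>"
  \<comment> \<open>This holds for every sign of \<gamma>; the three cases differ only in what the
    weighted space is.\<close>
  have eq: "?M = weighted_Hinf \<Omega> \<Delta> (\<gamma> / real m)"
  proof (intro subset_antisym subsetI)
    fix G assume G: "G \<in> ?M"
    then have hol: "G \<in> holomorphic_functions (tube \<Omega>)" by (simp add: hardy_bergman_multipliers_def multipliers_def)
    obtain M where M: "\<And>x y. y \<in> \<Omega> \<Longrightarrow> \<Delta> y powr (\<gamma> / real m) * norm (G (complex_vec x y)) \<le> M"
      using S.multiplier_imp_weighted_bound[OF assms(6,9) \<gamma> G] by blast
    have "\<Delta> (Im_vec z) powr (\<gamma> / real m) * norm (G z) \<le> M" if "z \<in> tube \<Omega>" for z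
      using M[of "Im_vec z" "Re_vec z"] that by (simp add: tube_def)
    then show "G \<in> weighted_Hinf \<Omega> \<Delta> (\<gamma> / real m)"
      using hol by (auto simp: weighted_Hinf_def intro!: bdd_aboveI2)
  next
    fix G assume G: "G \<in> weighted_Hinf \<Omega> \<Delta> (\<gamma> / real m)"
    then obtain M where "\<And>z. z \<in> tube \<Omega> \<Longrightarrow> \<Delta> (Im_vec z) powr (\<gamma> / real m) * norm (G z) \<le> M"
      by (auto simp: weighted_Hinf_def bdd_above_def)
    from this[of "complex_vec _ _"] show "G \<in> ?M"
      using G by (intro S.weighted_bound_imp_multiplier[OF assms(6,9) \<gamma>]) (auto simp: weighted_Hinf_def)
  qed
  have "weighted_Hinf \<Omega> \<Delta> (\<gamma> / real m) = bounded_Hinf \<Omega>" if "\<gamma> = 0"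
  proof -
    have "bdd_above ((\<lambda>z. \<Delta> (Im_vec z) powr 0 * norm (F z)) ` tube \<Omega>) \<longleftrightarrow> bounded (F ` tube \<Omega>)" for F :: "complex^'n \<Rightarrow> complex"
    proof -
      \<comment> \<open>\<open>0 powr 0\<close> is 0, so it takes the positivity of \<Delta> on the
        cone to make the weight equal to 1.\<close>
      have "(\<lambda>z. \<Delta> (Im_vec z) powr 0 * norm (F z)) ` tube \<Omega> = (\<lambda>z. norm (F z)) ` tube \<Omega>"
        using S.det_pos by (intro image_cong) (force simp: tube_def)+
      then show ?thesis by (auto simp: bdd_above_def bounded_iff)
    qed
    then show ?thesis unfolding weighted_Hinf_def bounded_Hinf_def that by simp
  qed
  moreover have "?M = {\<lambda>z. 0}" if "\<gamma> < 0"
  proof -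
    have "G = (\<lambda>z. 0)" if G: "G \<in> ?M" for G
    proof -
      have hol: "G \<in> holomorphic_functions (tube \<Omega>)" using G by (simp add: hardy_bergman_multipliers_def multipliers_def)
      obtain M where M: "\<And>x y. y \<in> \<Omega> \<Longrightarrow> \<Delta> y powr (\<gamma> / real m) * norm (G (complex_vec x y)) \<le> M"
        using S.multiplier_imp_weighted_bound[OF assms(6,9) \<gamma> G] by blast
      show ?thesis
      proof (rule S.holomorphic_vanishing_at_boundary[OF hol])
        show "- \<gamma> / real m > 0" using \<open>\<gamma> < 0\<close> assms(9) by (intro divide_pos_pos) auto
        show "norm (G (complex_vec x y)) \<le> M * \<Delta> y powr (- \<gamma> / real m)" if "y \<in> \<Omega>" for x y
          using M[OF that, of x] S.det_pos[OF that] by (simp add: powr_minus field_simps)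
      qed
    qed
    moreover have "(\<lambda>z. 0) \<in> ?M" by (rule S.zero_multiplier[OF assms(6,9) \<gamma>])
    ultimately show ?thesis by blast
  qed
  ultimately show ?thesis using eq by blast
qed

end
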